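(* Let $N\ge 2$ identical nonlinear circuits, each consisting of the parallel connection of a passive LTI impedance $z_{\mathrm{osc}}(s)$ and a voltage-dependent current source $i_{\mathrm g}=-g(v)$ with $\sigma:=\sup_{v\in\mathbb R}\left|\frac{\mathrm d}{\mathrm dv}g(v)\right|<\infty$, be coupled through a passive, connected LTI electrical network that has no shunt elements and has uniform line characteristics, so that its Kron-reduced admittance matrix is of the form $Y(s)=y_{\mathrm{series}}(s)\,L$, where $L\in\mathbb R^{N\times N}$ is the (real, symmetric) weighted Laplacian matrix of a connected graph. Let $\lambda_2,\dots,\lambda_N$ be the nonzero eigenvalues of $L$. If for all $j\in\{2,\dots,N\}$ $$\left\Vert \mathcal F\big(z_{\mathrm{osc}}(\mathrm j\omega),\,y_{\mathrm{series}}(\mathrm j\omega)\lambda_j\big)\right\Vert_\infty\,\sigma<1,$$ then the terminal voltages synchronize globally asymptotically, i.e. (for all initial conditions) $$\lim_{t\to\infty}\big(v_j(t)-v_k(t)\big)=0\qquad\forall\, j,k\in\{1,\dots,N\}.$$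
   Context: Coupled system. Circuit $j$ has terminal voltage $v_j$, injects current $i_j$ into the network, and has source current $i_{\mathrm gj}=-g(v_j)$; $g:\mathbb R\to\mathbb R$ may be piecewise linear (then the supremum defining $\sigma$ is over its slopes). In the Laplace domain the linear part obeys $v_j=z_{\mathrm{osc}}\,(i_{\mathrm gj}-i_j)$, where $z_{\mathrm{osc}}(s)$ is the impedance of an interconnection of passive LTI circuit elements, and the network imposes $i=Yv$ with $i=[i_1,\dots,i_N]^{\mathrm T}$, $v=[v_1,\dots,v_N]^{\mathrm T}$. Initial conditions refer to the states of the energy-storage elements. Network. The network has node set $\mathcal A$, boundary nodes $\{1,\dots,N\}\subseteq\mathcal A$ (where the circuits are connected) and interior nodes $\mathcal I=\mathcal A\setminus\{1,\dots,N\}$ (zero current injection). With branch admittances $y_{mn}=y_{nm}$ and no shunt admittances to ground, the admittance matrix $Y_{\mathcal A}$ has entries $[Y_{\mathcal A}]_{mm}=\sum_k y_{mk}$ (sum over branches at $m$), $[Y_{\mathcal A}]_{mn}=-y_{mn}$ for branches $(m,n)$, and $0$ otherwise. Uniform line characteristics means $y_{mn}=y_{\mathrm{series}}\,a_{mn}$ with real $a_{mn}>0$ and the same $y_{\mathrm{series}}$ for every branch. Partitioning $Y_{\mathcal A}$ into boundary ($\mathcal N$) and interior ($\mathcal I$) blocks, the Kron-reduced admittance matrix is $Y=Y_{\mathcal{NN}}-Y_{\mathcal{NI}}Y_{\mathcal{II}}^{-1}Y_{\mathcal{NI}}^{\mathrm T}$ ($Y_{\mathcal{II}}$ is assumed nonsingular).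 The Laplacian of a symmetric nonnegative weight matrix $A=(a_{nm})$ has off-diagonal entries $-a_{nm}$ and diagonal entries $\sum_m a_{nm}$; for a connected graph its zero eigenvalue $\lambda_1=0$ is simple. Linear fractional transformation: $\mathcal F(A,B):=(I+AB)^{-1}A$; for scalars $\mathcal F(a,b)=a/(1+ab)$. For a scalar transfer function $h$ all of whose poles have strictly negative real part, $\Vert h\Vert_\infty:=\sup_{\omega\in\mathbb R}|h(\mathrm j\omega)|$ (the condition on the norm includes that it is defined in this sense). *)

theory Defs
  imports
    "HOL-Analysis.Analysis"
    "HOL-Computational_Algebra.Computational_Algebra"
    "HOL-Computational_Algebra.Field_as_Ring"
    "Jordan_Normal_Form.Matrix"
    "Jordan_Normal_Form.Gauss_Jordan_Elimination"
    "Jordan_Normal_Form.Char_Poly"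
begin

section \<open>Rational transfer functions\<close>

text \<open>
  Transfer functions are elements of the field of rational functions, so that cancellations in
  feedback interconnections are carried out before poles and values are read off; both refer to
  the representation in lowest terms.
\<close>

type_synonym transfer_function = "complex poly fract"

definition tf_const :: "real \<Rightarrow> transfer_function" where
  "tf_const c = to_fract [:complex_of_real c:]"

definition tf_eval :: "transfer_function \<Rightarrow> complex \<Rightarrow> complex" where
  "tf_eval h s = poly (fst (quot_of_fract h)) s / poly (snd (quot_of_fract h)) s"

definition tf_pole :: "transfer_function \<Rightarrow> complex \<Rightarrow> bool" where
  "tf_pole h s \<longleftrightarrow> poly (snd (quot_of_fract h)) s = 0"

definition lft :: "transfer_function \<Rightarrow> transfer_function \<Rightarrow> transfer_function" where
  "lft a b = a / (1 + a * b)"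

definition hinf_norm :: "transfer_function \<Rightarrow> real" where
  "hinf_norm h = (SUP \<omega>::real. cmod (tf_eval h (\<i> * complex_of_real \<omega>)))"

text \<open>The boundedness condition excludes stable but improper functions, whose supremum is infinite.\<close>

definition hinf_norm_defined :: "transfer_function \<Rightarrow> bool" where
  "hinf_norm_defined h \<longleftrightarrow>
     (\<forall>s. tf_pole h s \<longrightarrow> Re s < 0) \<and>
     bdd_above (range (\<lambda>\<omega>::real. cmod (tf_eval h (\<i> * complex_of_real \<omega>))))"


section \<open>Interconnections of passive LTI circuit elements\<close>

text \<open>
  Natural numbers name the nodes of a circuit. The real parameter is the resistance, inductance,
  capacitance, turns ratio or gyration resistance. The transformer and the gyrator are two-port
  elements; \<open>element_ports\<close> lists the node pair of each port.
\<close>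

datatype element =
    Resistor nat nat real
  | Inductor nat nat real
  | Capacitor nat nat real
  | Transformer nat nat nat nat real
  | Gyrator nat nat nat nat real

fun element_ports :: "element \<Rightarrow> (nat \<times> nat) list" where
  "element_ports (Resistor m n _) = [(m, n)]"
| "element_ports (Inductor m n _) = [(m, n)]"
| "element_ports (Capacitor m n _) = [(m, n)]"
| "element_ports (Transformer m n m' n' _) = [(m, n), (m', n')]"
| "element_ports (Gyrator m n m' n' _) = [(m, n), (m', n')]"

fun passive_element :: "element \<Rightarrow> bool" where
  "passive_element (Resistor _ _ r) \<longleftrightarrow> 0 < r"
| "passive_element (Inductor _ _ l) \<longleftrightarrow> 0 < l"
| "passive_element (Capacitor _ _ c) \<longleftrightarrow> 0 < c"
| "passive_element (Transformer _ _ _ _ _) \<longleftrightarrow> True"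
| "passive_element (Gyrator _ _ _ _ _) \<longleftrightarrow> True"

datatype one_port = One_Port (elements: "element list") (plus_terminal: nat) (minus_terminal: nat)

definition passive_one_port :: "one_port \<Rightarrow> bool" where
  "passive_one_port C \<longleftrightarrow> (\<forall>e \<in> set (elements C). passive_element e)"

text \<open>Voltage across port \<open>p\<close> of an element, given the node potentials.\<close>

definition element_voltage :: "(nat \<Rightarrow> 'a::ab_group_add) \<Rightarrow> element \<Rightarrow> nat \<Rightarrow> 'a" where
  "element_voltage \<phi> e p = \<phi> (fst (element_ports e ! p)) - \<phi> (snd (element_ports e ! p))"

text \<open>
  Kirchhoff's current law. \<open>c k p\<close> is the current through port \<open>p\<close> of the \<open>k\<close>-th element, directed
  from the first to the second node of that port; \<open>i\<close> enters the circuit at the plus terminal and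
  leaves it at the minus terminal.
\<close>

definition kcl :: "one_port \<Rightarrow> (nat \<Rightarrow> nat \<Rightarrow> 'a::ab_group_add) \<Rightarrow> 'a \<Rightarrow> bool" where
  "kcl C c i \<longleftrightarrow> (\<forall>n.
     (\<Sum>k<length (elements C). \<Sum>p<length (element_ports (elements C ! k)).
        (if fst (element_ports (elements C ! k) ! p) = n then c k p else 0)
      - (if snd (element_ports (elements C ! k) ! p) = n then c k p else 0))
     = (if n = plus_terminal C then i else 0) - (if n = minus_terminal C then i else 0))"

text \<open>
  The element laws, first between Laplace-domain amplitudes at the complex frequency \<open>s\<close>, then
  between signals on the time axis \<open>[0, \<infinity>)\<close>. The first argument after the element gives the
  port voltages, the second the port currents.
\<close>

fun phasor_law :: "complex \<Rightarrow> element \<Rightarrow> (nat \<Rightarrow> complex) \<Rightarrow> (nat \<Rightarrow> complex) \<Rightarrow> bool" where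
  "phasor_law s (Resistor _ _ r) u i \<longleftrightarrow> u 0 = complex_of_real r * i 0"
| "phasor_law s (Inductor _ _ l) u i \<longleftrightarrow> u 0 = s * complex_of_real l * i 0"
| "phasor_law s (Capacitor _ _ c) u i \<longleftrightarrow> i 0 = s * complex_of_real c * u 0"
| "phasor_law s (Transformer _ _ _ _ r) u i \<longleftrightarrow>
     u 0 = complex_of_real r * u 1 \<and> i 1 = - complex_of_real r * i 0"
| "phasor_law s (Gyrator _ _ _ _ r) u i \<longleftrightarrow>
     u 0 = - complex_of_real r * i 1 \<and> u 1 = complex_of_real r * i 0"

fun time_law :: "element \<Rightarrow> (nat \<Rightarrow> real \<Rightarrow> real) \<Rightarrow> (nat \<Rightarrow> real \<Rightarrow> real) \<Rightarrow> bool" where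
  "time_law (Resistor _ _ r) u i \<longleftrightarrow> (\<forall>t\<ge>0. u 0 t = r * i 0 t)"
| "time_law (Inductor _ _ l) u i \<longleftrightarrow>
     (\<forall>t\<ge>0. (i 0 has_real_derivative u 0 t / l) (at t within {0..}))"
| "time_law (Capacitor _ _ c) u i \<longleftrightarrow>
     (\<forall>t\<ge>0. (u 0 has_real_derivative i 0 t / c) (at t within {0..}))"
| "time_law (Transformer _ _ _ _ r) u i \<longleftrightarrow> (\<forall>t\<ge>0. u 0 t = r * u 1 t \<and> i 1 t = - r * i 0 t)"
| "time_law (Gyrator _ _ _ _ r) u i \<longleftrightarrow> (\<forall>t\<ge>0. u 0 t = - r * i 1 t \<and> u 1 t = r * i 0 t)"

definition port_phasor :: "one_port \<Rightarrow> complex \<Rightarrow> complex \<Rightarrow> complex \<Rightarrow> bool" where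
  "port_phasor C s v i \<longleftrightarrow> (\<exists>\<phi> c.
     v = \<phi> (plus_terminal C) - \<phi> (minus_terminal C) \<and>
     kcl C c i \<and>
     (\<forall>k<length (elements C).
        phasor_law s (elements C ! k) (element_voltage \<phi> (elements C ! k)) (c k)))"

text \<open>Impedance and admittance are identities of rational functions, hence the finite exceptional set.\<close>

definition has_impedance :: "one_port \<Rightarrow> transfer_function \<Rightarrow> bool" where
  "has_impedance C z \<longleftrightarrow> finite {s. \<not> (\<forall>v i. port_phasor C s v i \<longleftrightarrow> v = tf_eval z s * i)}"

definition has_admittance :: "one_port \<Rightarrow> transfer_function \<Rightarrow> bool" where
  "has_admittance C y \<longleftrightarrow> finite {s. \<not> (\<forall>v i. port_phasor C s v i \<longleftrightarrow> i = tf_eval y s * v)}"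

text \<open>
  Port signals \<open>(v, i)\<close> compatible with the circuit. The initial capacitor voltages and inductor
  currents are not constrained, so all initial conditions are covered.
\<close>

definition port_trajectory :: "one_port \<Rightarrow> (real \<Rightarrow> real) \<Rightarrow> (real \<Rightarrow> real) \<Rightarrow> bool" where
  "port_trajectory C v i \<longleftrightarrow> (\<exists>\<phi> c.
     (\<forall>n. continuous_on {0..} (\<phi> n)) \<and>
     (\<forall>k p. continuous_on {0..} (c k p)) \<and>
     (\<forall>t\<ge>0. v t = \<phi> (plus_terminal C) t - \<phi> (minus_terminal C) t) \<and>
     (\<forall>t\<ge>0. kcl C (\<lambda>k p. c k p t) (i t)) \<and>
     (\<forall>k<length (elements C).
        time_law (elements C ! k)
          (\<lambda>p t. element_voltage (\<lambda>n. \<phi> n t) (elements C ! k) p) (c k)))"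


section \<open>Networks\<close>

text \<open>
  A network has nodes \<open>0, \<dots>, M - 1\<close>, of which \<open>0, \<dots>, N - 1\<close> are the boundary nodes. A weight
  \<open>a m n = 0\<close> means that there is no branch between \<open>m\<close> and \<open>n\<close>.
\<close>

definition weighted_graph :: "nat \<Rightarrow> (nat \<Rightarrow> nat \<Rightarrow> real) \<Rightarrow> bool" where
  "weighted_graph M a \<longleftrightarrow>
     (\<forall>m<M. \<forall>n<M. a m n = a n m \<and> 0 \<le> a m n) \<and> (\<forall>m<M. a m m = 0)"

definition connected_graph :: "nat \<Rightarrow> (nat \<Rightarrow> nat \<Rightarrow> real) \<Rightarrow> bool" where
  "connected_graph M a \<longleftrightarrow>
     (\<forall>m<M. \<forall>n<M. (m, n) \<in> {(j, k). j < M \<and> k < M \<and> 0 < a j k}\<^sup>*)"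

text \<open>
  The Laplacian matrix of real weights, which is also the admittance matrix of a network without
  shunt elements when the weights are branch admittances.
\<close>

definition laplacian :: "nat \<Rightarrow> (nat \<Rightarrow> nat \<Rightarrow> 'a::ab_group_add) \<Rightarrow> 'a mat" where
  "laplacian M w = mat M M (\<lambda>(m, n). if m = n then (\<Sum>k<M. w m k) else - w m n)"

definition interior_block :: "nat \<Rightarrow> 'a mat \<Rightarrow> 'a mat" where
  "interior_block N Y = (case split_block Y N N of (YNN, YNI, YIN, YII) \<Rightarrow> YII)"

definition kron_reduction :: "nat \<Rightarrow> 'a::field mat \<Rightarrow> 'a mat" where
  "kron_reduction N Y = (case split_block Y N N of (YNN, YNI, YIN, YII) \<Rightarrow>
     YNN - YNI * the (mat_inverse YII) * transpose_mat YNI)"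


section \<open>The coupled system\<close>

text \<open>
  \<open>nondiff_points\<close> is empty for a differentiable characteristic and consists of break points for a
  piecewise linear one, in which case \<open>max_slope\<close> is the supremum over the slopes of the pieces.
\<close>

definition nondiff_points :: "(real \<Rightarrow> real) \<Rightarrow> real set" where
  "nondiff_points g = {x. \<not> g differentiable (at x)}"

definition slopes :: "(real \<Rightarrow> real) \<Rightarrow> real set" where
  "slopes g = (\<lambda>x. \<bar>deriv g x\<bar>) ` (- nondiff_points g)"

definition max_slope :: "(real \<Rightarrow> real) \<Rightarrow> real" where
  "max_slope g = Sup (slopes g)"

definition bounded_slope_source :: "(real \<Rightarrow> real) \<Rightarrow> bool" where
  "bounded_slope_source g \<longleftrightarrow>
     continuous_on UNIV g \<and>
     (\<forall>x y. finite (nondiff_points g \<inter> {x..y})) \<and>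
     bdd_above (slopes g)"

text \<open>
  \<open>v m\<close> is the voltage of node \<open>m\<close>, \<open>i m\<close> the current injected into the network at node \<open>m\<close>, and
  \<open>b m n\<close> the current from \<open>m\<close> to \<open>n\<close> in the branch between these nodes. Every boundary node carries
  its own copy of the linear circuit \<open>C\<close>, in parallel with the source current \<open>- g (v j)\<close>;
  \<open>line m n\<close> is the circuit forming the branch between \<open>m\<close> and \<open>n\<close>, for \<open>m < n\<close>.
\<close>

definition coupled_trajectory ::
  "nat \<Rightarrow> nat \<Rightarrow> one_port \<Rightarrow> (real \<Rightarrow> real) \<Rightarrow> (nat \<Rightarrow> nat \<Rightarrow> real) \<Rightarrow> (nat \<Rightarrow> nat \<Rightarrow> one_port) \<Rightarrow>
   (nat \<Rightarrow> real \<Rightarrow> real) \<Rightarrow> (nat \<Rightarrow> real \<Rightarrow> real) \<Rightarrow> (nat \<Rightarrow> nat \<Rightarrow> real \<Rightarrow> real) \<Rightarrow> bool" where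
  "coupled_trajectory N M C g a line v i b \<longleftrightarrow>
     (\<forall>j<N. port_trajectory C (v j) (\<lambda>t. - g (v j t) - i j t)) \<and>
     (\<forall>n<M. \<forall>m<n. 0 < a m n \<longrightarrow> port_trajectory (line m n) (\<lambda>t. v m t - v n t) (b m n)) \<and>
     (\<forall>m<M. \<forall>n<M. \<forall>t\<ge>0. b n m t = - b m n t \<and> (a m n = 0 \<longrightarrow> b m n t = 0)) \<and>
     (\<forall>m<M. \<forall>t\<ge>0. i m t = (\<Sum>n<M. b m n t)) \<and>
     (\<forall>m. N \<le> m \<and> m < M \<longrightarrow> (\<forall>t\<ge>0. i m t = 0))"

end

theory Submission
  imports Defs
begin

text \<open>
  Convolving a trajectory with a smooth bump supported in \<open>(0, \<epsilon>)\<close> turns the circuit equations into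
  equations between smooth signals, on which polynomials in the derivative \<open>D\<close> act, so that
  elimination is linear algebra over \<open>\<complex>[D]\<close>. At the ports this gives the relations \<open>d v = n i\<close> that
  describe the impedance and the admittances, up to hidden modes; a hidden mode that does not decay could be
  combined with a controllable motion into a trajectory extracting unbounded energy from a passive
  circuit, so all hidden modes decay. Kron reduction eliminates the interior nodes, and an
  orthonormal eigenbasis of \<open>L\<close> decouples the network into scalar loops.

  Each mode with \<open>\<lambda> \<noteq> 0\<close> is driven by the corresponding mode of \<open>g(v)\<close> through a stable transfer function
  \<open>G / H\<close> of gain \<open>\<gamma> < 1 / \<sigma>\<close>. Spectral factorization of \<open>\<gamma>\<^sup>2 \<bar>H\<bar>\<^sup>2 - \<bar>G\<bar>\<^sup>2\<close> on the imaginary axis gives the \<open>L\<^sup>2\<close>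
  gain. Since \<open>g\<close> is Lipschitz with constant \<open>\<sigma>\<close>, the nonzero modes of \<open>g(v)\<close> are bounded by \<open>\<sigma>\<close> times those
  of \<open>v\<close>, and the small-gain argument makes all of them square integrable. A mode then differs from its
  input times the gain at infinite frequency by a vanishing function, and a second small-gain
  argument, now pointwise, yields convergence to \<open>0\<close>.
\<close>

text \<open>Laplace transforms of trajectories are of no direct use: the loop is nonlinear, internal
  potentials and currents are only continuous and perhaps not determined by the ports, and no growth
  bound is given. Transfer functions therefore enter as coprime polynomials acting on smooth
  signals, and every cancellation is an issue. Inside a circuit, the impedance forgets hidden modes,
  which the annihilators \<alpha> retain. In the loop, \<open>lft\<close> is reduced to lowest
  terms, so its stability alone does not exclude a cancelled zero of the loop denominator in the
  closed right half plane; positive realness of both factors does. The frequency bound becomes an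
  energy bound without Fourier theory: integration by parts makes the energy of q(D) w depend only
  on q times its adjoint. Square integrability does not end the proof, since G / H may have direct
  feedthrough; but the feedthrough has modulus at most \<gamma>, being a limit of values on the
  axis. The modes are treated jointly because g mixes them: only the sum over all nonzero modes is
  controlled by the Lipschitz constant.\<close>

lemma max_slope_lipschitz:
  assumes "bounded_slope_source g"
  shows "0 \<le> max_slope g" "\<bar>g x - g y\<bar> \<le> max_slope g * \<bar>x - y\<bar>"
proof -
  have bdd: "bdd_above (slopes g)" and cont: "continuous_on UNIV g"
    and fin: "\<And>x y. finite (nondiff_points g \<inter> {x..y})"
    using assms by (auto simp: bounded_slope_source_def)
  have slope: "\<bar>deriv g x\<bar> \<le> max_slope g" if "x \<notin> nondiff_points g" for x
    unfolding max_slope_def using bdd that by (intro cSup_upper) (auto simp: slopes_def)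
  \<comment> \<open>A supremum over an empty set would carry no information, so one point of
    differentiability is exhibited: break points are finite in number on [0, 1].\<close>
  have "infinite ({0..1::real} - nondiff_points g \<inter> {0..1})"
    by (rule Diff_infinite_finite[OF fin]) auto
  then obtain x0 where "x0 \<notin> nondiff_points g"
    by (metis Diff_eq_empty_iff Int_iff finite.emptyI subsetI)
  from slope[OF this] show nonneg: "0 \<le> max_slope g" by linarith
  have main: "\<bar>g y - g x\<bar> \<le> max_slope g * (y - x)" if "x \<le> y" for x y
  proof -
    define S where "S = nondiff_points g \<inter> {x..y}"
    define f' where "f' = (\<lambda>t. if t \<in> S then 0 else deriv g t)"
    \<comment> \<open>The fundamental theorem of calculus tolerates the finite set of break points,
      and the value 0 given to \<open>f'\<close> there respects the bound.\<close>
    have "(f' has_integral (g y - g x)) {x..y}"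
    proof (rule fundamental_theorem_of_calculus_interior_strong[of S])
      show "finite S" unfolding S_def by (rule fin)
      show "x \<le> y" by fact
      show "(g has_vector_derivative f' t) (at t)" if "t \<in> {x<..<y} - S" for t
        using that unfolding f'_def S_def nondiff_points_def
        by (auto simp: has_real_derivative_iff_has_vector_derivative[symmetric]
            real_differentiable_def dest: DERIV_imp_deriv)
      show "continuous_on {x..y} g" using cont by (rule continuous_on_subset) auto
    qed
    moreover have "finite S" unfolding S_def by (rule fin)
    ultimately have "norm (g y - g x) \<le> max_slope g * Henstock_Kurzweil_Integration.content {x..y}"
      by (intro has_integral_bound_real[of "max_slope g" S f'])
         (use nonneg slope in \<open>auto simp: f'_def S_def\<close>)
    then show ?thesis using that by simp
  qed
  show "\<bar>g x - g y\<bar> \<le> max_slope g * \<bar>x - y\<bar>"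
    using main[of x y] main[of y x] by (cases "x \<le> y") auto
qed

subsection \<open>Laplacians and Kron reduction\<close>

lemma laplacian_index:
  assumes "m < M" "n < M"
  shows "laplacian M w $$ (m, n) = (if m = n then (\<Sum>k<M. w m k) else - w m n)"
  using assms by (simp add: laplacian_def)

lemma laplacian_row_weighted:
  fixes w :: "nat \<Rightarrow> nat \<Rightarrow> 'a::comm_ring_1"
  assumes "m < M" "w m m = 0"
  shows "(\<Sum>n<M. laplacian M w $$ (m, n) * x n) = (\<Sum>n<M. w m n * (x m - x n))"
proof -
  have "(\<Sum>n<M. laplacian M w $$ (m, n) * x n) = 
     (\<Sum>n<M. (if n = m then (\<Sum>k<M. w m k) * x m else 0) - w m n * x n)"
    using assms by (intro sum.cong refl) (auto simp: laplacian_index)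
  also have "\<dots> = (\<Sum>k<M. w m k) * x m - (\<Sum>n<M. w m n * x n)"
    using assms by (simp add: sum_subtractf)
  also have "\<dots> = (\<Sum>n<M. w m n * (x m - x n))"
    by (simp add: sum_distrib_right sum_subtractf right_diff_distrib)
  finally show ?thesis .
qed

text \<open>Adding the form to its copy with the indices exchanged symmetrizes each term into a
  squared modulus; this is where the factor 1/2 comes from.\<close>

lemma laplacian_energy:
  fixes w :: "nat \<Rightarrow> nat \<Rightarrow> real" and x :: "nat \<Rightarrow> complex"
  assumes w: "weighted_graph M w"
  shows "(\<Sum>m<M. cnj (x m) * (\<Sum>n<M. of_real (laplacian M w $$ (m, n)) * x n)) =
     of_real ((\<Sum>m<M. \<Sum>n<M. w m n * (cmod (x m - x n))\<^sup>2) / 2)"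
proof -
  have sym: "w m n = w n m" and diag: "w m m = 0" if "m < M" "n < M" for m n
    using w that by (auto simp: weighted_graph_def)
  have row: "(\<Sum>n<M. of_real (laplacian M w $$ (m, n)) * x n) = (\<Sum>n<M. of_real (w m n) * (x m - x n))"
    if m: "m < M" for m
  proof -
    have "complex_of_real (laplacian M w $$ (m, n)) = laplacian M (\<lambda>m n. complex_of_real (w m n)) $$ (m, n)" if "n < M" for n
      using m that by (simp add: laplacian_index)
    then show ?thesis
      using laplacian_row_weighted[of m M "\<lambda>m n. complex_of_real (w m n)" x] m diag by simp
  qed
  define S where "S = (\<Sum>m<M. \<Sum>n<M. of_real (w m n) * (cnj (x m) * (x m - x n)))"
  have "S = (\<Sum>m<M. \<Sum>n<M. of_real (w m n) * (cnj (x n) * (x n - x m)))"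
    unfolding S_def by (subst sum.swap) (intro sum.cong refl, simp add: sym)
  then have "S + S = (\<Sum>m<M. \<Sum>n<M. of_real (w m n) * (cnj (x m) * (x m - x n)) + of_real (w m n) * (cnj (x n) * (x n - x m)))"
    by (subst (1) S_def) (simp add: sum.distrib)
  also have "\<dots> = (\<Sum>m<M. \<Sum>n<M. of_real (w m n * (cmod (x m - x n))\<^sup>2))"
    by (intro sum.cong refl) (simp only: of_real_mult complex_norm_square, simp add: algebra_simps)
  finally have "S + S = of_real (\<Sum>m<M. \<Sum>n<M. w m n * (cmod (x m - x n))\<^sup>2)" by simp
  moreover have "(\<Sum>m<M. cnj (x m) * (\<Sum>n<M. of_real (laplacian M w $$ (m, n)) * x n)) = S"
    unfolding S_def by (intro sum.cong refl) (simp only: row lessThan_iff sum_distrib_left mult.left_commute)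
  ultimately show ?thesis by (simp add: field_simps)
qed

text \<open>Induction along a path, the form in which connectedness is used.\<close>

lemma connected_graph_invariant:
  assumes "connected_graph M a" "m < M" "n < M" "P m"
    and "\<And>j k. j < M \<Longrightarrow> k < M \<Longrightarrow> 0 < a j k \<Longrightarrow> P j \<Longrightarrow> P k"
  shows "P n"
proof -
  have "(m, n) \<in> {(j, k). j < M \<and> k < M \<and> 0 < a j k}\<^sup>*"
    using assms(1-3) by (auto simp: connected_graph_def)
  then show ?thesis by (induction rule: rtrancl_induct) (use assms(4,5) in auto)
qed

text \<open>Nonnegative summands of a zero sum vanish one by one, so x agrees across every edge of
  positive weight.\<close>

lemma connected_zero_energy_const:
  fixes x :: "nat \<Rightarrow> complex"
  assumes w: "weighted_graph M w" and c: "connected_graph M w"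
    and e: "(\<Sum>m<M. \<Sum>n<M. w m n * (cmod (x m - x n))\<^sup>2) = 0" and "m < M" "n < M"
  shows "x n = x m"
proof (rule connected_graph_invariant[OF c, where P = "\<lambda>n. x n = x m" and m = m])
  have nn: "0 \<le> w j k * (cmod (x j - x k))\<^sup>2" if "j < M" "k < M" for j k
    using w that by (auto simp: weighted_graph_def)
  fix j k assume jk: "j < M" "k < M" "0 < w j k" "x j = x m"
  have "\<forall>m\<in>{..<M}. (\<Sum>n<M. w m n * (cmod (x m - x n))\<^sup>2) = 0"
    using e nn by (subst (asm) sum_nonneg_eq_0_iff) (auto intro!: sum_nonneg)
  then have "(\<Sum>n<M. w j n * (cmod (x j - x n))\<^sup>2) = 0" using jk(1) by blast
  then have "\<forall>n\<in>{..<M}. w j n * (cmod (x j - x n))\<^sup>2 = 0"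
    using nn[OF jk(1)] by (subst (asm) sum_nonneg_eq_0_iff) auto
  then have "w j k * (cmod (x j - x k))\<^sup>2 = 0" using jk(2) by blast
  then have "x j = x k" using jk(3) by simp
  with jk(4) show "x k = x m" by simp
qed (use assms in auto)

section \<open>Kron reduction with uniform line characteristics\<close>

lemma laplacian_smult:
  "laplacian M (\<lambda>m n. y * f (a m n)) = y \<cdot>\<^sub>m laplacian M (\<lambda>m n. f (a m n))"
  for y :: "'a::comm_ring_1"
  by (intro eq_matI) (auto simp: laplacian_def sum_distrib_left)

text \<open>Supplies the homomorphism laws for sums, differences and matrix products when real
  matrices are embedded into matrices of transfer functions.\<close>

interpretation tf_const: inj_comm_ring_hom tf_const
proof -
  have e: "tf_const = (\<lambda>c. to_fract [:complex_of_real c:])" by (rule ext) (simp add: tf_const_def)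
  have one: "[:1::complex:] = 1" by (simp add: one_pCons)
  show "inj_comm_ring_hom tf_const"
    by unfold_locales (simp_all add: e one flip: to_fract_add to_fract_mult)
qed

lemma tf_const_laplacian:
  "laplacian M (\<lambda>m n. tf_const (a m n)) = map_mat tf_const (laplacian M a)"
  by (intro eq_matI) (auto simp: laplacian_def tf_const.hom_sum tf_const.hom_uminus)

lemma split_block_eq:
  "split_block Y N N = (mat N N (\<lambda>ij. Y $$ ij), mat N (dim_col Y - N) (\<lambda>(i, j). Y $$ (i, j + N)),
     mat (dim_row Y - N) N (\<lambda>(i, j). Y $$ (i + N, j)),
     mat (dim_row Y - N) (dim_col Y - N) (\<lambda>(i, j). Y $$ (i + N, j + N)))"
  by (simp add: split_block_def Let_def)

lemma laplacian_carrier [simp]: "laplacian M w \<in> carrier_mat M M"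
  by (simp add: laplacian_def)

lemma laplacian_dim [simp]: "dim_row (laplacian M w) = M" "dim_col (laplacian M w) = M"
  by (simp_all add: laplacian_def)

lemma mat_inverse_eqI:
  fixes A :: "'a::field mat"
  assumes "A \<in> carrier_mat n n" "B \<in> carrier_mat n n" "A * B = 1\<^sub>m n"
  shows "mat_inverse A = Some B"
proof -
  have BA: "B * A = 1\<^sub>m n" by (rule mat_mult_left_right_inverse[OF assms])
  have "A \<in> Units (ring_mat TYPE('a) n ())"
    unfolding Units_def ring_mat_def using assms BA by auto
  with mat_inverse(1)[OF assms(1), of "()"] obtain Z where Z: "mat_inverse A = Some Z" by (cases "mat_inverse A") auto
  from mat_inverse(2)[OF assms(1) Z] have z: "Z * A = 1\<^sub>m n" "Z \<in> carrier_mat n n" by auto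
  have "Z = Z * (A * B)" using assms z by simp
  also have "\<dots> = (Z * A) * B" by (rule assoc_mult_mat[symmetric, OF z(2) assms(1,2)])
  also have "\<dots> = B" using assms z by simp
  finally show ?thesis using Z by simp
qed

text \<open>The determinant of the scaled interior block is y^k times that of the real one, with k =
  M - N. Invertibility over the rational functions therefore gives invertibility over the reals, and
  y is nonzero unless k = 0. In the Schur complement the factors y and 1 / y meet, so that one y
  remains; k = 0 is treated apart because y may then vanish.\<close>

lemma kron_reduction_uniform:
  fixes a :: "nat \<Rightarrow> nat \<Rightarrow> real" and y :: transfer_function
  assumes NM: "N \<le> M"
    and inv: "invertible_mat (interior_block N (laplacian M (\<lambda>m n. y * tf_const (a m n))))"
  defines "A \<equiv> laplacian M a"
  shows "kron_reduction N (laplacian M (\<lambda>m n. y * tf_const (a m n))) = y \<cdot>\<^sub>m map_mat tf_const (kron_reduction N A)"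
    and "\<exists>R \<in> carrier_mat (M - N) (M - N). interior_block N A * R = 1\<^sub>m (M - N) \<and> R * interior_block N A = 1\<^sub>m (M - N) \<and>
      mat_inverse (interior_block N A) = Some R"
proof -
  define k where "k = M - N"
  define YI where "YI = interior_block N A"
  define B where "B = mat N k (\<lambda>(i, j). A $$ (i, j + N))"
  have dA: "dim_row A = M" "dim_col A = M" by (simp_all add: A_def)
  have ib: "YI = mat k k (\<lambda>(i, j). A $$ (i + N, j + N))"
    by (simp add: YI_def interior_block_def split_block_eq dA k_def)
  have YI: "YI \<in> carrier_mat k k" by (simp add: ib)
  have YA: "laplacian M (\<lambda>m n. y * tf_const (a m n)) = y \<cdot>\<^sub>m map_mat tf_const A" (is "?YA = _")
    by (simp add: laplacian_smult tf_const_laplacian A_def)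
  have ibY: "interior_block N ?YA = y \<cdot>\<^sub>m map_mat tf_const YI"
    unfolding YA ib using NM
    by (intro eq_matI) (auto simp: interior_block_def split_block_eq dA k_def)
  let ?YI = "y \<cdot>\<^sub>m map_mat tf_const YI"
  have cYI: "?YI \<in> carrier_mat k k" using YI by simp
  from inv[unfolded ibY] obtain Z where "inverts_mat ?YI Z" "inverts_mat Z ?YI"
    by (auto simp: invertible_mat_def)
  then have Z: "?YI * Z = 1\<^sub>m k" "Z * ?YI = 1\<^sub>m (dim_row Z)" using YI by (auto simp: inverts_mat_def)
  have "dim_col Z = k" using arg_cong[OF Z(1), of dim_col] by simp
  moreover have "dim_row Z = k" using arg_cong[OF Z(2), of dim_col] YI by simp
  ultimately have cZ: "Z \<in> carrier_mat k k" by auto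
  have "det ?YI * det Z = 1" using det_mult[OF cYI cZ] Z(1) by simp
  then have "det ?YI \<noteq> 0" by (metis mult_zero_left zero_neq_one)
  then have dets: "det YI \<noteq> 0" and y0: "y \<noteq> 0 \<or> k = 0"
    using YI by (auto simp: power_0_left split: if_splits)
  from det_non_zero_imp_unit[OF YI dets, of "()"] obtain R where R: "YI * R = 1\<^sub>m k" "R \<in> carrier_mat k k"
    unfolding Units_def ring_mat_def by auto
  have R': "R * YI = 1\<^sub>m k" by (rule mat_mult_left_right_inverse[OF YI R(2,1)])
  have invR: "mat_inverse YI = Some R" by (rule mat_inverse_eqI[OF YI R(2,1)])
  with R R' show "\<exists>R \<in> carrier_mat (M - N) (M - N). interior_block N A * R = 1\<^sub>m (M - N) \<and> R * interior_block N A
      = 1\<^sub>m (M - N) \<and>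
      mat_inverse (interior_block N A) = Some R" unfolding YI_def k_def by auto
  define W where "W = (1 / y) \<cdot>\<^sub>m map_mat tf_const R"
  have cW: "W \<in> carrier_mat k k" using R by (simp add: W_def)
  have "?YI * W = 1\<^sub>m k"
  proof (cases "k = 0")
    case True
    then show ?thesis using cYI cW by (intro eq_matI) auto
  next
    case False
    with y0 have "y \<noteq> 0" by simp
    have "?YI * W = (y * (1 / y)) \<cdot>\<^sub>m (map_mat tf_const YI * map_mat tf_const R)"
      unfolding W_def using YI R(2)
      by (intro eq_matI) (auto simp: scalar_prod_def sum_distrib_left mult_ac)
    also have "map_mat tf_const YI * map_mat tf_const R = 1\<^sub>m k"
      using tf_const.mat_hom_mult[OF YI R(2)] R(1) by (simp add: tf_const.mat_hom_one)
    also have "(y * (1 / y)) \<cdot>\<^sub>m 1\<^sub>m k = 1\<^sub>m k" using \<open>y \<noteq> 0\<close> by (intro eq_matI) auto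
    finally show ?thesis .
  qed
  then have invW: "mat_inverse ?YI = Some W" by (rule mat_inverse_eqI[OF cYI cW])
  have B: "B \<in> carrier_mat N k" by (simp add: B_def)
  have kA: "kron_reduction N A = mat N N (\<lambda>ij. A $$ ij) - B * R * transpose_mat B"
    using invR unfolding ib B_def by (simp add: kron_reduction_def split_block_eq dA flip: k_def)
  have yB: "mat N k (\<lambda>(i, j). ?YA $$ (i, j + N)) = y \<cdot>\<^sub>m map_mat tf_const B"
    unfolding YA B_def using NM by (intro eq_matI) (auto simp: dA k_def)
  have yI: "mat k k (\<lambda>(i, j). ?YA $$ (i + N, j + N)) = ?YI"
    using ibY by (simp add: interior_block_def split_block_eq k_def)
  have kY: "kron_reduction N ?YA = mat N N (\<lambda>ij. ?YA $$ ij)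
      - (y \<cdot>\<^sub>m map_mat tf_const B) * W * transpose_mat (y \<cdot>\<^sub>m map_mat tf_const B)"
    using invW yB yI by (simp add: kron_reduction_def split_block_eq k_def)
  have prod: "(y \<cdot>\<^sub>m map_mat tf_const B) * W * transpose_mat (y \<cdot>\<^sub>m map_mat tf_const B)
      = y \<cdot>\<^sub>m map_mat tf_const (B * R * transpose_mat B)"
  proof (cases "k = 0")
    case True
    then show ?thesis using B R(2) cW by (intro eq_matI) (auto simp: scalar_prod_def)
  next
    case False
    with y0 have "y \<noteq> 0" by simp
    have "(y \<cdot>\<^sub>m map_mat tf_const B) * W = map_mat tf_const B * map_mat tf_const R"
      unfolding W_def using B R(2) \<open>y \<noteq> 0\<close>
      by (intro eq_matI) (auto simp: scalar_prod_def)
    also have "\<dots> = map_mat tf_const (B * R)" by (rule tf_const.mat_hom_mult[symmetric, OF B R(2)])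
    finally have "(y \<cdot>\<^sub>m map_mat tf_const B) * W * transpose_mat (y \<cdot>\<^sub>m map_mat tf_const B)
       = map_mat tf_const (B * R) * (y \<cdot>\<^sub>m map_mat tf_const (transpose_mat B))"
      using B by (simp add: transpose_mat_def) (rule arg_cong2[of _ _ _ _ "(*)"], auto intro!: eq_matI)
    also have "\<dots> = y \<cdot>\<^sub>m (map_mat tf_const (B * R) * map_mat tf_const (transpose_mat B))"
      using B R(2) by (intro mult_smult_distrib[of _ N k _ N]) auto
    also have "map_mat tf_const (B * R) * map_mat tf_const (transpose_mat B) = map_mat tf_const (B * R * transpose_mat B)"
      using B R(2) by (intro tf_const.mat_hom_mult[symmetric, of _ N k _ N]) auto
    finally show ?thesis .
  qed
  show "kron_reduction N ?YA = y \<cdot>\<^sub>m map_mat tf_const (kron_reduction N A)"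
    unfolding kY kA prod unfolding YA using NM B R(2)
    by (intro eq_matI) (auto simp: dA tf_const.hom_minus right_diff_distrib)
qed

text \<open>Block elimination by rows, with K = B R for the inverse R of the interior block. In this
  form the reduction can be applied to signals, where the real coefficients K commute with all
  polynomials in D.\<close>

lemma kron_reduction_elimination:
  fixes a :: "nat \<Rightarrow> nat \<Rightarrow> real" and y :: transfer_function
  assumes NM: "N \<le> M" and w: "weighted_graph M a"
    and inv: "invertible_mat (interior_block N (laplacian M (\<lambda>m n. y * tf_const (a m n))))"
  defines "A \<equiv> laplacian M a"
  shows "\<exists>K. \<forall>j<N. \<forall>k<M. A $$ (j, k) - (\<Sum>m=N..<M. K j m * A $$ (m, k)) =
    (if k < N then kron_reduction N A $$ (j, k) else 0)"
proof -
  define q where "q = M - N"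
  obtain R where R: "R \<in> carrier_mat q q" "R * interior_block N A = 1\<^sub>m q" "mat_inverse (interior_block N A) = Some R"
    using kron_reduction_uniform(2)[OF NM inv] unfolding A_def q_def by auto
  have dA: "dim_row A = M" "dim_col A = M" by (simp_all add: A_def)
  define B where "B = mat N q (\<lambda>(i, j). A $$ (i, j + N))"
  have ib: "interior_block N A = mat q q (\<lambda>(i, j). A $$ (i + N, j + N))"
    by (simp add: interior_block_def split_block_eq dA q_def)
  have B: "B \<in> carrier_mat N q" by (simp add: B_def)
  have kA: "kron_reduction N A = mat N N (\<lambda>ij. A $$ ij) - B * R * transpose_mat B"
    using R(3) unfolding ib by (simp add: kron_reduction_def split_block_eq dA q_def B_def)
  have sym: "A $$ (m, n) = A $$ (n, m)" if "m < M" "n < M" for m n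
    using w that unfolding A_def weighted_graph_def by (simp add: laplacian_index)
  define K where "K j m = (B * R) $$ (j, m - N)" for j m
  have shift: "(\<Sum>m=N..<M. f m) = (\<Sum>m=0..<q. f (m + N))" for f :: "nat \<Rightarrow> real"
    using NM sum.shift_bounds_nat_ivl[of f 0 N q] by (simp add: q_def add.commute)
  have "A $$ (j, k) - (\<Sum>m=N..<M. K j m * A $$ (m, k)) = (if k < N then kron_reduction N A $$ (j, k) else 0)"
    if j: "j < N" and k: "k < M" for j k
  proof (cases "k < N")
    case True
    have "(\<Sum>m=N..<M. K j m * A $$ (m, k)) = (B * R * transpose_mat B) $$ (j, k)"
      unfolding shift using j True B R(1) NM
      by (subst index_mult_mat(1)) (auto simp: K_def scalar_prod_def q_def B_def sym intro!: sum.cong)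
    then show ?thesis unfolding kA using j True B R(1) by simp
  next
    case False
    define k' where "k' = k - N"
    have k': "k = k' + N" "k' < q" using False k by (auto simp: k'_def q_def)
    have "(\<Sum>m=N..<M. K j m * A $$ (m, k)) = (B * R * interior_block N A) $$ (j, k')"
      unfolding shift using j k' B R(1)
      by (subst index_mult_mat(1)) (auto simp: K_def scalar_prod_def ib intro!: sum.cong)
    also have "B * R * interior_block N A = B * (R * interior_block N A)"
      by (rule assoc_mult_mat[OF B R(1), of _ q]) (simp add: ib)
    also have "\<dots> = B" using R(2) B by simp
    finally show ?thesis using j k' False by (simp add: B_def)
  qed
  then show ?thesis by blast
qed

text \<open>The rows of (I, -K) are harmonic extensions of unit boundary potentials. The
  off-diagonal signs of \<open>L\<close> follow from the minimum principle, its symmetry from the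
  energy form, and a disconnected reduction would give a nonconstant potential of energy 0.\<close>

lemma kron_reduction_laplacian:
  fixes a :: "nat \<Rightarrow> nat \<Rightarrow> real" and L :: "real mat"
  assumes N: "0 < N" "N \<le> M" and w: "weighted_graph M a" and c: "connected_graph M a"
    and L: "L \<in> carrier_mat N N"
    and K: "\<And>j k. j < N \<Longrightarrow> k < M \<Longrightarrow> laplacian M a $$ (j, k) - (\<Sum>m=N..<M. K j m * laplacian M a $$ (m, k)) =
      (if k < N then L $$ (j, k) else 0)"
  shows "\<exists>w. weighted_graph N w \<and> connected_graph N w \<and> L = laplacian N w"
proof -
  let ?A = "laplacian M a"
  have asym: "a m n = a n m" and adiag: "a m m = 0" and ann: "0 \<le> a m n" if "m < M" "n < M" for m n
    using w that by (auto simp: weighted_graph_def)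
  have Asym: "?A $$ (m, n) = ?A $$ (n, m)" if "m < M" "n < M" for m n
    using that asym by (simp add: laplacian_index)
  \<comment> \<open>\<open>p j\<close> is the potential with value 1 at boundary node j, 0 at the
    other boundary nodes and no injection at interior nodes; row j of \<open>L\<close> lists its
    boundary injections.\<close>
  define p where "p j m = (if m < N then if m = j then 1 else 0 else - K j m)" for j m
  have pL: "(\<Sum>m<M. p j m * ?A $$ (m, k)) = (if k < N then L $$ (j, k) else 0)" if j: "j < N" and k: "k < M" for j k
  proof -
    have "(\<Sum>m<M. p j m * ?A $$ (m, k)) = (\<Sum>m<N. p j m * ?A $$ (m, k)) + (\<Sum>m=N..<M. p j m * ?A $$ (m, k))"
      using N sum.atLeastLessThan_concat[of 0 N M "\<lambda>m. p j m * ?A $$ (m, k)"] by (simp add: atLeast0LessThan)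
    also have "(\<Sum>m<N. p j m * ?A $$ (m, k)) = ?A $$ (j, k)"
      using j by (simp add: p_def if_distrib if_distribR cong: if_cong)
    also have "(\<Sum>m=N..<M. p j m * ?A $$ (m, k)) = - (\<Sum>m=N..<M. K j m * ?A $$ (m, k))"
      by (simp add: p_def sum_negf[symmetric])
    finally show ?thesis using K[OF j k] by simp
  qed
  have pw: "(\<Sum>m<M. a k m * (p j k - p j m)) = (if k < N then L $$ (j, k) else 0)" if j: "j < N" and k: "k < M" for j k
  proof -
    have "(\<Sum>m<M. a k m * (p j k - p j m)) = (\<Sum>m<M. ?A $$ (k, m) * p j m)"
      using laplacian_row_weighted[of k M a "p j"] k adiag by simp
    also have "\<dots> = (\<Sum>m<M. p j m * ?A $$ (m, k))"
      using k Asym by (intro sum.cong refl) (simp add: mult.commute)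
    finally show ?thesis using pL[OF j k] by simp
  qed
  \<comment> \<open>Minimum principle: at a negative minimum, necessarily interior, zero injection
    forces the same value on all neighbours; connectedness carries it to boundary node 0, where
    \<open>p j\<close> is nonnegative.\<close>
  have pnn: "0 \<le> p j n" if j: "j < N" and n: "n < M" for j n
  proof (rule ccontr)
    assume neg: "\<not> 0 \<le> p j n"
    have "\<exists>m<M. \<forall>k<M. p j m \<le> p j k"
    proof -
      have f: "finite (p j ` {..<M})" "p j ` {..<M} \<noteq> {}" using n by auto
      then obtain m where "m < M" "p j m = Min (p j ` {..<M})" using Min_in[OF f] by (metis imageE lessThan_iff)
      then show ?thesis using f Min_le[OF f(1)] by (intro exI[of _ m]) auto
    qed
    then obtain m where m: "m < M" "\<And>k. k < M \<Longrightarrow> p j m \<le> p j k" by blast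
    have neg': "p j m < 0" using m(2)[OF n] neg by linarith
    have "p j 0 = p j m"
    proof (rule connected_graph_invariant[OF c m(1), where P = "\<lambda>n. p j n = p j m"])
      fix k l assume kl: "k < M" "l < M" "0 < a k l" "p j k = p j m"
      have "\<not> k < N" using kl(4) neg' by (auto simp: p_def split: if_splits)
      then have "(\<Sum>i<M. a k i * (p j i - p j k)) = 0"
        using pw[OF j kl(1)] by (simp add: right_diff_distrib sum_subtractf)
      moreover have "0 \<le> a k i * (p j i - p j k)" if "i < M" for i
        using m(2)[OF that] ann[OF kl(1) that] kl(4) by simp
      ultimately have "\<forall>i\<in>{..<M}. a k i * (p j i - p j k) = 0"
        by (subst (asm) sum_nonneg_eq_0_iff) auto
      then have "a k l * (p j l - p j k) = 0" using kl(2) by blast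
      with kl show "p j l = p j m" by simp
    qed (use N in auto)
    moreover have "0 \<le> p j 0" using N by (simp add: p_def)
    ultimately show False using neg' by simp
  qed
  define w where "w j k = (if j = k then 0 else - L $$ (j, k))" for j k
  have wnn: "0 \<le> w j k" if "j < N" "k < N" for j k
  proof (cases "j = k")
    case False
    have "L $$ (j, k) = (\<Sum>m<M. a k m * (p j k - p j m))" using pw[of j k] that N by simp
    also have "\<dots> \<le> 0" using False that N
      by (intro sum_nonpos) (auto simp: p_def[of j k] intro!: mult_nonneg_nonneg ann pnn)
    finally show ?thesis using False by (simp add: w_def)
  qed (simp add: w_def)
  have Lsym: "L $$ (j, k) = L $$ (k, j)" if "j < N" "k < N" for j k
  proof -
    \<comment> \<open>\<open>L\<close> is the energy form of \<open>A\<close> evaluated at the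
      extensions: the injections of \<open>p j\<close> vanish in the interior, and on the boundary
      \<open>p k\<close> is a unit vector. Symmetry is thus inherited from \<open>A\<close>.\<close>
    have form: "L $$ (j, k) = (\<Sum>n<M. \<Sum>m<M. p j m * ?A $$ (m, n) * p k n)" if "j < N" "k < N" for j k
    proof -
      have "(\<Sum>n<M. \<Sum>m<M. p j m * ?A $$ (m, n) * p k n) = (\<Sum>n<M. (if n < N then L $$ (j, n) else 0) * p k n)"
        using that pL by (intro sum.cong refl) (simp add: sum_distrib_right[symmetric])
      also have "\<dots> = (\<Sum>n<N. L $$ (j, n) * p k n)"
        using N by (intro sum.mono_neutral_cong_right) auto
      also have "\<dots> = (\<Sum>n<N. if n = k then L $$ (j, k) else 0)"
        by (intro sum.cong refl) (auto simp: p_def)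
      also have "\<dots> = L $$ (j, k)" using that by simp
      finally show ?thesis by simp
    qed
    have "L $$ (j, k) = (\<Sum>m<M. \<Sum>n<M. p j m * ?A $$ (m, n) * p k n)"
      using form[OF that] by (subst (asm) sum.swap)
    also have "\<dots> = (\<Sum>m<M. \<Sum>n<M. p k n * ?A $$ (n, m) * p j m)"
      by (intro sum.cong refl) (simp add: Asym mult_ac)
    also have "\<dots> = L $$ (k, j)" using form[OF that(2,1)] by simp
    finally show ?thesis .
  qed
  have rows: "(\<Sum>k<N. L $$ (j, k)) = 0" if j: "j < N" for j
  proof -
    have "(\<Sum>k<N. L $$ (j, k)) = (\<Sum>k<M. if k < N then L $$ (j, k) else 0)"
      using N by (intro sum.mono_neutral_cong_left) auto
    also have "\<dots> = (\<Sum>k<M. \<Sum>m<M. p j m * ?A $$ (m, k))"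
      using pL[OF j] by (intro sum.cong refl) auto
    also have "\<dots> = (\<Sum>m<M. p j m * (\<Sum>k<M. ?A $$ (m, k) * 1))"
      by (subst sum.swap) (simp add: sum_distrib_left)
    also have "\<dots> = 0"
      using laplacian_row_weighted[of _ M a "\<lambda>_. 1"] adiag by (intro sum.neutral) auto
    finally show ?thesis .
  qed
  have "L = laplacian N w"
  proof (intro eq_matI)
    fix j k assume "j < dim_row (laplacian N w)" "k < dim_col (laplacian N w)"
    then have jk: "j < N" "k < N" by simp_all
    have "(\<Sum>k<N. w j k) = (\<Sum>k<N. (if k = j then L $$ (j, j) else 0) - L $$ (j, k))"
      by (intro sum.cong refl) (auto simp: w_def)
    also have "\<dots> = L $$ (j, j)" using rows[OF jk(1)] jk by (simp add: sum_subtractf)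
    finally have "(\<Sum>k<N. w j k) = L $$ (j, j)" .
    then show "L $$ (j, k) = laplacian N w $$ (j, k)"
      using jk by (cases "j = k") (simp_all add: laplacian_index, simp add: w_def)
  qed (use L in auto)
  moreover have "weighted_graph N w"
    using wnn Lsym by (auto simp: weighted_graph_def w_def)
  moreover have "connected_graph N w"
    unfolding connected_graph_def
  proof (intro allI impI, rule ccontr)
    fix j0 k0 assume j0: "j0 < N" and k0: "k0 < N"
    define E where "E = {(j, k). j < N \<and> k < N \<and> 0 < w j k}"
    assume "(j0, k0) \<notin> {(j, k). j < N \<and> k < N \<and> 0 < w j k}\<^sup>*"
    then have nr: "(j0, k0) \<notin> E\<^sup>*" unfolding E_def .
    define S where "S = {k. k < N \<and> (j0, k) \<in> E\<^sup>*}"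
    have S: "finite S" "S \<subseteq> {..<N}" "j0 \<in> S" "k0 \<notin> S" using j0 nr unfolding S_def by auto
    have closed: "L $$ (j, n) = 0" if "j \<in> S" "n < N" "n \<notin> S" for j n
    proof -
      have "(j, n) \<notin> E" using that unfolding S_def by (auto intro: rtrancl_into_rtrancl)
      then have "\<not> 0 < w j n" using that unfolding E_def S_def by auto
      with wnn[of j n] that show ?thesis unfolding w_def S_def by (auto split: if_splits)
    qed
    \<comment> \<open>Sum of the extensions over the component S: 1 on S and 0 on the other boundary
      nodes. As S is decoupled in \<open>L\<close>, the energy is a sum of full row sums of
      \<open>L\<close>, hence 0.\<close>
    define x where "x m = (\<Sum>j\<in>S. p j m)" for m
    have xB: "x n = (if n \<in> S then 1 else 0)" if "n < N" for n
      using S(1) that by (simp add: x_def p_def)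
    have xA: "(\<Sum>m<M. x m * ?A $$ (m, n)) = (if n < N then \<Sum>j\<in>S. L $$ (j, n) else 0)" if "n < M" for n
    proof -
      have "(\<Sum>m<M. x m * ?A $$ (m, n)) = (\<Sum>j\<in>S. \<Sum>m<M. p j m * ?A $$ (m, n))"
        unfolding x_def sum_distrib_right by (rule sum.swap)
      also have "\<dots> = (\<Sum>j\<in>S. if n < N then L $$ (j, n) else 0)"
        using S(2) that by (intro sum.cong refl pL) auto
      finally show ?thesis by simp
    qed
    have "(\<Sum>m<M. x m * (\<Sum>n<M. ?A $$ (m, n) * x n)) = (\<Sum>n<M. (\<Sum>m<M. x m * ?A $$ (m, n)) * x n)"
      unfolding sum_distrib_left sum_distrib_right by (subst sum.swap) (simp add: mult.assoc)
    also have "\<dots> = (\<Sum>n<N. (\<Sum>j\<in>S. L $$ (j, n)) * (if n \<in> S then 1 else 0))"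
      using N xA xB by (intro sum.mono_neutral_cong_right) auto
    also have "\<dots> = (\<Sum>n\<in>S. \<Sum>j\<in>S. L $$ (j, n))"
      using S(2) by (intro sum.mono_neutral_cong_right) auto
    also have "\<dots> = (\<Sum>j\<in>S. \<Sum>n\<in>S. L $$ (j, n))" by (rule sum.swap)
    also have "\<dots> = (\<Sum>j\<in>S. \<Sum>n<N. L $$ (j, n))"
      using S(2) closed by (intro sum.cong refl sum.mono_neutral_left) auto
    also have "\<dots> = 0" using S(2) rows by (intro sum.neutral) auto
    finally have z: "(\<Sum>m<M. x m * (\<Sum>n<M. ?A $$ (m, n) * x n)) = 0" .
    have "complex_of_real ((\<Sum>m<M. \<Sum>n<M. a m n * (cmod (of_real (x m) - of_real (x n)))\<^sup>2) / 2) =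
       complex_of_real (\<Sum>m<M. x m * (\<Sum>n<M. ?A $$ (m, n) * x n))"
      by (subst laplacian_energy[OF w, symmetric]) simp
    then have "(\<Sum>m<M. \<Sum>n<M. a m n * (cmod (of_real (x m) - of_real (x n)))\<^sup>2) = 0"
      unfolding z of_real_eq_iff by simp
    from connected_zero_energy_const[OF w c this, of j0 k0] j0 k0 N have "x j0 = x k0" by simp
    then show False using xB[OF j0] xB[OF k0] S by simp
  qed
  ultimately show ?thesis by blast
qed

subsection \<open>Eigenvectors of symmetric matrices\<close>

definition inner_prod :: "nat \<Rightarrow> (nat \<Rightarrow> complex) \<Rightarrow> (nat \<Rightarrow> complex) \<Rightarrow> complex" where
  "inner_prod n x y = (\<Sum>j<n. x j * cnj (y j))"

text \<open>The value 0 from index n on keeps all iterates supported below n, so that linearity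
  holds as an equality of functions.\<close>

definition mat_apply :: "nat \<Rightarrow> (nat \<Rightarrow> nat \<Rightarrow> complex) \<Rightarrow> (nat \<Rightarrow> complex) \<Rightarrow> nat \<Rightarrow> complex" where
  "mat_apply n A x j = (if j < n then \<Sum>k<n. A j k * x k else 0)"

lemma mat_apply_add: "mat_apply n A (\<lambda>j. x j + y j) = (\<lambda>j. mat_apply n A x j + mat_apply n A y j)"
  by (auto simp: mat_apply_def sum.distrib algebra_simps)

lemma mat_apply_scale: "mat_apply n A (\<lambda>j. c * x j) = (\<lambda>j. c * mat_apply n A x j)"
  by (auto simp: mat_apply_def sum_distrib_left algebra_simps)

text \<open>The vector p(A) x, with the powers of A as iterates.\<close>

definition poly_apply :: "nat \<Rightarrow> (nat \<Rightarrow> nat \<Rightarrow> complex) \<Rightarrow> complex poly \<Rightarrow> (nat \<Rightarrow> complex) \<Rightarrow> nat \<Rightarrow> complex" where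
  "poly_apply n A p x j = (\<Sum>i\<le>degree p. coeff p i * ((mat_apply n A ^^ i) x) j)"

lemma poly_apply_ge:
  assumes "degree p \<le> d"
  shows "poly_apply n A p x j = (\<Sum>i\<le>d. coeff p i * ((mat_apply n A ^^ i) x) j)"
  unfolding poly_apply_def using assms
  by (intro sum.mono_neutral_left) (auto simp: coeff_eq_0)

lemma mat_apply_sum:
  "mat_apply n A (\<lambda>j. \<Sum>i\<le>(d::nat). c i * f i j) = (\<lambda>j. \<Sum>i\<le>d. c i * mat_apply n A (f i) j)"
proof (induction d)
  case 0
  then show ?case by (simp add: mat_apply_scale)
next
  case (Suc d)
  then show ?case by (simp add: mat_apply_add mat_apply_scale)
qed

lemma poly_apply_linear_factor:
  "poly_apply n A ([:-\<mu>, 1:] * q) x j = mat_apply n A (poly_apply n A q x) j - \<mu> * poly_apply n A q x j"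
proof -
  let ?T = "mat_apply n A"
  have deg: "degree ([:-\<mu>, 1:] * q) \<le> Suc (degree q)"
    by (rule order.trans[OF degree_mult_le]) auto
  have eq: "[:-\<mu>, 1:] * q = pCons 0 q - Polynomial.smult \<mu> q" by simp
  have "poly_apply n A ([:-\<mu>, 1:] * q) x j = (\<Sum>i\<le>Suc (degree q). coeff (pCons 0 q) i * (?T ^^ i) x j)
     - (\<Sum>i\<le>Suc (degree q). \<mu> * (coeff q i * (?T ^^ i) x j))"
    unfolding poly_apply_ge[OF deg] unfolding eq
    by (simp add: sum_subtractf[symmetric] algebra_simps del: sum.atMost_Suc)
  also have "(\<Sum>i\<le>Suc (degree q). coeff (pCons 0 q) i * (?T ^^ i) x j) =
      (\<Sum>i\<le>degree q. coeff q i * ?T ((?T ^^ i) x) j)"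
    by (subst sum.atMost_Suc_shift) simp
  also have "\<dots> = ?T (poly_apply n A q x) j"
    unfolding poly_apply_def[abs_def] by (simp add: mat_apply_sum)
  also have "(\<Sum>i\<le>Suc (degree q). \<mu> * (coeff q i * (?T ^^ i) x j)) = \<mu> * poly_apply n A q x j"
    by (simp add: poly_apply_ge[of q "Suc (degree q)"] sum_distrib_left algebra_simps)
  finally show ?thesis .
qed

text \<open>Linear factors are stripped from an annihilating polynomial of x: the last nonzero q(A)
  x before the product vanishes is an eigenvector, and it lies in V because V contains every q(A)
  x.\<close>

lemma eigenvector_in_invariant_subspace:
  assumes "V x" "x j0 \<noteq> 0" "p \<noteq> 0" "\<And>j. poly_apply n A p x j = 0"
    and V: "\<And>q. V (poly_apply n A q x)"
  shows "\<exists>u \<mu>. V u \<and> (\<exists>j. u j \<noteq> 0) \<and> (\<forall>j. mat_apply n A u j = \<mu> * u j)"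
  using assms(3,4)
proof (induction "degree p" arbitrary: p)
  case 0
  then obtain c where "p = [:c:]" "c \<noteq> 0" by (metis degree_0_id pCons_0_0)
  with 0(3)[of j0] assms(2) show ?case by (simp add: poly_apply_def)
next
  case (Suc d)
  have "\<not> constant (poly p)" using Suc(2) by (simp add: constant_degree)
  then obtain \<mu> where "poly p \<mu> = 0" using fundamental_theorem_of_algebra by blast
  then obtain q where q: "p = [:-\<mu>, 1:] * q" by (auto simp: poly_eq_0_iff_dvd elim: dvdE)
  with Suc(3) have q0: "q \<noteq> 0" by auto
  have "degree p = Suc (degree q)" unfolding q using q0 by (subst degree_mult_eq) auto
  with Suc(2) have d: "d = degree q" by simp
  show ?case
  proof (cases "\<forall>j. poly_apply n A q x j = 0")
    case True
    then show ?thesis using Suc(1)[OF d q0] by auto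
  next
    case False
    have "mat_apply n A (poly_apply n A q x) j = \<mu> * poly_apply n A q x j" for j
      using Suc(4)[of j] unfolding q poly_apply_linear_factor by simp
    with False V[of q] show ?thesis by blast
  qed
qed

text \<open>x, A x, ..., A^n x are n + 1 vectors in dimension n. A zero last row completes them to a
  singular square matrix, and a kernel vector lists the coefficients.\<close>

lemma annihilating_poly_exists:
  assumes "\<And>j. n \<le> j \<Longrightarrow> x j = 0"
  shows "\<exists>p. p \<noteq> 0 \<and> (\<forall>j. poly_apply n A p x j = 0)"
proof -
  let ?T = "mat_apply n A"
  define M where "M = mat (Suc n) (Suc n) (\<lambda>(j, i). if j < n then (?T ^^ i) x j else 0)"
  have M: "M \<in> carrier_mat (Suc n) (Suc n)" unfolding M_def by simp
  have "transpose_mat M *\<^sub>v unit_vec (Suc n) n = 0\<^sub>v (Suc n)"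
    by (intro eq_vecI) (auto simp: M_def scalar_prod_def unit_vec_def if_distrib cong: if_cong intro!: sum.neutral)
  then have "det (transpose_mat M) = 0"
    using M det_0_iff_vec_prod_zero_field[of "transpose_mat M" "Suc n"]
    by (metis lessI transpose_carrier_mat unit_vec_carrier unit_vec_nonzero)
  then have "det M = 0" using det_transpose[OF M] by simp
  then obtain c where c: "c \<in> carrier_vec (Suc n)" "c \<noteq> 0\<^sub>v (Suc n)" "M *\<^sub>v c = 0\<^sub>v (Suc n)"
    using det_0_iff_vec_prod_zero_field[OF M] by auto
  define p where "p = (\<Sum>i\<le>n. monom (c $ i) i)"
  have cf: "coeff p i = (if i \<le> n then c $ i else 0)" for i
    unfolding p_def by (simp add: coeff_sum)
  obtain i where "i < Suc n" "c $ i \<noteq> 0" using c(1,2) by (metis carrier_vecD eq_vecI index_zero_vec zero_carrier_vec)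
  then have "p \<noteq> 0" using cf[of i] by auto
  moreover have deg: "degree p \<le> n" using cf by (auto intro: degree_le)
  have "poly_apply n A p x j = 0" for j
  proof (cases "j < n")
    case True
    have "0 = (M *\<^sub>v c) $ j" using c(3) True by simp
    also have "\<dots> = (\<Sum>i\<le>n. c $ i * (?T ^^ i) x j)"
      using True c(1) by (simp add: M_def scalar_prod_def mult.commute atLeast0LessThan lessThan_Suc_atMost)
    also have "\<dots> = poly_apply n A p x j"
      unfolding poly_apply_ge[OF deg] by (intro sum.cong) (auto simp: cf)
    finally show ?thesis by simp
  next
    case False
    then have "(?T ^^ i) x j = 0" for i using assms by (cases i) (auto simp: mat_apply_def)
    then show ?thesis unfolding poly_apply_def by simp
  qed
  ultimately show ?thesis by blast
qed

text \<open>The orthogonal complement of the eigenvectors found so far is invariant because A is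
  Hermitian, so the next eigenvector can be sought inside it.\<close>

lemma hermitian_partial_eigenbasis:
  assumes herm: "\<And>j k. j < n \<Longrightarrow> k < n \<Longrightarrow> A j k = cnj (A k j)" and "k \<le> n"
  shows "\<exists>u lam. (\<forall>l<k. \<forall>j. mat_apply n A (u l) j = lam l * u l j) \<and>
           (\<forall>l<k. \<forall>m<k. inner_prod n (u l) (u m) = (if l = m then 1 else 0))"
  using assms(2)
proof (induction k)
  case 0
  then show ?case by auto
next
  case (Suc k)
  then obtain u lam where "\<forall>l<k. \<forall>j. mat_apply n A (u l) j = lam l * u l j"
    "\<forall>l<k. \<forall>m<k. inner_prod n (u l) (u m) = (if l = m then 1 else 0)"
    using Suc_leD by blast
  then have eig: "\<And>l j. l < k \<Longrightarrow> mat_apply n A (u l) j = lam l * u l j"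
    and orth: "\<And>l m. l < k \<Longrightarrow> m < k \<Longrightarrow> inner_prod n (u l) (u m) = (if l = m then 1 else 0)"
    by blast+
  define V where "V x \<longleftrightarrow> (\<forall>j\<ge>n. x j = 0) \<and> (\<forall>l<k. inner_prod n x (u l) = 0)" for x
  have adj: "inner_prod n (mat_apply n A x) y = inner_prod n x (mat_apply n A y)" for x y
  proof -
    have "inner_prod n (mat_apply n A x) y = (\<Sum>j<n. \<Sum>i<n. A j i * x i * cnj (y j))"
      by (simp add: inner_prod_def mat_apply_def sum_distrib_right)
    also have "\<dots> = (\<Sum>i<n. \<Sum>j<n. x i * cnj (A i j * y j))"
    proof (subst sum.swap, intro sum.cong refl)
      fix i j assume "i \<in> {..<n}" "j \<in> {..<n}"
      then have "A j i = cnj (A i j)" using herm[of j i] by simp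
      then show "A j i * x i * cnj (y j) = x i * cnj (A i j * y j)" by simp
    qed
    also have "\<dots> = inner_prod n x (mat_apply n A y)"
      by (simp add: inner_prod_def mat_apply_def sum_distrib_left)
    finally show ?thesis .
  qed
  have V_T: "V (mat_apply n A x)" if x: "V x" for x
  proof -
    have "inner_prod n (mat_apply n A x) (u l) = 0" if "l < k" for l
    proof -
      have "mat_apply n A (u l) = (\<lambda>j. lam l * u l j)" by (rule ext) (rule eig[OF that])
      then have "inner_prod n (mat_apply n A x) (u l) = cnj (lam l) * inner_prod n x (u l)"
        unfolding adj by (simp add: inner_prod_def sum_distrib_left mult.left_commute)
      with x that show ?thesis by (simp add: V_def)
    qed
    then show ?thesis unfolding V_def by (simp add: mat_apply_def)
  qed
  have V_add: "V (\<lambda>j. x j + c * y j)" if xy: "V x" "V y" for x y c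
  proof -
    have "inner_prod n (\<lambda>j. x j + c * y j) (u l) = inner_prod n x (u l) + c * inner_prod n y (u l)" for l
      by (simp add: inner_prod_def distrib_right sum.distrib sum_distrib_left mult.assoc)
    then show ?thesis using xy unfolding V_def by simp
  qed
  have V_pow: "V ((mat_apply n A ^^ i) x)" if "V x" for x i
    by (induction i) (use that V_T in auto)
  have V_sum: "V (\<lambda>j. \<Sum>i\<in>I. c i * (mat_apply n A ^^ i) x j)" if "V x" "finite I" for x c and I :: "nat set"
    using that(2)
  proof (induction I)
    case empty
    show ?case by (simp add: V_def inner_prod_def)
  next
    case (insert i I)
    from V_add[OF insert(3) V_pow[OF that(1), of i], of "c i"] show ?case
      using insert by (simp add: add.commute)
  qed
  have "\<exists>x. V x \<and> (\<exists>j. x j \<noteq> 0)"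
  proof (rule ccontr)
    assume *: "\<nexists>x. V x \<and> (\<exists>j. x j \<noteq> 0)"
    \<comment> \<open>\<open>w i\<close> is the projection of the i-th unit vector onto the
      complement. If all of them were 0, comparing the trace of the identity with that of the
      projection onto the span would give n = k.\<close>
    define w where "w i = (\<lambda>j. if j < n then (if j = i then 1 else 0) - (\<Sum>l<k. cnj (u l i) * u l j) else 0)" for i
    have "V (w i)" if i: "i < n" for i
    proof -
      have "inner_prod n (w i) (u m) = 0" if m: "m < k" for m
      proof -
        have "inner_prod n (w i) (u m) = (\<Sum>j<n. (if j = i then cnj (u m j) else 0)
            - (\<Sum>l<k. cnj (u l i) * (u l j * cnj (u m j))))"
          unfolding inner_prod_def w_def
          by (intro sum.cong refl) (simp add: left_diff_distrib sum_distrib_right mult.assoc if_distrib if_distribR)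
        also have "\<dots> = cnj (u m i) - (\<Sum>l<k. cnj (u l i) * inner_prod n (u l) (u m))"
          using i by (simp add: sum_subtractf inner_prod_def sum_distrib_left)
             (subst sum.swap, simp)
        also have "\<dots> = 0" using m by (simp add: orth if_distrib cong: if_cong)
        finally show ?thesis .
      qed
      then show ?thesis unfolding V_def by (auto simp: w_def)
    qed
    with * have "w i i = 0" if "i < n" for i using that by blast
    then have "(\<Sum>l<k. cnj (u l i) * u l i) = 1" if "i < n" for i using that unfolding w_def by simp
    then have "of_nat n = (\<Sum>i<n. \<Sum>l<k. cnj (u l i) * u l i)" by simp
    also have "\<dots> = (\<Sum>l<k. inner_prod n (u l) (u l))"
      by (subst sum.swap) (simp add: inner_prod_def mult.commute)
    also have "\<dots> = of_nat k" by (simp add: orth)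
    finally have "n = k" using of_nat_eq_iff by blast
    then show False using Suc(2) by simp
  qed
  then obtain x j0 where x: "V x" "x j0 \<noteq> 0" by blast
  obtain p where p: "p \<noteq> 0" "\<And>j. poly_apply n A p x j = 0"
    using annihilating_poly_exists[of n x A] x(1) by (auto simp: V_def)
  have "V (poly_apply n A q x)" for q
    using V_sum[OF x(1), of "{..degree q}" "coeff q"] unfolding poly_apply_def[abs_def] by simp
  from eigenvector_in_invariant_subspace[of V, OF x p this]
  obtain e \<mu> j where e: "V e" "e j \<noteq> 0" "\<And>j. mat_apply n A e j = \<mu> * e j" by blast
  define r where "r = sqrt (\<Sum>j<n. (cmod (e j))\<^sup>2)"
  have "j < n" using e(1,2) unfolding V_def by (meson not_le)
  then have pos: "0 < (\<Sum>j<n. (cmod (e j))\<^sup>2)" using e(2) by (intro sum_pos2[of _ j]) auto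
  then have r: "r > 0" unfolding r_def by simp
  have ee: "inner_prod n e e = of_real (r^2)"
    unfolding inner_prod_def r_def using pos by (simp add: complex_norm_square flip: of_real_power)
  define e' where "e' = (\<lambda>j. e j / of_real r)"
  have n1: "inner_prod n e' e' = 1"
    using ee r unfolding inner_prod_def e'_def
    by (simp add: sum_divide_distrib[symmetric] power2_eq_square)
  have n2: "inner_prod n e' (u l) = 0" if "l < k" for l
    using e(1) that unfolding V_def inner_prod_def e'_def by (simp add: sum_divide_distrib[symmetric])
  have n3: "inner_prod n (u l) e' = 0" if "l < k" for l
    using arg_cong[OF n2[OF that], of cnj] by (simp add: inner_prod_def mult.commute)
  have n4: "mat_apply n A e' j = \<mu> * e' j" for j
    using e(3)[of j] mat_apply_scale[of n A "1 / of_real r" e] unfolding e'_def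
    by (simp add: fun_eq_iff)
  show ?case
    by (rule exI[of _ "u(k := e')"], rule exI[of _ "lam(k := \<mu>)"])
       (auto simp: less_Suc_eq eig orth n1 n2 n3 n4)
qed

text \<open>Complex eigenvectors suffice for the decoupling; that \<open>lam l\<close> is an
  eigenvalue over the reals is witnessed by their real or imaginary parts. Parseval's identity holds
  because a left inverse of a square matrix is a right inverse.\<close>

lemma real_symmetric_eigenbasis:
  fixes A :: "real mat"
  assumes A: "A \<in> carrier_mat n n" and sym: "\<And>j k. j < n \<Longrightarrow> k < n \<Longrightarrow> A $$ (j, k) = A $$ (k, j)"
  shows "\<exists>(u :: nat \<Rightarrow> nat \<Rightarrow> complex) (lam :: nat \<Rightarrow> real).
     (\<forall>l<n. eigenvalue A (lam l)) \<and>
     (\<forall>l<n. \<forall>j<n. (\<Sum>k<n. A $$ (j, k) * u l k) = lam l * u l j) \<and>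
     (\<forall>l<n. (\<Sum>j<n. (cmod (u l j))\<^sup>2) = 1) \<and>
     (\<forall>x. (\<Sum>l<n. (cmod (\<Sum>j<n. cnj (u l j) * x j))\<^sup>2) = (\<Sum>j<n. (cmod (x j))\<^sup>2))"
proof -
  define B where "B j k = complex_of_real (A $$ (j, k))" for j k
  have herm: "B j k = cnj (B k j)" if "j < n" "k < n" for j k
    using that sym by (simp add: B_def)
  obtain u \<mu> where "\<forall>l<n. \<forall>j. mat_apply n B (u l) j = \<mu> l * u l j"
    "\<forall>l<n. \<forall>m<n. inner_prod n (u l) (u m) = (if l = m then 1 else 0)"
    using hermitian_partial_eigenbasis[of n B n] herm by blast
  then have eig: "\<And>l j. l < n \<Longrightarrow> mat_apply n B (u l) j = \<mu> l * u l j"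
    and orth: "\<And>l m. l < n \<Longrightarrow> m < n \<Longrightarrow> inner_prod n (u l) (u m) = (if l = m then 1 else 0)"
    by blast+
  have eig': "(\<Sum>k<n. B j k * u l k) = \<mu> l * u l j" if "l < n" "j < n" for l j
    using eig[OF that(1), of j] that by (simp add: mat_apply_def)
  have norm1: "(\<Sum>j<n. (cmod (u l j))\<^sup>2) = 1" if "l < n" for l
  proof -
    have "complex_of_real (\<Sum>j<n. (cmod (u l j))\<^sup>2) = 1"
      using orth[OF that that] by (simp add: inner_prod_def complex_norm_square flip: of_real_power)
    then show ?thesis using of_real_eq_1_iff by blast
  qed
  have real: "\<mu> l = of_real (Re (\<mu> l))" if l: "l < n" for l
  proof -
    have "\<mu> l = (\<Sum>j<n. (\<mu> l * u l j) * cnj (u l j))"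
      using orth[OF l l] by (simp add: inner_prod_def mult.assoc sum_distrib_left[symmetric])
    also have "\<dots> = (\<Sum>j<n. \<Sum>k<n. B j k * u l k * cnj (u l j))"
      using l by (simp add: eig'[symmetric] sum_distrib_right)
    finally have 1: "\<mu> l = (\<Sum>j<n. \<Sum>k<n. B j k * u l k * cnj (u l j))" .
    have "cnj (\<mu> l) = (\<Sum>j<n. \<Sum>k<n. B j k * cnj (u l k) * u l j)"
      by (subst 1) (simp add: B_def)
    also have "\<dots> = (\<Sum>k<n. \<Sum>j<n. B k j * u l j * cnj (u l k))"
      by (subst sum.swap) (auto intro!: sum.cong simp: B_def sym mult_ac)
    also have "\<dots> = \<mu> l" using 1 by simp
    finally show ?thesis by (simp add: complex_eq_iff)
  qed
  have eigval: "eigenvalue A (Re (\<mu> l))" if l: "l < n" for l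
  proof -
    have "\<exists>j<n. u l j \<noteq> 0"
    proof (rule ccontr)
      assume "\<not> (\<exists>j<n. u l j \<noteq> 0)"
      then have "(\<Sum>j<n. (cmod (u l j))\<^sup>2) = 0" by simp
      then show False using norm1[OF l] by simp
    qed
    then obtain j where j: "j < n" "u l j \<noteq> 0" by auto
    have part: "eigenvalue A (Re (\<mu> l))"
      if f: "\<And>j. j < n \<Longrightarrow> (\<Sum>k<n. A $$ (j, k) * f k) = Re (\<mu> l) * f j" and "f j \<noteq> 0" for f
    proof -
      have "eigenvector A (vec n f) (Re (\<mu> l))"
        unfolding eigenvector_def using A j(1) that(2)
        by (auto intro!: eq_vecI simp: scalar_prod_def f[symmetric] atLeast0LessThan
            dest: arg_cong[of _ _ "\<lambda>v. vec_index v j"])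
      then show ?thesis unfolding eigenvalue_def by blast
    qed
    have e: "(\<Sum>k<n. A $$ (j, k) * u l k) = of_real (Re (\<mu> l)) * u l j" if "j < n" for j
      using eig'[OF l that] real[OF l] unfolding B_def by simp
    have re: "(\<Sum>k<n. A $$ (j, k) * Re (u l k)) = Re (\<mu> l) * Re (u l j)"
      and im: "(\<Sum>k<n. A $$ (j, k) * Im (u l k)) = Re (\<mu> l) * Im (u l j)" if "j < n" for j
      using arg_cong[OF e[OF that], of Re] arg_cong[OF e[OF that], of Im] by simp_all
    show ?thesis
      using part[of "\<lambda>k. Re (u l k)"] part[of "\<lambda>k. Im (u l k)"] re im j(2) by (auto simp: complex_eq_iff)
  qed
  have parseval: "(\<Sum>l<n. (cmod (\<Sum>j<n. cnj (u l j) * x j))\<^sup>2) = (\<Sum>j<n. (cmod (x j))\<^sup>2)" for x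
  proof -
    define U where "U = mat n n (\<lambda>(j, l). u l j)"
    define U' where "U' = mat n n (\<lambda>(l, j). cnj (u l j))"
    have c: "U \<in> carrier_mat n n" "U' \<in> carrier_mat n n" unfolding U_def U'_def by auto
    have "U' * U = 1\<^sub>m n"
      by (intro eq_matI)
         (use orth in \<open>auto simp: U_def U'_def scalar_prod_def atLeast0LessThan inner_prod_def mult.commute\<close>)
    then have UU: "U * U' = 1\<^sub>m n" by (rule mat_mult_left_right_inverse[OF c(2,1)])
    have compl: "(\<Sum>l<n. u l j * cnj (u l k)) = (if j = k then 1 else 0)" if "j < n" "k < n" for j k
      using arg_cong[OF UU, of "\<lambda>M. M $$ (j, k)"] that
      by (simp add: U_def U'_def scalar_prod_def atLeast0LessThan)
    have "complex_of_real (\<Sum>l<n. (cmod (\<Sum>j<n. cnj (u l j) * x j))\<^sup>2)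
        = (\<Sum>l<n. (\<Sum>k<n. cnj (u l k) * x k) * cnj (\<Sum>j<n. cnj (u l j) * x j))"
      by (simp only: of_real_sum complex_norm_square)
    also have "\<dots> = (\<Sum>l<n. \<Sum>k<n. \<Sum>j<n. x k * cnj (x j) * (u l j * cnj (u l k)))"
      by (simp add: sum_product mult_ac)
    also have "\<dots> = (\<Sum>k<n. \<Sum>j<n. \<Sum>l<n. x k * cnj (x j) * (u l j * cnj (u l k)))"
      by (subst sum.swap) (intro sum.cong refl sum.swap)
    also have "\<dots> = (\<Sum>k<n. \<Sum>j<n. x k * cnj (x j) * (if j = k then 1 else 0))"
      by (intro sum.cong refl) (simp add: compl sum_distrib_left[symmetric])
    also have "\<dots> = complex_of_real (\<Sum>j<n. (cmod (x j))\<^sup>2)"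
      by (simp only: of_real_sum complex_norm_square) (simp add: if_distrib cong: if_cong)
    finally show ?thesis using of_real_eq_iff by blast
  qed
  show ?thesis
  proof (rule exI[of _ u], rule exI[of _ "\<lambda>l. Re (\<mu> l)"], intro conjI allI impI)
    show "(\<Sum>k<n. A $$ (j, k) * u l k) = Re (\<mu> l) * u l j" if "l < n" "j < n" for l j
      using eig'[OF that] real[OF that(1)] unfolding B_def by simp
  qed (use eigval norm1 parseval in auto)
qed

subsection \<open>Hurwitz polynomials and spectral factorization\<close>

definition hurwitz :: "complex poly \<Rightarrow> bool" where
  "hurwitz p \<longleftrightarrow> p \<noteq> 0 \<and> (\<forall>s. poly p s = 0 \<longrightarrow> Re s < 0)"

lemma hurwitz_1 [simp]: "hurwitz 1"
  by (simp add: hurwitz_def)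

lemma hurwitz_mult: "hurwitz p \<Longrightarrow> hurwitz q \<Longrightarrow> hurwitz (p * q)"
  by (auto simp: hurwitz_def)

lemma hurwitz_prod: "(\<And>i. i \<in> I \<Longrightarrow> hurwitz (p i)) \<Longrightarrow> hurwitz (\<Prod>i\<in>I. p i)"
  by (induction I rule: infinite_finite_induct) (auto intro: hurwitz_mult)

lemma hurwitz_roots:
  assumes "hurwitz p"
  obtains c rs where "c \<noteq> 0" "p = Polynomial.smult c (\<Prod>r\<leftarrow>rs. [:-r, 1:])" "\<forall>r\<in>set rs. Re r < 0"
proof -
  obtain rs where rs: "Polynomial.smult (lead_coeff p) (\<Prod>r\<leftarrow>rs. [:-r, 1:]) = p"
    using fundamental_theorem_algebra_factorized[of p] by blast
  have "poly (\<Prod>r\<leftarrow>rs. [:-r, 1:]) r = 0" if "r \<in> set rs" for r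
    using that by (induction rs) auto
  then have "poly p r = 0" if "r \<in> set rs" for r
    using that by (subst rs[symmetric]) simp
  then show ?thesis
    using assms rs by (intro that[of "lead_coeff p" rs]) (auto simp: hurwitz_def)
qed

text \<open>The paraconjugate: the polynomial that equals the conjugate of p on the imaginary axis,
  with the roots reflected in that axis.\<close>

definition adjoint :: "complex poly \<Rightarrow> complex poly" where
  "adjoint p = map_poly cnj (pcompose p [:0, -1:])"

lemma poly_adjoint: "poly (adjoint p) s = cnj (poly p (- cnj s))"
  by (simp add: adjoint_def poly_pcompose)

lemma adjoint_mult: "adjoint (p * q) = adjoint p * adjoint q"
  by (simp add: poly_eq_poly_eq_iff[symmetric] fun_eq_iff poly_adjoint)

lemma poly_adjoint_imag: "poly (adjoint p) (\<i> * of_real \<omega>) = cnj (poly p (\<i> * of_real \<omega>))"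
  by (simp add: poly_adjoint)

lemma coeff_adjoint: "coeff (adjoint p) n = (-1) ^ n * cnj (coeff p n)"
proof -
  have "coeff (pcompose p [:0, -1:]) n = (-1) ^ n * coeff p n"
  proof (induction p arbitrary: n)
    case (pCons a p)
    show ?case by (cases n) (simp_all add: pcompose_pCons pCons.IH)
  qed simp
  then show ?thesis by (simp add: adjoint_def coeff_map_poly)
qed

lemma imag_axis_poly_eqI:
  assumes "\<And>\<omega>::real. \<omega> \<noteq> \<omega>0 \<Longrightarrow> poly p (\<i> * of_real \<omega>) = poly q (\<i> * of_real \<omega>)"
  shows "p = q"
proof (rule ccontr)
  assume "p \<noteq> q"
  then have "finite {s. poly (p - q) s = 0}" by (intro poly_roots_finite) simp
  moreover have "(\<lambda>\<omega>. \<i> * complex_of_real \<omega>) ` (UNIV - {\<omega>0}) \<subseteq> {s. poly (p - q) s = 0}"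
    using assms by auto
  ultimately have "finite ((\<lambda>\<omega>. \<i> * complex_of_real \<omega>) ` (UNIV - {\<omega>0}))"
    by (rule rev_finite_subset)
  then have "finite (UNIV - {\<omega>0} :: real set)"
    by (rule finite_imageD) (auto simp: inj_on_def)
  then show False by (simp add: infinite_UNIV_char_0)
qed

lemma nonneg_limit_imag_axis:
  assumes "\<And>\<omega>::real. \<omega> \<noteq> \<omega>0 \<Longrightarrow> poly p (\<i> * of_real \<omega>) \<in> \<real>\<^sub>\<ge>\<^sub>0"
  shows "poly p (\<i> * of_real \<omega>) \<in> \<real>\<^sub>\<ge>\<^sub>0"
proof (cases "\<omega> = \<omega>0")
  case True
  have "((\<lambda>\<omega>. poly p (\<i> * of_real \<omega>)) \<longlongrightarrow> poly p (\<i> * of_real \<omega>0)) (at \<omega>0)"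
    by (intro tendsto_intros)
  moreover have "\<forall>\<^sub>F \<omega> in at \<omega>0. poly p (\<i> * of_real \<omega>) \<in> \<real>\<^sub>\<ge>\<^sub>0"
    using assms by (auto simp: eventually_at_filter)
  ultimately show ?thesis unfolding True
    by (rule Lim_in_closed_set[OF closed_nonneg_Reals_complex _ at_neq_bot, rotated])
qed (use assms in auto)

text \<open>The roots of \<open>X\<close> come in pairs symmetric about the axis.\<close>

lemma spectral_factorization:
  assumes "\<And>\<omega>::real. poly X (\<i> * of_real \<omega>) \<in> \<real>\<^sub>\<ge>\<^sub>0"
  shows "\<exists>W. X = W * adjoint W"
  using assms
proof (induction "degree X" arbitrary: X rule: less_induct)
  case less
  show ?case
  proof (cases "degree X = 0")
    case True
    then obtain c where X: "X = [:c:]" by (metis degree_0_id)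
    with less(2)[of 0] obtain r where r: "c = of_real r" "r \<ge> 0" by (auto elim: nonneg_Reals_cases)
    have "X = [:of_real (sqrt r):] * adjoint [:of_real (sqrt r):]"
      unfolding X r(1) using r(2)
      by (simp add: poly_eq_poly_eq_iff[symmetric] fun_eq_iff poly_adjoint flip: of_real_mult)
    then show ?thesis by blast
  next
    case False
    then have "\<not> constant (poly X)" by (simp add: constant_degree)
    then obtain z where z: "poly X z = 0" using fundamental_theorem_of_algebra by blast
    define l where "l = [:-z, 1:]"
    have X0: "X \<noteq> 0" using False by auto
    have self: "adjoint X = X"
    proof (rule imag_axis_poly_eqI)
      show "poly (adjoint X) (\<i> * of_real \<omega>) = poly X (\<i> * of_real \<omega>)" for \<omega>
        using less(2)[of \<omega>] by (auto simp: poly_adjoint_imag elim: nonneg_Reals_cases)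
    qed
    have adjl: "adjoint l = [:-cnj z, -1:]"
      by (simp add: l_def poly_eq_poly_eq_iff[symmetric] fun_eq_iff poly_adjoint)
    obtain X1 where X1: "X = l * X1" using z by (auto simp: poly_eq_0_iff_dvd l_def elim: dvdE)
    have "poly X1 (- cnj z) = 0"
    proof (cases "Re z = 0")
      case False
      have "poly X (- cnj z) = 0"
        using poly_adjoint[of X "- cnj z"] z by (simp add: self)
      moreover have "poly l (- cnj z) \<noteq> 0" using False by (auto simp: l_def complex_eq_iff)
      ultimately show ?thesis unfolding X1 poly_mult mult_eq_0_iff by blast
    next
      case True
      define \<omega>0 where "\<omega>0 = Im z"
      have zi: "z = \<i> * of_real \<omega>0" "- cnj z = z" using True by (auto simp: \<omega>0_def complex_eq_iff)
      \<comment> \<open>A root on the axis cannot be simple since X does not change sign: (\<omega>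
        - \<omega>0) f(\<omega>) is nonnegative, so f is nonnegative to the right of \<omega>0,
        nonpositive to the left, and 0 at \<omega>0.\<close>
      define f where "f \<omega> = \<i> * poly X1 (\<i> * of_real \<omega>)" for \<omega> :: real
      have cont: "(f \<longlongrightarrow> f \<omega>0) (at \<omega>0 within S)" for S
        unfolding f_def by (intro tendsto_intros)
      have fX: "of_real (\<omega> - \<omega>0) * f \<omega> \<in> \<real>\<^sub>\<ge>\<^sub>0" for \<omega>
        using less(2)[of \<omega>] by (simp add: X1 l_def zi f_def algebra_simps)
      have pos: "f \<omega> \<in> \<real>\<^sub>\<ge>\<^sub>0" if "\<omega> > \<omega>0" for \<omega>
        using fX[of \<omega>] that by (auto simp: complex_nonneg_Reals_iff zero_le_mult_iff)
      have neg: "f \<omega> \<in> \<real>\<^sub>\<le>\<^sub>0" if "\<omega> < \<omega>0" for \<omega>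
        using fX[of \<omega>] that by (auto simp: complex_nonneg_Reals_iff complex_nonpos_Reals_iff zero_le_mult_iff)
      have "f \<omega>0 \<in> \<real>\<^sub>\<ge>\<^sub>0"
        by (rule Lim_in_closed_set[OF closed_nonneg_Reals_complex _ _ cont[of "{\<omega>0<..}"]])
           (auto simp: eventually_at_filter pos)
      moreover have "f \<omega>0 \<in> \<real>\<^sub>\<le>\<^sub>0"
        by (rule Lim_in_closed_set[OF closed_nonpos_Reals_complex _ _ cont[of "{..<\<omega>0}"]])
           (auto simp: eventually_at_filter neg)
      ultimately have "f \<omega>0 = 0"
        by (auto simp: complex_nonneg_Reals_iff complex_nonpos_Reals_iff complex_eq_iff)
      then show ?thesis by (simp add: f_def zi(2) flip: zi(1))
    qed
    then obtain X2 where "X1 = [:cnj z, 1:] * X2"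
      by (metis dvdE minus_minus poly_eq_0_iff_dvd)
    moreover have "adjoint l = - [:cnj z, 1:]" by (simp add: adjl)
    ultimately have X2: "X = l * adjoint l * (- X2)"
      unfolding X1 by (simp only: mult_minus_left mult_minus_right minus_minus mult.assoc)
    have "degree X = 2 + degree X2"
    proof -
      have "l \<noteq> 0" "degree l = 1" "adjoint l \<noteq> 0" "degree (adjoint l) = 1"
        unfolding adjl by (simp_all add: l_def)
      moreover have "X2 \<noteq> 0" using X0 X2 by auto
      ultimately show ?thesis unfolding X2 by (simp add: degree_mult_eq)
    qed
    \<comment> \<open>On the axis \<open>l * adjoint l\<close> is a squared modulus, positive away
      from Im z, so the quotient inherits nonnegativity there; continuity covers the remaining
      point.\<close>
    moreover have off: "poly (- X2) (\<i> * of_real \<omega>) \<in> \<real>\<^sub>\<ge>\<^sub>0" if \<omega>: "\<omega> \<noteq> Im z" for \<omega>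
    proof -
      define v where "v = poly l (\<i> * of_real \<omega>)"
      have v0: "v \<noteq> 0" using \<omega> by (auto simp: v_def l_def complex_eq_iff)
      have "poly X (\<i> * of_real \<omega>) = of_real ((cmod v)\<^sup>2) * poly (- X2) (\<i> * of_real \<omega>)"
        unfolding X2 by (simp add: poly_adjoint_imag v_def complex_norm_square flip: of_real_power)
      with less(2)[of \<omega>] v0 show ?thesis
        by (simp add: complex_nonneg_Reals_iff mult_le_0_iff flip: of_real_power)
    qed
    then have "poly (- X2) (\<i> * of_real \<omega>) \<in> \<real>\<^sub>\<ge>\<^sub>0" for \<omega>
      using nonneg_limit_imag_axis[of "Im z" "- X2" \<omega>] by blast
    ultimately obtain W where W: "- X2 = W * adjoint W"
      using less(1)[of "- X2"] by auto
    have "X = (l * W) * adjoint (l * W)"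
      unfolding X2 W adjoint_mult by (simp add: ac_simps)
    then show ?thesis by blast
  qed
qed

section \<open>Behaviour at infinite frequency\<close>

lemma poly_imag_axis_asymptotics:
  assumes "degree p \<le> n"
  shows "((\<lambda>\<omega>. poly p (\<i> * of_real \<omega>) / of_real \<omega> ^ n) \<longlongrightarrow> coeff p n * \<i> ^ n) at_top"
proof -
  have "((\<lambda>\<omega>::real. coeff p k * \<i> ^ k * (of_real \<omega> ^ k / of_real \<omega> ^ n)) \<longlongrightarrow>
      coeff p k * \<i> ^ k * (if k = n then 1 else 0)) at_top" if "k \<le> n" for k
  proof (intro tendsto_mult tendsto_const)
    show "((\<lambda>\<omega>::real. complex_of_real \<omega> ^ k / of_real \<omega> ^ n) \<longlongrightarrow> (if k = n then 1 else 0)) at_top"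
    proof (cases "k = n")
      case True
      then show ?thesis
        by (auto intro!: tendsto_eventually eventually_mono[OF eventually_gt_at_top[of 0]])
    next
      case False
      with that have n: "n = k + (n - k)" "0 < n - k" by auto
      have "((\<lambda>\<omega>::real. inverse (\<omega> ^ (n - k))) \<longlongrightarrow> 0) at_top"
        using n(2) by (intro tendsto_inverse_0_at_top filterlim_pow_at_top filterlim_ident)
      then have "((\<lambda>\<omega>::real. complex_of_real (inverse (\<omega> ^ (n - k)))) \<longlongrightarrow> of_real 0) at_top"
        by (intro tendsto_of_real)
      moreover have "\<forall>\<^sub>F \<omega>::real in at_top. complex_of_real (inverse (\<omega> ^ (n - k))) = of_real \<omega> ^ k / of_real \<omega> ^ n"
        by (rule eventually_mono[OF eventually_gt_at_top[of 0]])
           (subst (2) n(1), simp add: power_add field_simps)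
      ultimately show ?thesis using False by (simp add: tendsto_cong)
    qed
  qed
  then have "((\<lambda>\<omega>::real. \<Sum>k\<le>n. coeff p k * \<i> ^ k * (of_real \<omega> ^ k / of_real \<omega> ^ n)) \<longlongrightarrow>
      (\<Sum>k\<le>n. coeff p k * \<i> ^ k * (if k = n then 1 else 0))) at_top"
    by (intro tendsto_sum) auto
  moreover have "poly p s = (\<Sum>k\<le>n. coeff p k * s ^ k)" for s
    unfolding poly_altdef using assms by (intro sum.mono_neutral_left) (auto simp: coeff_eq_0)
  ultimately show ?thesis
    by (simp add: sum_divide_distrib power_mult_distrib mult.assoc if_distrib cong: if_cong)
qed

text \<open>The frequency bound in the limit of large \<omega>. With n = degree H it bounds the
  direct feedthrough of G / H; with n = degree G > degree H it shows that G / H must be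
  proper.\<close>

lemma imag_axis_bound_coeff:
  assumes bound: "\<And>\<omega>::real. cmod (poly G (\<i> * of_real \<omega>)) \<le> c * cmod (poly H (\<i> * of_real \<omega>))"
    and "degree G \<le> n" "degree H \<le> n"
  shows "cmod (coeff G n) \<le> c * cmod (coeff H n)"
proof -
  have "cmod (coeff G n * \<i> ^ n) \<le> c * cmod (coeff H n * \<i> ^ n)"
  proof (rule tendsto_le[OF trivial_limit_at_top_linorder
        tendsto_mult[OF tendsto_const tendsto_norm[OF poly_imag_axis_asymptotics[OF assms(3)]]]
        tendsto_norm[OF poly_imag_axis_asymptotics[OF assms(2)]]])
    show "\<forall>\<^sub>F \<omega> in at_top. cmod (poly G (\<i> * complex_of_real \<omega>) / complex_of_real \<omega> ^ n)
        \<le> c * cmod (poly H (\<i> * complex_of_real \<omega>) / complex_of_real \<omega> ^ n)"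
      using bound by (auto simp: norm_divide divide_right_mono norm_power intro!: always_eventually)
  qed
  then show ?thesis by (simp add: norm_mult norm_power)
qed

lemma imag_axis_bound_degree:
  assumes bound: "\<And>\<omega>::real. cmod (poly G (\<i> * of_real \<omega>)) \<le> c * cmod (poly H (\<i> * of_real \<omega>))"
  shows "degree G \<le> degree H"
proof (rule ccontr)
  assume "\<not> degree G \<le> degree H"
  then have "cmod (lead_coeff G) \<le> 0"
    using imag_axis_bound_coeff[OF bound, of "degree G"] by (simp add: coeff_eq_0)
  with \<open>\<not> degree G \<le> degree H\<close> show False by auto
qed

text \<open>A zero of \<open>n / d\<close> on the boundary of the half plane that meets a pole of \<open>Q / P\<close> cannot be
  a zero of the loop denominator: the two positive real functions behave like \<open>\<kappa> (s - s0)^m\<close> and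
  \<open>- 1 / (\<kappa> (s - s0)^m)\<close> up to positive factors, and their real parts would have opposite signs.\<close>

lemma passive_loop_no_hidden_zero:
  fixes n d P Q h n1 P1 :: "complex poly" and lam :: real
  assumes n: "n = h * n1" and P: "P = h * P1" and P0: "P \<noteq> 0"
    and cop: "coprime n1 P1" "coprime n d" "coprime P Q"
    and PR: "\<And>s. 0 < Re s \<Longrightarrow> 0 \<le> Re (poly n s * cnj (poly d s))"
            "\<And>s. 0 < Re s \<Longrightarrow> 0 \<le> Re (poly Q s * cnj (poly P s))"
    and lam: "0 < lam" and s0: "0 \<le> Re s0"
    and zero: "poly (P1 * d + Polynomial.smult (of_real lam) (n1 * Q)) s0 = 0"
  shows "poly (n * P1) s0 \<noteq> 0"
proof
  assume z: "poly (n * P1) s0 = 0"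
  have no_common: "\<not> (poly p s0 = 0 \<and> poly q s0 = 0)" if "coprime p q" for p q
    using that coprime_poly_0 by blast
  have eq: "poly P1 s0 * poly d s0 + of_real lam * (poly n1 s0 * poly Q s0) = 0"
    using zero by simp
  have P1: "poly P1 s0 \<noteq> 0"
  proof
    assume *: "poly P1 s0 = 0"
    then have "poly n1 s0 = 0 \<or> poly Q s0 = 0" using eq lam by simp
    then show False using * no_common[OF cop(1)] no_common[OF cop(3)] P by auto
  qed
  with z have n0: "poly n s0 = 0" by simp
  then have d0: "poly d s0 \<noteq> 0" using no_common[OF cop(2)] by auto
  then have n1: "poly n1 s0 \<noteq> 0" using eq P1 by auto
  have h0: "h \<noteq> 0" "poly h s0 = 0" using P0 P n0 n1 n by auto
  define m where "m = order s0 h"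
  have m: "0 < m" using h0 by (simp add: m_def order_gt_0_iff)
  obtain k where k: "h = [:-s0, 1:] ^ m * k" "\<not> [:-s0, 1:] dvd k"
    using order_decomp[OF h0(1), of s0] unfolding m_def by auto
  have k0: "poly k s0 \<noteq> 0" using k(2) by (simp add: poly_eq_0_iff_dvd)
  \<comment> \<open>Up to a positive factor, \<kappa> is the leading coefficient of n / d at s0,
    where n vanishes to the order m.\<close>
  define \<kappa> where "\<kappa> = poly (k * n1) s0 * cnj (poly d s0)"
  have \<kappa>0: "\<kappa> \<noteq> 0" using k0 n1 d0 by (simp add: \<kappa>_def)
  have Re_scale: "Re (of_real r * x) = r * Re x" for r x by simp
  have scaled: "0 \<le> Re y" if "0 \<le> Re x" "x = of_real (\<epsilon> ^ m) * y" "0 < \<epsilon>" for x y and \<epsilon> :: real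
    using that zero_less_power[OF that(3), of m]
    by (simp only: Re_scale) (simp add: zero_le_mult_iff)
  \<comment> \<open>s0 is approached along the ray with direction \<zeta>, inside the half plane.
    Division by \<epsilon>^m preserves both positivity conditions, and the loop equation at s0 turns
    the second limit into a nonpositive multiple of the first.\<close>
  have both: "Re (\<zeta> ^ m * \<kappa>) = 0" if \<zeta>: "0 < Re \<zeta>" for \<zeta>
  proof -
    define s where "s \<epsilon> = s0 + of_real \<epsilon> * \<zeta>" for \<epsilon> :: real
    have pos: "0 < Re (s \<epsilon>)" if "0 < \<epsilon>" for \<epsilon>
      using that \<zeta> s0 by (simp add: s_def add_nonneg_pos)
    have s_lim: "(s \<longlongrightarrow> s0) (at_right 0)"
    proof -
      have "(s \<longlongrightarrow> s0 + of_real 0 * \<zeta>) (at_right 0)" unfolding s_def by (intro tendsto_intros)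
      then show ?thesis by simp
    qed
    have hs: "poly h (s \<epsilon>) = of_real (\<epsilon> ^ m) * (\<zeta> ^ m * poly k (s \<epsilon>))" for \<epsilon>
      by (simp add: k(1) s_def poly_power power_mult_distrib mult.assoc)
    have 1: "0 \<le> Re (\<zeta> ^ m * poly (k * n1) s0 * cnj (poly d s0))"
    proof (rule tendsto_lowerbound[of "\<lambda>\<epsilon>. Re (\<zeta> ^ m * poly (k * n1) (s \<epsilon>) * cnj (poly d (s \<epsilon>)))" _ "at_right 0"])
      show "\<forall>\<^sub>F \<epsilon> in at_right 0. 0 \<le> Re (\<zeta> ^ m * poly (k * n1) (s \<epsilon>) * cnj (poly d (s \<epsilon>)))"
      proof (rule eventually_at_rightI[of 0 1])
        fix \<epsilon> :: real assume \<epsilon>: "\<epsilon> \<in> {0<..<1}"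
        have "poly n (s \<epsilon>) * cnj (poly d (s \<epsilon>)) = of_real (\<epsilon> ^ m) * (\<zeta> ^ m * poly (k * n1) (s \<epsilon>) * cnj (poly d (s \<epsilon>)))"
          by (simp add: n hs del: of_real_power)
        then show "0 \<le> Re (\<zeta> ^ m * poly (k * n1) (s \<epsilon>) * cnj (poly d (s \<epsilon>)))"
          by (rule scaled[OF PR(1)[OF pos], rotated 1]) (use \<epsilon> in auto)
      qed simp
    qed (intro tendsto_intros s_lim, simp)
    have 2: "0 \<le> Re (poly Q s0 * cnj (\<zeta> ^ m * poly (k * P1) s0))"
    proof (rule tendsto_lowerbound[of "\<lambda>\<epsilon>. Re (poly Q (s \<epsilon>) * cnj (\<zeta> ^ m * poly (k * P1) (s \<epsilon>)))" _ "at_right 0"])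
      show "\<forall>\<^sub>F \<epsilon> in at_right 0. 0 \<le> Re (poly Q (s \<epsilon>) * cnj (\<zeta> ^ m * poly (k * P1) (s \<epsilon>)))"
      proof (rule eventually_at_rightI[of 0 1])
        fix \<epsilon> :: real assume \<epsilon>: "\<epsilon> \<in> {0<..<1}"
        have "poly Q (s \<epsilon>) * cnj (poly P (s \<epsilon>)) = of_real (\<epsilon> ^ m) * (poly Q (s \<epsilon>) * cnj (\<zeta> ^ m * poly (k * P1) (s \<epsilon>)))"
          by (simp add: P hs mult_ac del: of_real_power)
        then show "0 \<le> Re (poly Q (s \<epsilon>) * cnj (\<zeta> ^ m * poly (k * P1) (s \<epsilon>)))"
          by (rule scaled[OF PR(2)[OF pos], rotated 1]) (use \<epsilon> in auto)
      qed simp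
    qed (intro tendsto_intros s_lim, simp)
    have "of_real (lam * (cmod (poly n1 s0))\<^sup>2) * (poly Q s0 * cnj (\<zeta> ^ m * poly (k * P1) s0))
       = (of_real lam * (poly n1 s0 * poly Q s0)) * (cnj (poly n1 s0) * cnj (\<zeta> ^ m * poly (k * P1) s0))"
      by (simp only: of_real_mult complex_norm_square) (simp add: mult_ac)
    also have "of_real lam * (poly n1 s0 * poly Q s0) = - (poly P1 s0 * poly d s0)"
      using eq by (simp add: eq_neg_iff_add_eq_0 add.commute)
    also have "- (poly P1 s0 * poly d s0) * (cnj (poly n1 s0) * cnj (\<zeta> ^ m * poly (k * P1) s0))
       = - (of_real ((cmod (poly P1 s0))\<^sup>2) * cnj (\<zeta> ^ m * \<kappa>))"
      by (simp only: complex_norm_square \<kappa>_def) (simp add: mult_ac)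
    finally have "Re (of_real (lam * (cmod (poly n1 s0))\<^sup>2) * (poly Q s0 * cnj (\<zeta> ^ m * poly (k * P1) s0)))
       = Re (- (of_real ((cmod (poly P1 s0))\<^sup>2) * cnj (\<zeta> ^ m * \<kappa>)))" by (rule arg_cong)
    then have "lam * (cmod (poly n1 s0))\<^sup>2 * Re (poly Q s0 * cnj (\<zeta> ^ m * poly (k * P1) s0))
        = - ((cmod (poly P1 s0))\<^sup>2 * Re (\<zeta> ^ m * \<kappa>))"
      by (simp only: Re_scale uminus_complex.sel cnj.sel mult.assoc)
    moreover have "0 \<le> lam * (cmod (poly n1 s0))\<^sup>2 * Re (poly Q s0 * cnj (\<zeta> ^ m * poly (k * P1) s0))"
      using lam 2 by (intro mult_nonneg_nonneg) auto
    ultimately have "(cmod (poly P1 s0))\<^sup>2 * Re (\<zeta> ^ m * \<kappa>) \<le> 0" by linarith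
    then have "Re (\<zeta> ^ m * \<kappa>) \<le> 0" using P1 by (simp add: mult_le_0_iff)
    moreover have "0 \<le> Re (\<zeta> ^ m * \<kappa>)" using 1 by (simp add: \<kappa>_def mult.assoc)
    ultimately show ?thesis by linarith
  qed
  have "Re \<kappa> = 0" using both[of 1] by simp
  \<comment> \<open>cis(pi / (4 m)) lies in the open right half plane and its m-th power is cis(pi /
    4). Together with \<zeta> = 1 this gives two independent real conditions on \<kappa>.\<close>
  moreover have "Re (cis (pi / 4) * \<kappa>) = 0"
  proof -
    have "cis (pi / (4 * m)) ^ m = cis (pi / 4)" using m by (simp add: Complex.DeMoivre)
    moreover have "0 < cos (pi / (4 * m))"
      using m by (intro cos_gt_zero_pi) (auto simp: field_simps intro: less_le_trans[of _ 0])
    ultimately show ?thesis using both[of "cis (pi / (4 * m))"] by simp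
  qed
  ultimately have "\<kappa> = 0" by (auto simp: complex_eq_iff cos_45 sin_45)
  with \<kappa>0 show False by simp
qed

subsection \<open>Gain of stable linear filters\<close>

abbreviation Int0 :: "(real \<Rightarrow> 'a::banach) \<Rightarrow> real \<Rightarrow> 'a" where
  "Int0 f t \<equiv> integral {0..t} f"

lemma integral_deriv_half_line:
  fixes f :: "real \<Rightarrow> 'a::banach"
  assumes "continuous_on {0..} f" "0 < t"
  shows "(Int0 f has_vector_derivative f t) (at t)"
proof -
  have "(Int0 f has_vector_derivative f t) (at t within {0..t+1})"
    using assms by (intro integral_has_vector_derivative continuous_on_subset[OF assms(1)]) auto
  then show ?thesis using assms(2) by (simp add: at_within_Icc_at)
qed

lemma integrable_half_line:
  fixes f :: "real \<Rightarrow> 'a::banach"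
  shows "continuous_on {0..} f \<Longrightarrow> 0 \<le> a \<Longrightarrow> f integrable_on {a..b}"
  by (rule integrable_continuous_real, erule continuous_on_subset) auto

lemma continuous_on_half_lineI:
  fixes f :: "real \<Rightarrow> 'a::topological_space"
  assumes "\<And>b. continuous_on {0..b} f"
  shows "continuous_on {0..} f"
proof -
  have "continuous (at t within {0..}) f" if "0 \<le> t" for t
  proof -
    have "continuous (at t within {0..t+1}) f"
      using assms[of "t + 1"] that by (auto simp: continuous_on_eq_continuous_within)
    moreover have "at t within {0..t+1} = at t within {0..}"
      by (rule at_within_nhd[of t "{t-1<..<t+1}"]) auto
    ultimately show ?thesis by (simp add: continuous_within)
  qed
  then show ?thesis by (simp add: continuous_on_eq_continuous_within)
qed

lemma integral_continuous_half_line: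
  fixes f :: "real \<Rightarrow> 'a::banach"
  assumes "continuous_on {0..} f"
  shows "continuous_on {0..} (Int0 f)"
  by (rule continuous_on_half_lineI)
     (intro indefinite_integral_continuous_1 integrable_half_line[OF assms] order.refl)

lemma Int0_split:
  fixes f :: "real \<Rightarrow> 'a::banach"
  assumes "continuous_on {0..} f" "0 \<le> s" "s \<le> t"
  shows "Int0 f t = Int0 f s + integral {s..t} f"
  by (rule Henstock_Kurzweil_Integration.integral_combine[OF assms(2,3) integrable_half_line[OF assms(1) order.refl], symmetric])

lemma Int0_mono:
  fixes f :: "real \<Rightarrow> real"
  assumes "continuous_on {0..} f" "0 \<le> s" "s \<le> t" "\<And>x. 0 \<le> x \<Longrightarrow> 0 \<le> f x"
  shows "Int0 f s \<le> Int0 f t"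
  unfolding Int0_split[OF assms(1-3)] using assms
  by (intro order.trans[OF _ add_left_mono[OF integral_nonneg]] integrable_half_line) auto

text \<open>\<open>resolvent r f\<close> is the solution of \<open>u' = r u + f\<close> with \<open>u 0 = 0\<close>.\<close>

definition resolvent :: "complex \<Rightarrow> (real \<Rightarrow> complex) \<Rightarrow> real \<Rightarrow> complex" where
  "resolvent r f t = exp (r * of_real t) * Int0 (\<lambda>\<tau>. exp (- r * of_real \<tau>) * f \<tau>) t"

lemma resolvent_0 [simp]: "resolvent r f 0 = 0"
  by (simp add: resolvent_def)

lemma exp_cont: "continuous_on S (\<lambda>\<tau>::real. exp (c * complex_of_real \<tau>))"
  by (intro continuous_intros)

lemma resolvent_continuous:
  assumes "continuous_on {0..} f"
  shows "continuous_on {0..} (resolvent r f)"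
  unfolding resolvent_def using assms
  by (intro continuous_on_mult integral_continuous_half_line exp_cont)

lemma resolvent_deriv:
  assumes "continuous_on {0..} f" "0 < t"
  shows "(resolvent r f has_vector_derivative r * resolvent r f t + f t) (at t)"
proof -
  let ?I = "Int0 (\<lambda>\<tau>. exp (- r * of_real \<tau>) * f \<tau>)"
  have 1: "(?I has_vector_derivative exp (- r * of_real t) * f t) (at t)"
    by (rule integral_deriv_half_line[OF continuous_on_mult[OF exp_cont assms(1)] assms(2)])
  have 2: "((\<lambda>t. exp (r * of_real t)) has_vector_derivative r * exp (r * of_real t)) (at t)"
    by (auto intro!: derivative_eq_intros has_vector_derivative_real_field simp: mult.commute)
  have "((\<lambda>t. exp (r * of_real t) * ?I t) has_vector_derivative
      exp (r * of_real t) * (exp (- r * of_real t) * f t) + r * exp (r * of_real t) * ?I t) (at t)"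
    by (rule has_vector_derivative_mult[OF 2 1])
  moreover have X: "exp (r * of_real t) * (exp (- r * of_real t) * f t) = f t"
    unfolding mult.assoc[symmetric] exp_add[symmetric] by simp
  moreover have "exp (r * of_real t) * (exp (- r * of_real t) * f t) + r * exp (r * of_real t) * ?I t
      = r * resolvent r f t + f t"
    unfolding X resolvent_def mult.assoc by (rule add.commute)
  ultimately have "((\<lambda>t. exp (r * of_real t) * ?I t) has_vector_derivative r * resolvent r f t + f t) (at t)"
    by metis
  then show ?thesis unfolding resolvent_def[abs_def] .
qed

lemma resolvent_cong:
  assumes "\<And>s. 0 \<le> s \<Longrightarrow> s \<le> t \<Longrightarrow> f s = g s"
  shows "resolvent r f t = resolvent r g t"
  unfolding resolvent_def using assms by (auto intro!: integral_cong)

lemma cont_norm_sq: "continuous_on S f \<Longrightarrow> continuous_on S (\<lambda>t. (cmod (f t))\<^sup>2)"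
  by (intro continuous_intros)

text \<open>Square integrability on the half line, expressed by a bound on truncated integrals to
  avoid improper ones.\<close>

definition square_bounded :: "(real \<Rightarrow> complex) \<Rightarrow> bool" where
  "square_bounded f \<longleftrightarrow> continuous_on {0..} f \<and> (\<exists>B. \<forall>t\<ge>0. Int0 (\<lambda>s. (cmod (f s))\<^sup>2) t \<le> B)"

lemma weighted_arith_geo_mean:
  fixes d x y :: real
  assumes "0 < d"
  shows "2 * (x * y) \<le> d * x\<^sup>2 + y\<^sup>2 / d"
proof -
  have "d * (y\<^sup>2 / d) = y\<^sup>2" using assms by simp
  then have "d * (d * x\<^sup>2 + y\<^sup>2 / d - 2 * (x * y)) = (d * x - y)\<^sup>2"
    by (simp only: right_diff_distrib distrib_left) (simp add: power2_eq_square algebra_simps)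
  then have "0 \<le> d * (d * x\<^sup>2 + y\<^sup>2 / d - 2 * (x * y))" by simp
  then show ?thesis using assms by (simp add: zero_le_mult_iff)
qed

lemma Re_mult_real_const: "Re (z * of_real a) = Re z * a"
  by simp

text \<open>Young's inequality with weight - Re r spends half of the dissipation 2 Re r |u|^2 on the
  cross term.\<close>

lemma resolvent_energy_deriv:
  fixes u f r :: complex
  assumes "Re r < 0"
  shows "2 * Re (cnj u * (r * u + f)) \<le> Re r * (cmod u)\<^sup>2 + (cmod f)\<^sup>2 / (- Re r)"
proof -
  have "cnj u * (r * u) = of_real ((cmod u)\<^sup>2) * r"
    unfolding complex_norm_square by (simp only: mult_ac)
  then have "Re (cnj u * (r * u)) = Re (of_real ((cmod u)\<^sup>2) * r)" by (rule arg_cong)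
  also have "\<dots> = Re r * (cmod u)\<^sup>2" by (subst mult.commute) (rule Re_mult_real_const)
  finally have "Re (cnj u * (r * u)) = Re r * (cmod u)\<^sup>2" .
  moreover have "2 * Re (cnj u * f) \<le> (- Re r) * (cmod u)\<^sup>2 + (cmod f)\<^sup>2 / (- Re r)"
  proof -
    have "Re (cnj u * f) \<le> cmod u * cmod f"
      using complex_Re_le_cmod[of "cnj u * f"] by (simp only: norm_mult complex_mod_cnj)
    then have "2 * Re (cnj u * f) \<le> 2 * (cmod u * cmod f)" by (rule mult_left_mono) simp
    also have "\<dots> \<le> (- Re r) * (cmod u)\<^sup>2 + (cmod f)\<^sup>2 / (- Re r)"
      by (rule weighted_arith_geo_mean) (use assms in simp)
    finally show ?thesis .
  qed
  moreover have "2 * Re (cnj u * (r * u + f)) = 2 * Re (cnj u * (r * u)) + 2 * Re (cnj u * f)"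
    by (simp only: distrib_left plus_complex.sel)
  ultimately show ?thesis by (simp only: mult_minus_left)
qed

lemma norm_sq_deriv:
  assumes "(f has_vector_derivative f') (at t)"
  shows "((\<lambda>t. (cmod (f t))\<^sup>2) has_real_derivative 2 * Re (cnj (f t) * f')) (at t)"
proof -
  have "((\<lambda>t. f t * cnj (f t)) has_vector_derivative f t * cnj f' + f' * cnj (f t)) (at t)"
    by (intro has_vector_derivative_mult assms has_vector_derivative_cnj)
  note bounded_linear.has_vector_derivative[OF bounded_linear_Re this]
  moreover have "(\<lambda>t. (cmod (f t))\<^sup>2) = (\<lambda>t. Re (f t * cnj (f t)))"
    by (rule ext) (simp only: cmod_power2 complex_mult_cnj Re_complex_of_real)
  ultimately show ?thesis
    by (simp add: has_real_derivative_iff_has_vector_derivative algebra_simps)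
qed

text \<open>With E = |u|^2 and F the truncated energy of f, the function E + \<delta> Int0 E - F /
  \<delta> does not increase. From time 0 on this bounds the energy of u. Between later times E can
  grow only by the vanishing tail of F / \<delta>, so once small it stays small.\<close>

lemma resolvent_square_bounded:
  assumes f: "square_bounded f" and r: "Re r < 0"
  shows "square_bounded (resolvent r f)" and "(resolvent r f \<longlongrightarrow> 0) at_top"
proof -
  define \<delta> where "\<delta> = - Re r"
  have \<delta>: "0 < \<delta>" using r by (simp add: \<delta>_def)
  obtain B where cf: "continuous_on {0..} f" and B: "\<And>t. 0 \<le> t \<Longrightarrow> Int0 (\<lambda>s. (cmod (f s))\<^sup>2) t \<le> B"
    using f by (auto simp: square_bounded_def)
  define u where "u = resolvent r f"
  define E where "E t = (cmod (u t))\<^sup>2" for t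
  define F where "F = Int0 (\<lambda>s. (cmod (f s))\<^sup>2)"
  define \<phi> where "\<phi> t = E t + \<delta> * Int0 E t - F t / \<delta>" for t
  have cu: "continuous_on {0..} u" unfolding u_def by (rule resolvent_continuous[OF cf])
  have cE: "continuous_on {0..} E" unfolding E_def by (rule cont_norm_sq[OF cu])
  have cF: "continuous_on {0..} F" unfolding F_def by (intro integral_continuous_half_line cont_norm_sq cf)
  have \<phi>_dec: "\<phi> t \<le> \<phi> s" if "0 \<le> s" "s \<le> t" for s t
  proof (rule DERIV_nonpos_imp_decreasing_open[OF that(2)])
    show "continuous_on {s..t} \<phi>"
      unfolding \<phi>_def using that \<delta>
      by (intro continuous_on_add continuous_on_diff continuous_on_mult continuous_on_divide continuous_on_const
          continuous_on_subset[OF cE] continuous_on_subset[OF cF]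
          continuous_on_subset[OF integral_continuous_half_line[OF cE]]) auto
    fix x assume x: "s < x" "x < t"
    then have x0: "0 < x" using that by simp
    have "(u has_vector_derivative r * u x + f x) (at x)"
      unfolding u_def by (rule resolvent_deriv[OF cf x0])
    then have 1: "(E has_real_derivative 2 * Re (cnj (u x) * (r * u x + f x))) (at x)"
      unfolding E_def by (rule norm_sq_deriv)
    have 2: "(Int0 E has_real_derivative E x) (at x)"
      using integral_deriv_half_line[OF cE x0] by (simp add: has_real_derivative_iff_has_vector_derivative)
    have 3: "(F has_real_derivative (cmod (f x))\<^sup>2) (at x)"
      unfolding F_def using integral_deriv_half_line[OF cont_norm_sq[OF cf] x0]
      by (simp add: has_real_derivative_iff_has_vector_derivative)
    have "(\<phi> has_real_derivative 2 * Re (cnj (u x) * (r * u x + f x)) + \<delta> * E x - (cmod (f x))\<^sup>2 / \<delta>) (at x)"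
      unfolding \<phi>_def by (intro DERIV_add DERIV_diff DERIV_cmult DERIV_cdivide 1 2 3)
    moreover have "2 * Re (cnj (u x) * (r * u x + f x)) + \<delta> * E x - (cmod (f x))\<^sup>2 / \<delta> \<le> 0"
      using resolvent_energy_deriv[of r "u x" "f x"] \<delta> unfolding \<delta>_def E_def by linarith
    ultimately show "\<exists>y. (\<phi> has_real_derivative y) (at x) \<and> y \<le> 0" by blast
  qed
  have E0: "0 \<le> E t" for t by (simp add: E_def)
  have \<phi>0: "\<phi> 0 = 0" by (simp add: \<phi>_def E_def F_def u_def)
  have IE: "Int0 E t \<le> B / \<delta> / \<delta>" if "0 \<le> t" for t
  proof -
    have "\<delta> * Int0 E t \<le> F t / \<delta>" using \<phi>_dec[of 0 t] that E0[of t] \<phi>0 by (simp add: \<phi>_def)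
    also have "\<dots> \<le> B / \<delta>" using B[OF that] \<delta> unfolding F_def by (intro divide_right_mono) auto
    finally show ?thesis using \<delta> by (simp add: field_simps)
  qed
  then show "square_bounded (resolvent r f)"
    using cu unfolding square_bounded_def E_def u_def by auto
  have F_mono: "F s \<le> F t" if "0 \<le> s" "s \<le> t" for s t
    unfolding F_def using that by (intro Int0_mono cont_norm_sq cf) auto
  have step: "E t \<le> E s + (F t - F s) / \<delta>" if "0 \<le> s" "s \<le> t" for s t
  proof -
    have "Int0 E s \<le> Int0 E t" using that by (intro Int0_mono cE E0)
    then have "\<delta> * Int0 E s \<le> \<delta> * Int0 E t" using \<delta> by simp
    then show ?thesis using \<phi>_dec[OF that] unfolding \<phi>_def by (simp add: diff_divide_distrib)
  qed
  have "(E \<longlongrightarrow> 0) at_top"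
  proof (rule tendstoI)
    fix e :: real assume e: "0 < e"
    define k where "k = 1 + 1 / \<delta>"
    have k: "0 < k" using \<delta> by (simp add: k_def add_pos_pos)
    \<comment> \<open>With this choice the starting value e1 plus the largest later growth e1 /
      \<delta> make e / 2.\<close>
    define e1 where "e1 = e / 2 / k"
    have "e1 + e1 / \<delta> = e1 * k" by (simp add: k_def distrib_left)
    also have "\<dots> = e / 2" using k by (simp add: e1_def)
    finally have "e1 + e1 / \<delta> < e" using e by linarith
    moreover have "0 < e1" using e k by (simp add: e1_def)
    ultimately have e1: "0 < e1" "e1 + e1 / \<delta> < e" by blast+
    define S where "S = (SUP t\<in>{0..}. F t)"
    have bdd: "bdd_above (F ` {0..})" using B unfolding F_def by (auto intro!: bdd_aboveI[of _ B])
    have "S - e1 < S" using e1 by simp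
    then obtain s0 where s0: "0 \<le> s0" "S - e1 < F s0"
      unfolding S_def using less_cSUP_iff[OF _ bdd, of "S - e1"] unfolding S_def by auto
    have tail: "F t - F s \<le> e1" if "s0 \<le> s" "s \<le> t" for s t
    proof -
      have "F t \<le> S" unfolding S_def using that s0 by (intro cSUP_upper bdd) auto
      moreover have "F s0 \<le> F s" using that s0 by (intro F_mono) auto
      ultimately show ?thesis using s0(2) by linarith
    qed
    have "\<exists>s\<ge>s0. E s < e1"
    proof (rule ccontr)
      assume "\<not> (\<exists>s\<ge>s0. E s < e1)"
      then have ge: "e1 \<le> E s" if "s0 \<le> s" for s using that by force
      \<comment> \<open>If E stayed above e1 up to this time, its integral would exceed the bound B
        / \<delta> / \<delta> by 1.\<close>
      define t where "t = s0 + (B / \<delta> / \<delta> + 1) / e1"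
      have B0: "0 \<le> B" using B[of 0] by simp
      have t: "s0 \<le> t" using e1 B0 \<delta> by (simp add: t_def)
      have "integral {s0..t} (\<lambda>_. e1) \<le> integral {s0..t} E"
        by (rule integral_le[OF integrable_const_ivl integrable_half_line[OF cE s0(1)]]) (simp add: ge)
      then have "(t - s0) * e1 \<le> integral {s0..t} E" using t by (simp add: mult.commute)
      also have "\<dots> \<le> Int0 E t"
        using Int0_split[OF cE s0(1) t] integral_nonneg[of E "{0..s0}"] integrable_half_line[OF cE, of 0 s0] E0 by simp
      also have "\<dots> \<le> B / \<delta> / \<delta>" using IE s0 t by simp
      finally show False using e1 by (simp add: t_def)
    qed
    then obtain s where s: "s0 \<le> s" "E s < e1" by blast
    have "E t < e" if "s \<le> t" for t
    proof -
      have "(F t - F s) / \<delta> \<le> e1 / \<delta>" using tail[OF s(1) that] \<delta> by (simp add: divide_right_mono)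
      then show ?thesis using step[of s t] s s0 that e1 by linarith
    qed
    then show "\<forall>\<^sub>F t in at_top. dist (E t) 0 < e"
      using E0 by (auto simp: eventually_at_top_linorder dist_real_def)
  qed
  then have "((\<lambda>t. sqrt (E t)) \<longlongrightarrow> sqrt 0) at_top" by (intro tendsto_real_sqrt)
  then have "((\<lambda>t. cmod (u t)) \<longlongrightarrow> 0) at_top" by (simp add: E_def)
  then show "(resolvent r f \<longlongrightarrow> 0) at_top" unfolding u_def by (rule tendsto_norm_zero_cancel)
qed

section \<open>Responses of proper rational filters\<close>

fun resolvents :: "complex list \<Rightarrow> (real \<Rightarrow> complex) \<Rightarrow> real \<Rightarrow> complex" where
  "resolvents [] f = f"
| "resolvents (r # rs) f = resolvent r (resolvents rs f)"

text \<open>\<open>proper_response rs p f\<close> is \<open>p(D) w\<close> for the solution \<open>w\<close> of \<open>\<Prod>(D - r) w = f\<close> with zero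
  initial data, where \<open>degree p\<close> is at most the order of the equation. The division
  \<open>p = (D - r) q + p(r)\<close> avoids all derivatives of \<open>f\<close>.\<close>

fun proper_response :: "complex list \<Rightarrow> complex poly \<Rightarrow> (real \<Rightarrow> complex) \<Rightarrow> real \<Rightarrow> complex" where
  "proper_response [] p f = (\<lambda>t. coeff p 0 * f t)"
| "proper_response (r # rs) p f =
     (\<lambda>t. proper_response rs (synthetic_div p r) f t + poly p r * resolvents (r # rs) f t)"

lemma resolvents_continuous: "continuous_on {0..} f \<Longrightarrow> continuous_on {0..} (resolvents rs f)"
  by (induction rs) (auto intro: resolvent_continuous)

lemma proper_response_continuous: "continuous_on {0..} f \<Longrightarrow> continuous_on {0..} (proper_response rs p f)"
proof (induction rs arbitrary: p)
  case (Cons r rs)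
  have "continuous_on {0..} (resolvents (r # rs) f)" by (rule resolvents_continuous[OF Cons.prems])
  then show ?case
    unfolding proper_response.simps by (intro continuous_on_add continuous_on_mult continuous_on_const Cons)
qed (auto intro!: continuous_intros)

lemma synthetic_div_add: "synthetic_div (p + q) r = synthetic_div p r + synthetic_div q r"
  for p q :: "complex poly"
proof -
  have "synthetic_div (p + q) r = synthetic_div p r + synthetic_div q r \<and> poly (p + q) r = poly p r + poly q r"
    by (induction p q rule: poly_induct2) (auto simp: algebra_simps)
  then show ?thesis ..
qed

lemma synthetic_div_smult: "synthetic_div (Polynomial.smult c p) r = Polynomial.smult c (synthetic_div p r)"
  for p :: "complex poly"
  by (induction p) auto

lemma proper_response_add: "proper_response rs (p + q) f t = proper_response rs p f t + proper_response rs q f t"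
  by (induction rs arbitrary: p q) (simp_all add: synthetic_div_add algebra_simps)

lemma proper_response_smult: "proper_response rs (Polynomial.smult c p) f t = c * proper_response rs p f t"
  by (induction rs arbitrary: p) (simp_all add: synthetic_div_smult algebra_simps)

lemma proper_response_0 [simp]: "proper_response rs 0 f t = 0"
  using proper_response_smult[of rs 0 0 f t] by simp

lemma proper_response_1: "proper_response rs 1 f t = resolvents rs f t"
proof (cases rs)
  case (Cons r rs')
  have "synthetic_div 1 r = (0 :: complex poly)" by (simp add: synthetic_div_eq_0_iff)
  then show ?thesis by (simp add: Cons)
qed simp

lemma proper_response_prod: "proper_response rs (\<Prod>r\<leftarrow>rs. [:-r, 1:]) f t = f t"
proof (induction rs arbitrary: t)
  case (Cons r rs)
  have "synthetic_div ([:-r, 1:] * (\<Prod>r\<leftarrow>rs. [:-r, 1:])) r = (\<Prod>r\<leftarrow>rs. [:-r, 1:])"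
    by (rule synthetic_div_unique[THEN conjunct2, symmetric, of _ _ _ 0]) simp
  with Cons show ?case by simp
qed simp

text \<open>D p(D) w = (D p)(D) w. As the degree of p is below the order of the filter, the response
  contains no direct copy of f, and a continuous f suffices.\<close>

lemma proper_response_deriv:
  assumes f: "continuous_on {0..} f" and t: "0 < t" and deg: "degree p < length rs \<or> p = 0"
  shows "(proper_response rs p f has_vector_derivative proper_response rs (pCons 0 p) f t) (at t)"
  using deg
proof (induction rs arbitrary: p)
  case (Cons r rs)
  define q where "q = synthetic_div p r"
  have "degree q < length rs \<or> q = 0"
    using Cons.prems by (cases "degree p = 0") (auto simp: q_def degree_synthetic_div synthetic_div_eq_0_iff)
  then have 1: "(proper_response rs q f has_vector_derivative proper_response rs (pCons 0 q) f t) (at t)"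
    by (rule Cons.IH)
  have 2: "(resolvents (r # rs) f has_vector_derivative r * resolvents (r # rs) f t + resolvents rs f t) (at t)"
    unfolding resolvents.simps by (rule resolvent_deriv[OF resolvents_continuous[OF f] t])
  have sd: "synthetic_div (pCons 0 p) r = pCons 0 q + [:poly p r:]" by (simp add: q_def)
  have const: "proper_response rs [:poly p r:] f t = poly p r * resolvents rs f t"
    using proper_response_smult[of rs "poly p r" 1 f t] by (simp add: proper_response_1)
  have "((\<lambda>t. proper_response rs q f t + poly p r * resolvents (r # rs) f t) has_vector_derivative
     proper_response rs (pCons 0 q) f t + poly p r * (r * resolvents (r # rs) f t + resolvents rs f t)) (at t)"
    by (intro has_vector_derivative_add has_vector_derivative_mult_right 1 2)
  moreover have "proper_response rs (pCons 0 q) f t + poly p r * (r * resolvents (r # rs) f t + resolvents rs f t)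
     = proper_response (r # rs) (pCons 0 p) f t"
    unfolding proper_response.simps sd proper_response_add const
    by (simp add: algebra_simps del: resolvents.simps)
  ultimately show ?case by (simp add: q_def del: resolvents.simps)
qed simp

text \<open>The filter starts at rest, which removes the boundary terms at time 0 in later
  integrations by parts.\<close>

lemma proper_response_at_0: "degree p < length rs \<or> p = 0 \<Longrightarrow> proper_response rs p f 0 = 0"
proof (induction rs arbitrary: p)
  case (Cons r rs)
  then have "degree (synthetic_div p r) < length rs \<or> synthetic_div p r = 0"
    by (cases "degree p = 0") (auto simp: degree_synthetic_div synthetic_div_eq_0_iff)
  then show ?case using Cons.IH by simp
qed simp

lemma resolvents_square_bounded:
  assumes "square_bounded f" "\<forall>r\<in>set rs. Re r < 0"
  shows "square_bounded (resolvents rs f)"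
  using assms by (induction rs) (auto intro: resolvent_square_bounded)

text \<open>For a strictly proper filter every summand passes through a resolvent, whose output
  vanishes at infinity for square integrable input.\<close>

lemma proper_response_vanishes:
  assumes f: "square_bounded f" and rs: "\<forall>r\<in>set rs. Re r < 0" and deg: "degree p < length rs \<or> p = 0"
  shows "(proper_response rs p f \<longlongrightarrow> 0) at_top"
  using rs deg
proof (induction rs arbitrary: p)
  case (Cons r rs)
  then have "degree (synthetic_div p r) < length rs \<or> synthetic_div p r = 0"
    by (cases "degree p = 0") (auto simp: degree_synthetic_div synthetic_div_eq_0_iff)
  with Cons have 1: "(proper_response rs (synthetic_div p r) f \<longlongrightarrow> 0) at_top" by auto
  have 2: "(resolvent r (resolvents rs f) \<longlongrightarrow> 0) at_top"
    using Cons.prems by (intro resolvent_square_bounded(2) resolvents_square_bounded f) auto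
  show ?case using tendsto_add[OF 1 tendsto_mult[OF tendsto_const[of "poly p r"] 2]] by simp
qed simp

text \<open>Causality, which permits changing the input beyond T.\<close>

lemma proper_response_cong:
  assumes "\<And>s. 0 \<le> s \<Longrightarrow> s \<le> T \<Longrightarrow> f s = g s" "0 \<le> t" "t \<le> T"
  shows "proper_response rs p f t = proper_response rs p g t"
proof -
  have r: "resolvents rs f s = resolvents rs g s" if "0 \<le> s" "s \<le> T" for rs s
    using that
  proof (induction rs arbitrary: s)
    case (Cons r rs)
    then show ?case by (auto intro: resolvent_cong)
  qed (use assms in auto)
  show ?thesis
    by (induction rs arbitrary: p) (use r[OF assms(2,3)] assms in \<open>auto simp del: resolvents.simps\<close>)
qed

lemma proper_response_monom_expand:
  assumes "degree q \<le> m"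
  shows "proper_response rs q f t = (\<Sum>a\<le>m. coeff q a * proper_response rs (monom 1 a) f t)"
proof -
  have "proper_response rs (\<Sum>a\<in>S. monom (coeff q a) a) f t
      = (\<Sum>a\<in>S. coeff q a * proper_response rs (monom 1 a) f t)" if "finite S" for S
    using that
  proof (induction S)
    case (insert a S)
    have "monom (coeff q a) a = Polynomial.smult (coeff q a) (monom 1 a)" by (simp add: smult_monom)
    with insert show ?case by (simp add: proper_response_add proper_response_smult)
  qed simp
  from this[of "{..m}"] show ?thesis using poly_as_sum_of_monoms'[OF assms] by simp
qed

lemma coeff_mult_sum:
  fixes p q :: "complex poly"
  assumes "degree p \<le> m" "degree q \<le> m"
  shows "(\<Sum>a\<le>m. \<Sum>b\<le>m. coeff p a * coeff q b * K (a + b)) = (\<Sum>n\<le>2*m. coeff (p * q) n * K n)"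
proof -
  have "(\<Sum>n\<le>2*m. coeff (p * q) n * K n) = (\<Sum>n\<le>2*m. \<Sum>i\<le>n. coeff p i * coeff q (n - i) * K (i + (n - i)))"
    by (simp add: coeff_mult sum_distrib_right)
  also have "\<dots> = (\<Sum>(a, b)\<in>{(a, b). a + b \<le> 2*m}. coeff p a * coeff q b * K (a + b))"
    by (rule sum.triangle_reindex_eq[symmetric])
  also have "\<dots> = (\<Sum>(a, b)\<in>{..m} \<times> {..m}. coeff p a * coeff q b * K (a + b))"
  proof (rule sum.mono_neutral_right)
    show "finite {(a, b). a + b \<le> 2*m}"
      by (rule finite_subset[of _ "{..2*m} \<times> {..2*m}"]) auto
  qed (use assms in \<open>auto dest!: le_degree\<close>)
  finally show ?thesis by (simp add: sum.cartesian_product)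
qed

lemma Int0_norm_sq:
  assumes "continuous_on {0..} f"
  shows "Int0 (\<lambda>t. f t * cnj (f t)) R = of_real (Int0 (\<lambda>t. (cmod (f t))\<^sup>2) R)"
proof -
  have "((\<lambda>t. (cmod (f t))\<^sup>2) has_integral Int0 (\<lambda>t. (cmod (f t))\<^sup>2) R) {0..R}"
    by (intro integrable_integral integrable_half_line cont_norm_sq assms order.refl)
  from has_integral_linear[OF this bounded_linear_of_real[where 'a = complex]]
  have "((\<lambda>t. f t * cnj (f t)) has_integral of_real (Int0 (\<lambda>t. (cmod (f t))\<^sup>2) R)) {0..R}"
    by (simp only: o_def complex_norm_square)
  then show ?thesis by (rule integral_unique)
qed

text \<open>Plancherel's theorem in the time domain. Let w be the latent solution, so that f = H(D)
  w. Integration by parts shows that the energy of q(D) w is, in the limit, a linear function of q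
  times its adjoint. The spectral factor W then identifies c^2 |f|^2 - |p(D) w|^2 in the mean with
  |W(D) w|^2, which is nonnegative. Compact support makes f square integrable, so that the boundary
  terms vanish at infinity.\<close>

lemma proper_response_gain_compact:
  assumes f: "continuous_on {0..} f" and supp: "0 \<le> T" "\<And>t. T \<le> t \<Longrightarrow> f t = 0"
    and rs: "\<forall>r\<in>set rs. Re r < 0"
    and bound: "\<And>\<omega>::real. cmod (poly p (\<i> * of_real \<omega>)) \<le> c * cmod (poly (\<Prod>r\<leftarrow>rs. [:-r, 1:]) (\<i> * of_real \<omega>))"
    and c: "0 \<le> c" and R0: "0 \<le> R0"
  shows "Int0 (\<lambda>t. (cmod (proper_response rs p f t))\<^sup>2) R0 \<le> c\<^sup>2 * Int0 (\<lambda>t. (cmod (f t))\<^sup>2) T"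
proof -
  define m where "m = length rs"
  define H where "H = (\<Prod>r\<leftarrow>rs. [:-r, 1:])"
  have degH: "degree H = m" unfolding H_def m_def by (rule degree_linear_factors)
  have degp: "degree p \<le> m" using imag_axis_bound_degree[OF bound] degH unfolding H_def by simp
  define X where "X = Polynomial.smult (of_real (c\<^sup>2)) (H * adjoint H) - p * adjoint p"
  have X_axis: "poly X (\<i> * of_real \<omega>) = of_real ((c * cmod (poly H (\<i> * of_real \<omega>)))\<^sup>2
      - (cmod (poly p (\<i> * of_real \<omega>)))\<^sup>2)" for \<omega>
    unfolding X_def power_mult_distrib of_real_diff of_real_mult[of "c\<^sup>2"]
    by (simp only: complex_norm_square) (simp add: poly_adjoint_imag)
  have "poly X (\<i> * of_real \<omega>) \<in> \<real>\<^sub>\<ge>\<^sub>0" for \<omega>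
    unfolding X_axis nonneg_Reals_of_real_iff
    using power_mono[OF bound[of \<omega>] norm_ge_zero, of 2] by (simp add: H_def)
  then obtain W where W: "X = W * adjoint W" using spectral_factorization by blast
  have "cmod (poly W (\<i> * of_real \<omega>)) \<le> c * cmod (poly H (\<i> * of_real \<omega>))" for \<omega>
  proof (rule power2_le_imp_le)
    have "complex_of_real ((cmod (poly W (\<i> * of_real \<omega>)))\<^sup>2) = poly X (\<i> * of_real \<omega>)"
      unfolding W by (simp only: complex_norm_square) (simp add: poly_adjoint_imag)
    then show "(cmod (poly W (\<i> * of_real \<omega>)))\<^sup>2 \<le> (c * cmod (poly H (\<i> * of_real \<omega>)))\<^sup>2"
      unfolding X_axis of_real_eq_iff by simp
  qed (use c in simp)
  then have degW: "degree W \<le> m" using imag_axis_bound_degree degH by metis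
  have degadj: "degree (adjoint q) \<le> m" if "degree q \<le> m" for q
    using that by (intro degree_le) (auto simp: coeff_adjoint coeff_eq_0)

  have IRf: "Int0 (\<lambda>t. (cmod (f t))\<^sup>2) R \<le> Int0 (\<lambda>t. (cmod (f t))\<^sup>2) T" if "0 \<le> R" for R
  proof (cases "R \<le> T")
    case True
    then show ?thesis using that by (intro Int0_mono cont_norm_sq f) auto
  next
    case False
    then have "Int0 (\<lambda>t. (cmod (f t))\<^sup>2) R = Int0 (\<lambda>t. (cmod (f t))\<^sup>2) T + integral {T..R} (\<lambda>t. (cmod (f t))\<^sup>2)"
      using supp(1) by (intro Int0_split cont_norm_sq f) auto
    also have "integral {T..R} (\<lambda>t. (cmod (f t))\<^sup>2) = integral {T..R} (\<lambda>t. 0)"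
      using supp(2) by (intro integral_cong) auto
    finally show ?thesis by simp
  qed
  then have sqb: "square_bounded f" unfolding square_bounded_def using f by blast

  define P where "P a = proper_response rs (monom 1 a) f" for a
  have cP: "continuous_on {0..} (P a)" for a unfolding P_def by (rule proper_response_continuous[OF f])
  define I where "I R a b = Int0 (\<lambda>t. P a t * cnj (P b t)) R" for R a b
  have int: "((\<lambda>t. P a t * cnj (P b t)) has_integral I R a b) {0..R}" for R a b
    unfolding I_def by (intro integrable_integral integrable_half_line continuous_on_mult continuous_on_cnj cP order.refl)
  \<comment> \<open>The sum is the integral of the derivative of P a times the conjugate of P b, a
    product that is 0 at time 0 and vanishes at infinity as both orders are below m.\<close>
  have lim: "((\<lambda>R. I R (Suc a) b + I R a (Suc b)) \<longlongrightarrow> 0) at_top" if "a < m" "b < m" for a b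
  proof -
    have deg: "degree (monom 1 k :: complex poly) < length rs \<or> monom 1 k = (0 :: complex poly)" if "k < m" for k
      using that by (simp add: degree_monom_eq m_def)
    have Pd: "(P k has_vector_derivative P (Suc k) t) (at t)" if "k < m" "0 < t" for k t
      using proper_response_deriv[OF f that(2) deg[OF that(1)]] unfolding P_def by (simp add: monom_Suc)
    have P0: "P k 0 = 0" if "k < m" for k
      unfolding P_def by (rule proper_response_at_0[OF deg[OF that]])
    have Pinf: "(P k \<longlongrightarrow> 0) at_top" if "k < m" for k
      unfolding P_def by (rule proper_response_vanishes[OF sqb rs deg[OF that]])
    have eq: "I R (Suc a) b + I R a (Suc b) = P a R * cnj (P b R)" if R: "0 \<le> R" for R
    proof -
      have "((\<lambda>t. P a t * cnj (P (Suc b) t) + P (Suc a) t * cnj (P b t)) has_integral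
         P a R * cnj (P b R) - P a 0 * cnj (P b 0)) {0..R}"
      proof (rule fundamental_theorem_of_calculus_interior[OF R])
        show "continuous_on {0..R} (\<lambda>t. P a t * cnj (P b t))"
          by (intro continuous_on_mult continuous_on_cnj continuous_on_subset[OF cP]) auto
        show "((\<lambda>t. P a t * cnj (P b t)) has_vector_derivative
            P a t * cnj (P (Suc b) t) + P (Suc a) t * cnj (P b t)) (at t)" if "t \<in> {0<..<R}" for t
          using that \<open>a < m\<close> \<open>b < m\<close> by (intro has_vector_derivative_mult has_vector_derivative_cnj Pd) auto
      qed
      then have "P a R * cnj (P b R) = I R a (Suc b) + I R (Suc a) b"
        using has_integral_add[OF int[of a "Suc b" R] int[of "Suc a" b R]] P0[OF \<open>a < m\<close>]
        by (auto dest: has_integral_unique)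
      then show ?thesis by simp
    qed
    have "((\<lambda>R. P a R * cnj (P b R)) \<longlongrightarrow> 0 * cnj 0) at_top"
      by (intro tendsto_mult tendsto_cnj Pinf that)
    then have "((\<lambda>R. P a R * cnj (P b R)) \<longlongrightarrow> 0) at_top" by simp
    then show ?thesis
      by (rule Lim_transform_eventually) (auto simp: eq eventually_at_top_linorder intro!: exI[of _ 0])
  qed

  \<comment> \<open>Integration by parts trades \<open>I R (Suc a) b\<close> for minus
    \<open>I R a (Suc b)\<close>; with the sign (-1)^b the value depends in the limit on a + b only.
    \<open>K\<close> fixes one representative of each sum n up to 2 m with both indices at most
    m.\<close>
  define s where "s R a b = (-1) ^ b * I R a b" for R a b
  define K where "K R n = s R (min n m) (n - min n m)" for R n
  have close: "((\<lambda>R. s R a b - K R (a + b)) \<longlongrightarrow> 0) at_top" if "a \<le> m" "b \<le> m" for a b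
    using that
  proof (induction "m - a" arbitrary: a b)
    case 0
    then have "a = m" by simp
    then show ?case by (simp add: K_def)
  next
    case (Suc k)
    show ?case
    proof (cases b)
      case 0
      then show ?thesis using Suc.prems by (simp add: K_def)
    next
      case (Suc b')
      have "((\<lambda>R. (-1) ^ b * (I R (Suc a) b' + I R a (Suc b'))) \<longlongrightarrow> (-1) ^ b * 0) at_top"
        using Suc Suc.prems \<open>Suc k = m - a\<close> by (intro tendsto_mult tendsto_const lim) auto
      then have 1: "((\<lambda>R. s R a b - s R (Suc a) b') \<longlongrightarrow> 0) at_top"
        unfolding s_def Suc by (simp add: algebra_simps)
      have 2: "((\<lambda>R. s R (Suc a) b' - K R (Suc a + b')) \<longlongrightarrow> 0) at_top"
        using Suc Suc.prems \<open>Suc k = m - a\<close> by (intro Suc.hyps(1)) auto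
      show ?thesis using tendsto_add[OF 1 2] by (simp add: Suc)
    qed
  qed

  define E where "E q R = Int0 (\<lambda>t. (cmod (proper_response rs q f t))\<^sup>2) R" for q R
  \<comment> \<open>\<Psi> is linear in the polynomial x, so the factorization of X becomes a
    relation between limits of energies.\<close>
  define \<Psi> where "\<Psi> x R = (\<Sum>n\<le>2*m. coeff x n * K R n)" for x R
  have E_lim: "((\<lambda>R. of_real (E q R) - \<Psi> (q * adjoint q) R) \<longlongrightarrow> 0) at_top" if q: "degree q \<le> m" for q
  proof -
    have Eq: "of_real (E q R) = (\<Sum>a\<le>m. \<Sum>b\<le>m. coeff q a * coeff (adjoint q) b * s R a b)" for R
    proof -
      have "of_real (E q R) = Int0 (\<lambda>t. proper_response rs q f t * cnj (proper_response rs q f t)) R"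
        unfolding E_def by (rule Int0_norm_sq[symmetric, OF proper_response_continuous[OF f]])
      also have "\<dots> = Int0 (\<lambda>t. \<Sum>a\<le>m. \<Sum>b\<le>m. coeff q a * cnj (coeff q b) * (P a t * cnj (P b t))) R"
        unfolding proper_response_monom_expand[OF q] P_def[symmetric]
        by (simp add: sum_product mult_ac)
      also have "\<dots> = (\<Sum>a\<le>m. \<Sum>b\<le>m. coeff q a * cnj (coeff q b) * I R a b)"
        by (intro integral_unique has_integral_sum has_integral_mult_right int finite_atMost)
      also have "\<dots> = (\<Sum>a\<le>m. \<Sum>b\<le>m. coeff q a * coeff (adjoint q) b * s R a b)"
      proof (intro sum.cong refl)
        fix a b
        have "(-1) ^ b * (-1) ^ b = (1 :: complex)" by (simp flip: power_add add: mult_2[symmetric])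
        then have "coeff q a * cnj (coeff q b) * I R a b = coeff q a * cnj (coeff q b) * I R a b * ((-1) ^ b * (-1) ^ b)"
          by simp
        then show "coeff q a * cnj (coeff q b) * I R a b = coeff q a * coeff (adjoint q) b * s R a b"
          by (simp only: s_def coeff_adjoint mult_ac)
      qed
      finally show ?thesis .
    qed
    have lim1: "((\<lambda>R. \<Sum>a\<le>m. \<Sum>b\<le>m. coeff q a * coeff (adjoint q) b * (s R a b - K R (a + b))) \<longlongrightarrow>
        (\<Sum>a\<le>m. \<Sum>b\<le>m. coeff q a * coeff (adjoint q) b * 0)) at_top"
      by (intro tendsto_sum tendsto_mult tendsto_const close) auto
    have eq1: "(\<Sum>a\<le>m. \<Sum>b\<le>m. coeff q a * coeff (adjoint q) b * (s R a b - K R (a + b)))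
        = of_real (E q R) - \<Psi> (q * adjoint q) R" for R
      unfolding Eq \<Psi>_def coeff_mult_sum[OF q degadj[OF q], symmetric]
      by (simp add: right_diff_distrib sum_subtractf)
    show ?thesis using lim1 unfolding eq1 by simp
  qed
  have lim2: "((\<lambda>R. of_real (c\<^sup>2) * (of_real (E H R) - \<Psi> (H * adjoint H) R) - (of_real (E p R) - \<Psi> (p * adjoint p) R)
       - (of_real (E W R) - \<Psi> (W * adjoint W) R)) \<longlongrightarrow> of_real (c\<^sup>2) * 0 - 0 - 0) at_top"
    by (intro tendsto_diff tendsto_mult tendsto_const E_lim) (use degH degp degW in auto)
  have eq2: "of_real (c\<^sup>2) * (of_real (E H R) - \<Psi> (H * adjoint H) R) - (of_real (E p R) - \<Psi> (p * adjoint p) R)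
       - (of_real (E W R) - \<Psi> (W * adjoint W) R) = complex_of_real (c\<^sup>2 * E H R - E p R - E W R)" for R
  proof -
    have "\<Psi> (W * adjoint W) R = of_real (c\<^sup>2) * \<Psi> (H * adjoint H) R - \<Psi> (p * adjoint p) R"
      unfolding W[symmetric] X_def \<Psi>_def
      by (simp add: left_diff_distrib sum_subtractf sum_distrib_left mult.assoc)
    then show ?thesis by (simp add: algebra_simps)
  qed
  have "((\<lambda>R. complex_of_real (c\<^sup>2 * E H R - E p R - E W R)) \<longlongrightarrow> of_real 0) at_top"
    using lim2 unfolding eq2 by (simp only: mult_zero_right diff_self of_real_0)
  then have lim0: "((\<lambda>R. c\<^sup>2 * E H R - E p R - E W R) \<longlongrightarrow> 0) at_top"
    by (simp only: tendsto_of_real_iff)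
  have EH: "E H R = Int0 (\<lambda>t. (cmod (f t))\<^sup>2) R" for R
    unfolding E_def H_def by (simp add: proper_response_prod)
  \<comment> \<open>The energies of p and W do not decrease in R and that of W is nonnegative, so
    the relation in the limit gives an inequality at the finite time R0.\<close>
  have "0 \<le> c\<^sup>2 * Int0 (\<lambda>t. (cmod (f t))\<^sup>2) T - E p R0"
  proof (rule tendsto_upperbound[OF lim0])
    show "\<forall>\<^sub>F R in at_top. c\<^sup>2 * E H R - E p R - E W R \<le> c\<^sup>2 * Int0 (\<lambda>t. (cmod (f t))\<^sup>2) T - E p R0"
    proof (rule eventually_mono[OF eventually_ge_at_top[of R0]])
      fix R assume R: "R0 \<le> R"
      have "c\<^sup>2 * E H R \<le> c\<^sup>2 * Int0 (\<lambda>t. (cmod (f t))\<^sup>2) T"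
        unfolding EH using R R0 by (intro mult_left_mono IRf) auto
      moreover have "E p R0 \<le> E p R"
        unfolding E_def using R R0 by (intro Int0_mono cont_norm_sq proper_response_continuous f) auto
      moreover have "0 \<le> E W R"
        unfolding E_def by (intro integral_nonneg integrable_half_line cont_norm_sq proper_response_continuous f) auto
      ultimately show "c\<^sup>2 * E H R - E p R - E W R \<le> c\<^sup>2 * Int0 (\<lambda>t. (cmod (f t))\<^sup>2) T - E p R0"
        by linarith
    qed
  qed simp
  then show ?thesis by (simp add: E_def)
qed

text \<open>The compactly supported case is applied to f continued beyond T by a short ramp to 0.
  Causality leaves the response up to T unchanged, and the ramp adds at most \<epsilon> |f T|^2 to
  the input energy.\<close>

lemma proper_response_gain:
  assumes f: "continuous_on {0..} f" and T: "0 \<le> T"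
    and rs: "\<forall>r\<in>set rs. Re r < 0"
    and bound: "\<And>\<omega>::real. cmod (poly p (\<i> * of_real \<omega>)) \<le> c * cmod (poly (\<Prod>r\<leftarrow>rs. [:-r, 1:]) (\<i> * of_real \<omega>))"
    and c: "0 \<le> c"
  shows "Int0 (\<lambda>t. (cmod (proper_response rs p f t))\<^sup>2) T \<le> c\<^sup>2 * Int0 (\<lambda>t. (cmod (f t))\<^sup>2) T"
proof (rule field_le_epsilon)
  fix e :: real assume e: "0 < e"
  \<comment> \<open>Dividing e by k keeps the contribution of the ramp below e; the summand 1 makes
    k positive.\<close>
  define k where "k = c\<^sup>2 * (cmod (f T))\<^sup>2 + 1"
  have k: "0 < k" unfolding k_def by (simp add: add_nonneg_pos)
  define \<epsilon> where "\<epsilon> = e / k"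
  have \<epsilon>: "0 < \<epsilon>" using e k by (simp add: \<epsilon>_def)
  define \<rho> where "\<rho> t = max 0 (min 1 (1 - (t - T) / \<epsilon>))" for t
  define g where "g t = of_real (\<rho> t) * f (min t T)" for t
  have \<rho>: "0 \<le> \<rho> t" "\<rho> t \<le> 1" for t unfolding \<rho>_def by auto
  have \<rho>1: "\<rho> t = 1" if "t \<le> T" for t
    using that \<epsilon> by (simp add: \<rho>_def min_def divide_nonpos_pos)
  have \<rho>0: "\<rho> t = 0" if "T + \<epsilon> \<le> t" for t
    using that \<epsilon> by (simp add: \<rho>_def max_def min_def field_simps)
  have cg: "continuous_on {0..} g"
    unfolding g_def \<rho>_def using T \<epsilon>
    by (intro continuous_intros continuous_on_compose2[OF f]) auto
  have gf: "g t = f t" if "t \<le> T" for t using that \<rho>1 by (simp add: g_def)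
  have "Int0 (\<lambda>t. (cmod (proper_response rs p f t))\<^sup>2) T = Int0 (\<lambda>t. (cmod (proper_response rs p g t))\<^sup>2) T"
  proof (rule integral_cong)
    fix t assume "t \<in> {0..T}"
    then have "proper_response rs p f t = proper_response rs p g t"
      using gf by (intro proper_response_cong[of T]) auto
    then show "(cmod (proper_response rs p f t))\<^sup>2 = (cmod (proper_response rs p g t))\<^sup>2" by simp
  qed
  also have "\<dots> \<le> c\<^sup>2 * Int0 (\<lambda>t. (cmod (g t))\<^sup>2) (T + \<epsilon>)"
    by (rule proper_response_gain_compact[OF cg _ _ rs bound c T]) (use T \<epsilon> \<rho>0 in \<open>auto simp: g_def\<close>)
  also have "Int0 (\<lambda>t. (cmod (g t))\<^sup>2) (T + \<epsilon>) = Int0 (\<lambda>t. (cmod (g t))\<^sup>2) T + integral {T..T+\<epsilon>} (\<lambda>t. (cmod (g t))\<^sup>2)"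
    using T \<epsilon> by (intro Int0_split cont_norm_sq cg) auto
  also have "Int0 (\<lambda>t. (cmod (g t))\<^sup>2) T = Int0 (\<lambda>t. (cmod (f t))\<^sup>2) T"
    using gf by (intro integral_cong) auto
  also have "integral {T..T+\<epsilon>} (\<lambda>t. (cmod (g t))\<^sup>2) \<le> integral {T..T+\<epsilon>} (\<lambda>t. (cmod (f T))\<^sup>2)"
  proof (rule integral_le)
    show "(\<lambda>t. (cmod (g t))\<^sup>2) integrable_on {T..T+\<epsilon>}"
      by (rule integrable_half_line[OF cont_norm_sq[OF cg] T])
    fix t assume "t \<in> {T..T+\<epsilon>}"
    then have "cmod (g t) \<le> 1 * cmod (f T)"
      unfolding g_def norm_mult using \<rho>[of t] by (intro mult_mono) (auto simp: min_def)
    then show "(cmod (g t))\<^sup>2 \<le> (cmod (f T))\<^sup>2" by (simp add: power_mono)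
  qed (rule integrable_const_ivl)
  also have "integral {T..T+\<epsilon>} (\<lambda>t. (cmod (f T))\<^sup>2) = \<epsilon> * (cmod (f T))\<^sup>2" using \<epsilon> by simp
  finally have "Int0 (\<lambda>t. (cmod (proper_response rs p f t))\<^sup>2) T
      \<le> c\<^sup>2 * (Int0 (\<lambda>t. (cmod (f t))\<^sup>2) T + \<epsilon> * (cmod (f T))\<^sup>2)"
    by (simp add: mult_left_mono)
  also have "\<dots> = c\<^sup>2 * Int0 (\<lambda>t. (cmod (f t))\<^sup>2) T + \<epsilon> * (c\<^sup>2 * (cmod (f T))\<^sup>2)"
    by (simp add: algebra_simps)
  also have "\<epsilon> * (c\<^sup>2 * (cmod (f T))\<^sup>2) \<le> \<epsilon> * k" using \<epsilon> by (intro mult_left_mono) (auto simp: k_def)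
  also have "\<epsilon> * k = e" using k by (simp add: \<epsilon>_def)
  finally show "Int0 (\<lambda>t. (cmod (proper_response rs p f t))\<^sup>2) T \<le> c\<^sup>2 * Int0 (\<lambda>t. (cmod (f t))\<^sup>2) T + e"
    by simp
qed

text \<open>Difference analogue of the product of the factors D - r: f(t + 1) - e^r f(t) kills exp(r
  t) and makes sense for merely continuous f.\<close>

fun shift_diff :: "complex list \<Rightarrow> (real \<Rightarrow> complex) \<Rightarrow> real \<Rightarrow> complex" where
  "shift_diff [] f = f"
| "shift_diff (r # rs) f = shift_diff rs (\<lambda>t. f (t + 1) - exp r * f t)"

lemma continuous_shift:
  fixes f :: "real \<Rightarrow> complex"
  assumes f: "continuous_on {0..} f"
  shows "continuous_on {0..} (\<lambda>t. f (t + 1) - c * f t)"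
proof -
  have "continuous_on {0..} (\<lambda>t. f (t + 1))"
    by (rule continuous_on_compose2[OF f]) (auto intro!: continuous_intros)
  then show ?thesis by (intro continuous_on_diff continuous_on_mult continuous_on_const f)
qed

lemma shift_diff_continuous: "continuous_on {0..} f \<Longrightarrow> continuous_on {0..} (shift_diff rs f)"
  by (induction rs arbitrary: f) (auto simp: continuous_shift)

text \<open>A factor gives |f(t + 1)| <= \<rho> |f t| + C1 exp(- \<mu> t) with \<rho> < exp(-
  \<mu>). The strict gap preserves the rate \<mu> from factor to factor, also at repeated
  roots.\<close>

lemma shift_diff_decay:
  assumes "continuous_on {0..} f" "\<And>t. 0 < t \<Longrightarrow> shift_diff rs f t = 0" "\<forall>r\<in>set rs. Re r < - \<mu>" "0 < \<mu>"
  shows "\<exists>C\<ge>0. \<forall>t\<ge>0. cmod (f t) \<le> C * exp (- \<mu> * t)"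
  using assms(1-3)
proof (induction rs arbitrary: f)
  case Nil
  have "cmod (f t) \<le> cmod (f 0) * exp (- \<mu> * t)" if "0 \<le> t" for t
    using Nil(2)[of t] that by (cases "t = 0") auto
  then show ?case by (intro exI[of _ "cmod (f 0)"]) auto
next
  case (Cons r rs)
  define f1 where "f1 t = f (t + 1) - exp r * f t" for t
  have "\<exists>C\<ge>0. \<forall>t\<ge>0. cmod (f1 t) \<le> C * exp (- \<mu> * t)"
    using Cons.prems continuous_shift[OF Cons.prems(1)] by (intro Cons.IH) (auto simp: f1_def[abs_def])
  then obtain C1 where C1: "0 \<le> C1" "\<And>t. 0 \<le> t \<Longrightarrow> cmod (f1 t) \<le> C1 * exp (- \<mu> * t)" by auto
  have "compact (f ` {0..1})"
    using Cons.prems(1) by (intro compact_continuous_image) (auto intro: continuous_on_subset)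
  then obtain B where B: "\<And>t. 0 \<le> t \<Longrightarrow> t \<le> 1 \<Longrightarrow> cmod (f t) \<le> B"
    using compact_imp_bounded bounded_iff by (metis atLeastAtMost_iff image_eqI)
  have B0: "0 \<le> B" using B[of 0] norm_ge_zero[of "f 0"] by linarith
  define \<rho> where "\<rho> = cmod (exp r)"
  have \<rho>: "\<rho> < exp (- \<mu>)" using Cons.prems(3) by (simp add: \<rho>_def)
  \<comment> \<open>The first term covers the initial unit interval, the second gives \<rho> C + C1
    <= C exp(- \<mu>), which closes the induction over unit intervals.\<close>
  define C where "C = max (B * exp \<mu>) (C1 / (exp (- \<mu>) - \<rho>))"
  have C0: "0 \<le> C" using B0 by (simp add: C_def max.coboundedI1)
  have C: "\<rho> * C + C1 \<le> C * exp (- \<mu>)"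
  proof -
    have "C1 / (exp (- \<mu>) - \<rho>) \<le> C" by (simp add: C_def)
    then have "C1 \<le> C * (exp (- \<mu>) - \<rho>)" using \<rho> by (simp add: pos_divide_le_eq)
    then show ?thesis by (simp add: algebra_simps)
  qed
  have small: "cmod (f t) \<le> C * exp (- \<mu> * t)" if "0 \<le> t" "t \<le> 1" for t
  proof -
    have "cmod (f t) \<le> B * exp \<mu> * exp (- \<mu>)" using B[OF that] by (simp add: mult.assoc flip: exp_add)
    also have "\<dots> \<le> C * exp (- \<mu> * t)"
      using that \<open>0 < \<mu>\<close> C0 by (intro mult_mono) (auto simp: C_def mult_left_le)
    finally show ?thesis .
  qed
  have "cmod (f t) \<le> C * exp (- \<mu> * t)" if "0 \<le> t" "t \<le> real n + 1" for n t
    using that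
  proof (induction n arbitrary: t)
    case (Suc n)
    show ?case
    proof (cases "t \<le> 1")
      case False
      define u where "u = t - 1"
      have u: "t = u + 1" "0 \<le> u" "u \<le> real n + 1" using False Suc.prems by (auto simp: u_def)
      have "f t = exp r * f u + f1 u" by (simp add: u(1) f1_def)
      then have "cmod (f t) \<le> \<rho> * cmod (f u) + cmod (f1 u)"
        using norm_triangle_ineq[of "exp r * f u" "f1 u"] by (simp add: norm_mult \<rho>_def)
      also have "\<dots> \<le> \<rho> * (C * exp (- \<mu> * u)) + C1 * exp (- \<mu> * u)"
        using Suc.IH[OF u(2,3)] C1(2)[OF u(2)] by (intro add_mono mult_left_mono) (auto simp: \<rho>_def)
      also have "\<dots> = (\<rho> * C + C1) * exp (- \<mu> * u)" by (simp add: algebra_simps)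
      also have "\<dots> \<le> C * exp (- \<mu>) * exp (- \<mu> * u)" using C by (intro mult_right_mono) auto
      also have "\<dots> = C * exp (- \<mu> * t)" by (simp add: u(1) mult.assoc algebra_simps flip: exp_add)
      finally show ?thesis .
    qed (use small Suc in auto)
  qed (use small in auto)
  then have "cmod (f t) \<le> C * exp (- \<mu> * t)" if "0 \<le> t" for t
    using that real_arch_simple[of t] by (metis add.commute add_increasing zero_le_one)
  with C0 show ?case by blast
qed

lemma exp_bound_square_bounded:
  assumes f: "continuous_on {0..} f" and bound: "\<And>t. 0 \<le> t \<Longrightarrow> cmod (f t) \<le> C * exp (- \<mu> * t)"
    and \<mu>: "0 < \<mu>" and C: "0 \<le> C"
  shows "square_bounded f" "(f \<longlongrightarrow> 0) at_top"
proof -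
  have "Int0 (\<lambda>s. (cmod (f s))\<^sup>2) t \<le> C\<^sup>2 / (2 * \<mu>)" if t: "0 \<le> t" for t
  proof -
    have I: "((\<lambda>s. C\<^sup>2 * exp (- 2 * \<mu> * s)) has_integral (- C\<^sup>2 / (2 * \<mu>) * exp (- 2 * \<mu> * t))
        - (- C\<^sup>2 / (2 * \<mu>) * exp (- 2 * \<mu> * 0))) {0..t}"
      using \<mu> by (intro fundamental_theorem_of_calculus t)
        (auto intro!: derivative_eq_intros simp: has_real_derivative_iff_has_vector_derivative[symmetric] field_simps)
    have "Int0 (\<lambda>s. (cmod (f s))\<^sup>2) t \<le> Int0 (\<lambda>s. C\<^sup>2 * exp (- 2 * \<mu> * s)) t"
    proof (rule integral_le)
      show "(\<lambda>s. (cmod (f s))\<^sup>2) integrable_on {0..t}"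
        by (intro integrable_half_line cont_norm_sq f order.refl)
      show "(\<lambda>s. C\<^sup>2 * exp (- 2 * \<mu> * s)) integrable_on {0..t}" using I by blast
      fix s assume "s \<in> {0..t}"
      then have "(cmod (f s))\<^sup>2 \<le> (C * exp (- \<mu> * s))\<^sup>2" using bound by (intro power_mono) auto
      then show "(cmod (f s))\<^sup>2 \<le> C\<^sup>2 * exp (- 2 * \<mu> * s)"
        by (simp add: power_mult_distrib algebra_simps flip: exp_double)
    qed
    also have "\<dots> = C\<^sup>2 / (2 * \<mu>) - C\<^sup>2 / (2 * \<mu>) * exp (- 2 * \<mu> * t)"
      using integral_unique[OF I] by simp
    also have "\<dots> \<le> C\<^sup>2 / (2 * \<mu>)" using \<mu> by simp
    finally show ?thesis .
  qed
  then show "square_bounded f" unfolding square_bounded_def using f by blast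
  have "((\<lambda>t. exp (- \<mu> * t)) \<longlongrightarrow> 0) at_top"
    using \<mu> by real_asymp
  then have "((\<lambda>t. C * exp (- \<mu> * t)) \<longlongrightarrow> 0) at_top" by (rule tendsto_mult_right_zero)
  then show "(f \<longlongrightarrow> 0) at_top"
    by (rule Lim_null_comparison[rotated]) (use bound in \<open>auto simp: eventually_at_top_linorder\<close>)
qed

subsection \<open>Smooth signals as a module over polynomials\<close>

text \<open>A chain of successive derivatives on the open half line; the behaviour at 0 is left
  free.\<close>

definition smooth :: "(real \<Rightarrow> complex) \<Rightarrow> bool" where
  "smooth f \<longleftrightarrow> (\<exists>F. F 0 = f \<and> (\<forall>k. \<forall>t>0. (F k has_vector_derivative F (Suc k) t) (at t)))"

text \<open>Dependent choice builds the chain of derivatives from a class closed under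
  differentiation, so higher derivatives need not be written down.\<close>

lemma smooth_coinduct:
  assumes "S f" and step: "\<And>f. S f \<Longrightarrow> \<exists>g. S g \<and> (\<forall>t>0. (f has_vector_derivative g t) (at t))"
  shows "smooth f"
proof -
  have "\<exists>F. \<forall>n. (S (F n) \<and> (n = 0 \<longrightarrow> F n = f)) \<and> (\<forall>t>0. (F n has_vector_derivative F (Suc n) t) (at t))"
  proof (rule dependent_nat_choice)
    show "\<exists>g. S g \<and> (0 = 0 \<longrightarrow> g = f)" using assms(1) by blast
    show "\<exists>h. (S h \<and> (Suc n = 0 \<longrightarrow> h = f)) \<and> (\<forall>t>0. (g has_vector_derivative h t) (at t))"
      if "S g \<and> (n = 0 \<longrightarrow> g = f)" for g n using step[of g] that by simp
  qed
  then obtain F where F: "\<forall>n. (S (F n) \<and> (n = 0 \<longrightarrow> F n = f)) \<and> (\<forall>t>0. (F n has_vector_derivative F (Suc n) t) (at t))"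
    by blast
  show ?thesis unfolding smooth_def by (rule exI[of _ F]) (use F in simp)
qed

lemma smooth_deriv:
  assumes "smooth f"
  shows "\<exists>g. smooth g \<and> (\<forall>t>0. (f has_vector_derivative g t) (at t))"
proof -
  from assms obtain F where F: "F 0 = f" "\<forall>k. \<forall>t>0. (F k has_vector_derivative F (Suc k) t) (at t)"
    unfolding smooth_def by blast
  have "smooth (F 1)" unfolding smooth_def
    by (rule exI[of _ "\<lambda>k. F (Suc k)"]) (use F in auto)
  moreover have "\<forall>t>0. (f has_vector_derivative F 1 t) (at t)" using F by (metis One_nat_def)
  ultimately show ?thesis by blast
qed

lemma has_vector_derivative_cong_pos:
  assumes "(f has_vector_derivative d) (at t)" "0 < t" "\<And>s. 0 < s \<Longrightarrow> f s = g s"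
  shows "(g has_vector_derivative d) (at t)"
  by (rule has_vector_derivative_transform_within_open[OF assms(1), of "{0<..}"]) (use assms in auto)

lemma smooth_cong:
  assumes "smooth f" "\<And>t. 0 < t \<Longrightarrow> f t = g t"
  shows "smooth g"
proof (rule smooth_coinduct[where S = "\<lambda>h. \<exists>f. smooth f \<and> (\<forall>t>0. f t = h t)"])
  fix h assume "\<exists>f. smooth f \<and> (\<forall>t>0. f t = h t)"
  then obtain f where f: "smooth f" "\<And>t. 0 < t \<Longrightarrow> f t = h t" by blast
  obtain g where "smooth g" "\<And>t. 0 < t \<Longrightarrow> (f has_vector_derivative g t) (at t)"
    using smooth_deriv[OF f(1)] by blast
  then show "\<exists>g. (\<exists>f. smooth f \<and> (\<forall>t>0. f t = g t)) \<and> (\<forall>t>0. (h has_vector_derivative g t) (at t))"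
    using has_vector_derivative_cong_pos f(2) by metis
qed (use assms in blast)

lemma smooth_const: "smooth (\<lambda>t. c)"
  by (rule smooth_coinduct[where S = "\<lambda>f. \<exists>c. f = (\<lambda>t. c)"]) (auto intro!: exI[of _ "\<lambda>t. 0"])

lemma smooth_add:
  assumes "smooth f" "smooth g"
  shows "smooth (\<lambda>t. f t + g t)"
proof (rule smooth_coinduct[where S = "\<lambda>h. \<exists>f g. smooth f \<and> smooth g \<and> h = (\<lambda>t. f t + g t)"])
  fix h assume "\<exists>f g. smooth f \<and> smooth g \<and> h = (\<lambda>t. f t + g t)"
  then obtain f g where h: "smooth f" "smooth g" "h = (\<lambda>t. f t + g t)" by blast
  obtain f' g' where d: "smooth f'" "smooth g'" "\<And>t. 0 < t \<Longrightarrow> (f has_vector_derivative f' t) (at t)"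
     "\<And>t. 0 < t \<Longrightarrow> (g has_vector_derivative g' t) (at t)"
    using smooth_deriv h(1,2) by metis
  show "\<exists>k. (\<exists>f g. smooth f \<and> smooth g \<and> k = (\<lambda>t. f t + g t)) \<and> (\<forall>t>0. (h has_vector_derivative k t) (at t))"
    by (rule exI[of _ "\<lambda>t. f' t + g' t"]) (use d h(3) in \<open>auto intro: has_vector_derivative_add\<close>)
qed (use assms in blast)

text \<open>Products are not closed under differentiation, finite sums of products are. The
  derivative of a sum of n products consists of 2 n products, indexed by concatenation.\<close>

lemma smooth_mult:
  assumes "smooth f" "smooth g"
  shows "smooth (\<lambda>t. f t * g t)"
proof -
  define S where "S = (\<lambda>h. \<exists>n. \<exists>f g. (\<forall>i<n. smooth (f i) \<and> smooth (g i)) \<and>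
      h = (\<lambda>t. \<Sum>i<(n::nat). f i t * (g i t :: complex)))"
  have step: "\<exists>k. S k \<and> (\<forall>t>0. (h has_vector_derivative k t) (at t))" if "S h" for h
  proof -
    from that obtain n :: nat and f g where "\<forall>i<n. smooth (f i) \<and> smooth (g i)"
      and h3: "h = (\<lambda>t. \<Sum>i<n. f i t * g i t)" unfolding S_def by metis
    then have h: "\<And>i. i < n \<Longrightarrow> smooth (f i)" "\<And>i. i < n \<Longrightarrow> smooth (g i)" by blast+
    have "\<forall>i\<in>{..<n}. \<exists>k. smooth k \<and> (\<forall>t>0. (f i has_vector_derivative k t) (at t))"
      using smooth_deriv h(1) by simp
    from bchoice[OF this] obtain f' where "\<forall>i\<in>{..<n}. smooth (f' i) \<and> (\<forall>t>0. (f i has_vector_derivative f' i t) (at t))"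
      by blast
    then have f': "\<And>i. i < n \<Longrightarrow> smooth (f' i)" "\<And>i t. i < n \<Longrightarrow> 0 < t \<Longrightarrow> (f i has_vector_derivative f' i t) (at t)"
      by auto
    have "\<forall>i\<in>{..<n}. \<exists>k. smooth k \<and> (\<forall>t>0. (g i has_vector_derivative k t) (at t))"
      using smooth_deriv h(2) by simp
    from bchoice[OF this] obtain g' where "\<forall>i\<in>{..<n}. smooth (g' i) \<and> (\<forall>t>0. (g i has_vector_derivative g' i t) (at t))"
      by blast
    then have g': "\<And>i. i < n \<Longrightarrow> smooth (g' i)" "\<And>i t. i < n \<Longrightarrow> 0 < t \<Longrightarrow> (g i has_vector_derivative g' i t) (at t)"
      by auto
    define F where "F i = (if i < n then f i else f' (i - n))" for i
    define G where "G i = (if i < n then g' i else g (i - n))" for i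
    have "(\<Sum>i<n+n. F i t * G i t) = (\<Sum>i<n. f i t * g' i t + f' i t * g i t)" for t
    proof -
      have "(\<Sum>i<n+n. F i t * G i t) = (\<Sum>i<n. F i t * G i t) + (\<Sum>i<n. F (i + n) t * G (i + n) t)"
        by (simp add: sum.nat_group[symmetric] lessThan_atLeast0 sum.atLeastLessThan_concat[of 0 n "n+n", symmetric]
            sum.shift_bounds_nat_ivl[of _ 0 n n, simplified])
      then show ?thesis by (simp add: F_def G_def sum.distrib)
    qed
    then have "S (\<lambda>t. \<Sum>i<n. f i t * g' i t + f' i t * g i t)"
      unfolding S_def using h f' g'
      by (intro exI[of _ "n + n"] exI[of _ F] exI[of _ G]) (auto simp: F_def G_def)
    moreover have "(h has_vector_derivative (\<Sum>i<n. f i t * g' i t + f' i t * g i t)) (at t)" if "0 < t" for t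
      unfolding h3 using f' g' that by (intro has_vector_derivative_sum has_vector_derivative_mult) auto
    ultimately show ?thesis by blast
  qed
  have "S (\<lambda>t. f t * g t)"
    unfolding S_def using assms
    by (intro exI[of _ 1] exI[of _ "\<lambda>_. f"] exI[of _ "\<lambda>_. g"]) auto
  then show ?thesis using step by (rule smooth_coinduct)
qed

lemma smooth_exp: "smooth (\<lambda>t. exp (r * of_real t))"
proof (rule smooth_coinduct[where S = "\<lambda>f. \<exists>c. f = (\<lambda>t. c * exp (r * of_real t))"])
  fix f assume "\<exists>c. f = (\<lambda>t. c * exp (r * of_real t))"
  then obtain c where c: "f = (\<lambda>t. c * exp (r * of_real t))" by blast
  show "\<exists>g. (\<exists>c. g = (\<lambda>t. c * exp (r * of_real t))) \<and> (\<forall>t>0. (f has_vector_derivative g t) (at t))"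
    unfolding c by (rule exI[of _ "\<lambda>t. c * r * exp (r * of_real t)"])
      (auto intro!: derivative_eq_intros has_vector_derivative_real_field)
qed (auto intro: exI[of _ 1])

lemma smooth_shift:
  assumes "smooth f"
  shows "smooth (\<lambda>t. f (t + 1))"
proof (rule smooth_coinduct[where S = "\<lambda>h. \<exists>f. smooth f \<and> h = (\<lambda>t. f (t + 1))"])
  fix h assume "\<exists>f. smooth f \<and> h = (\<lambda>t. f (t + 1))"
  then obtain f where f: "smooth f" "h = (\<lambda>t. f (t + 1))" by blast
  obtain g where g: "smooth g" "\<And>t. 0 < t \<Longrightarrow> (f has_vector_derivative g t) (at t)"
    using smooth_deriv[OF f(1)] by blast
  have "((\<lambda>t. f (t + 1)) has_vector_derivative g (t + 1)) (at t)" if "0 < t" for t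
  proof -
    have "((f \<circ> (\<lambda>t. t + 1)) has_vector_derivative 1 *\<^sub>R g (t + 1)) (at t)"
      using that by (intro vector_diff_chain_at g) (auto intro!: derivative_eq_intros)
    then show ?thesis by (simp add: o_def)
  qed
  then show "\<exists>k. (\<exists>f. smooth f \<and> k = (\<lambda>t. f (t + 1))) \<and> (\<forall>t>0. (h has_vector_derivative k t) (at t))"
    using g f by blast
qed (use assms in blast)

text \<open>Two smooth functions on the open half line are the same signal; the value \<open>0\<close> elsewhere makes
  equality of signals the equality of functions.\<close>

typedef signal = "{f :: real \<Rightarrow> complex. smooth f \<and> (\<forall>t\<le>0. f t = 0)}"
  morphisms val Abs_signal
proof
  show "(\<lambda>t. 0) \<in> {f :: real \<Rightarrow> complex. smooth f \<and> (\<forall>t\<le>0. f t = 0)}" by (simp add: smooth_const)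
qed

lemma smooth_val: "smooth (val f)" and val_nonpos: "t \<le> 0 \<Longrightarrow> val f t = 0"
  using val[of f] by auto

definition signal_of :: "(real \<Rightarrow> complex) \<Rightarrow> signal" where
  "signal_of f = Abs_signal (\<lambda>t. if 0 < t then f t else 0)"

lemma val_signal_of: "smooth f \<Longrightarrow> val (signal_of f) t = (if 0 < t then f t else 0)"
  unfolding signal_of_def by (subst Abs_signal_inverse) (auto intro: smooth_cong[of f])

lemma signal_eqI: "(\<And>t. 0 < t \<Longrightarrow> val f t = val g t) \<Longrightarrow> f = g"
  using val_nonpos by (metis val_inject ext not_le)

instantiation signal :: ab_group_add
begin
definition "0 = signal_of (\<lambda>t. 0)"
definition "f + g = signal_of (\<lambda>t. val f t + val g t)"
definition "- f = signal_of (\<lambda>t. (-1) * val f t)"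
definition "f - g = f + (- g :: signal)"

lemma val_0 [simp]: "val 0 t = 0"
  by (simp add: zero_signal_def val_signal_of smooth_const)

lemma val_add [simp]: "val (f + g) t = val f t + val g t"
  by (simp add: plus_signal_def val_signal_of smooth_add smooth_val val_nonpos)

lemma val_uminus [simp]: "val (- f) t = - val f t"
  using val_signal_of[OF smooth_mult[OF smooth_const[of "-1"] smooth_val[of f]], of t]
  by (simp add: uminus_signal_def val_nonpos)

lemma val_diff [simp]: "val (f - g) t = val f t - val g t"
  by (simp add: minus_signal_def)

instance by standard (rule signal_eqI; simp)+
end

lemma val_sum [simp]: "val (\<Sum>i\<in>I. f i) t = (\<Sum>i\<in>I. val (f i) t)"
  by (induction I rule: infinite_finite_induct) auto

definition scale :: "complex \<Rightarrow> signal \<Rightarrow> signal" where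
  "scale c f = signal_of (\<lambda>t. c * val f t)"

lemma val_scale [simp]: "val (scale c f) t = c * val f t"
  by (simp add: scale_def val_signal_of smooth_mult smooth_const smooth_val val_nonpos)

definition deriv_signal :: "signal \<Rightarrow> signal" where
  "deriv_signal f = signal_of (\<lambda>t. vector_derivative (val f) (at t))"

lemma val_deriv_signal:
  assumes "0 < t"
  shows "(val f has_vector_derivative val (deriv_signal f) t) (at t)"
proof -
  obtain g where g: "smooth g" "\<And>t. 0 < t \<Longrightarrow> (val f has_vector_derivative g t) (at t)"
    using smooth_deriv[OF smooth_val[of f]] by blast
  have eq: "vector_derivative (val f) (at t) = g t" if "0 < t" for t
    using g(2)[OF that] by (rule vector_derivative_at)
  have "smooth (\<lambda>t. vector_derivative (val f) (at t))" by (rule smooth_cong[OF g(1)]) (simp add: eq)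
  then show ?thesis unfolding deriv_signal_def using val_signal_of eq g(2) assms by simp
qed

lemma val_deriv_unique:
  assumes "0 < t" "(f has_vector_derivative d) (at t)" "\<And>s. 0 < s \<Longrightarrow> val F s = f s"
  shows "val (deriv_signal F) t = d"
proof -
  have "(f has_vector_derivative val (deriv_signal F) t) (at t)"
    using has_vector_derivative_cong_pos[OF val_deriv_signal[OF assms(1), of F] assms(1) assms(3)] .
  with assms(2) show ?thesis using vector_derivative_unique_at by blast
qed

lemma deriv_signal_add: "deriv_signal (f + g) = deriv_signal f + deriv_signal g"
proof (rule signal_eqI)
  fix t :: real assume t: "0 < t"
  show "val (deriv_signal (f + g)) t = val (deriv_signal f + deriv_signal g) t"
    unfolding val_add
    by (rule val_deriv_unique[OF t has_vector_derivative_add[OF val_deriv_signal[OF t] val_deriv_signal[OF t]]]) simp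
qed

lemma deriv_signal_scale: "deriv_signal (scale c f) = scale c (deriv_signal f)"
proof (rule signal_eqI)
  fix t :: real assume t: "0 < t"
  show "val (deriv_signal (scale c f)) t = val (scale c (deriv_signal f)) t"
    unfolding val_scale
    by (rule val_deriv_unique[OF t has_vector_derivative_mult_right[OF val_deriv_signal[OF t]]]) simp
qed

lemma scale_add: "scale c (f + g) = scale c f + scale c g" and scale_add_left: "scale (c + d) f = scale c f + scale d f"
  and scale_scale: "scale c (scale d f) = scale (c * d) f" and scale_one: "scale 1 f = f"
  and scale_zero: "scale 0 f = 0"
  by (auto intro!: signal_eqI simp: algebra_simps)

text \<open>Horner evaluation of p at the differentiation operator: the signal p(D) f.\<close>

definition act :: "complex poly \<Rightarrow> signal \<Rightarrow> signal" where
  "act p f = fold_coeffs (\<lambda>a h. scale a f + deriv_signal h) p 0"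

lemma deriv_signal_0: "deriv_signal 0 = 0"
  using deriv_signal_scale[of 0 0] by (simp add: scale_zero)

lemma act_0 [simp]: "act 0 f = 0"
  by (simp add: act_def)

lemma act_pCons: "act (pCons a p) f = scale a f + deriv_signal (act p f)"
proof (cases "a = 0 \<and> p = 0")
  case False
  then show ?thesis unfolding act_def by (cases "a = 0") auto
qed (simp add: deriv_signal_0 scale_zero)

lemma act_add_left: "act (p + q) f = act p f + act q f"
  by (induction p q rule: poly_induct2) (simp_all add: act_pCons deriv_signal_add scale_add_left)

lemma act_smult: "act (Polynomial.smult c p) f = scale c (act p f)"
  by (induction p) (auto simp: act_pCons deriv_signal_scale scale_add scale_scale intro: signal_eqI)

lemma act_add_right: "act p (f + g) = act p f + act p g"
  by (induction p) (simp_all add: act_pCons deriv_signal_add scale_add)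

lemma act_scale_right: "act p (scale c f) = scale c (act p f)"
  by (induction p) (auto simp: act_pCons deriv_signal_scale scale_add scale_scale mult.commute intro: signal_eqI)

lemma act_mult: "act (p * q) f = act p (act q f)"
  by (induction p) (simp_all add: act_pCons act_add_left act_smult scale_zero)

lemma act_const: "act [:c:] f = scale c f"
  by (simp add: act_pCons deriv_signal_0)

text \<open>With polynomials in D as scalars, the general module laws give distributivity over sums
  and differences.\<close>

interpretation signal: Modules.module act
proof
  show "act 1 f = f" for f by (simp add: one_pCons act_const scale_one)
qed (simp_all add: act_add_left act_add_right act_mult)

lemma act_commute: "act p (act q f) = act q (act p f)"
  by (metis act_mult mult.commute)

lemma act_linear: "act [:-r, 1:] f = deriv_signal f - scale r f"
  by (simp add: act_pCons deriv_signal_0 scale_one) (auto intro: signal_eqI)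

definition exp_signal :: "complex \<Rightarrow> signal" where
  "exp_signal r = signal_of (\<lambda>t. exp (r * of_real t))"

lemma val_exp_signal: "0 < t \<Longrightarrow> val (exp_signal r) t = exp (r * of_real t)"
  by (simp add: exp_signal_def val_signal_of smooth_exp)

lemma deriv_exp_signal: "deriv_signal (exp_signal r) = scale r (exp_signal r)"
proof (rule signal_eqI)
  fix t :: real assume t: "0 < t"
  have "((\<lambda>t. exp (r * of_real t)) has_vector_derivative r * exp (r * of_real t)) (at t)"
    by (auto intro!: derivative_eq_intros has_vector_derivative_real_field simp: mult.commute)
  then show "val (deriv_signal (exp_signal r)) t = val (scale r (exp_signal r)) t"
    using t by (subst val_deriv_unique) (auto simp: val_exp_signal)
qed

lemma act_exp_signal: "act p (exp_signal r) = scale (poly p r) (exp_signal r)"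
  by (induction p) (auto simp: act_pCons deriv_signal_scale deriv_exp_signal scale_scale scale_add_left[symmetric] scale_zero mult.commute)

section \<open>Kernels and solvability of differential operators\<close>

lemma kernel_linear:
  assumes "act [:-r, 1:] f = 0"
  obtains c where "f = scale c (exp_signal r)"
proof -
  have D: "val (deriv_signal f) t = r * val f t" for t
    using arg_cong[OF assms, of "\<lambda>g. val g t"] by (simp add: act_linear)
  define h where "h t = exp (- r * of_real t) * val f t" for t
  have "(h has_vector_derivative 0) (at t)" if "0 < t" for t
  proof -
    have 1: "((\<lambda>t. exp (- r * of_real t)) has_vector_derivative - r * exp (- r * of_real t)) (at t)"
      by (auto intro!: derivative_eq_intros has_vector_derivative_real_field simp: mult.commute)
    have "(h has_vector_derivative exp (- r * of_real t) * (r * val f t) + - r * exp (- r * of_real t) * val f t) (at t)"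
      unfolding h_def using has_vector_derivative_mult[OF 1 val_deriv_signal[OF that, of f]] by (simp add: D)
    then show ?thesis by (simp add: algebra_simps)
  qed
  then have d0: "(h has_vector_derivative 0) (at t within {0<..})" if "t \<in> {0<..}" for t
    by (rule has_vector_derivative_at_within) (use that in simp)
  obtain c where "\<And>t. t \<in> {0<..} \<Longrightarrow> h t = c"
    by (rule has_vector_derivative_zero_constant[OF convex_real_interval(3) d0]) auto
  then have c: "h t = c" if "0 < t" for t using that by simp
  have "f = scale c (exp_signal r)"
  proof (rule signal_eqI)
    fix t :: real assume t: "0 < t"
    have "val f t = exp (r * of_real t) * h t"
      unfolding h_def mult.assoc[symmetric] exp_add[symmetric] by simp
    then show "val f t = val (scale c (exp_signal r)) t" using c[OF t] t by (simp add: val_exp_signal)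
  qed
  then show ?thesis by (rule that)
qed

text \<open>A signal may be unbounded near 0, so the antiderivative is based at 1, with the sign
  reversed to the left of 1.\<close>

lemma antiderivative_pos:
  fixes g :: "real \<Rightarrow> complex"
  assumes "continuous_on {0<..} g"
  obtains G where "\<And>t. 0 < t \<Longrightarrow> (G has_vector_derivative g t) (at t)"
proof
  define G where "G t = (if 1 \<le> t then integral {1..t} g else - integral {t..1} g)" for t
  have int: "g integrable_on {a..b}" if "0 < a" for a b
    using that by (intro integrable_continuous_real continuous_on_subset[OF assms]) auto
  have G: "G t = integral {a..t} g - integral {a..1} g" if "0 < a" "a \<le> t" "a \<le> 1" for a t
  proof (cases "1 \<le> t")
    case True
    then show ?thesis
      using Henstock_Kurzweil_Integration.integral_combine[of a 1 t g] int that by (simp add: G_def algebra_simps)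
  next
    case False
    then show ?thesis
      using Henstock_Kurzweil_Integration.integral_combine[of a t 1 g] int that by (simp add: G_def algebra_simps)
  qed
  fix t :: real assume t: "0 < t"
  define a where "a = min t 1 / 2"
  have a: "0 < a" "a < t" "a < 1" using t by (auto simp: a_def)
  have "((\<lambda>u. integral {a..u} g) has_vector_derivative g t) (at t within {a..t+1})"
    using a by (intro integral_has_vector_derivative continuous_on_subset[OF assms]) auto
  then have "((\<lambda>u. integral {a..u} g) has_vector_derivative g t) (at t)"
    using a by (simp add: at_within_Icc_at)
  then have "((\<lambda>u. integral {a..u} g - integral {a..1} g) has_vector_derivative g t - 0) (at t)"
    by (intro has_vector_derivative_diff has_vector_derivative_const)
  then have "((\<lambda>u. integral {a..u} g - integral {a..1} g) has_vector_derivative g t) (at t)" by simp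
  then show "(G has_vector_derivative g t) (at t)"
    by (rule has_vector_derivative_transform_within_open[of _ _ _ "{a<..}"]) (use a G in auto)
qed

lemma val_continuous: "continuous_on {0<..} (val f)"
  using val_deriv_signal
  by (auto intro!: continuous_at_imp_continuous_on has_vector_derivative_continuous)

text \<open>Variation of constants solves one factor D - r at a time. Surjectivity allows dividing a
  port motion by the factor m that polynomial solutions of a circuit carry.\<close>

lemma act_surj:
  assumes "p \<noteq> 0"
  shows "\<exists>f. act p f = g"
proof -
  have lin: "\<exists>f. act [:-r, 1:] f = g" for r g
  proof -
    have "continuous_on {0<..} (\<lambda>t. exp (- r * of_real t) * val g t)"
      by (intro continuous_intros val_continuous)
    then obtain G where G: "\<And>t. 0 < t \<Longrightarrow> (G has_vector_derivative exp (- r * of_real t) * val g t) (at t)"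
      using antiderivative_pos by blast
    have "smooth (\<lambda>t. exp (- r * of_real t) * val g t)" by (intro smooth_mult smooth_exp smooth_val)
    then obtain F where F: "F 0 = (\<lambda>t. exp (- r * of_real t) * val g t)"
        "\<And>k t. 0 < t \<Longrightarrow> (F k has_vector_derivative F (Suc k) t) (at t)" unfolding smooth_def by blast
    have "smooth G" unfolding smooth_def
      by (rule exI[of _ "\<lambda>k. case k of 0 \<Rightarrow> G | Suc k \<Rightarrow> F k"]) (use G F in \<open>auto split: nat.split\<close>)
    then have s: "smooth (\<lambda>t. exp (r * of_real t) * G t)" by (intro smooth_mult smooth_exp)
    define f where "f = signal_of (\<lambda>t. exp (r * of_real t) * G t)"
    have "act [:-r, 1:] f = g"
    proof (rule signal_eqI)
      fix t :: real assume t: "0 < t"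
      have 1: "((\<lambda>t. exp (r * of_real t)) has_vector_derivative r * exp (r * of_real t)) (at t)"
        by (auto intro!: derivative_eq_intros has_vector_derivative_real_field simp: mult.commute)
      have "val (deriv_signal f) t = exp (r * of_real t) * (exp (- r * of_real t) * val g t) + r * exp (r * of_real t) * G t"
        by (rule val_deriv_unique[OF t has_vector_derivative_mult[OF 1 G[OF t]]]) (simp add: f_def val_signal_of s)
      also have "exp (r * of_real t) * (exp (- r * of_real t) * val g t) = val g t"
        unfolding mult.assoc[symmetric] exp_add[symmetric] by simp
      finally show "val (act [:-r, 1:] f) t = val g t"
        using t by (simp add: act_linear f_def val_signal_of s)
    qed
    then show ?thesis by blast
  qed
  obtain rs where rs: "Polynomial.smult (lead_coeff p) (\<Prod>r\<leftarrow>rs. [:-r, 1:]) = p"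
    using fundamental_theorem_algebra_factorized[of p] by blast
  have "\<exists>f. act (\<Prod>r\<leftarrow>rs. [:-r, 1:]) f = g" for g
  proof (induction rs arbitrary: g)
    case (Cons r rs)
    obtain h where "act [:-r, 1:] h = g" using lin by blast
    moreover obtain f where "act (\<Prod>r\<leftarrow>rs. [:-r, 1:]) f = h" using Cons by blast
    ultimately show ?case by (auto simp only: list.map prod_list.Cons act_mult)
  qed auto
  then obtain f where f: "act (\<Prod>r\<leftarrow>rs. [:-r, 1:]) f = scale (1 / lead_coeff p) g" by blast
  have "act p f = g"
    by (subst rs[symmetric]) (use assms in \<open>simp add: act_smult f scale_scale scale_one\<close>)
  then show ?thesis by blast
qed

definition shift_signal :: "signal \<Rightarrow> signal" where
  "shift_signal f = signal_of (\<lambda>t. val f (t + 1))"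

lemma val_shift_signal: "0 < t \<Longrightarrow> val (shift_signal f) t = val f (t + 1)"
  by (simp add: shift_signal_def val_signal_of smooth_shift smooth_val)

lemma deriv_shift_signal: "deriv_signal (shift_signal f) = shift_signal (deriv_signal f)"
proof (rule signal_eqI)
  fix t :: real assume t: "0 < t"
  have "((val f \<circ> (\<lambda>t. t + 1)) has_vector_derivative 1 *\<^sub>R val (deriv_signal f) (t + 1)) (at t)"
    using t by (intro vector_diff_chain_at val_deriv_signal) (auto intro!: derivative_eq_intros)
  then have "((\<lambda>t. val f (t + 1)) has_vector_derivative val (deriv_signal f) (t + 1)) (at t)"
    by (simp add: o_def)
  then show "val (deriv_signal (shift_signal f)) t = val (shift_signal (deriv_signal f)) t"
    using t by (subst val_deriv_unique[OF t]) (auto simp: val_shift_signal)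
qed

lemma shift_signal_add: "shift_signal (f + g) = shift_signal f + shift_signal g"
  and shift_signal_scale: "shift_signal (scale c f) = scale c (shift_signal f)"
  by (auto intro!: signal_eqI simp: val_shift_signal)

lemma act_shift_signal: "act p (shift_signal f) = shift_signal (act p f)"
proof (induction p)
  case 0
  show ?case by (auto intro!: signal_eqI simp: val_shift_signal)
qed (simp add: act_pCons deriv_shift_signal shift_signal_add shift_signal_scale)

subsection \<open>Mollification\<close>

text \<open>The functions p(1 / t) exp(- 1 / t), continued by 0, form a class closed under
  differentiation, and all of them are flat at 0.\<close>

definition flat :: "real poly \<Rightarrow> real \<Rightarrow> real" where
  "flat p t = (if 0 < t then poly p (1 / t) * exp (- (1 / t)) else 0)"

lemma poly_times_exp_neg_tendsto_0:
  fixes p :: "real poly"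
  shows "((\<lambda>x. poly p x * exp (- x)) \<longlongrightarrow> 0) at_top"
proof -
  have "((\<lambda>x::real. \<Sum>i\<le>degree p. coeff p i * (x ^ i / exp x)) \<longlongrightarrow> (\<Sum>i\<le>degree p. coeff p i * 0)) at_top"
    by (intro tendsto_sum tendsto_mult tendsto_const tendsto_power_div_exp_0)
  then show ?thesis
    by (simp add: poly_altdef sum_distrib_right exp_minus divide_inverse mult.assoc)
qed

text \<open>With x = 1 / t, d/dt is - x^2 d/dx, and differentiating p(x) exp(-x) gives x^2 (p -
  p').\<close>

definition flat_deriv :: "real poly \<Rightarrow> real poly" where
  "flat_deriv p = [:0, 0, 1:] * (p - pderiv p)"

lemma flat_has_derivative: "(flat p has_real_derivative flat (flat_deriv p) t) (at t)"
proof -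
  consider "t < 0" | "t = 0" | "0 < t" by linarith
  then show ?thesis
  proof cases
    case 1
    have "((\<lambda>t. 0) has_real_derivative 0) (at t)" by simp
    then have "(flat p has_real_derivative 0) (at t)"
      by (rule has_field_derivative_transform_within_open[of _ _ _ "{..<0}"]) (use 1 in \<open>auto simp: flat_def\<close>)
    then show ?thesis using 1 by (simp add: flat_def)
  next
    case 2
    have "((\<lambda>h. flat p h / h) \<longlongrightarrow> 0) (at_right 0)"
    proof -
      have "((\<lambda>x. poly (pCons 0 p) x * exp (- x)) \<longlongrightarrow> 0) at_top" by (rule poly_times_exp_neg_tendsto_0)
      then have "((\<lambda>h. poly (pCons 0 p) (inverse h) * exp (- inverse h)) \<longlongrightarrow> 0) (at_right 0)"
        by (rule filterlim_compose[OF _ filterlim_inverse_at_top_right])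
      then show ?thesis
        by (rule Lim_transform_eventually)
           (auto simp: eventually_at_filter flat_def divide_inverse mult_ac)
    qed
    moreover have "((\<lambda>h. flat p h / h) \<longlongrightarrow> 0) (at_left 0)"
      by (rule tendsto_eventually) (auto simp: eventually_at_filter flat_def)
    ultimately have "((\<lambda>h. flat p h / h) \<longlongrightarrow> 0) (at 0)"
      by (simp add: filterlim_at_split)
    then show ?thesis using 2 by (simp add: has_field_derivative_iff flat_def)
  next
    case 3
    have "((\<lambda>t. poly p (1 / t) * exp (- (1 / t))) has_real_derivative
        poly (pderiv p) (1 / t) * (- (1 / t\<^sup>2)) * exp (- (1 / t)) + poly p (1 / t) * (exp (- (1 / t)) * (1 / t\<^sup>2))) (at t)"
      using 3 by (auto intro!: derivative_eq_intros DERIV_chain2[OF poly_DERIV] simp: power2_eq_square field_simps)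
    also have "poly (pderiv p) (1 / t) * (- (1 / t\<^sup>2)) * exp (- (1 / t))
        + poly p (1 / t) * (exp (- (1 / t)) * (1 / t\<^sup>2)) = flat (flat_deriv p) t"
      using 3 by (simp add: flat_def flat_deriv_def power2_eq_square algebra_simps)
    finally show ?thesis
      by (rule has_field_derivative_transform_within_open[of _ _ _ "{0<..}"]) (use 3 in \<open>auto simp: flat_def\<close>)
  qed
qed

text \<open>Sums are included so that the product rule stays in the class; derivatives of mollified
  functions are then mollified by bumps with the same support.\<close>

inductive bump :: "real \<Rightarrow> (real \<Rightarrow> real) \<Rightarrow> bool" for \<epsilon> where
  "bump \<epsilon> (\<lambda>t. flat p t * flat q (\<epsilon> - t))"
| "bump \<epsilon> b \<Longrightarrow> bump \<epsilon> c \<Longrightarrow> bump \<epsilon> (\<lambda>t. b t + c t)"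

lemma bump_minus: "bump \<epsilon> b \<Longrightarrow> bump \<epsilon> (\<lambda>t. - b t)"
proof (induction rule: bump.induct)
  case (1 p q)
  have "(\<lambda>t. - (flat p t * flat q (\<epsilon> - t))) = (\<lambda>t. flat (- p) t * flat q (\<epsilon> - t))"
    by (auto simp: flat_def fun_eq_iff)
  then show ?case using bump.intros(1)[of \<epsilon> "- p" q] by simp
next
  case (2 b c)
  have "(\<lambda>t. - (b t + c t)) = (\<lambda>t. - b t + - c t)" by auto
  then show ?case using bump.intros(2)[OF 2(3,4)] by simp
qed

lemma bump_deriv: "bump \<epsilon> b \<Longrightarrow> \<exists>b'. bump \<epsilon> b' \<and> (\<forall>t. (b has_real_derivative b' t) (at t))"
proof (induction rule: bump.induct)
  case (1 p q)
  have "((\<lambda>t. flat p t * flat q (\<epsilon> - t)) has_real_derivative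
      flat (flat_deriv p) t * flat q (\<epsilon> - t) + - (flat p t * flat (flat_deriv q) (\<epsilon> - t))) (at t)" for t
  proof -
    have "((\<lambda>t. flat q (\<epsilon> - t)) has_real_derivative flat (flat_deriv q) (\<epsilon> - t) * (0 - 1)) (at t)"
      by (intro DERIV_chain2[OF flat_has_derivative] DERIV_diff DERIV_const DERIV_ident)
    from DERIV_mult[OF flat_has_derivative this] show ?thesis by (simp add: algebra_simps)
  qed
  moreover have "bump \<epsilon> (\<lambda>t. flat (flat_deriv p) t * flat q (\<epsilon> - t) + - (flat p t * flat (flat_deriv q) (\<epsilon> - t)))"
    by (intro bump.intros(2) bump.intros(1) bump_minus)
  ultimately show ?case by blast
next
  case (2 b c)
  then obtain b' c' where "bump \<epsilon> b'" "\<forall>t. (b has_real_derivative b' t) (at t)"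
     "bump \<epsilon> c'" "\<forall>t. (c has_real_derivative c' t) (at t)" by blast
  then show ?case by (intro exI[of _ "\<lambda>t. b' t + c' t"]) (auto intro: bump.intros(2) DERIV_add)
qed

lemma bump_support: "bump \<epsilon> b \<Longrightarrow> t \<le> 0 \<or> \<epsilon> \<le> t \<Longrightarrow> b t = 0"
  by (induction rule: bump.induct) (auto simp: flat_def)

lemma bump_continuous: "bump \<epsilon> b \<Longrightarrow> continuous_on S b"
  using bump_deriv by (meson DERIV_isCont continuous_at_imp_continuous_on)

text \<open>The average looks forward in time: for t > 0 only values of f at positive times enter,
  and the interval contains the support of every bump with \<epsilon> at most 1.\<close>

definition mol :: "(real \<Rightarrow> real) \<Rightarrow> (real \<Rightarrow> complex) \<Rightarrow> real \<Rightarrow> complex" where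
  "mol b f t = integral {0..1} (\<lambda>\<tau>. of_real (b \<tau>) * f (t + \<tau>))"

lemma mol_integrand_continuous:
  fixes f :: "real \<Rightarrow> complex"
  assumes "bump \<epsilon> b" "continuous_on {0..} f" "0 < t"
  shows "continuous_on {0..1} (\<lambda>\<tau>. of_real (b \<tau>) * f (t + \<tau>))"
proof -
  have cf: "continuous_on {0..1} (\<lambda>\<tau>. f (t + \<tau>))"
    by (rule continuous_on_compose2[OF assms(2)]) (use assms(3) in \<open>auto intro!: continuous_intros\<close>)
  show ?thesis by (intro continuous_on_mult continuous_on_of_real bump_continuous[OF assms(1)] cf)
qed

text \<open>For differentiation under the integral sign, the dependence on t is moved into the bump,
  over a domain that does not move with t.\<close>

lemma mol_eq_fixed_interval:
  assumes b: "bump \<epsilon> b" "\<epsilon> \<le> 1" and f: "continuous_on {0..} f" and t: "0 < t" "t + 1 \<le> T"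
  shows "mol b f t = integral {0..T} (\<lambda>x. of_real (b (x - t)) * f x)"
proof -
  define h where "h x = complex_of_real (b (x - t)) * f x" for x
  have "continuous_on {t..t+1} h"
    unfolding h_def using t
    by (intro continuous_on_mult continuous_on_of_real continuous_on_subset[OF f]
        continuous_on_compose2[OF bump_continuous[OF b(1), of UNIV]] continuous_intros) auto
  then have "(h has_integral integral {t..t+1} h) {t..t+1}"
    by (intro integrable_integral integrable_continuous_real)
  moreover have "integral {t..t+1} h = mol b f t"
    using integral_shift_Icc_real[of 0 1 h t] by (simp add: mol_def h_def o_def add.commute)
  ultimately have "(h has_integral mol b f t) {t..t+1}" by simp
  then have "(h has_integral mol b f t) {0..T}"
    by (rule has_integral_on_superset) (use t b bump_support[OF b(1)] in \<open>auto simp: h_def not_le\<close>)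
  then show ?thesis unfolding h_def by (rule integral_unique[symmetric])
qed

lemma mol_has_derivative:
  assumes b: "bump \<epsilon> b" "\<epsilon> \<le> 1" and f: "continuous_on {0..} f" and t: "0 < t"
    and d: "bump \<epsilon> b'" "\<And>t. (b has_real_derivative b' t) (at t)"
  shows "(mol b f has_vector_derivative mol (\<lambda>t. - b' t) f t) (at t)"
proof -
  define T where "T = t + 2"
  define U where "U = {0<..<t+1}"
  have cf: "continuous_on {0..T} f" using f by (rule continuous_on_subset) auto
  have leib: "((\<lambda>s. integral (cbox 0 T) (\<lambda>x. of_real (b (x - s)) * f x)) has_vector_derivative
      integral (cbox 0 T) (\<lambda>x. of_real (- b' (x - t)) * f x)) (at t within U)"
  proof (rule leibniz_rule_vector_derivative)
    show "((\<lambda>s. of_real (b (x - s)) * f x) has_vector_derivative of_real (- b' (x - s)) * f x) (at s within U)" for s x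
    proof -
      have "((\<lambda>s. b (x - s)) has_real_derivative b' (x - s) * (0 - 1)) (at s)"
        by (intro DERIV_chain2[OF d(2)] DERIV_diff DERIV_const DERIV_ident)
      then have "((\<lambda>s. b (x - s)) has_real_derivative - b' (x - s)) (at s within U)"
        by (simp add: has_field_derivative_at_within)
      then show ?thesis by (rule has_vector_derivative_mult_left[OF has_vector_derivative_of_real])
    qed
    show "(\<lambda>x. of_real (b (x - s)) * f x) integrable_on cbox 0 T" for s
      unfolding box_real
      by (intro integrable_continuous_real continuous_on_mult cf continuous_on_of_real
          continuous_on_compose2[OF bump_continuous[OF b(1), of UNIV]] continuous_intros) auto
    show "continuous_on (U \<times> cbox 0 T) (\<lambda>(s, x). of_real (- b' (x - s)) * f x)"
      unfolding case_prod_beta box_real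
      by (intro continuous_on_mult continuous_on_of_real continuous_on_minus
          continuous_on_compose2[OF bump_continuous[OF d(1), of UNIV]]
          continuous_on_compose2[OF cf] continuous_intros) auto
  qed (use t in \<open>auto simp: U_def\<close>)
  have "at t within U = at t" using t by (intro at_within_open) (auto simp: U_def)
  then have "((\<lambda>s. integral {0..T} (\<lambda>x. of_real (b (x - s)) * f x)) has_vector_derivative
      integral {0..T} (\<lambda>x. of_real (- b' (x - t)) * f x)) (at t)"
    using leib unfolding box_real by metis
  also have "integral {0..T} (\<lambda>x. of_real (- b' (x - t)) * f x) = mol (\<lambda>t. - b' t) f t"
    by (rule mol_eq_fixed_interval[OF bump_minus[OF d(1)] b(2) f t, symmetric]) (simp add: T_def)
  finally show ?thesis
    by (rule has_vector_derivative_transform_within_open[of _ _ _ U])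
       (use t mol_eq_fixed_interval[OF b f, of _ T] in \<open>auto simp: U_def T_def\<close>)
qed

lemma mol_smooth:
  assumes "bump \<epsilon> b" "\<epsilon> \<le> 1" "continuous_on {0..} f"
  shows "smooth (mol b f)"
proof (rule smooth_coinduct[where S = "\<lambda>h. \<exists>b. bump \<epsilon> b \<and> h = mol b f"])
  fix h assume "\<exists>b. bump \<epsilon> b \<and> h = mol b f"
  then obtain b where b: "bump \<epsilon> b" "h = mol b f" by blast
  obtain b' where b': "bump \<epsilon> b'" "\<And>t. (b has_real_derivative b' t) (at t)" using bump_deriv[OF b(1)] by blast
  show "\<exists>g. (\<exists>b. bump \<epsilon> b \<and> g = mol b f) \<and> (\<forall>t>0. (h has_vector_derivative g t) (at t))"
    using mol_has_derivative[OF b(1) assms(2,3) _ b'] bump_minus[OF b'(1)] b(2) by blast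
qed (use assms in blast)

definition mollify :: "(real \<Rightarrow> real) \<Rightarrow> (real \<Rightarrow> complex) \<Rightarrow> signal" where
  "mollify b f = signal_of (mol b f)"

lemma val_mollify:
  "bump \<epsilon> b \<Longrightarrow> \<epsilon> \<le> 1 \<Longrightarrow> continuous_on {0..} f \<Longrightarrow> 0 < t \<Longrightarrow> val (mollify b f) t = mol b f t"
  unfolding mollify_def by (subst val_signal_of[OF mol_smooth]) auto

lemma mollify_cong:
  assumes "\<And>t. 0 \<le> t \<Longrightarrow> f t = g t"
  shows "mollify b f = mollify b g"
proof -
  have "(if 0 < t then mol b f t else 0) = (if 0 < t then mol b g t else 0)" for t
    using assms by (auto simp: mol_def intro!: integral_cong)
  then show ?thesis by (simp add: mollify_def signal_of_def)
qed

context
  fixes \<epsilon> :: real and b :: "real \<Rightarrow> real"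
  assumes b: "bump \<epsilon> b" "\<epsilon> \<le> 1"
begin

lemma mollify_add:
  assumes "continuous_on {0..} f" "continuous_on {0..} g"
  shows "mollify b (\<lambda>t. f t + g t) = mollify b f + mollify b g"
proof (rule signal_eqI)
  fix t :: real assume t: "0 < t"
  note i = integrable_continuous_real[OF mol_integrand_continuous[OF b(1) _ t]]
  have "mol b (\<lambda>t. f t + g t) t = mol b f t + mol b g t"
    unfolding mol_def distrib_left
    by (rule Henstock_Kurzweil_Integration.integral_add[OF i[OF assms(1)] i[OF assms(2)]])
  then show "val (mollify b (\<lambda>t. f t + g t)) t = val (mollify b f + mollify b g) t"
    using t assms by (simp add: val_mollify[OF b] continuous_on_add)
qed

lemma mollify_scale:
  assumes "continuous_on {0..} f"
  shows "mollify b (\<lambda>t. c * f t) = scale c (mollify b f)"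
proof (rule signal_eqI)
  fix t :: real assume t: "0 < t"
  have "mol b (\<lambda>t. c * f t) t = c * mol b f t"
    unfolding mol_def mult.left_commute[of _ c]
    by (rule Henstock_Kurzweil_Integration.integral_mult_right)
  then show "val (mollify b (\<lambda>t. c * f t)) t = val (scale c (mollify b f)) t"
    using t assms by (simp add: val_mollify[OF b] continuous_on_mult)
qed

lemma mollify_0: "mollify b (\<lambda>t. 0) = 0"
  using mollify_scale[of "\<lambda>t. 0" 0] by (simp add: scale_zero)

lemma mollify_diff:
  assumes "continuous_on {0..} f" "continuous_on {0..} g"
  shows "mollify b (\<lambda>t. f t - g t) = mollify b f - mollify b g"
proof -
  have "continuous_on {0..} (\<lambda>t. -1 * g t)"
    by (intro continuous_on_mult continuous_on_const assms(2))
  from mollify_add[OF assms(1) this] mollify_scale[OF assms(2), of "-1"]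
  have "mollify b (\<lambda>t. f t - g t) = mollify b f + scale (-1) (mollify b g)" by simp
  then show ?thesis by (auto intro: signal_eqI)
qed

lemma mollify_sum:
  assumes "\<And>i. i \<in> I \<Longrightarrow> continuous_on {0..} (f i)"
  shows "mollify b (\<lambda>t. \<Sum>i\<in>I. f i t) = (\<Sum>i\<in>I. mollify b (f i))"
  using assms by (induction I rule: infinite_finite_induct) (simp_all add: mollify_0 mollify_add continuous_on_sum)

text \<open>The derivative falls on the bump first and returns to f by integration by parts; the
  bump vanishes at 0 and 1, so no boundary terms arise.\<close>

lemma mollify_deriv:
  assumes f: "continuous_on {0..} f" "continuous_on {0..} f'"
    and d: "\<And>t. 0 < t \<Longrightarrow> (f has_vector_derivative f' t) (at t)"
  shows "deriv_signal (mollify b f) = mollify b f'"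
proof (rule signal_eqI)
  fix t :: real assume t: "0 < t"
  obtain b' where b': "bump \<epsilon> b'" "\<And>t. (b has_real_derivative b' t) (at t)" using bump_deriv[OF b(1)] by blast
  have "val (deriv_signal (mollify b f)) t = mol (\<lambda>t. - b' t) f t"
    by (rule val_deriv_unique[OF t mol_has_derivative[OF b f(1) t b']]) (simp add: val_mollify[OF b f(1)])
  also have "\<dots> = mol b f' t"
  proof -
    have 1: "((\<lambda>\<tau>. complex_of_real (b \<tau>) * f (t + \<tau>)) has_vector_derivative
        of_real (b \<tau>) * f' (t + \<tau>) + of_real (b' \<tau>) * f (t + \<tau>)) (at \<tau>)" if "0 \<le> \<tau>" for \<tau>
    proof (intro has_vector_derivative_mult has_vector_derivative_of_real)
      show "(b has_real_derivative b' \<tau>) (at \<tau>)" by (rule b'(2))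
      have "((f \<circ> (\<lambda>\<tau>. t + \<tau>)) has_vector_derivative 1 *\<^sub>R f' (t + \<tau>)) (at \<tau>)"
        using t that by (intro vector_diff_chain_at d) (auto intro!: derivative_eq_intros)
      then show "((\<lambda>\<tau>. f (t + \<tau>)) has_vector_derivative f' (t + \<tau>)) (at \<tau>)" by (simp add: o_def)
    qed
    have "((\<lambda>\<tau>. of_real (b \<tau>) * f' (t + \<tau>) + of_real (b' \<tau>) * f (t + \<tau>)) has_integral
        of_real (b 1) * f (t + 1) - of_real (b 0) * f (t + 0)) {0..1}"
      by (rule fundamental_theorem_of_calculus) (auto intro!: has_vector_derivative_at_within 1)
    moreover have "b 1 = 0" "b 0 = 0" using bump_support[OF b(1)] b(2) by auto
    ultimately have z: "((\<lambda>\<tau>. of_real (b \<tau>) * f' (t + \<tau>) + of_real (b' \<tau>) * f (t + \<tau>)) has_integral 0) {0..1}"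
      by simp
    have m: "((\<lambda>\<tau>. of_real (- b' \<tau>) * f (t + \<tau>)) has_integral mol (\<lambda>t. - b' t) f t) {0..1}"
      unfolding mol_def
      by (intro integrable_integral integrable_continuous_real mol_integrand_continuous[OF bump_minus[OF b'(1)] f(1) t])
    have "((\<lambda>\<tau>. of_real (b \<tau>) * f' (t + \<tau>)) has_integral mol (\<lambda>t. - b' t) f t) {0..1}"
      using has_integral_add[OF z m] by simp
    then show ?thesis unfolding mol_def[of b] by (rule integral_unique[symmetric])
  qed
  also have "\<dots> = val (mollify b f') t" by (simp add: val_mollify[OF b f(2) t])
  finally show "val (deriv_signal (mollify b f)) t = val (mollify b f') t" .
qed

text \<open>The response was defined without derivatives; once mollified it is p(D) applied to a
  genuine signal. For p = H the same signal produces the input, so input and output share one latent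
  variable.\<close>

lemma mollify_proper_response:
  assumes f: "continuous_on {0..} f" and deg: "degree p \<le> length rs"
  shows "mollify b (proper_response rs p f) = act p (mollify b (resolvents rs f))"
  using deg
proof (induction "degree p" arbitrary: p)
  case 0
  then obtain c where p: "p = [:c:]" by (metis degree_0_id)
  have "proper_response rs p f = (\<lambda>t. c * resolvents rs f t)"
    using proper_response_smult[of rs c 1 f] by (auto simp: p proper_response_1)
  then show ?case by (simp add: p act_const mollify_scale resolvents_continuous[OF f])
next
  case (Suc k)
  obtain a q where p: "p = pCons a q" by (cases p)
  with Suc(2) have q: "k = degree q" "q \<noteq> 0" by (auto split: if_splits)
  have cq: "continuous_on {0..} (proper_response rs (pCons 0 q) f)" "continuous_on {0..} (proper_response rs q f)"
    by (intro proper_response_continuous[OF f])+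
  have pe: "p = Polynomial.smult a 1 + pCons 0 q" by (simp add: p)
  have "proper_response rs p f = (\<lambda>t. a * resolvents rs f t + proper_response rs (pCons 0 q) f t)"
    by (rule ext) (simp only: pe proper_response_add proper_response_smult proper_response_1)
  then have "mollify b (proper_response rs p f) = scale a (mollify b (resolvents rs f))
      + mollify b (proper_response rs (pCons 0 q) f)"
    by (simp add: mollify_add mollify_scale resolvents_continuous[OF f] cq continuous_on_mult)
  also have "mollify b (proper_response rs (pCons 0 q) f) = deriv_signal (mollify b (proper_response rs q f))"
    using Suc.prems Suc(2) q
    by (intro mollify_deriv[symmetric] cq proper_response_deriv[OF f]) auto
  also have "mollify b (proper_response rs q f) = act q (mollify b (resolvents rs f))"
    using Suc.prems Suc(2) q by (intro Suc(1)) auto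
  finally show ?case by (simp add: p act_pCons)
qed

end

lemma shift_diff_cong_pos:
  assumes "\<And>s. 0 < s \<Longrightarrow> f s = g s" "0 < t"
  shows "shift_diff rs f t = shift_diff rs g t"
  using assms(1)
proof (induction rs arbitrary: f g)
  case (Cons r rs)
  show ?case unfolding shift_diff.simps by (rule Cons.IH) (use Cons.prems in simp)
qed (use assms(2) in simp)

text \<open>After all factors but one, a multiple of exp(r t) remains, which the difference f(t + 1)
  - e^r f(t) kills. The shift commutes with polynomials in D, so this difference satisfies the
  equation of the remaining factors.\<close>

lemma kernel_shift_diff:
  assumes "act (\<Prod>r\<leftarrow>rs. [:-r, 1:]) f = 0" "0 < t"
  shows "shift_diff rs (val f) t = 0"
  using assms
proof (induction rs arbitrary: f)
  case (Cons r rs)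
  define p where "p = (\<Prod>r\<leftarrow>rs. [:-r, 1:])"
  define f1 where "f1 = shift_signal f + scale (- exp r) f"
  have "act [:-r, 1:] (act p f) = 0" using Cons.prems(1) by (simp only: act_mult p_def list.map prod_list.Cons)
  then obtain c where c: "act p f = scale c (exp_signal r)" using kernel_linear by blast
  have "shift_signal (exp_signal r) = scale (exp r) (exp_signal r)"
    by (auto intro!: signal_eqI simp: val_shift_signal val_exp_signal distrib_left exp_add mult.commute)
  then have "act p f1 = 0"
    by (auto simp: f1_def act_add_right act_shift_signal act_scale_right c shift_signal_scale scale_scale intro!: signal_eqI)
  then have "shift_diff rs (val f1) t = 0" using Cons.IH Cons.prems(2) by (simp add: p_def)
  also have "shift_diff rs (val f1) t = shift_diff rs (\<lambda>t. val f (t + 1) - exp r * val f t) t"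
    using Cons.prems(2) by (intro shift_diff_cong_pos) (auto simp: f1_def val_shift_signal)
  finally show ?case by simp
qed simp

text \<open>Averaging commutes with the shift by 1, so the difference operator moves inside.\<close>

lemma mol_shift_diff:
  assumes b: "bump \<epsilon> b" "\<epsilon> \<le> 1" and f: "continuous_on {0..} f" and t: "0 < t"
  shows "shift_diff rs (mol b f) t = mol b (shift_diff rs f) t"
  using f
proof (induction rs arbitrary: f)
  case (Cons r rs)
  have step: "mol b f (s + 1) - exp r * mol b f s = mol b (\<lambda>t. f (t + 1) - exp r * f t) s" if s: "0 < s" for s
  proof -
    note i = integrable_integral[OF integrable_continuous_real[OF mol_integrand_continuous[OF b(1) Cons.prems]]]
    have "((\<lambda>\<tau>. of_real (b \<tau>) * f (s + 1 + \<tau>) - exp r * (of_real (b \<tau>) * f (s + \<tau>))) has_integral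
        mol b f (s + 1) - exp r * mol b f s) {0..1}"
      unfolding mol_def using s by (intro has_integral_diff has_integral_mult_right i) auto
    then show ?thesis
      unfolding mol_def[of b "\<lambda>t. f (t + 1) - exp r * f t"]
      by (intro integral_unique[symmetric]) (simp add: algebra_simps)
  qed
  have "shift_diff rs (\<lambda>s. mol b f (s + 1) - exp r * mol b f s) t = shift_diff rs (mol b (\<lambda>t. f (t + 1) - exp r * f t)) t"
    by (rule shift_diff_cong_pos[OF step t])
  also have "\<dots> = mol b (shift_diff rs (\<lambda>t. f (t + 1) - exp r * f t)) t"
    by (rule Cons.IH[OF continuous_shift[OF Cons.prems]])
  finally show ?case by simp
qed simp

text \<open>Approximate identity: if f t were nonzero, a nonnegative bump short enough to see only
  values within |f t| / 2 of f t could not average to 0.\<close>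

lemma mol_all_zero:
  assumes f: "continuous_on {0..} f" and t: "0 < t"
    and z: "\<And>\<epsilon> b. 0 < \<epsilon> \<Longrightarrow> \<epsilon> \<le> 1 \<Longrightarrow> bump \<epsilon> b \<Longrightarrow> mol b f t = 0"
  shows "f t = 0"
proof (rule ccontr)
  assume nz: "f t \<noteq> 0"
  have "continuous (at t within {0..}) f" using f t by (auto simp: continuous_on_eq_continuous_within)
  then obtain \<delta> where \<delta>: "0 < \<delta>" "\<And>x. 0 \<le> x \<Longrightarrow> dist x t < \<delta> \<Longrightarrow> dist (f x) (f t) < cmod (f t) / 2"
    unfolding continuous_within_eps_delta using nz by (metis atLeast_iff half_gt_zero zero_less_norm_iff)
  define \<epsilon> where "\<epsilon> = min 1 (\<delta> / 2)"
  have \<epsilon>: "0 < \<epsilon>" "\<epsilon> \<le> 1" "\<epsilon> < \<delta>" using \<delta>(1) by (auto simp: \<epsilon>_def)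
  define b where "b = (\<lambda>t. flat 1 t * flat 1 (\<epsilon> - t))"
  have b: "bump \<epsilon> b" unfolding b_def by (rule bump.intros)
  have b0: "0 \<le> b x" for x by (auto simp: b_def flat_def)
  have bi: "b integrable_on {0..1}" by (intro integrable_continuous_real bump_continuous[OF b])
  have bpos: "0 < integral {0..1} b"
  proof -
    have "integral {0..1} b \<noteq> 0"
    proof
      assume "integral {0..1} b = 0"
      then have "b (\<epsilon> / 2) = 0"
        using integral_eq_0_iff[OF bump_continuous[OF b]] b0 \<epsilon> by (auto simp: less_imp_le)
      then show False using \<epsilon> by (simp add: b_def flat_def)
    qed
    moreover have "0 \<le> integral {0..1} b" by (intro integral_nonneg bi) (simp add: b0)
    ultimately show ?thesis by simp
  qed
  have i1: "((\<lambda>\<tau>. of_real (b \<tau>) * f (t + \<tau>)) has_integral 0) {0..1}"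
    using integrable_integral[OF integrable_continuous_real[OF mol_integrand_continuous[OF b f t]]] z[OF \<epsilon>(1,2) b]
    by (simp add: mol_def)
  have i2: "((\<lambda>\<tau>. complex_of_real (b \<tau>) * f t) has_integral of_real (integral {0..1} b) * f t) {0..1}"
    using has_integral_mult_left[OF has_integral_linear[OF integrable_integral[OF bi] bounded_linear_of_real[where 'a = complex]], of "f t"]
    by (simp add: o_def)
  have i3: "((\<lambda>\<tau>. of_real (b \<tau>) * f (t + \<tau>) - complex_of_real (b \<tau>) * f t) has_integral 0
      - of_real (integral {0..1} b) * f t) {0..1}"
    by (rule has_integral_diff[OF i1 i2])
  have i4: "((\<lambda>\<tau>. b \<tau> * (cmod (f t) / 2)) has_integral integral {0..1} b * (cmod (f t) / 2)) {0..1}"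
    by (intro has_integral_mult_left integrable_integral bi)
  have "cmod (0 - of_real (integral {0..1} b) * f t) \<le> integral {0..1} b * (cmod (f t) / 2)"
  proof -
    have "norm (integral {0..1} (\<lambda>\<tau>. of_real (b \<tau>) * f (t + \<tau>) - complex_of_real (b \<tau>) * f t))
       \<le> integral {0..1} (\<lambda>\<tau>. b \<tau> * (cmod (f t) / 2))"
    proof (rule integral_norm_bound_integral)
      fix \<tau> :: real assume \<tau>: "\<tau> \<in> {0..1}"
      show "norm (of_real (b \<tau>) * f (t + \<tau>) - complex_of_real (b \<tau>) * f t) \<le> b \<tau> * (cmod (f t) / 2)"
      proof (cases "\<tau> < \<epsilon>")
        case True
        have "dist (f (t + \<tau>)) (f t) < cmod (f t) / 2"
          using True \<tau> t \<epsilon> by (intro \<delta>(2)) (auto simp: dist_real_def)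
        then have "cmod (f (t + \<tau>) - f t) \<le> cmod (f t) / 2" by (simp add: dist_norm)
        from mult_left_mono[OF this b0[of \<tau>]] show ?thesis
          unfolding right_diff_distrib[symmetric] norm_mult norm_of_real abs_of_nonneg[OF b0] .
      next
        case False
        then have "b \<tau> = 0" using bump_support[OF b] by simp
        then show ?thesis by simp
      qed
    qed (use i3 i4 in blast)+
    then show ?thesis using integral_unique[OF i3] integral_unique[OF i4] by simp
  qed
  then have "integral {0..1} b * cmod (f t) \<le> integral {0..1} b * (cmod (f t) / 2)"
    using bpos by (simp add: norm_mult)
  then show False using bpos nz by (simp add: mult_le_cancel_left)
qed

text \<open>The difference equation for the signals passes to the mollified function and, the bumps
  shrinking to a point, to the function itself; no derivative of it is needed.\<close>

lemma weak_kernel_decay: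
  assumes f: "continuous_on {0..} f" and H: "hurwitz H"
    and z: "\<And>\<epsilon> b. 0 < \<epsilon> \<Longrightarrow> \<epsilon> \<le> 1 \<Longrightarrow> bump \<epsilon> b \<Longrightarrow> act H (mollify b f) = 0"
  shows "square_bounded f" "(f \<longlongrightarrow> 0) at_top"
proof -
  obtain c rs where rs: "c \<noteq> 0" "H = Polynomial.smult c (\<Prod>r\<leftarrow>rs. [:-r, 1:])" "\<forall>r\<in>set rs. Re r < 0"
    using hurwitz_roots[OF H] .
  \<comment> \<open>Half the smallest distance of a root from the axis, capped by 1, so that the
    inequality for the roots is strict; the 1 also serves an empty list of roots.\<close>
  define \<mu> where "\<mu> = Min (insert 1 ((\<lambda>r. - Re r) ` set rs)) / 2"
  have m: "0 < Min (insert 1 ((\<lambda>r. - Re r) ` set rs))" using rs(3) by auto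
  have \<mu>: "0 < \<mu>" "\<forall>r\<in>set rs. Re r < - \<mu>"
  proof -
    show "0 < \<mu>" using m by (simp add: \<mu>_def)
    show "\<forall>r\<in>set rs. Re r < - \<mu>"
    proof
      fix r assume "r \<in> set rs"
      then have "Min (insert 1 ((\<lambda>r. - Re r) ` set rs)) \<le> - Re r" by (intro Min_le) auto
      then show "Re r < - \<mu>" using m unfolding \<mu>_def by linarith
    qed
  qed
  have "shift_diff rs f t = 0" if t: "0 < t" for t
  proof (rule mol_all_zero[OF shift_diff_continuous[OF f] t])
    fix \<epsilon> b assume e: "0 < \<epsilon>" "\<epsilon> \<le> (1::real)" "bump \<epsilon> b"
    define X where "X = act (\<Prod>r\<leftarrow>rs. [:-r, 1:]) (mollify b f)"
    have "scale c X = 0"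
      using z[OF e] unfolding rs(2) act_smult X_def .
    moreover have "X = scale (1 / c) (scale c X)" using rs(1) by (simp add: scale_scale scale_one)
    ultimately have "X = 0" by (auto intro: signal_eqI)
    then have "act (\<Prod>r\<leftarrow>rs. [:-r, 1:]) (mollify b f) = 0" by (simp add: X_def)
    then have "shift_diff rs (val (mollify b f)) t = 0" using t by (rule kernel_shift_diff)
    also have "shift_diff rs (val (mollify b f)) t = shift_diff rs (mol b f) t"
      using val_mollify[OF e(3,2) f] t by (intro shift_diff_cong_pos) auto
    also have "\<dots> = mol b (shift_diff rs f) t" by (rule mol_shift_diff[OF e(3,2) f t])
    finally show "mol b (shift_diff rs f) t = 0" .
  qed
  from shift_diff_decay[OF f this \<mu>(2,1)] obtain C where C: "0 \<le> C" "\<forall>t\<ge>0. cmod (f t) \<le> C * exp (- \<mu> * t)"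
    by blast
  then show "square_bounded f" "(f \<longlongrightarrow> 0) at_top"
    using exp_bound_square_bounded[OF f _ \<mu>(1) C(1)] by blast+
qed

subsection \<open>Elimination of circuit variables\<close>

datatype circuit_var = Potential nat | Current nat nat | PortCurrent

type_synonym row = "(complex poly \<times> circuit_var) list"

text \<open>The scalar action is a parameter, so that one system of rows is read in three ways: over
  polynomials, for phasors at a fixed frequency, and on signals with the variable acting as D.
  Elimination is done over polynomials and transferred to the others.\<close>

definition row_eval :: "(complex poly \<Rightarrow> 'a \<Rightarrow> 'a::ab_group_add) \<Rightarrow> row \<Rightarrow> (circuit_var \<Rightarrow> 'a) \<Rightarrow> 'a" where
  "row_eval s r x = (\<Sum>(p, j)\<leftarrow>r. s p (x j))"

lemma row_eval_Nil [simp]: "row_eval s [] x = 0"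
  and row_eval_Cons [simp]: "row_eval s ((p, j) # r) x = s p (x j) + row_eval s r x"
  and row_eval_append [simp]: "row_eval s (r @ r') x = row_eval s r x + row_eval s r' x"
  by (simp_all add: row_eval_def)

abbreviation poly_eval :: "row \<Rightarrow> (circuit_var \<Rightarrow> complex poly) \<Rightarrow> complex poly" where
  "poly_eval \<equiv> row_eval (*)"

abbreviation point_eval :: "complex \<Rightarrow> row \<Rightarrow> (circuit_var \<Rightarrow> complex) \<Rightarrow> complex" where
  "point_eval s \<equiv> row_eval (\<lambda>p x. poly p s * x)"

lemma poly_poly_eval: "poly (poly_eval r x) s = point_eval s r (\<lambda>j. poly (x j) s)"
  by (induction r) auto

lemma poly_eval_linear: "poly_eval r (\<lambda>j. a * x j - b * y j) = a * poly_eval r x - b * poly_eval r y"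
  by (induction r) (auto simp: algebra_simps)

definition row_comb :: "complex poly \<Rightarrow> row \<Rightarrow> complex poly \<Rightarrow> row \<Rightarrow> row" where
  "row_comb a r b r' = map (\<lambda>(p, j). (a * p, j)) r @ map (\<lambda>(p, j). (- b * p, j)) r'"

lemma poly_eval_scale_row: "poly_eval (map (\<lambda>(p, j). (a * p, j)) r) x = a * poly_eval r x"
  by (induction r) (auto simp: algebra_simps)

lemma poly_eval_row_comb: "poly_eval (row_comb a r b r') x = a * poly_eval r x - b * poly_eval r' x"
  by (simp only: row_comb_def row_eval_append poly_eval_scale_row) simp

text \<open>Fraction-free form of the statement that a linear form vanishing on the solutions of a
  homogeneous system is a combination of its equations.\<close>

lemma row_alternative:
  assumes "finite E"
  shows "(\<exists>\<alpha> \<rho>. \<alpha> \<noteq> 0 \<and> (\<forall>x. \<alpha> * poly_eval f x = (\<Sum>r\<in>E. \<rho> r * poly_eval r x))) \<or>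
         (\<exists>x. (\<forall>r\<in>E. poly_eval r x = 0) \<and> poly_eval f x \<noteq> 0)"
  using assms
proof (induction E arbitrary: f)
  case empty
  show ?case by (cases "\<exists>x. poly_eval f x \<noteq> 0") (auto intro: exI[of _ 1])
next
  case (insert e E)
  show ?case
  proof (cases "\<exists>\<alpha> \<rho>. \<alpha> \<noteq> 0 \<and> (\<forall>x. \<alpha> * poly_eval e x = (\<Sum>r\<in>E. \<rho> r * poly_eval r x))")
    case True
    then obtain \<alpha> \<rho> where e: "\<alpha> \<noteq> 0" "\<And>x. \<alpha> * poly_eval e x = (\<Sum>r\<in>E. \<rho> r * poly_eval r x)" by blast
    from insert.IH[of f] show ?thesis
    proof
      assume "\<exists>\<alpha> \<rho>. \<alpha> \<noteq> 0 \<and> (\<forall>x. \<alpha> * poly_eval f x = (\<Sum>r\<in>E. \<rho> r * poly_eval r x))"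
      then obtain \<alpha> \<rho> where f: "\<alpha> \<noteq> 0" "\<And>x. \<alpha> * poly_eval f x = (\<Sum>r\<in>E. \<rho> r * poly_eval r x)" by blast
      have "(\<Sum>r\<in>E. (\<rho>(e := 0)) r * poly_eval r x) = (\<Sum>r\<in>E. \<rho> r * poly_eval r x)" for x
        using insert.hyps by (intro sum.cong) auto
      then show ?thesis
        using f insert.hyps by (intro disjI1 exI[of _ \<alpha>] exI[of _ "\<rho>(e := 0)"]) simp
    next
      assume "\<exists>x. (\<forall>r\<in>E. poly_eval r x = 0) \<and> poly_eval f x \<noteq> 0"
      then obtain x where x: "\<And>r. r \<in> E \<Longrightarrow> poly_eval r x = 0" "poly_eval f x \<noteq> 0" by blast
      then have "poly_eval e x = 0" using e(2)[of x] e(1) by simp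
      with x show ?thesis by blast
    qed
  next
    case False
    with insert.IH[of e] obtain x0 where x0: "\<And>r. r \<in> E \<Longrightarrow> poly_eval r x0 = 0" "poly_eval e x0 \<noteq> 0" by blast
    \<comment> \<open>x0 solves E but not e. The form a f - b e vanishes at x0, so the claim for it
      over E settles the claim for f; in the second case \<open>x'\<close> corrects a solution of E
      by a multiple of x0 so that e vanishes too.\<close>
    define a b where "a = poly_eval e x0" and "b = poly_eval f x0"
    from insert.IH[of "row_comb a f b e"] show ?thesis
    proof
      assume "\<exists>\<alpha> \<rho>. \<alpha> \<noteq> 0 \<and> (\<forall>x. \<alpha> * poly_eval (row_comb a f b e) x = (\<Sum>r\<in>E. \<rho> r * poly_eval r x))"
      then obtain \<alpha> \<rho> where f: "\<alpha> \<noteq> 0" "\<And>x. \<alpha> * (a * poly_eval f x - b * poly_eval e x) = (\<Sum>r\<in>E. \<rho> r * poly_eval r x)"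
        unfolding poly_eval_row_comb by blast
      have "(\<Sum>r\<in>E. (\<rho>(e := \<alpha> * b)) r * poly_eval r x) = (\<Sum>r\<in>E. \<rho> r * poly_eval r x)" for x
        using insert.hyps by (intro sum.cong) auto
      then have "\<alpha> * a * poly_eval f x = (\<Sum>r\<in>insert e E. (\<rho>(e := \<alpha> * b)) r * poly_eval r x)" for x
        using insert.hyps f(2)[of x] by (simp add: algebra_simps)
      then show ?thesis using f(1) x0(2) unfolding a_def
        by (intro disjI1 exI[of _ "\<alpha> * poly_eval e x0"] exI[of _ "\<rho>(e := \<alpha> * b)"]) auto
    next
      assume "\<exists>x. (\<forall>r\<in>E. poly_eval r x = 0) \<and> poly_eval (row_comb a f b e) x \<noteq> 0"
      then obtain x where x: "\<And>r. r \<in> E \<Longrightarrow> poly_eval r x = 0" "a * poly_eval f x - b * poly_eval e x \<noteq> 0"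
        unfolding poly_eval_row_comb by blast
      define x' where "x' j = a * x j - poly_eval e x * x0 j" for j
      have ev: "poly_eval r x' = a * poly_eval r x - poly_eval e x * poly_eval r x0" for r
        unfolding x'_def by (rule poly_eval_linear)
      have "poly_eval r x' = 0" if "r \<in> insert e E" for r
        using that x(1) x0(1) by (auto simp: ev a_def)
      moreover have "poly_eval f x' \<noteq> 0" using x(2) by (simp add: ev b_def mult.commute)
      ultimately show ?thesis by blast
    qed
  qed
qed

lemma row_eval_expand:
  assumes m: "Modules.module s" and J: "finite J" "snd ` set r \<subseteq> J"
  shows "row_eval s r x = (\<Sum>j\<in>J. s (poly_eval r (\<lambda>k. if k = j then 1 else 0)) (x j))"
  using J(2)
proof (induction r)
  case Nil
  then show ?case using module.scale_zero_left[OF m] by simp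
next
  case (Cons pj r)
  obtain p j0 where pj: "pj = (p, j0)" by (cases pj)
  have "(\<Sum>j\<in>J. s (p * (if j0 = j then 1 else 0)) (x j)) = (\<Sum>j\<in>J. if j = j0 then s p (x j0) else 0)"
    by (intro sum.cong refl) (auto simp: Modules.module.scale_zero_left[OF m])
  also have "\<dots> = s p (x j0)" using J(1) Cons.prems by (simp add: pj)
  finally show ?case
    using Cons by (simp add: pj Modules.module.scale_left_distrib[OF m] sum.distrib)
qed

text \<open>An identity of polynomial rows holds coefficient by coefficient, as unit vectors show,
  and therefore in every module.\<close>

lemma row_identity_transfer:
  assumes m: "Modules.module s" and E: "finite E"
    and id: "\<And>x. \<alpha> * poly_eval f x = (\<Sum>r\<in>E. \<rho> r * poly_eval r x)"
  shows "s \<alpha> (row_eval s f x) = (\<Sum>r\<in>E. s (\<rho> r) (row_eval s r x))"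
proof -
  interpret m: Modules.module s by (rule m)
  define J where "J = snd ` set f \<union> (\<Union>r\<in>E. snd ` set r)"
  have J: "finite J" using E by (simp add: J_def)
  let ?u = "\<lambda>j k. if k = j then 1 else (0 :: complex poly)"
  have "s \<alpha> (row_eval s f x) = (\<Sum>j\<in>J. s (\<alpha> * poly_eval f (?u j)) (x j))"
    by (subst row_eval_expand[OF m J]) (auto simp: J_def m.scale_sum_right)
  also have "\<dots> = (\<Sum>j\<in>J. \<Sum>r\<in>E. s (\<rho> r) (s (poly_eval r (?u j)) (x j)))"
    by (simp add: id m.scale_sum_left)
  also have "\<dots> = (\<Sum>r\<in>E. \<Sum>j\<in>J. s (\<rho> r) (s (poly_eval r (?u j)) (x j)))" by (rule sum.swap)
  also have "\<dots> = (\<Sum>r\<in>E. s (\<rho> r) (row_eval s r x))"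
  proof (rule sum.cong[OF refl])
    fix r assume "r \<in> E"
    then have "snd ` set r \<subseteq> J" by (auto simp: J_def)
    from row_eval_expand[OF m J this]
    show "(\<Sum>j\<in>J. s (\<rho> r) (s (poly_eval r (?u j)) (x j))) = s (\<rho> r) (row_eval s r x)"
      by (simp add: m.scale_sum_right)
  qed
  finally show ?thesis .
qed

lemma module_point: "Modules.module (\<lambda>p x. poly p s * x)"
  by standard (auto simp: algebra_simps)

section \<open>Circuits as systems of polynomial equations\<close>

fun module_law :: "(complex poly \<Rightarrow> 'a \<Rightarrow> 'a::ab_group_add) \<Rightarrow> element \<Rightarrow> (nat \<Rightarrow> 'a) \<Rightarrow> (nat \<Rightarrow> 'a) \<Rightarrow> bool" where
  "module_law s (Resistor _ _ r) u i \<longleftrightarrow> u 0 = s [:of_real r:] (i 0)"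
| "module_law s (Inductor _ _ l) u i \<longleftrightarrow> u 0 = s [:0, of_real l:] (i 0)"
| "module_law s (Capacitor _ _ c) u i \<longleftrightarrow> i 0 = s [:0, of_real c:] (u 0)"
| "module_law s (Transformer _ _ _ _ r) u i \<longleftrightarrow> u 0 = s [:of_real r:] (u 1) \<and> i 1 = s [:- of_real r:] (i 0)"
| "module_law s (Gyrator _ _ _ _ r) u i \<longleftrightarrow> u 0 = s [:- of_real r:] (i 1) \<and> u 1 = s [:of_real r:] (i 0)"

lemma module_law_point: "module_law (\<lambda>p x. poly p s * x) e u i \<longleftrightarrow> phasor_law s e u i"
  by (cases e) (auto simp: mult.assoc)

fun law_rows :: "nat \<Rightarrow> element \<Rightarrow> row list" where
  "law_rows k (Resistor m n r) = [[(1, Potential m), (-1, Potential n), (- [:of_real r:], Current k 0)]]"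
| "law_rows k (Inductor m n l) = [[(1, Potential m), (-1, Potential n), (- [:0, of_real l:], Current k 0)]]"
| "law_rows k (Capacitor m n c) = [[(1, Current k 0), (- [:0, of_real c:], Potential m), ([:0, of_real c:], Potential n)]]"
| "law_rows k (Transformer m n m' n' r) =
    [[(1, Potential m), (-1, Potential n), (- [:of_real r:], Potential m'), ([:of_real r:], Potential n')],
     [(1, Current k 1), (- [:- of_real r:], Current k 0)]]"
| "law_rows k (Gyrator m n m' n' r) =
    [[(1, Potential m), (-1, Potential n), (- [:- of_real r:], Current k 1)],
     [(1, Potential m'), (-1, Potential n'), (- [:of_real r:], Current k 0)]]"

lemma law_rows_iff:
  assumes "Modules.module s"
  shows "(\<forall>r\<in>set (law_rows k e). row_eval s r x = 0) \<longleftrightarrow>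
    module_law s e (element_voltage (\<lambda>n. x (Potential n)) e) (\<lambda>p. x (Current k p))"
proof -
  interpret m: Modules.module s by (rule assms)
  have neg: "s (- p) a = - s p a" for p a by (rule m.scale_minus_left)
  have one: "s (-1) a = - a" for a using neg[of 1 a] by simp
  show ?thesis
    by (cases e)
      (simp_all only: law_rows.simps module_law.simps list.set ball_simps row_eval_Cons row_eval_Nil neg one
        m.scale_one element_voltage_def element_ports.simps nth_Cons_0 nth_Cons_Suc One_nat_def fst_conv snd_conv m.scale_right_diff_distrib,
       auto simp: algebra_simps eq_neg_iff_add_eq_0 add_eq_0_iff)
qed

definition incidence :: "element \<Rightarrow> nat \<Rightarrow> nat \<Rightarrow> complex poly" where
  "incidence e p n = (if fst (element_ports e ! p) = n then 1 else 0) - (if snd (element_ports e ! p) = n then 1 else 0)"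

definition kcl_row :: "one_port \<Rightarrow> nat \<Rightarrow> row" where
  "kcl_row C n = concat (map (\<lambda>k. map (\<lambda>p. (incidence (elements C ! k) p n, Current k p))
      [0..<length (element_ports (elements C ! k))]) [0..<length (elements C)])
    @ [((if n = minus_terminal C then 1 else 0) - (if n = plus_terminal C then 1 else 0), PortCurrent)]"

lemma row_eval_map: "row_eval s (map (\<lambda>p. (f p, g p)) ps) x = (\<Sum>p\<leftarrow>ps. s (f p) (x (g p)))"
  by (induction ps) auto

lemma row_eval_concat: "row_eval s (concat rs) x = (\<Sum>r\<leftarrow>rs. row_eval s r x)"
  by (induction rs) auto

lemma kcl_row_iff:
  assumes "Modules.module s"
  shows "kcl C (\<lambda>k p. x (Current k p)) (x PortCurrent) \<longleftrightarrow> (\<forall>n. row_eval s (kcl_row C n) x = 0)"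
proof -
  interpret m: Modules.module s by (rule assms)
  have ind: "s ((if A then 1 else 0) - (if B then 1 else 0)) a = (if A then a else 0) - (if B then a else 0)" for A B a
    by (simp add: m.scale_left_diff_distrib)
  have "row_eval s (kcl_row C n) x =
     (\<Sum>k<length (elements C). \<Sum>p<length (element_ports (elements C ! k)).
        (if fst (element_ports (elements C ! k) ! p) = n then x (Current k p) else 0)
      - (if snd (element_ports (elements C ! k) ! p) = n then x (Current k p) else 0))
     - ((if n = plus_terminal C then x PortCurrent else 0) - (if n = minus_terminal C then x PortCurrent else 0))" for n
    unfolding kcl_row_def row_eval_append row_eval_concat map_map o_def row_eval_map incidence_def ind row_eval_Cons row_eval_Nil
    by (simp add: interv_sum_list_conv_sum_set_nat atLeast0LessThan)
  then show ?thesis unfolding kcl_def by simp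
qed

text \<open>Kirchhoff's law is demanded at every natural number; from this bound on neither an
  element nor a terminal is attached, and finitely many rows express the law.\<close>

definition node_bound :: "one_port \<Rightarrow> nat" where
  "node_bound C = Suc (plus_terminal C + minus_terminal C +
     (\<Sum>e\<leftarrow>elements C. \<Sum>(m, n)\<leftarrow>element_ports e. m + n))"

lemma node_bound_ports:
  assumes "k < length (elements C)" "p < length (element_ports (elements C ! k))"
  shows "fst (element_ports (elements C ! k) ! p) < node_bound C" "snd (element_ports (elements C ! k) ! p) < node_bound C"
proof -
  let ?e = "elements C ! k"
  have "(\<lambda>(m, n). m + n) (element_ports ?e ! p) \<le> (\<Sum>(m, n)\<leftarrow>element_ports ?e. m + n)"
    using assms(2) by (intro member_le_sum_list) (auto intro: nth_mem)
  also have "\<dots> \<le> (\<Sum>e\<leftarrow>elements C. \<Sum>(m, n)\<leftarrow>element_ports e. m + n)"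
    using assms(1) by (intro member_le_sum_list) (auto intro: nth_mem)
  finally have "fst (element_ports ?e ! p) + snd (element_ports ?e ! p) < node_bound C"
    by (simp add: node_bound_def case_prod_beta)
  then show "fst (element_ports ?e ! p) < node_bound C" "snd (element_ports ?e ! p) < node_bound C" by linarith+
qed

lemma node_bound_terminals: "plus_terminal C < node_bound C" "minus_terminal C < node_bound C"
  by (auto simp: node_bound_def)

definition circuit_rows :: "one_port \<Rightarrow> row list" where
  "circuit_rows C = map (kcl_row C) [0..<node_bound C] @
     concat (map (\<lambda>k. law_rows k (elements C ! k)) [0..<length (elements C)])"

definition solves :: "(complex poly \<Rightarrow> 'a \<Rightarrow> 'a::ab_group_add) \<Rightarrow> one_port \<Rightarrow> (circuit_var \<Rightarrow> 'a) \<Rightarrow> bool" where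
  "solves s C x \<longleftrightarrow> (\<forall>r\<in>set (circuit_rows C). row_eval s r x = 0)"

lemma solves_iff:
  assumes m: "Modules.module s"
  shows "solves s C x \<longleftrightarrow> kcl C (\<lambda>k p. x (Current k p)) (x PortCurrent) \<and>
     (\<forall>k<length (elements C). module_law s (elements C ! k)
        (element_voltage (\<lambda>n. x (Potential n)) (elements C ! k)) (\<lambda>p. x (Current k p)))"
proof -
  interpret m: Modules.module s by (rule m)
  have far: "row_eval s (kcl_row C n) x = 0" if "\<not> n < node_bound C" for n
  proof -
    have "row_eval s (map (\<lambda>p. (incidence (elements C ! k) p n, Current k p))
      [0..<length (element_ports (elements C ! k))]) x = 0" if k: "k < length (elements C)" for k
    proof -
      have "incidence (elements C ! k) p n = 0" if "p < length (element_ports (elements C ! k))" for p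
        using node_bound_ports[OF k that] \<open>\<not> n < node_bound C\<close> by (auto simp: incidence_def)
      then show ?thesis
        unfolding row_eval_map interv_sum_list_conv_sum_set_nat
        by (intro sum.neutral) (simp add: atLeast0LessThan)
    qed
    then have "row_eval s (concat (map (\<lambda>k. map (\<lambda>p. (incidence (elements C ! k) p n, Current k p))
      [0..<length (element_ports (elements C ! k))]) [0..<length (elements C)])) x = (\<Sum>k\<leftarrow>[0..<length (elements C)]. 0)"
      unfolding row_eval_concat map_map o_def by (intro arg_cong[of _ _ sum_list] map_cong) auto
    moreover have "n \<noteq> plus_terminal C" "n \<noteq> minus_terminal C" using node_bound_terminals[of C] that by auto
    ultimately show ?thesis by (simp add: kcl_row_def)
  qed
  have "(\<forall>n<node_bound C. row_eval s (kcl_row C n) x = 0) \<longleftrightarrow> (\<forall>n. row_eval s (kcl_row C n) x = 0)"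
    using far by blast
  then show ?thesis
    unfolding solves_def circuit_rows_def kcl_row_iff[OF m] law_rows_iff[OF m, symmetric] by auto
qed

definition port_voltage :: "one_port \<Rightarrow> (circuit_var \<Rightarrow> 'a::ab_group_add) \<Rightarrow> 'a" where
  "port_voltage C x = x (Potential (plus_terminal C)) - x (Potential (minus_terminal C))"

lemma port_phasor_iff:
  "port_phasor C s v i \<longleftrightarrow> (\<exists>x. solves (\<lambda>p x. poly p s * x) C x \<and> v = port_voltage C x \<and> i = x PortCurrent)"
proof
  assume "port_phasor C s v i"
  then obtain \<phi> c where *: "v = \<phi> (plus_terminal C) - \<phi> (minus_terminal C)" "kcl C c i"
     "\<forall>k<length (elements C). phasor_law s (elements C ! k) (element_voltage \<phi> (elements C ! k)) (c k)"
    unfolding port_phasor_def by blast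
  define x where "x j = (case j of Potential n \<Rightarrow> \<phi> n | Current k p \<Rightarrow> c k p | PortCurrent \<Rightarrow> i)" for j
  show "\<exists>x. solves (\<lambda>p x. poly p s * x) C x \<and> v = port_voltage C x \<and> i = x PortCurrent"
    unfolding solves_iff[OF module_point] module_law_point port_voltage_def
    by (rule exI[of _ x]) (use * in \<open>simp add: x_def\<close>)
next
  assume "\<exists>x. solves (\<lambda>p x. poly p s * x) C x \<and> v = port_voltage C x \<and> i = x PortCurrent"
  then obtain x where "solves (\<lambda>p x. poly p s * x) C x" "v = port_voltage C x" "i = x PortCurrent" by blast
  then show "port_phasor C s v i"
    unfolding port_phasor_def solves_iff[OF module_point] module_law_point port_voltage_def
    by (intro exI[of _ "\<lambda>n. x (Potential n)"] exI[of _ "\<lambda>k p. x (Current k p)"]) simp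
qed

text \<open>The equation d v = n i expresses an impedance n / d as well as an admittance d / n, and
  it stays meaningful when n or d is 0.\<close>

definition port_relation :: "one_port \<Rightarrow> complex poly \<Rightarrow> complex poly \<Rightarrow> bool" where
  "port_relation C n d \<longleftrightarrow> coprime n d \<and>
     finite {s. \<not> (\<forall>v i. port_phasor C s v i \<longleftrightarrow> poly d s * v = poly n s * i)}"

definition relation_row :: "one_port \<Rightarrow> complex poly \<Rightarrow> complex poly \<Rightarrow> row" where
  "relation_row C n d = [(d, Potential (plus_terminal C)), (- d, Potential (minus_terminal C)), (- n, PortCurrent)]"

lemma row_eval_relation_row:
  assumes "Modules.module s"
  shows "row_eval s (relation_row C n d) x = s d (port_voltage C x) - s n (x PortCurrent)"
proof -
  interpret m: Modules.module s by (rule assms)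
  show ?thesis by (simp add: relation_row_def port_voltage_def m.scale_minus_left m.scale_right_diff_distrib algebra_simps)
qed

lemma module_poly: "Modules.module ((*) :: complex poly \<Rightarrow> _)"
  by standard (auto simp: algebra_simps)

lemma poly_zero_cofinite:
  assumes "finite S" "\<And>s. s \<notin> S \<Longrightarrow> poly p s = (0 :: complex)"
  shows "p = 0"
proof (rule ccontr)
  assume "p \<noteq> 0"
  then have "finite ({s. poly p s = 0} \<union> S)" using assms(1) poly_roots_finite by blast
  moreover have "{s. poly p s = 0} \<union> S = UNIV" using assms(2) by blast
  ultimately show False using infinite_UNIV_char_0[where 'a = complex] by simp
qed

text \<open>If d v - n i did not follow from the circuit equations, some polynomial solution would
  violate it, and its values at almost every s would be a phasor violating the port relation. The
  multiplier \<alpha> stems from elimination without fractions and carries the hidden modes.\<close>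

lemma port_relation_eliminated:
  assumes rel: "port_relation C n d"
  shows "\<exists>\<alpha>. \<alpha> \<noteq> 0 \<and> (\<forall>x. solves act C x \<longrightarrow> act \<alpha> (act d (port_voltage C x) - act n (x PortCurrent)) = 0)"
proof -
  define S where "S = {s. \<not> (\<forall>v i. port_phasor C s v i \<longleftrightarrow> poly d s * v = poly n s * i)}"
  have S: "finite S" using rel by (simp add: port_relation_def S_def)
  let ?E = "set (circuit_rows C)" and ?f = "relation_row C n d"
  have "\<not> (\<exists>x. (\<forall>r\<in>?E. poly_eval r x = 0) \<and> poly_eval ?f x \<noteq> 0)"
  proof
    assume "\<exists>x. (\<forall>r\<in>?E. poly_eval r x = 0) \<and> poly_eval ?f x \<noteq> 0"
    then obtain x where x: "\<And>r. r \<in> ?E \<Longrightarrow> poly_eval r x = 0" "poly_eval ?f x \<noteq> 0" by blast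
    have "poly (poly_eval ?f x) s = 0" if "s \<notin> S" for s
    proof -
      define xs where "xs = (\<lambda>j. poly (x j) s)"
      have "solves (\<lambda>p x. poly p s * x) C xs"
        unfolding solves_def xs_def poly_poly_eval[symmetric] using x(1) by simp
      then have "port_phasor C s (port_voltage C xs) (xs PortCurrent)" unfolding port_phasor_iff by blast
      then have "poly d s * port_voltage C xs = poly n s * xs PortCurrent" using that by (simp add: S_def)
      then show ?thesis
        unfolding poly_poly_eval xs_def[symmetric] row_eval_relation_row[OF module_point] by simp
    qed
    from poly_zero_cofinite[OF S this] x(2) show False by blast
  qed
  with row_alternative[of ?E ?f] obtain \<alpha> \<rho> where \<alpha>: "\<alpha> \<noteq> 0"
    "\<And>x. \<alpha> * poly_eval ?f x = (\<Sum>r\<in>?E. \<rho> r * poly_eval r x)" by auto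
  have "act \<alpha> (act d (port_voltage C x) - act n (x PortCurrent)) = 0" if "solves act C x" for x
  proof -
    have "act \<alpha> (row_eval act ?f x) = (\<Sum>r\<in>?E. act (\<rho> r) (row_eval act r x))"
      by (rule row_identity_transfer[OF signal.module_axioms _ \<alpha>(2)]) simp
    also have "\<dots> = 0" using that by (intro sum.neutral) (simp add: solves_def)
    finally show ?thesis unfolding row_eval_relation_row[OF signal.module_axioms] .
  qed
  with \<alpha>(1) show ?thesis by blast
qed

text \<open>The controllable motions: applied to a signal w, this solution is a trajectory with port
  variables m n w and m d w. If every polynomial solution were 0 at the port, elimination would
  force n and d to vanish together at some s, against coprimality.\<close>

lemma port_relation_image:
  assumes rel: "port_relation C n d"
  shows "\<exists>x m. m \<noteq> 0 \<and> solves (*) C x \<and> port_voltage C x = m * n \<and> x PortCurrent = m * d"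
proof -
  define S where "S = {s. \<not> (\<forall>v i. port_phasor C s v i \<longleftrightarrow> poly d s * v = poly n s * i)}"
  have S: "finite S" and cop: "coprime n d" using rel by (simp_all add: port_relation_def S_def)
  let ?E = "set (circuit_rows C)"
  define fv where "fv = relation_row C 0 1"
  define fi where "fi = relation_row C 1 0"
  have fv: "row_eval s fv x = port_voltage C x" if "Modules.module s" for s :: "complex poly \<Rightarrow> 'b \<Rightarrow> 'b::ab_group_add" and x
    using row_eval_relation_row[OF that, of C 0 1 x] Modules.module.scale_one[OF that] Modules.module.scale_zero_left[OF that]
    by (simp add: fv_def)
  have fi: "row_eval s fi x = - x PortCurrent" if "Modules.module s" for s :: "complex poly \<Rightarrow> 'b \<Rightarrow> 'b::ab_group_add" and x
    using row_eval_relation_row[OF that, of C 1 0 x] Modules.module.scale_one[OF that] Modules.module.scale_zero_left[OF that]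
    by (simp add: fi_def)
  have "\<exists>x. solves (*) C x \<and> (port_voltage C x \<noteq> 0 \<or> x PortCurrent \<noteq> 0)"
  proof (rule ccontr)
    assume no: "\<not> ?thesis"
    have "\<not> (\<exists>x. (\<forall>r\<in>?E. poly_eval r x = 0) \<and> poly_eval fv x \<noteq> 0)"
      using no unfolding fv[OF module_poly] solves_def by blast
    with row_alternative[of ?E fv] obtain \<alpha> \<rho> where \<alpha>: "\<alpha> \<noteq> 0"
      "\<And>x. \<alpha> * poly_eval fv x = (\<Sum>r\<in>?E. \<rho> r * poly_eval r x)" by auto
    have "\<not> (\<exists>x. (\<forall>r\<in>?E. poly_eval r x = 0) \<and> poly_eval fi x \<noteq> 0)"
      using no unfolding fi[OF module_poly] solves_def by auto
    with row_alternative[of ?E fi] obtain \<beta> \<tau> where \<beta>: "\<beta> \<noteq> 0"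
      "\<And>x. \<beta> * poly_eval fi x = (\<Sum>r\<in>?E. \<tau> r * poly_eval r x)" by auto
    have "poly (\<alpha> * \<beta>) s = 0" if "s \<notin> S" for s
    proof (rule ccontr)
      assume nz: "poly (\<alpha> * \<beta>) s \<noteq> 0"
      have "port_phasor C s (poly n s) (poly d s)" using that by (simp add: S_def)
      then obtain x where x: "solves (\<lambda>p x. poly p s * x) C x" "poly n s = port_voltage C x" "poly d s = x PortCurrent"
        unfolding port_phasor_iff by blast
      have "poly \<alpha> s * point_eval s fv x = (\<Sum>r\<in>?E. poly (\<rho> r) s * point_eval s r x)"
        by (rule row_identity_transfer[OF module_point _ \<alpha>(2)]) simp
      also have "\<dots> = 0" using x(1) by (intro sum.neutral) (simp add: solves_def)
      finally have "poly n s = 0" using nz unfolding fv[OF module_point] x(2) by simp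
      have "poly \<beta> s * point_eval s fi x = (\<Sum>r\<in>?E. poly (\<tau> r) s * point_eval s r x)"
        by (rule row_identity_transfer[OF module_point _ \<beta>(2)]) simp
      also have "\<dots> = 0" using x(1) by (intro sum.neutral) (simp add: solves_def)
      finally have "poly d s = 0" using nz unfolding fi[OF module_point] x(3) by simp
      with \<open>poly n s = 0\<close> cop show False using coprime_poly_0 by blast
    qed
    from poly_zero_cofinite[OF S this] \<alpha>(1) \<beta>(1) show False by simp
  qed
  then obtain x where x: "solves (*) C x" "port_voltage C x \<noteq> 0 \<or> x PortCurrent \<noteq> 0" by blast
  have "d * port_voltage C x - n * x PortCurrent = 0"
  proof (rule poly_zero_cofinite[OF S])
    fix s assume "s \<notin> S"
    define xs where "xs = (\<lambda>j. poly (x j) s)"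
    have "solves (\<lambda>p x. poly p s * x) C xs"
      unfolding solves_def xs_def poly_poly_eval[symmetric] using x(1) by (simp add: solves_def)
    then have "port_phasor C s (port_voltage C xs) (xs PortCurrent)" unfolding port_phasor_iff by blast
    then have "poly d s * port_voltage C xs = poly n s * xs PortCurrent" using \<open>s \<notin> S\<close> by (simp add: S_def)
    then show "poly (d * port_voltage C x - n * x PortCurrent) s = 0" by (simp add: xs_def port_voltage_def)
  qed
  then have eq: "d * port_voltage C x = n * x PortCurrent" by simp
  then have "n dvd port_voltage C x" using cop by (metis coprime_dvd_mult_right_iff dvd_triv_left)
  then obtain m where m: "port_voltage C x = n * m" by (elim dvdE)
  show ?thesis
  proof (cases "n = 0")
    \<comment> \<open>For n = 0, coprimality makes d a unit, and m is read off from the current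
      instead of the voltage.\<close>
    case True
    then have "is_unit d" using cop by simp
    then obtain d' where d': "1 = d * d'" by (elim dvdE)
    have "x PortCurrent = (x PortCurrent * d') * d" using d' by (simp add: mult_ac)
    moreover have "x PortCurrent * d' \<noteq> 0" using x(2) m True calculation by auto
    ultimately show ?thesis using x(1) m True by (intro exI[of _ x] exI[of _ "x PortCurrent * d'"]) auto
  next
    case False
    have "n * x PortCurrent = n * (m * d)" unfolding eq[symmetric] m by (simp only: mult_ac)
    then have "x PortCurrent = m * d" using False by simp
    moreover have "m \<noteq> 0" using x(2) m calculation by auto
    ultimately show ?thesis using x(1) m by (intro exI[of _ x] exI[of _ m]) (simp add: mult.commute)
  qed
qed

subsection \<open>Passivity\<close>

text \<open>Tellegen's theorem: summation by parts over the nodes. Only Kirchhoff's laws enter and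
  no element law, so it serves phasors and signals alike.\<close>

lemma tellegen:
  fixes \<phi> :: "nat \<Rightarrow> complex"
  assumes "kcl C c i"
  shows "(\<Sum>k<length (elements C). \<Sum>p<length (element_ports (elements C ! k)).
     element_voltage \<phi> (elements C ! k) p * cnj (c k p)) = (\<phi> (plus_terminal C) - \<phi> (minus_terminal C)) * cnj i"
proof -
  define B where "B = node_bound C"
  let ?P = "\<lambda>k p. element_ports (elements C ! k) ! p"
  let ?K = "length (elements C)" and ?L = "\<lambda>k. length (element_ports (elements C ! k))"
  have pick: "\<phi> m * z = (\<Sum>n<B. \<phi> n * (if m = n then z else 0))" if "m < B" for m z
    using that by (simp add: if_distrib cong: if_cong)
  have "element_voltage \<phi> (elements C ! k) p * cnj (c k p) =
      (\<Sum>n<B. \<phi> n * cnj ((if fst (?P k p) = n then c k p else 0) - (if snd (?P k p) = n then c k p else 0)))"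
    if "k < ?K" "p < ?L k" for k p
    unfolding element_voltage_def left_diff_distrib
    using node_bound_ports[OF that] by (simp add: pick B_def[symmetric] right_diff_distrib sum_subtractf if_distrib[of cnj] cong: if_cong)
  then have "(\<Sum>k<?K. \<Sum>p<?L k. element_voltage \<phi> (elements C ! k) p * cnj (c k p)) =
     (\<Sum>k<?K. \<Sum>p<?L k. \<Sum>n<B. \<phi> n * cnj ((if fst (?P k p) = n then c k p else 0) - (if snd (?P k p) = n then c k p else 0)))"
    by (intro sum.cong refl) simp
  also have "\<dots> = (\<Sum>k<?K. \<Sum>n<B. \<Sum>p<?L k. \<phi> n * cnj ((if fst (?P k p) = n then c k p else 0)
      - (if snd (?P k p) = n then c k p else 0)))"
    by (intro sum.cong refl sum.swap)
  also have "\<dots> = (\<Sum>n<B. \<Sum>k<?K. \<Sum>p<?L k. \<phi> n * cnj ((if fst (?P k p) = n then c k p else 0)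
      - (if snd (?P k p) = n then c k p else 0)))"
    by (rule sum.swap)
  also have "\<dots> = (\<Sum>n<B. \<phi> n * cnj (\<Sum>k<?K. \<Sum>p<?L k. (if fst (?P k p) = n then c k p else 0)
      - (if snd (?P k p) = n then c k p else 0)))"
    by (simp add: sum_distrib_left)
  also have "\<dots> = (\<Sum>n<B. \<phi> n * cnj ((if n = plus_terminal C then i else 0) - (if n = minus_terminal C then i else 0)))"
    using assms by (simp add: kcl_def)
  also have "\<dots> = (\<phi> (plus_terminal C) - \<phi> (minus_terminal C)) * cnj i"
    using node_bound_terminals[of C]
    by (simp add: left_diff_distrib pick B_def[symmetric] right_diff_distrib sum_subtractf if_distrib[of cnj] eq_commute cong: if_cong)
  finally show ?thesis .
qed

lemma element_phasor_passive:
  assumes "passive_element e" "phasor_law s e u i" "0 \<le> Re s"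
  shows "0 \<le> Re (\<Sum>p<length (element_ports e). u p * cnj (i p))"
proof (cases e)
  case (Resistor m n r)
  then have "u 0 * cnj (i 0) = of_real (r * (cmod (i 0))\<^sup>2)"
    using assms(2) by (simp add: mult.assoc complex_norm_square[symmetric])
  then show ?thesis using assms(1) Resistor by simp
next
  case (Inductor m n l)
  then have "u 0 * cnj (i 0) = s * of_real (l * (cmod (i 0))\<^sup>2)"
    using assms(2) by (simp add: mult.assoc complex_norm_square[symmetric])
  then show ?thesis using assms(1,3) Inductor by simp
next
  case (Capacitor m n c)
  then have "u 0 * cnj (i 0) = cnj s * of_real (c * (cmod (u 0))\<^sup>2)"
    unfolding of_real_mult complex_norm_square using assms(2) by (simp add: mult_ac)
  then show ?thesis using assms(1,3) Capacitor by simp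
next
  case (Transformer m n m' n' r)
  then show ?thesis using assms(2) by (simp add: numeral_2_eq_2 algebra_simps)
next
  case (Gyrator m n m' n' r)
  then show ?thesis using assms(2) by (simp add: numeral_2_eq_2 algebra_simps)
qed

text \<open>Tellegen's theorem reduces the power at the port to that of the single elements.\<close>

lemma port_phasor_passive:
  assumes C: "passive_one_port C" and "port_phasor C s v i" "0 \<le> Re s"
  shows "0 \<le> Re (v * cnj i)"
proof -
  obtain \<phi> c where *: "v = \<phi> (plus_terminal C) - \<phi> (minus_terminal C)" "kcl C c i"
     "\<forall>k<length (elements C). phasor_law s (elements C ! k) (element_voltage \<phi> (elements C ! k)) (c k)"
    using assms(2) unfolding port_phasor_def by blast
  have "v * cnj i = (\<Sum>k<length (elements C). \<Sum>p<length (element_ports (elements C ! k)).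
     element_voltage \<phi> (elements C ! k) p * cnj (c k p))"
    unfolding *(1) by (rule tellegen[OF *(2), symmetric])
  moreover have "0 \<le> Re (\<Sum>p<length (element_ports (elements C ! k)). element_voltage \<phi> (elements C ! k) p * cnj (c k p))"
    if "k < length (elements C)" for k
    using C that *(3) assms(3) by (intro element_phasor_passive) (auto simp: passive_one_port_def)
  ultimately show ?thesis by (simp only: Re_sum[of _ "{..<length (elements C)}"]) (rule sum_nonneg, simp only: lessThan_iff)
qed

lemma eventually_not_in_finite_shift:
  assumes "finite S"
  shows "\<forall>\<^sub>F \<epsilon> in at_right (0::real). s + complex_of_real \<epsilon> \<notin> S"
proof -
  have "\<forall>\<^sub>F \<epsilon> in at_right (0::real). \<forall>y\<in>S. s + complex_of_real \<epsilon> \<noteq> y"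
  proof (intro eventually_ball_finite assms ballI)
    fix y assume "y \<in> S"
    have "\<forall>\<^sub>F \<epsilon> in at_right (0::real). \<epsilon> \<noteq> Re (y - s)" by (rule eventually_neq_at_within)
    then show "\<forall>\<^sub>F \<epsilon> in at_right (0::real). s + complex_of_real \<epsilon> \<noteq> y"
      by (rule eventually_mono) auto
  qed
  then show ?thesis by (rule eventually_mono) blast
qed

text \<open>At almost every s the values of n and d are themselves a phasor, to which the power
  balance applies; exceptional s are reached as limits from the right.\<close>

lemma port_relation_positive_real:
  assumes C: "passive_one_port C" and rel: "port_relation C n d" and s: "0 < Re s"
  shows "0 \<le> Re (poly n s * cnj (poly d s))"
proof (rule tendsto_lowerbound[of "\<lambda>\<epsilon>. Re (poly n (s + of_real \<epsilon>) * cnj (poly d (s + of_real \<epsilon>)))" _ "at_right 0"])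
  define S where "S = {s. \<not> (\<forall>v i. port_phasor C s v i \<longleftrightarrow> poly d s * v = poly n s * i)}"
  have S: "finite S" using rel by (simp add: port_relation_def S_def)
  have "((\<lambda>\<epsilon>. s + complex_of_real \<epsilon>) \<longlongrightarrow> s + of_real 0) (at_right 0)" by (intro tendsto_intros)
  then have "((\<lambda>\<epsilon>. s + complex_of_real \<epsilon>) \<longlongrightarrow> s) (at_right 0)" by simp
  then show "((\<lambda>\<epsilon>. Re (poly n (s + of_real \<epsilon>) * cnj (poly d (s + of_real \<epsilon>)))) \<longlongrightarrow> Re (poly n s * cnj (poly d s))) (at_right 0)"
    by (intro tendsto_intros)
  show "\<forall>\<^sub>F \<epsilon> in at_right 0. 0 \<le> Re (poly n (s + of_real \<epsilon>) * cnj (poly d (s + of_real \<epsilon>)))"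
    using eventually_not_in_finite_shift[OF S, of s] eventually_at_right_less[of 0]
  proof eventually_elim
    case (elim \<epsilon>)
    then have "port_phasor C (s + of_real \<epsilon>) (poly n (s + of_real \<epsilon>)) (poly d (s + of_real \<epsilon>))"
      by (simp add: S_def)
    then show ?case by (rule port_phasor_passive[OF C]) (use s elim in simp)
  qed
qed simp

text \<open>Element values are real, so at a real frequency the conjugate of a phasor is a phasor.
  With positivity this keeps the loop denominator from vanishing identically.\<close>

lemma port_relation_real:
  assumes rel: "port_relation C n d"
  shows "finite {r::real. Im (poly n (of_real r) * cnj (poly d (of_real r))) \<noteq> 0}"
proof -
  define S where "S = {s. \<not> (\<forall>v i. port_phasor C s v i \<longleftrightarrow> poly d s * v = poly n s * i)}"
  have S: "finite S" using rel by (simp add: port_relation_def S_def)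
  have "Im (poly n (of_real r) * cnj (poly d (of_real r))) = 0" if r: "complex_of_real r \<notin> S" for r
  proof -
    let ?n = "poly n (of_real r)" and ?d = "poly d (of_real r)"
    have "port_phasor C (of_real r) ?n ?d" using r by (simp add: S_def)
    then obtain \<phi> c where *: "?n = \<phi> (plus_terminal C) - \<phi> (minus_terminal C)" "kcl C c ?d"
       "\<forall>k<length (elements C). phasor_law (of_real r) (elements C ! k) (element_voltage \<phi> (elements C ! k)) (c k)"
      unfolding port_phasor_def by blast
    have law: "phasor_law (of_real r) e (\<lambda>p. cnj (u p)) (\<lambda>p. cnj (i p))" if "phasor_law (of_real r) e u i" for e u i
      using that by (cases e) auto
    have "kcl C (\<lambda>k p. cnj (c k p)) (cnj ?d)"
      unfolding kcl_def
    proof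
      fix n
      show "(\<Sum>k<length (elements C). \<Sum>p<length (element_ports (elements C ! k)).
        (if fst (element_ports (elements C ! k) ! p) = n then cnj (c k p) else 0)
      - (if snd (element_ports (elements C ! k) ! p) = n then cnj (c k p) else 0))
     = (if n = plus_terminal C then cnj ?d else 0) - (if n = minus_terminal C then cnj ?d else 0)"
        using arg_cong[OF *(2)[unfolded kcl_def, rule_format, of n], of cnj]
        by (simp add: if_distrib[of cnj] cong: if_cong)
    qed
    moreover have "cnj ?n = cnj (\<phi> (plus_terminal C)) - cnj (\<phi> (minus_terminal C))" by (simp add: *(1))
    moreover have "\<forall>k<length (elements C). phasor_law (of_real r) (elements C ! k)
        (element_voltage (\<lambda>n. cnj (\<phi> n)) (elements C ! k)) (\<lambda>p. cnj (c k p))"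
    proof (intro allI impI)
      fix k assume "k < length (elements C)"
      then have "phasor_law (of_real r) (elements C ! k) (\<lambda>p. cnj (element_voltage \<phi> (elements C ! k) p)) (\<lambda>p. cnj (c k p))"
        using *(3) law by blast
      then show "phasor_law (of_real r) (elements C ! k) (element_voltage (\<lambda>n. cnj (\<phi> n)) (elements C ! k)) (\<lambda>p. cnj (c k p))"
        by (simp add: element_voltage_def[abs_def])
    qed
    ultimately have "port_phasor C (of_real r) (cnj ?n) (cnj ?d)"
      unfolding port_phasor_def
      by (intro exI[of _ "\<lambda>n. cnj (\<phi> n)"] exI[of _ "\<lambda>k p. cnj (c k p)"]) simp
    then have "?d * cnj ?n = ?n * cnj ?d" using r by (simp add: S_def)
    then have "cnj (?n * cnj ?d) = ?n * cnj ?d" by (simp add: mult.commute)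
    then show ?thesis by (metis cnj.sel(2) equal_neg_zero)
  qed
  then have "{r::real. Im (poly n (of_real r) * cnj (poly d (of_real r))) \<noteq> 0} \<subseteq> complex_of_real -` S" by auto
  moreover have "finite (complex_of_real -` S)" by (intro finite_vimageI S) (simp add: inj_on_def)
  ultimately show ?thesis by (rule finite_subset)
qed

section \<open>Stored energy and hidden modes\<close>

fun element_energy :: "element \<Rightarrow> complex \<Rightarrow> complex \<Rightarrow> real" where
  "element_energy (Inductor _ _ l) u i = l / 2 * (cmod i)\<^sup>2"
| "element_energy (Capacitor _ _ c) u i = c / 2 * (cmod u)\<^sup>2"
| "element_energy _ u i = 0"

lemma element_energy_nonneg: "passive_element e \<Longrightarrow> 0 \<le> element_energy e u i"
  by (cases e) auto

lemma act_linear_monomial: "act [:0, c:] f = scale c (deriv_signal f)"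
  by (simp add: act_pCons deriv_signal_0 deriv_signal_scale scale_zero)

text \<open>Inductors and capacitors store what they receive, resistors dissipate, and transformers
  and gyrators pass the power on between their ports.\<close>

lemma element_energy_deriv:
  assumes e: "passive_element e" and law: "module_law act e u i" and t: "0 < t"
  shows "\<exists>E'. ((\<lambda>t. element_energy e (val (u 0) t) (val (i 0) t)) has_real_derivative E') (at t) \<and>
     E' \<le> Re (\<Sum>p<length (element_ports e). val (u p) t * cnj (val (i p) t))"
proof (cases e)
  case (Resistor m n r)
  then have "val (u 0) t = of_real r * val (i 0) t" using law by (simp add: act_const)
  then have "val (u 0) t * cnj (val (i 0) t) = of_real (r * (cmod (val (i 0) t))\<^sup>2)"
    by (simp add: mult.assoc complex_norm_square[symmetric])
  then show ?thesis using e Resistor by (intro exI[of _ 0]) simp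
next
  case (Inductor m n l)
  then have u: "val (u 0) t = of_real l * val (deriv_signal (i 0)) t"
    using law by (simp add: act_linear_monomial)
  have "((\<lambda>t. l / 2 * (cmod (val (i 0) t))\<^sup>2) has_real_derivative
      l / 2 * (2 * Re (cnj (val (i 0) t) * val (deriv_signal (i 0)) t))) (at t)"
    by (intro DERIV_cmult norm_sq_deriv val_deriv_signal t)
  moreover have "l / 2 * (2 * Re (cnj (val (i 0) t) * val (deriv_signal (i 0)) t)) = Re (val (u 0) t * cnj (val (i 0) t))"
    unfolding u by (simp add: algebra_simps)
  ultimately show ?thesis using Inductor by auto
next
  case (Capacitor m n c)
  then have i: "val (i 0) t = of_real c * val (deriv_signal (u 0)) t"
    using law by (simp add: act_linear_monomial)
  have "((\<lambda>t. c / 2 * (cmod (val (u 0) t))\<^sup>2) has_real_derivative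
      c / 2 * (2 * Re (cnj (val (u 0) t) * val (deriv_signal (u 0)) t))) (at t)"
    by (intro DERIV_cmult norm_sq_deriv val_deriv_signal t)
  moreover have "c / 2 * (2 * Re (cnj (val (u 0) t) * val (deriv_signal (u 0)) t)) = Re (val (u 0) t * cnj (val (i 0) t))"
    unfolding i by (simp add: algebra_simps)
  ultimately show ?thesis using Capacitor by auto
next
  case (Transformer m n m' n' r)
  then have "val (u 0) t = of_real r * val (u 1) t" "val (i 1) t = - of_real r * val (i 0) t"
    using law by (simp_all add: act_const)
  then show ?thesis using Transformer by (intro exI[of _ 0]) (simp add: numeral_2_eq_2 algebra_simps)
next
  case (Gyrator m n m' n' r)
  then have "val (u 0) t = - of_real r * val (i 1) t" "val (u 1) t = of_real r * val (i 0) t"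
    using law by (simp_all add: act_const)
  then show ?thesis using Gyrator by (intro exI[of _ 0]) (simp add: numeral_2_eq_2 algebra_simps)
qed

lemma kcl_val:
  assumes "kcl C c i"
  shows "kcl C (\<lambda>k p. val (c k p) t) (val i t)"
  unfolding kcl_def
proof
  fix n
  show "(\<Sum>k<length (elements C). \<Sum>p<length (element_ports (elements C ! k)).
        (if fst (element_ports (elements C ! k) ! p) = n then val (c k p) t else 0)
      - (if snd (element_ports (elements C ! k) ! p) = n then val (c k p) t else 0))
     = (if n = plus_terminal C then val i t else 0) - (if n = minus_terminal C then val i t else 0)"
    using arg_cong[OF assms[unfolded kcl_def, rule_format, of n], of "\<lambda>f. val f t"]
    by (simp add: if_distrib[of "\<lambda>f. val f t"] cong: if_cong)
qed

lemma signal_energy: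
  assumes C: "passive_one_port C" and x: "solves act C x"
  shows "\<exists>E. (\<forall>t. 0 \<le> E t) \<and> (\<forall>t>0. \<exists>E'. (E has_real_derivative E') (at t) \<and>
     E' \<le> Re (val (port_voltage C x) t * cnj (val (x PortCurrent) t)))"
proof -
  let ?e = "\<lambda>k. elements C ! k" and ?K = "length (elements C)"
  define u where "u k = element_voltage (\<lambda>n. x (Potential n)) (?e k)" for k
  define i where "i k = (\<lambda>p. x (Current k p))" for k
  have kcl: "kcl C i (x PortCurrent)" and law: "\<And>k. k < ?K \<Longrightarrow> module_law act (?e k) (u k) (i k)"
    using x unfolding solves_iff[OF signal.module_axioms] u_def i_def by auto
  have pass: "passive_element (?e k)" if "k < ?K" for k using C that by (simp add: passive_one_port_def)
  define E where "E t = (\<Sum>k<?K. element_energy (?e k) (val (u k 0) t) (val (i k 0) t))" for t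
  have "\<exists>E'. (E has_real_derivative E') (at t) \<and> E' \<le> Re (val (port_voltage C x) t * cnj (val (x PortCurrent) t))"
    if t: "0 < t" for t
  proof -
    have "\<forall>k\<in>{..<?K}. \<exists>E'. ((\<lambda>t. element_energy (?e k) (val (u k 0) t) (val (i k 0) t)) has_real_derivative E') (at t) \<and>
        E' \<le> Re (\<Sum>p<length (element_ports (?e k)). val (u k p) t * cnj (val (i k p) t))"
      using element_energy_deriv[OF pass law t] by simp
    from bchoice[OF this] obtain E' where E': "\<forall>k\<in>{..<?K}. ((\<lambda>t. element_energy (?e k) (val (u k 0) t) (val (i k 0) t)) has_real_derivative E' k) (at t) \<and>
        E' k \<le> Re (\<Sum>p<length (element_ports (?e k)). val (u k p) t * cnj (val (i k p) t))" by blast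
    have "(E has_real_derivative (\<Sum>k<?K. E' k)) (at t)"
      unfolding E_def using E' by (intro DERIV_sum) simp
    moreover have "(\<Sum>k<?K. E' k) \<le> (\<Sum>k<?K. Re (\<Sum>p<length (element_ports (?e k)). val (u k p) t * cnj (val (i k p) t)))"
      using E' by (intro sum_mono) simp
    moreover have "(\<Sum>k<?K. \<Sum>p<length (element_ports (?e k)). val (u k p) t * cnj (val (i k p) t))
        = val (port_voltage C x) t * cnj (val (x PortCurrent) t)"
      using tellegen[OF kcl_val[OF kcl, of t], of "\<lambda>n. val (x (Potential n)) t"]
      by (simp add: u_def element_voltage_def port_voltage_def)
    ultimately show ?thesis by (metis Re_sum)
  qed
  moreover have "0 \<le> E t" for t unfolding E_def by (intro sum_nonneg element_energy_nonneg pass) simp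
  ultimately show ?thesis by blast
qed

lemma row_eval_act_poly: "row_eval act r (\<lambda>j. act (x j) w) = act (poly_eval r x) w"
  by (induction r) (auto simp: act_add_left)

lemma row_eval_act_right: "row_eval act r (\<lambda>j. act q (x j)) = act q (row_eval act r x)"
  by (induction r) (auto simp: act_add_right mult.commute)

lemma row_eval_act_diff: "row_eval act r (\<lambda>j. x j - y j) = row_eval act r x - row_eval act r y"
  by (induction r) (auto simp: signal.scale_right_diff_distrib)

text \<open>An undamped or unstable mode that is not controllable from the port could be combined with a
  controllable motion into a trajectory that delivers power forever.\<close>

lemma no_hidden_mode:
  assumes C: "passive_one_port C" and rel: "port_relation C n d" and x: "solves act C x"
    and mode: "act d (port_voltage C x) - act n (x PortCurrent) = scale c (exp_signal s)"
    and s: "0 \<le> Re s"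
  shows "c = 0"
proof (rule ccontr)
  assume c: "c \<noteq> 0"
  have cop: "coprime n d" using rel by (simp add: port_relation_def)
  \<comment> \<open>If the expression vanished for \<rho> = 1 and for \<rho> = 2, both d and n would
    vanish at s.\<close>
  have "\<exists>\<rho>>0. poly d s * of_real \<rho> + poly n s \<noteq> 0"
  proof (rule ccontr)
    assume "\<not> ?thesis"
    then have all: "poly d s * of_real \<rho> + poly n s = 0" if "0 < \<rho>" for \<rho> using that by blast
    have 12: "poly d s * of_real 1 + poly n s = 0" "poly d s * of_real 2 + poly n s = 0" by (rule all, simp)+
    have "poly d s = (poly d s * of_real 2 + poly n s) - (poly d s * of_real 1 + poly n s)" by simp
    then have "poly d s = 0" unfolding 12 by simp
    with 12(1) have "poly n s = 0 \<and> poly d s = 0" by simp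
    then show False using coprime_poly_0[OF cop] by blast
  qed
  then obtain \<rho> where \<rho>: "0 < \<rho>" "poly d s * of_real \<rho> + poly n s \<noteq> 0" by blast
  \<comment> \<open>The port signals a exp(s t) and b exp(s t) with a = - \<rho> b are those of a
    negative resistance: since Re s >= 0, at least the power \<rho> |b|^2 is extracted at all times.
    The scale of b makes their defect in the port relation exactly the hidden mode.\<close>
  define b where "b = - c / (poly d s * of_real \<rho> + poly n s)"
  define a where "a = - of_real \<rho> * b"
  have b: "b \<noteq> 0" using c \<rho> by (simp add: b_def)
  have ab: "poly d s * a - poly n s * b = c"
  proof -
    have "poly d s * a - poly n s * b = - b * (poly d s * of_real \<rho> + poly n s)" by (simp add: a_def algebra_simps)
    then show ?thesis using \<rho> by (simp add: b_def)
  qed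
  define V where "V = port_voltage C x - scale a (exp_signal s)"
  define I where "I = x PortCurrent - scale b (exp_signal s)"
  have "act d V - act n I = (act d (port_voltage C x) - act n (x PortCurrent))
      - (act d (scale a (exp_signal s)) - act n (scale b (exp_signal s)))"
    unfolding V_def I_def by (simp add: signal.scale_right_diff_distrib)
  also have "\<dots> = 0"
    unfolding mode act_scale_right act_exp_signal scale_scale ab[symmetric]
    by (rule signal_eqI) (simp add: algebra_simps)
  finally have VI: "act d V = act n I" by simp
  \<comment> \<open>Bezout's identity turns d V = n I into the image form V = n w', I = d
    w'.\<close>
  obtain p q where pq: "p * n + q * d = 1"
    using cop bezout_coefficients_fst_snd[of n d] by (metis coprime_iff_gcd_eq_1)
  define w' where "w' = act p V + act q I"
  have nw: "act n w' = V"
  proof -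
    have "act n w' = act p (act n V) + act q (act n I)" unfolding w'_def act_add_right by (simp only: act_commute[of n])
    also have "\<dots> = act (p * n + q * d) V" unfolding VI[symmetric] by (simp only: act_add_left act_mult)
    finally show ?thesis by (simp add: pq)
  qed
  have dw: "act d w' = I"
  proof -
    have "act d w' = act p (act d V) + act q (act d I)" unfolding w'_def act_add_right by (simp only: act_commute[of d])
    also have "\<dots> = act (p * n + q * d) I" unfolding VI by (simp only: act_add_left act_mult)
    finally show ?thesis by (simp add: pq)
  qed
  obtain xp m where xp: "m \<noteq> 0" "solves (*) C xp" "port_voltage C xp = m * n" "xp PortCurrent = m * d"
    using port_relation_image[OF rel] by blast
  obtain w where w: "act m w = w'" using act_surj[OF xp(1)] by blast
  \<comment> \<open>Subtracting the controllable motion from x leaves the power extracting signals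
    at the port.\<close>
  define X where "X j = x j - act (xp j) w" for j
  have X: "solves act C X"
    using x xp(2) unfolding solves_def X_def row_eval_act_diff row_eval_act_poly by simp
  have "port_voltage C X = port_voltage C x - act (port_voltage C xp) w"
    unfolding port_voltage_def X_def by (simp add: signal.scale_left_diff_distrib)
  also have "act (port_voltage C xp) w = V" unfolding xp(3) mult.commute[of m] act_mult w nw ..
  finally have XV: "port_voltage C X = scale a (exp_signal s)" by (simp add: V_def)
  have "act (xp PortCurrent) w = I" unfolding xp(4) mult.commute[of m] act_mult w dw ..
  then have XI: "X PortCurrent = scale b (exp_signal s)" by (simp add: X_def I_def)
  obtain E where E: "\<And>t. 0 \<le> E t" "\<And>t. 0 < t \<Longrightarrow> \<exists>E'. (E has_real_derivative E') (at t) \<and>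
     E' \<le> Re (val (port_voltage C X) t * cnj (val (X PortCurrent) t))"
    using signal_energy[OF C X] by blast
  define k where "k = \<rho> * (cmod b)\<^sup>2"
  have k: "0 < k" using \<rho> b by (simp add: k_def)
  have power: "Re (val (port_voltage C X) t * cnj (val (X PortCurrent) t)) \<le> - k" if t: "0 < t" for t
  proof -
    have "val (port_voltage C X) t * cnj (val (X PortCurrent) t)
        = (a * cnj b) * (exp (s * of_real t) * cnj (exp (s * of_real t)))"
      using t by (simp add: XV XI val_exp_signal mult_ac)
    also have "a * cnj b = - of_real k"
      unfolding k_def of_real_mult complex_norm_square a_def by (simp add: mult_ac)
    also have "exp (s * of_real t) * cnj (exp (s * of_real t)) = of_real ((exp (Re s * t))\<^sup>2)"
      unfolding complex_norm_square[symmetric] by simp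
    finally have "Re (val (port_voltage C X) t * cnj (val (X PortCurrent) t)) = - (k * (exp (Re s * t))\<^sup>2)" by simp
    moreover have "1 \<le> (exp (Re s * t))\<^sup>2" using s t by (simp add: one_le_power)
    ultimately show ?thesis using mult_left_mono[of 1 "(exp (Re s * t))\<^sup>2" k] k by simp
  qed
  \<comment> \<open>By this time the extracted energy k (T - 1) exceeds the energy stored at time 1
    by 1.\<close>
  define T where "T = 1 + (E 1 + 1) / k"
  have T: "1 \<le> T" using k E(1)[of 1] by (simp add: T_def)
  have "E T + k * T \<le> E 1 + k * 1"
  proof (rule DERIV_nonpos_imp_nonincreasing[OF T])
    fix t assume "1 \<le> t" "t \<le> T"
    then have t: "0 < t" by simp
    obtain E' where E': "(E has_real_derivative E') (at t)" "E'
        \<le> Re (val (port_voltage C X) t * cnj (val (X PortCurrent) t))"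
      using E(2)[OF t] by blast
    have "((\<lambda>t. E t + k * t) has_real_derivative E' + k * 1) (at t)"
      by (intro DERIV_add E'(1) DERIV_cmult DERIV_ident)
    moreover have "E' + k * 1 \<le> 0" using E'(2) power[OF t] by simp
    ultimately show "\<exists>y. ((\<lambda>t. E t + k * t) has_real_derivative y) (at t) \<and> y \<le> 0" by blast
  qed
  moreover have "k * T = k + E 1 + 1" using k by (simp add: T_def algebra_simps)
  ultimately show False using E(1)[of T] by simp
qed

text \<open>Roots s of the annihilator with nonnegative real part are removed one at a time. With
  \<alpha> = (D - s) \<beta>, the defect multiplied by \<beta> is a multiple of exp(s t); it is also
  the defect of the trajectory \<beta> x, so passivity makes it 0.\<close>

lemma port_relation_hurwitz:
  assumes C: "passive_one_port C" and rel: "port_relation C n d"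
  shows "\<exists>\<alpha>. hurwitz \<alpha> \<and> (\<forall>x. solves act C x \<longrightarrow> act \<alpha> (act d (port_voltage C x) - act n (x PortCurrent)) = 0)"
proof -
  define e where "e x = act d (port_voltage C x) - act n (x PortCurrent)" for x
  have ind: "\<exists>\<alpha>. hurwitz \<alpha> \<and> (\<forall>x. solves act C x \<longrightarrow> act \<alpha> (e x) = 0)"
    if "\<alpha> \<noteq> 0" "\<forall>x. solves act C x \<longrightarrow> act \<alpha> (e x) = 0" for \<alpha>
    using that
  proof (induction "degree \<alpha>" arbitrary: \<alpha> rule: less_induct)
    case less
    show ?case
    proof (cases "hurwitz \<alpha>")
      case False
      then obtain s where s: "poly \<alpha> s = 0" "0 \<le> Re s" using less(2) by (auto simp: hurwitz_def not_less)
      then obtain \<beta> where \<beta>: "\<alpha> = [:-s, 1:] * \<beta>" by (metis dvdE poly_eq_0_iff_dvd)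
      have \<beta>0: "\<beta> \<noteq> 0" using less(2) \<beta> by auto
      have "act \<beta> (e x) = 0" if x: "solves act C x" for x
      proof -
        have "act [:-s, 1:] (act \<beta> (e x)) = 0" using less(3) x by (simp only: \<beta> act_mult)
        then obtain c where c: "act \<beta> (e x) = scale c (exp_signal s)" by (rule kernel_linear)
        define X where "X j = act \<beta> (x j)" for j
        have "solves act C X" using x unfolding solves_def X_def row_eval_act_right by simp
        moreover have "act d (port_voltage C X) - act n (X PortCurrent) = act \<beta> (e x)"
          unfolding e_def X_def port_voltage_def
          by (simp only: signal.scale_right_diff_distrib act_commute[of \<beta>])
        ultimately have "c = 0" using no_hidden_mode[OF C rel _ _ s(2)] c by metis
        then show ?thesis using c by (simp add: scale_zero)
      qed
      moreover have "degree \<beta> < degree \<alpha>" unfolding \<beta> using \<beta>0 by (subst degree_mult_eq) auto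
      ultimately show ?thesis using less(1) \<beta>0 by blast
    qed (use less(3) in blast)
  qed
  obtain \<alpha> where "\<alpha> \<noteq> 0" "\<forall>x. solves act C x \<longrightarrow> act \<alpha> (e x) = 0"
    using port_relation_eliminated[OF rel] unfolding e_def by blast
  from ind[OF this] show ?thesis unfolding e_def .
qed

section \<open>Time trajectories as signals\<close>

abbreviation mollify_real :: "(real \<Rightarrow> real) \<Rightarrow> (real \<Rightarrow> real) \<Rightarrow> signal" where
  "mollify_real b f \<equiv> mollify b (\<lambda>t. complex_of_real (f t))"

lemma continuous_of_real: "continuous_on S f \<Longrightarrow> continuous_on S (\<lambda>t. complex_of_real (f t))"
  by (rule continuous_on_of_real)

lemma mollify_real_deriv_within:
  assumes b: "bump \<epsilon> b" "\<epsilon> \<le> 1" and f: "continuous_on {0..} f" "continuous_on {0..} f'"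
    and d: "\<And>t. 0 \<le> t \<Longrightarrow> (f has_real_derivative f' t) (at t within {0..})"
  shows "deriv_signal (mollify_real b f) = mollify_real b f'"
proof (rule mollify_deriv[OF b continuous_of_real[OF f(1)] continuous_of_real[OF f(2)]])
  fix t :: real assume t: "0 < t"
  have "at t within {0..} = at t" using t by (intro at_within_interior) simp
  then have "(f has_real_derivative f' t) (at t)" using d[of t] t by simp
  then show "((\<lambda>t. complex_of_real (f t)) has_vector_derivative of_real (f' t)) (at t)"
    by (rule has_vector_derivative_of_real)
qed

text \<open>Mollification is linear and commutes with differentiation, so every law of the circuit
  passes to the mollified signals unchanged.\<close>

lemma port_trajectory_mollified:
  assumes b: "bump \<epsilon> b" "\<epsilon> \<le> 1" and traj: "port_trajectory C v i" and i: "continuous_on {0..} i"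
    and C: "passive_one_port C"
  shows "\<exists>x. solves act C x \<and> port_voltage C x = mollify_real b v \<and> x PortCurrent = mollify_real b i"
proof -
  obtain \<phi> c where \<phi>: "\<And>n. continuous_on {0..} (\<phi> n)" and c: "\<And>k p. continuous_on {0..} (c k p)"
    and v: "\<And>t. 0 \<le> t \<Longrightarrow> v t = \<phi> (plus_terminal C) t - \<phi> (minus_terminal C) t"
    and kcl: "\<And>t. 0 \<le> t \<Longrightarrow> kcl C (\<lambda>k p. c k p t) (i t)"
    and law: "\<And>k. k < length (elements C) \<Longrightarrow> time_law (elements C ! k)
          (\<lambda>p t. element_voltage (\<lambda>n. \<phi> n t) (elements C ! k) p) (c k)"
    using traj unfolding port_trajectory_def by auto
  define x where "x j = (case j of Potential n \<Rightarrow> mollify_real b (\<phi> n) | Current k p \<Rightarrow> mollify_real b (c k p)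
     | PortCurrent \<Rightarrow> mollify_real b i)" for j
  have diff: "mollify_real b f - mollify_real b g = mollify_real b (\<lambda>t. f t - g t)"
    if "continuous_on {0..} f" "continuous_on {0..} g" for f g
    using mollify_diff[OF b continuous_of_real[OF that(1)] continuous_of_real[OF that(2)]] by simp
  have scaled: "mollify_real b (\<lambda>t. r * f t) = scale (of_real r) (mollify_real b f)" if "continuous_on {0..} f" for f r
    using mollify_scale[OF b continuous_of_real[OF that], of "of_real r"] by simp
  have cong: "mollify_real b f = mollify_real b g" if "\<And>t. 0 \<le> t \<Longrightarrow> f t = g t" for f g
    using that by (intro mollify_cong) simp
  have if_m: "(if A then mollify_real b f else 0) = mollify_real b (\<lambda>t. if A then f t else 0)" for A f
    by (simp add: mollify_0[OF b])
  have if_c: "continuous_on {0..} (\<lambda>t. if A then f t else 0)" if "continuous_on {0..} f" for A and f :: "real \<Rightarrow> real"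
    using that by (cases A) auto
  have msum: "(\<Sum>j\<in>J. mollify_real b (f j)) = mollify_real b (\<lambda>t. \<Sum>j\<in>J. f j t)"
    if "\<And>j. j \<in> J \<Longrightarrow> continuous_on {0..} (f j)" for J :: "nat set" and f
    using mollify_sum[OF b, of J "\<lambda>j t. complex_of_real (f j t)"] that continuous_of_real by simp
  have "kcl C (\<lambda>k p. x (Current k p)) (x PortCurrent)"
    unfolding kcl_def
  proof
    fix n
    let ?P = "\<lambda>k p. element_ports (elements C ! k) ! p"
    let ?D = "\<lambda>k p t. (if fst (?P k p) = n then c k p t else 0) - (if snd (?P k p) = n then c k p t else 0)"
    have cD: "continuous_on {0..} (?D k p)" for k p by (intro continuous_on_diff if_c c)
    have "(\<Sum>k<length (elements C). \<Sum>p<length (element_ports (elements C ! k)).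
        (if fst (?P k p) = n then x (Current k p) else 0) - (if snd (?P k p) = n then x (Current k p) else 0))
      = (\<Sum>k<length (elements C). \<Sum>p<length (element_ports (elements C ! k)). mollify_real b (?D k p))"
      unfolding x_def circuit_var.case if_m by (intro sum.cong refl diff if_c c)
    also have "\<dots> = (\<Sum>k<length (elements C). mollify_real b (\<lambda>t. \<Sum>p<length (element_ports (elements C ! k)). ?D k p t))"
      by (intro sum.cong refl msum cD)
    also have "\<dots> = mollify_real b (\<lambda>t. \<Sum>k<length (elements C). \<Sum>p<length (element_ports (elements C ! k)). ?D k p t)"
      by (intro msum continuous_on_sum cD)
    also have "\<dots> = mollify_real b (\<lambda>t. (if n = plus_terminal C then i t else 0) - (if n = minus_terminal C then i t else 0))"
      by (rule cong) (use kcl in \<open>simp add: kcl_def\<close>)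
    also have "\<dots> = (if n = plus_terminal C then x PortCurrent else 0) - (if n = minus_terminal C then x PortCurrent else 0)"
      unfolding x_def circuit_var.case if_m by (intro diff[symmetric] if_c i)
    finally show "(\<Sum>k<length (elements C). \<Sum>p<length (element_ports (elements C ! k)).
        (if fst (?P k p) = n then x (Current k p) else 0) - (if snd (?P k p) = n then x (Current k p) else 0))
      = (if n = plus_terminal C then x PortCurrent else 0) - (if n = minus_terminal C then x PortCurrent else 0)" .
  qed
  moreover have "module_law act (elements C ! k) (element_voltage (\<lambda>n. x (Potential n)) (elements C ! k)) (\<lambda>p. x (Current k p))"
    if k: "k < length (elements C)" for k
  proof -
    let ?e = "elements C ! k"
    define u where "u p t = element_voltage (\<lambda>n. \<phi> n t) ?e p" for p t
    have cu: "continuous_on {0..} (u p)" for p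
      unfolding u_def element_voltage_def by (intro continuous_on_diff \<phi>)
    have xu: "element_voltage (\<lambda>n. x (Potential n)) ?e = (\<lambda>p. mollify_real b (u p))"
      unfolding u_def element_voltage_def x_def circuit_var.case by (intro ext diff \<phi>)
    have xc: "(\<lambda>p. x (Current k p)) = (\<lambda>p. mollify_real b (c k p))" by (simp add: x_def)
    have law': "time_law ?e u (c k)" using law[OF k] unfolding u_def .
    have pass: "passive_element ?e" using C k by (simp add: passive_one_port_def)
    show ?thesis
      unfolding xu xc
    proof (cases ?e)
      case (Resistor m n r)
      have "mollify_real b (u 0) = scale (of_real r) (mollify_real b (c k 0))"
        unfolding scaled[OF c, symmetric] by (rule cong) (use law' Resistor in simp)
      then show "module_law act ?e (\<lambda>p. mollify_real b (u p)) (\<lambda>p. mollify_real b (c k p))"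
        using Resistor by (simp add: act_const)
    next
      case (Inductor m n l)
      have "deriv_signal (mollify_real b (c k 0)) = mollify_real b (\<lambda>t. u 0 t / l)"
        by (rule mollify_real_deriv_within[OF b c])
           (use law' Inductor pass in \<open>auto intro!: continuous_on_divide cu\<close>)
      also have "\<dots> = scale (of_real (1 / l)) (mollify_real b (u 0))"
        using scaled[OF cu, of "1 / l" 0] by simp
      finally show "module_law act ?e (\<lambda>p. mollify_real b (u p)) (\<lambda>p. mollify_real b (c k p))"
        using Inductor pass by (simp add: act_linear_monomial scale_scale scale_one)
    next
      case (Capacitor m n cc)
      have "deriv_signal (mollify_real b (u 0)) = mollify_real b (\<lambda>t. c k 0 t / cc)"
        by (rule mollify_real_deriv_within[OF b cu])
           (use law' Capacitor pass in \<open>auto intro!: continuous_on_divide c\<close>)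
      also have "\<dots> = scale (of_real (1 / cc)) (mollify_real b (c k 0))"
        using scaled[OF c, of "1 / cc" k 0] by simp
      finally show "module_law act ?e (\<lambda>p. mollify_real b (u p)) (\<lambda>p. mollify_real b (c k p))"
        using Capacitor pass by (simp add: act_linear_monomial scale_scale scale_one)
    next
      case (Transformer m n m' n' r)
      have "mollify_real b (u 0) = scale (of_real r) (mollify_real b (u 1))"
        unfolding scaled[OF cu, symmetric] by (rule cong) (use law' Transformer in simp)
      moreover have "mollify_real b (c k 1) = scale (of_real (- r)) (mollify_real b (c k 0))"
        unfolding scaled[OF c, symmetric] by (rule cong) (use law' Transformer in simp)
      ultimately show "module_law act ?e (\<lambda>p. mollify_real b (u p)) (\<lambda>p. mollify_real b (c k p))"
        using Transformer by (simp add: act_const)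
    next
      case (Gyrator m n m' n' r)
      have "mollify_real b (u 0) = scale (of_real (- r)) (mollify_real b (c k 1))"
        unfolding scaled[OF c, symmetric] by (rule cong) (use law' Gyrator in simp)
      moreover have "mollify_real b (u 1) = scale (of_real r) (mollify_real b (c k 0))"
        unfolding scaled[OF c, symmetric] by (rule cong) (use law' Gyrator in simp)
      ultimately show "module_law act ?e (\<lambda>p. mollify_real b (u p)) (\<lambda>p. mollify_real b (c k p))"
        using Gyrator by (simp add: act_const)
    qed
  qed
  ultimately have "solves act C x" unfolding solves_iff[OF signal.module_axioms] by blast
  moreover have "port_voltage C x = mollify_real b v"
  proof -
    have "port_voltage C x = mollify_real b (\<lambda>t. \<phi> (plus_terminal C) t - \<phi> (minus_terminal C) t)"
      unfolding port_voltage_def x_def circuit_var.case by (rule diff[OF \<phi> \<phi>])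
    also have "\<dots> = mollify_real b v" by (rule cong) (simp add: v)
    finally show ?thesis .
  qed
  moreover have "x PortCurrent = mollify_real b i" by (simp add: x_def)
  ultimately show ?thesis by blast
qed

subsection \<open>Small gain\<close>

lemma norm_add_sq_le:
  assumes "0 < (\<eta>::real)"
  shows "(cmod (a + b))\<^sup>2 \<le> (1 + \<eta>) * (cmod a)\<^sup>2 + (1 + 1 / \<eta>) * (cmod b)\<^sup>2"
proof -
  have "(cmod (a + b))\<^sup>2 \<le> (cmod a + cmod b)\<^sup>2" by (intro power_mono norm_triangle_ineq) simp
  also have "\<dots> = (cmod a)\<^sup>2 + (cmod b)\<^sup>2 + 2 * (cmod a * cmod b)" by (simp add: power2_sum)
  also have "2 * (cmod a * cmod b) \<le> \<eta> * (cmod a)\<^sup>2 + (cmod b)\<^sup>2 / \<eta>"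
    by (rule weighted_arith_geo_mean[OF assms])
  finally show ?thesis by (simp add: algebra_simps)
qed

text \<open>A weak solution of \<open>H(D) v + G(D) g = 0\<close> is the forced response to \<open>g\<close> up to a decaying
  function; the response inherits the gain of \<open>G / H\<close> in the mean and, up to a vanishing part, the
  gain at infinite frequency pointwise.\<close>

lemma weak_response:
  assumes v: "continuous_on {0..} v" and g: "continuous_on {0..} g" and H: "hurwitz H"
    and bound: "\<And>\<omega>::real. cmod (poly G (\<i> * of_real \<omega>)) \<le> \<gamma> * cmod (poly H (\<i> * of_real \<omega>))"
    and \<gamma>: "0 \<le> \<gamma>"
    and eq: "\<And>\<epsilon> b. 0 < \<epsilon> \<Longrightarrow> \<epsilon> \<le> 1 \<Longrightarrow> bump \<epsilon> b \<Longrightarrow> act H (mollify b v) + act G (mollify b g) = 0"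
  shows "\<exists>B. \<forall>\<eta>>0. \<forall>T\<ge>0. Int0 (\<lambda>t. (cmod (v t))\<^sup>2) T \<le>
            (1 + \<eta>) * \<gamma>\<^sup>2 * Int0 (\<lambda>t. (cmod (g t))\<^sup>2) T + (1 + 1 / \<eta>) * B"
    and "square_bounded g \<Longrightarrow> \<exists>D. cmod D \<le> \<gamma> \<and> ((\<lambda>t. v t - D * g t) \<longlongrightarrow> 0) at_top"
proof -
  obtain c rs where rs: "c \<noteq> 0" "H = Polynomial.smult c (\<Prod>r\<leftarrow>rs. [:-r, 1:])" "\<forall>r\<in>set rs. Re r < 0"
    using hurwitz_roots[OF H] .
  define H1 where "H1 = (\<Prod>r\<leftarrow>rs. [:-r, 1:])"
  have degH1: "degree H1 = length rs" unfolding H1_def by (rule degree_linear_factors)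
  \<comment> \<open>H is normalized to leading coefficient 1; the minus sign comes from solving the
    equation for v.\<close>
  define G' where "G' = Polynomial.smult (- 1 / c) G"
  have bound': "cmod (poly G' (\<i> * of_real \<omega>)) \<le> \<gamma> * cmod (poly H1 (\<i> * of_real \<omega>))" for \<omega>
  proof -
    have "cmod c * cmod (poly G' (\<i> * of_real \<omega>)) \<le> cmod c * (\<gamma> * cmod (poly H1 (\<i> * of_real \<omega>)))"
      using bound[of \<omega>] rs(1) by (simp add: G'_def rs(2) H1_def[symmetric] norm_mult norm_divide mult.left_commute)
    then show ?thesis using rs(1) by simp
  qed
  have degG': "degree G' \<le> length rs" using imag_axis_bound_degree[OF bound'] degH1 by simp
  define v0 where "v0 = proper_response rs G' g"
  define e where "e t = v t - v0 t" for t
  have cv0: "continuous_on {0..} v0" unfolding v0_def by (rule proper_response_continuous[OF g])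
  have ce: "continuous_on {0..} e" unfolding e_def by (intro continuous_on_diff v cv0)
  have kernel: "act H (mollify b e) = 0" if \<epsilon>: "0 < \<epsilon>" "\<epsilon> \<le> 1" "bump \<epsilon> b" for \<epsilon> b
  proof -
    \<comment> \<open>After mollification g = H1 W and v0 = G' W, so v0 satisfies the same equation
      as v, and the difference e lies in the kernel of H.\<close>
    define W where "W = mollify b (resolvents rs g)"
    have mv0: "mollify b v0 = act G' W"
      unfolding v0_def W_def by (rule mollify_proper_response[OF \<epsilon>(3,2) g degG'])
    have "proper_response rs H1 g = g" unfolding H1_def by (rule ext) (rule proper_response_prod)
    then have mg: "mollify b g = act H1 W"
      using mollify_proper_response[OF \<epsilon>(3,2) g, of H1 rs] degH1 by (simp add: W_def)
    have "mollify b e = mollify b v - act G' W"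
      unfolding e_def mollify_diff[OF \<epsilon>(3,2) v cv0] mv0 ..
    then have "act H (mollify b e) = act H (mollify b v) - act (H * G') W"
      by (simp add: signal.scale_right_diff_distrib)
    moreover have "H * G' = - (G * H1)"
      using rs(1) by (simp add: G'_def rs(2) H1_def[symmetric] mult.commute)
    moreover have "act H (mollify b v) = - act (G * H1) W"
      using eq[OF \<epsilon>] unfolding mg by (simp add: eq_neg_iff_add_eq_0)
    ultimately show ?thesis by (simp add: signal.scale_minus_left)
  qed
  have sq_e: "square_bounded e" by (rule weak_kernel_decay(1)[OF ce H], rule kernel)
  have lim_e: "(e \<longlongrightarrow> 0) at_top" by (rule weak_kernel_decay(2)[OF ce H], rule kernel)
  obtain B where B: "\<And>t. 0 \<le> t \<Longrightarrow> Int0 (\<lambda>s. (cmod (e s))\<^sup>2) t \<le> B"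
    using sq_e unfolding square_bounded_def by blast
  have "Int0 (\<lambda>t. (cmod (v t))\<^sup>2) T \<le> (1 + \<eta>) * \<gamma>\<^sup>2 * Int0 (\<lambda>t. (cmod (g t))\<^sup>2) T + (1 + 1 / \<eta>) * B"
    if \<eta>: "0 < \<eta>" and T: "0 \<le> T" for \<eta> T :: real
  proof -
    note i = integrable_integral[OF integrable_half_line[OF cont_norm_sq order.refl]]
    have I: "((\<lambda>t. (1 + \<eta>) * (cmod (v0 t))\<^sup>2 + (1 + 1 / \<eta>) * (cmod (e t))\<^sup>2) has_integral
       (1 + \<eta>) * Int0 (\<lambda>t. (cmod (v0 t))\<^sup>2) T + (1 + 1 / \<eta>) * Int0 (\<lambda>t. (cmod (e t))\<^sup>2) T) {0..T}"
      by (intro has_integral_add has_integral_mult_right i cv0 ce)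
    have "Int0 (\<lambda>t. (cmod (v t))\<^sup>2) T \<le> (1 + \<eta>) * Int0 (\<lambda>t. (cmod (v0 t))\<^sup>2) T + (1 + 1 / \<eta>) * Int0 (\<lambda>t. (cmod (e t))\<^sup>2) T"
    proof (rule has_integral_le[OF i[OF v] I])
      show "(cmod (v t))\<^sup>2 \<le> (1 + \<eta>) * (cmod (v0 t))\<^sup>2 + (1 + 1 / \<eta>) * (cmod (e t))\<^sup>2" for t
        using norm_add_sq_le[OF \<eta>, of "v0 t" "e t"] by (simp add: e_def)
    qed
    also have "\<dots> \<le> (1 + \<eta>) * (\<gamma>\<^sup>2 * Int0 (\<lambda>t. (cmod (g t))\<^sup>2) T) + (1 + 1 / \<eta>) * B"
      using \<eta> proper_response_gain[OF g T rs(3) bound'[unfolded H1_def] \<gamma>] B[OF T]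
      by (intro add_mono mult_left_mono) (auto simp: v0_def add_nonneg_nonneg)
    finally show ?thesis by (simp add: mult.assoc)
  qed
  then show "\<exists>B. \<forall>\<eta>>0. \<forall>T\<ge>0. Int0 (\<lambda>t. (cmod (v t))\<^sup>2) T \<le>
            (1 + \<eta>) * \<gamma>\<^sup>2 * Int0 (\<lambda>t. (cmod (g t))\<^sup>2) T + (1 + 1 / \<eta>) * B" by blast
  assume sq: "square_bounded g"
  \<comment> \<open>D is the value of the transfer function at infinite frequency; removing it
    leaves the strictly proper R, whose response vanishes.\<close>
  define D where "D = coeff G' (length rs)"
  define R where "R = G' - Polynomial.smult D H1"
  have lead: "coeff H1 (length rs) = 1"
    unfolding H1_def by (induction rs) (auto simp: coeff_eq_0 degree_linear_factors)
  have "coeff R (length rs) = 0" by (simp add: R_def D_def lead)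
  moreover have "degree R \<le> length rs"
    unfolding R_def using degG' degH1 by (intro degree_diff_le) auto
  ultimately have "degree R < length rs \<or> R = 0"
    by (metis le_neq_implies_less leading_coeff_0_iff)
  then have "(proper_response rs R g \<longlongrightarrow> 0) at_top" by (rule proper_response_vanishes[OF sq rs(3)])
  from tendsto_add[OF this lim_e] have "((\<lambda>t. proper_response rs R g t + e t) \<longlongrightarrow> 0) at_top" by simp
  moreover have "proper_response rs R g t + e t = v t - D * g t" for t
  proof -
    have "R = G' + Polynomial.smult (- D) H1" by (simp add: R_def)
    then have "proper_response rs R g t = v0 t - D * g t"
      by (simp only: proper_response_add proper_response_smult v0_def) (simp add: H1_def proper_response_prod)
    then show ?thesis by (simp add: e_def)
  qed
  moreover have "cmod D \<le> \<gamma>"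
    using imag_axis_bound_coeff[OF bound' degG'] degH1 lead by (simp add: D_def)
  ultimately show "\<exists>D. cmod D \<le> \<gamma> \<and> ((\<lambda>t. v t - D * g t) \<longlongrightarrow> 0) at_top" by auto
qed

text \<open>On bounded intervals all energies are finite, so the loop inequality can be solved for
  the energy of x, with a bound independent of T. This makes y square integrable, whence
  \<open>asym\<close> applies. The loop inequality at single times then reads z <= \<theta> z + r
  with r vanishing.\<close>

lemma small_gain:
  fixes x y :: "nat \<Rightarrow> real \<Rightarrow> complex"
  assumes J: "finite J" and cx: "\<And>l. l \<in> J \<Longrightarrow> continuous_on {0..} (x l)" and cy: "\<And>l. l \<in> J \<Longrightarrow> continuous_on {0..} (y l)"
    and \<gamma>: "0 \<le> \<gamma>" and \<sigma>: "0 \<le> \<sigma>" "\<gamma> * \<sigma> < 1"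
    and slope: "\<And>t. 0 \<le> t \<Longrightarrow> (\<Sum>l\<in>J. (cmod (y l t))\<^sup>2) \<le> \<sigma>\<^sup>2 * (\<Sum>l\<in>J. (cmod (x l t))\<^sup>2)"
    and gain: "\<And>l. l \<in> J \<Longrightarrow> \<exists>B. \<forall>\<eta>>0. \<forall>T\<ge>0. Int0 (\<lambda>t. (cmod (x l t))\<^sup>2) T \<le>
            (1 + \<eta>) * \<gamma>\<^sup>2 * Int0 (\<lambda>t. (cmod (y l t))\<^sup>2) T + (1 + 1 / \<eta>) * B"
    and asym: "\<And>l. l \<in> J \<Longrightarrow> square_bounded (y l) \<Longrightarrow> \<exists>D. cmod D \<le> \<gamma> \<and> ((\<lambda>t. x l t - D * y l t) \<longlongrightarrow> 0) at_top"
  shows "((\<lambda>t. \<Sum>l\<in>J. (cmod (x l t))\<^sup>2) \<longlongrightarrow> 0) at_top"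
proof -
  define \<theta> where "\<theta> = \<gamma> * \<sigma>"
  have \<theta>: "0 \<le> \<theta>" "\<theta> < 1" using \<gamma> \<sigma> by (auto simp: \<theta>_def)
  have \<theta>2: "\<theta>\<^sup>2 < 1" using \<theta> by (simp add: power_less_one_iff)
  obtain B where B: "\<And>l \<eta> T. l \<in> J \<Longrightarrow> 0 < \<eta> \<Longrightarrow> 0 \<le> T \<Longrightarrow> Int0 (\<lambda>t. (cmod (x l t))\<^sup>2) T \<le>
            (1 + \<eta>) * \<gamma>\<^sup>2 * Int0 (\<lambda>t. (cmod (y l t))\<^sup>2) T + (1 + 1 / \<eta>) * B l"
    using bchoice[of J "\<lambda>l B. \<forall>\<eta>>0. \<forall>T\<ge>0. Int0 (\<lambda>t. (cmod (x l t))\<^sup>2) T \<le>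
            (1 + \<eta>) * \<gamma>\<^sup>2 * Int0 (\<lambda>t. (cmod (y l t))\<^sup>2) T + (1 + 1 / \<eta>) * B"] gain by blast
  define X where "X T = (\<Sum>l\<in>J. Int0 (\<lambda>t. (cmod (x l t))\<^sup>2) T)" for T
  define Y where "Y T = (\<Sum>l\<in>J. Int0 (\<lambda>t. (cmod (y l t))\<^sup>2) T)" for T
  \<comment> \<open>Splitting off the transient costs the factor 1 + \<eta>; with this \<eta> the
    remaining margin k equals (1 - \<theta>^2)^2.\<close>
  define \<eta> where "\<eta> = 1 - \<theta>\<^sup>2"
  have \<eta>: "0 < \<eta>" using \<theta>2 by (simp add: \<eta>_def)
  define k where "k = 1 - (1 + \<eta>) * \<theta>\<^sup>2"
  have k: "0 < k"
  proof -
    have "k = (1 - \<theta>\<^sup>2)\<^sup>2" by (simp add: k_def \<eta>_def power2_eq_square algebra_simps)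
    then show ?thesis using \<theta>2 by simp
  qed
  have XY: "Y T \<le> \<sigma>\<^sup>2 * X T" if T: "0 \<le> T" for T
  proof -
    have i: "((\<lambda>t. \<Sum>l\<in>J. (cmod (f l t))\<^sup>2) has_integral (\<Sum>l\<in>J. Int0 (\<lambda>t. (cmod (f l t))\<^sup>2) T)) {0..T}"
      if "\<And>l. l \<in> J \<Longrightarrow> continuous_on {0..} (f l)" for f :: "nat \<Rightarrow> real \<Rightarrow> complex"
      using that by (intro has_integral_sum J integrable_integral integrable_half_line cont_norm_sq order.refl)
    have iy: "((\<lambda>t. \<Sum>l\<in>J. (cmod (y l t))\<^sup>2) has_integral Y T) {0..T}" unfolding Y_def by (rule i, rule cy)
    have ix: "((\<lambda>t. \<Sum>l\<in>J. (cmod (x l t))\<^sup>2) has_integral X T) {0..T}" unfolding X_def by (rule i, rule cx)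
    show ?thesis
      by (rule has_integral_le[OF iy has_integral_mult_right[OF ix]]) (use slope in auto)
  qed
  define b where "b = (1 + 1 / \<eta>) * (\<Sum>l\<in>J. B l)"
  have Xb: "X T \<le> b / k" if T: "0 \<le> T" for T
  proof -
    have "X T \<le> (\<Sum>l\<in>J. (1 + \<eta>) * \<gamma>\<^sup>2 * Int0 (\<lambda>t. (cmod (y l t))\<^sup>2) T + (1 + 1 / \<eta>) * B l)"
      unfolding X_def by (intro sum_mono B \<eta> T)
    also have "\<dots> = (1 + \<eta>) * \<gamma>\<^sup>2 * Y T + b"
      by (simp add: Y_def b_def sum.distrib sum_distrib_left)
    also have "\<dots> \<le> (1 + \<eta>) * \<gamma>\<^sup>2 * (\<sigma>\<^sup>2 * X T) + b"
      using XY[OF T] \<eta> by (intro add_right_mono mult_left_mono) auto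
    also have "\<dots> = (1 - k) * X T + b" by (simp add: k_def \<theta>_def power_mult_distrib mult.assoc)
    finally have "k * X T \<le> b" by (simp add: algebra_simps)
    then show ?thesis using k by (simp add: pos_le_divide_eq mult.commute)
  qed
  have sq: "square_bounded (y l)" if l: "l \<in> J" for l
    unfolding square_bounded_def
  proof (intro conjI cy[OF l] exI[of _ "\<sigma>\<^sup>2 * (b / k)"] allI impI)
    fix T :: real assume T: "0 \<le> T"
    have "Int0 (\<lambda>t. (cmod (y l t))\<^sup>2) T \<le> Y T"
      unfolding Y_def
      by (rule member_le_sum[OF l _ J])
         (intro integral_nonneg integrable_half_line cont_norm_sq cy order.refl; simp)
    also have "\<dots> \<le> \<sigma>\<^sup>2 * X T" by (rule XY[OF T])
    also have "\<dots> \<le> \<sigma>\<^sup>2 * (b / k)" by (intro mult_left_mono Xb T) simp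
    finally show "Int0 (\<lambda>t. (cmod (y l t))\<^sup>2) T \<le> \<sigma>\<^sup>2 * (b / k)" .
  qed
  have "\<forall>l\<in>J. \<exists>D. cmod D \<le> \<gamma> \<and> ((\<lambda>t. x l t - D * y l t) \<longlongrightarrow> 0) at_top" using asym sq by blast
  from bchoice[OF this] obtain D where D: "\<forall>l\<in>J. cmod (D l) \<le> \<gamma> \<and> ((\<lambda>t. x l t - D l * y l t) \<longlongrightarrow> 0) at_top" by blast
  define z where "z t = L2_set (\<lambda>l. cmod (x l t)) J" for t
  define r where "r t = L2_set (\<lambda>l. cmod (x l t - D l * y l t)) J" for t
  \<comment> \<open>Minkowski's inequality over the modes; the slope condition concerns their joint
    Euclidean norm.\<close>
  have bound: "z t \<le> r t / (1 - \<theta>)" if t: "0 \<le> t" for t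
  proof -
    have "z t \<le> L2_set (\<lambda>l. cmod (D l * y l t) + cmod (x l t - D l * y l t)) J"
      unfolding z_def
    proof (rule L2_set_mono)
      show "cmod (x l t) \<le> cmod (D l * y l t) + cmod (x l t - D l * y l t)" for l
        using norm_triangle_ineq[of "D l * y l t" "x l t - D l * y l t"] by simp
    qed simp
    also have "\<dots> \<le> L2_set (\<lambda>l. cmod (D l * y l t)) J + r t"
      unfolding r_def by (rule L2_set_triangle_ineq)
    also have "L2_set (\<lambda>l. cmod (D l * y l t)) J \<le> L2_set (\<lambda>l. \<gamma> * cmod (y l t)) J"
      using D by (intro L2_set_mono) (auto simp: norm_mult mult_right_mono)
    also have "\<dots> = \<gamma> * L2_set (\<lambda>l. cmod (y l t)) J" by (rule L2_set_right_distrib[OF \<gamma>, symmetric])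
    also have "L2_set (\<lambda>l. cmod (y l t)) J \<le> \<sigma> * z t"
    proof -
      have "L2_set (\<lambda>l. cmod (y l t)) J \<le> sqrt (\<sigma>\<^sup>2 * (\<Sum>l\<in>J. (cmod (x l t))\<^sup>2))"
        unfolding L2_set_def by (intro real_sqrt_le_mono slope t)
      then show ?thesis using \<sigma>(1) by (simp add: z_def L2_set_def real_sqrt_mult)
    qed
    finally have "z t \<le> \<gamma> * (\<sigma> * z t) + r t" using \<gamma> by (simp add: mult_left_mono)
    then have "(1 - \<theta>) * z t \<le> r t" by (simp add: \<theta>_def algebra_simps)
    then show ?thesis using \<theta> by (simp add: pos_le_divide_eq mult.commute)
  qed
  have "((\<lambda>t. \<Sum>l\<in>J. (cmod (x l t - D l * y l t))\<^sup>2) \<longlongrightarrow> (\<Sum>l\<in>J. (cmod 0)\<^sup>2)) at_top"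
    using D by (intro tendsto_sum tendsto_power tendsto_norm) auto
  then have "(r \<longlongrightarrow> sqrt 0) at_top" unfolding r_def L2_set_def by (intro tendsto_real_sqrt) simp
  then have "((\<lambda>t. r t / (1 - \<theta>)) \<longlongrightarrow> 0) at_top" by (auto intro: tendsto_divide_zero)
  then have "(z \<longlongrightarrow> 0) at_top"
    by (rule Lim_null_comparison[rotated])
       (use bound in \<open>auto simp: z_def eventually_at_top_linorder intro!: exI[of _ 0]\<close>)
  then have "((\<lambda>t. (z t)\<^sup>2) \<longlongrightarrow> 0\<^sup>2) at_top" by (rule tendsto_power)
  then show ?thesis by (simp add: z_def L2_set_def sum_nonneg)
qed

subsection \<open>The modes of the network\<close>

text \<open>The denominator in lowest terms divides p, so an unreduced fraction may be evaluated
  wherever p does not vanish.\<close>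

lemma tf_eval_Fract:
  assumes p: "p \<noteq> 0" and s: "poly p s \<noteq> 0"
  shows "poly (snd (quot_of_fract (Fract q p))) s \<noteq> 0" "tf_eval (Fract q p) s = poly q s / poly p s"
proof -
  define a b where "a = fst (quot_of_fract (Fract q p))" and "b = snd (quot_of_fract (Fract q p))"
  have b: "b \<noteq> 0" by (simp add: b_def)
  have "Fract a b = Fract q p" by (simp add: a_def b_def)
  then have eq: "a * p = q * b" using eq_fract(1)[OF b p] by simp
  have cop: "coprime a b" unfolding a_def b_def by (rule coprime_quot_of_fract)
  have "b dvd p" using eq cop by (metis coprime_commute coprime_dvd_mult_right_iff dvd_triv_right)
  then show bs: "poly b s \<noteq> 0" using s by (auto elim: dvdE)
  have "poly a s * poly p s = poly q s * poly b s" using arg_cong[OF eq, of "\<lambda>f. poly f s"] by simp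
  then show "tf_eval (Fract q p) s = poly q s / poly p s"
    using bs s by (simp add: tf_eval_def a_def[symmetric] b_def[symmetric] field_simps)
qed

lemma impedance_port_relation:
  assumes "has_impedance C z"
  shows "port_relation C (fst (quot_of_fract z)) (snd (quot_of_fract z))"
proof -
  let ?n = "fst (quot_of_fract z)" and ?d = "snd (quot_of_fract z)"
  have "{s. \<not> (\<forall>v i. port_phasor C s v i \<longleftrightarrow> poly ?d s * v = poly ?n s * i)} \<subseteq>
     {s. \<not> (\<forall>v i. port_phasor C s v i \<longleftrightarrow> v = tf_eval z s * i)} \<union> {s. poly ?d s = 0}"
  proof
    fix s assume s: "s \<in> {s. \<not> (\<forall>v i. port_phasor C s v i \<longleftrightarrow> poly ?d s * v = poly ?n s * i)}"
    have "(v = tf_eval z s * i) = (poly ?d s * v = poly ?n s * i)" if "poly ?d s \<noteq> 0" for v i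
      using that by (auto simp: tf_eval_def field_simps)
    with s show "s \<in> {s. \<not> (\<forall>v i. port_phasor C s v i \<longleftrightarrow> v = tf_eval z s * i)} \<union> {s. poly ?d s = 0}"
      by (cases "poly ?d s = 0") simp_all
  qed
  moreover have "finite ({s. \<not> (\<forall>v i. port_phasor C s v i \<longleftrightarrow> v = tf_eval z s * i)} \<union> {s. poly ?d s = 0})"
    using assms poly_roots_finite[of ?d] by (simp add: has_impedance_def)
  ultimately show ?thesis
    unfolding port_relation_def using finite_subset coprime_quot_of_fract by blast
qed

lemma tf_const_mult_Fract: "p \<noteq> 0 \<Longrightarrow> Fract q p * tf_const a = Fract (Polynomial.smult (of_real a) q) p"
  by (simp add: tf_const_def to_fract_def)

lemma admittance_port_relation:
  assumes adm: "has_admittance C (y * tf_const a)" and a: "a \<noteq> 0"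
  shows "port_relation C (snd (quot_of_fract y)) (Polynomial.smult (of_real a) (fst (quot_of_fract y)))"
proof -
  let ?Q = "fst (quot_of_fract y)" and ?P = "snd (quot_of_fract y)"
  have P: "?P \<noteq> 0" by simp
  have y: "y * tf_const a = Fract (Polynomial.smult (of_real a) ?Q) ?P"
    using tf_const_mult_Fract[OF P, of ?Q a] by simp
  have "{s. \<not> (\<forall>v i. port_phasor C s v i \<longleftrightarrow> poly (Polynomial.smult (of_real a) ?Q) s * v = poly ?P s * i)} \<subseteq>
     {s. \<not> (\<forall>v i. port_phasor C s v i \<longleftrightarrow> i = tf_eval (y * tf_const a) s * v)} \<union> {s. poly ?P s = 0}"
  proof
    fix s assume s: "s \<in> {s. \<not> (\<forall>v i. port_phasor C s v i \<longleftrightarrow> poly (Polynomial.smult (of_real a) ?Q) s * v = poly ?P s * i)}"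
    have "(i = tf_eval (y * tf_const a) s * v) = (poly (Polynomial.smult (of_real a) ?Q) s * v = poly ?P s * i)"
      if "poly ?P s \<noteq> 0" for v i
      unfolding y tf_eval_Fract(2)[OF P that] using that by (auto simp: field_simps)
    with s show "s \<in> {s. \<not> (\<forall>v i. port_phasor C s v i \<longleftrightarrow> i = tf_eval (y * tf_const a) s * v)} \<union> {s. poly ?P s = 0}"
      by (cases "poly ?P s = 0") simp_all
  qed
  moreover have "finite ({s. \<not> (\<forall>v i. port_phasor C s v i \<longleftrightarrow> i = tf_eval (y * tf_const a) s * v)} \<union> {s. poly ?P s = 0})"
    using adm poly_roots_finite[OF P] by (simp add: has_admittance_def)
  moreover have "coprime ?P (Polynomial.smult (of_real a) ?Q)"
    using a coprime_quot_of_fract[of y]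
    by (intro coprime_divisors[of ?P ?P "Polynomial.smult (of_real a) ?Q" ?Q]) (auto simp: coprime_commute smult_dvd)
  ultimately show ?thesis unfolding port_relation_def using finite_subset by blast
qed

text \<open>With equal terminals every port voltage is 0, whereas an admittance admits v = 1 at
  almost every s. Distinct terminals make the branch current readable from Kirchhoff's law at the
  plus terminal, hence continuous.\<close>

lemma admittance_terminals_distinct:
  assumes "has_admittance C Y"
  shows "plus_terminal C \<noteq> minus_terminal C"
proof
  assume eq: "plus_terminal C = minus_terminal C"
  have "\<exists>s. s \<notin> {s. \<not> (\<forall>v i. port_phasor C s v i \<longleftrightarrow> i = tf_eval Y s * v)}"
    by (rule ex_new_if_finite[OF infinite_UNIV_char_0 assms[unfolded has_admittance_def]])
  then obtain s where "\<forall>v i. port_phasor C s v i \<longleftrightarrow> i = tf_eval Y s * v" by blast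
  then have "port_phasor C s 1 (tf_eval Y s)" by simp
  then show False unfolding port_phasor_def eq by simp
qed

lemma Re_mult_cnj_swap: "Re (a * cnj b) = Re (b * cnj a)"
  by simp

text \<open>The mode of the network with eigenvalue \<open>\<lambda>\<close> sees the loop of the impedance \<open>n / d\<close> with the
  admittance \<open>\<lambda> Q / P\<close>. Common factors of \<open>n\<close> and \<open>P\<close> cancel already in the differential equations.\<close>

lemma loop_polynomials:
  fixes z y :: transfer_function and \<mu> :: real
  defines "n \<equiv> fst (quot_of_fract z)" and "d \<equiv> snd (quot_of_fract z)"
    and "Q \<equiv> fst (quot_of_fract y)" and "P \<equiv> snd (quot_of_fract y)"
  assumes C: "passive_one_port C" "has_impedance C z"
    and C': "passive_one_port C'" "has_admittance C' (y * tf_const a)" and a: "0 < a"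
    and \<mu>: "0 < \<mu>" and defd: "hinf_norm_defined (lft z (y * tf_const \<mu>))"
  obtains h n1 P1 where "n = h * n1" "P = h * P1"
    "hurwitz (P1 * d + Polynomial.smult (of_real \<mu>) (n1 * Q))"
    "\<And>\<omega>::real. cmod (poly (n * P1) (\<i> * of_real \<omega>)) \<le> hinf_norm (lft z (y * tf_const \<mu>)) *
        cmod (poly (P1 * d + Polynomial.smult (of_real \<mu>) (n1 * Q)) (\<i> * of_real \<omega>))"
proof -
  have relC: "port_relation C n d" unfolding n_def d_def by (rule impedance_port_relation[OF C(2)])
  have relC': "port_relation C' P (Polynomial.smult (of_real a) Q)"
    unfolding P_def Q_def using a by (intro admittance_port_relation C'(2)) simp
  have P0: "P \<noteq> 0" and d0: "d \<noteq> 0" by (simp_all add: P_def d_def)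
  have cop: "coprime n d" "coprime P Q"
    using coprime_quot_of_fract[of z] coprime_quot_of_fract[of y] by (simp_all add: n_def d_def P_def Q_def coprime_commute)
  define h where "h = gcd n P"
  have h0: "h \<noteq> 0" using P0 by (simp add: h_def)
  obtain n1 P1 where n1: "n = h * n1" and P1: "P = h * P1" and cop1: "coprime n1 P1"
    using gcd_coprime_exists[of n P] P0 unfolding h_def by (metis gcd_eq_0_iff mult.commute)
  define q where "q = P1 * d + Polynomial.smult (of_real \<mu>) (n1 * Q)"
  have PRz: "0 \<le> Re (poly n s * cnj (poly d s))" if "0 < Re s" for s
    by (rule port_relation_positive_real[OF C(1) relC that])
  have PRy: "0 \<le> Re (poly Q s * cnj (poly P s))" if "0 < Re s" for s
  proof -
    have "0 \<le> Re (poly P s * cnj (of_real a * poly Q s))"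
      using port_relation_positive_real[OF C'(1) relC' that] by simp
    also have "poly P s * cnj (of_real a * poly Q s) = (poly P s * cnj (poly Q s)) * of_real a" by simp
    also have "Re \<dots> = Re (poly P s * cnj (poly Q s)) * a" by (rule Re_mult_real_const)
    finally have "0 \<le> Re (poly P s * cnj (poly Q s))" using a by (simp add: zero_le_mult_iff)
    then show ?thesis using Re_mult_cnj_swap by metis
  qed
  \<comment> \<open>On the positive axis, outside a finite set, n / d and Q / P are real and
    nonnegative, so 1 + \<mu> (n / d) (Q / P) is at least 1 there.\<close>
  have q0: "q \<noteq> 0"
  proof
    assume q: "q = 0"
    define S where "S = {r::real. Im (poly n (of_real r) * cnj (poly d (of_real r))) \<noteq> 0} \<union>
       {r::real. Im (poly P (of_real r) * cnj (poly (Polynomial.smult (of_real a) Q) (of_real r))) \<noteq> 0} \<union>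
       complex_of_real -` {s. poly (P * d) s = 0}"
    have "finite S" unfolding S_def
      using port_relation_real[OF relC] port_relation_real[OF relC'] P0 d0
      by (intro finite_UnI finite_vimageI poly_roots_finite) (auto simp: inj_on_def)
    moreover have "infinite {0<..(1::real)}" by simp
    ultimately obtain r where r: "0 < r" "r \<notin> S" by (metis finite_subset greaterThanAtMost_iff subsetI)
    let ?s = "complex_of_real r"
    define A where "A = poly n ?s * cnj (poly d ?s)"
    define B where "B = poly Q ?s * cnj (poly P ?s)"
    have A: "A = of_real (Re A)" "0 \<le> Re A"
      using r PRz[of ?s] by (auto simp: S_def A_def complex_eq_iff)
    have "Im (poly P ?s * cnj (poly Q ?s)) = 0"
    proof -
      have "Im ((poly P ?s * cnj (poly Q ?s)) * of_real a) = 0" using r a by (simp add: S_def mult_ac)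
      then show ?thesis using a by simp
    qed
    then have "Im B = 0" unfolding B_def by (simp add: algebra_simps)
    then have B: "B = of_real (Re B)" "0 \<le> Re B" using r PRy[of ?s] by (auto simp: B_def complex_eq_iff)
    have "poly (h * q) ?s = poly P ?s * poly d ?s + of_real \<mu> * (poly n ?s * poly Q ?s)"
      by (simp add: q_def n1 P1 algebra_simps)
    then have "0 = (poly P ?s * poly d ?s + of_real \<mu> * (poly n ?s * poly Q ?s)) * cnj (poly P ?s * poly d ?s)"
      by (simp add: q)
    also have "\<dots> = of_real ((cmod (poly P ?s * poly d ?s))\<^sup>2) + of_real \<mu> * (A * B)"
      unfolding complex_norm_square A_def B_def by (simp add: algebra_simps)
    also have "A * B = of_real (Re A * Re B)" using A(1) B(1) by (metis of_real_mult)
    finally have "complex_of_real ((cmod (poly P ?s * poly d ?s))\<^sup>2 + \<mu> * (Re A * Re B)) = of_real 0" by simp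
    then have "(cmod (poly P ?s * poly d ?s))\<^sup>2 + \<mu> * (Re A * Re B) = 0" unfolding of_real_eq_iff .
    moreover have "0 \<le> \<mu> * (Re A * Re B)" using \<mu> A(2) B(2) by simp
    ultimately have "cmod (poly P ?s * poly d ?s) = 0" by (smt (verit) zero_eq_power2 zero_le_power2)
    then show False using r by (simp add: S_def)
  qed
  have F: "lft z (y * tf_const \<mu>) = Fract (n * P1) q"
  proof -
    have z: "z = Fract n d" and y: "y * tf_const \<mu> = Fract (Polynomial.smult (of_real \<mu>) Q) P"
      using tf_const_mult_Fract[OF P0, of Q \<mu>] by (simp_all add: n_def d_def P_def Q_def)
    have "1 + z * (y * tf_const \<mu>) = Fract 1 1 + Fract n d * Fract (Polynomial.smult (of_real \<mu>) Q) P"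
      unfolding y by (simp only: z[symmetric] One_fract_def)
    also have "\<dots> = Fract (1 * (d * P) + (n * Polynomial.smult (of_real \<mu>) Q) * 1) (1 * (d * P))"
      using d0 P0 by (subst mult_fract, subst add_fract) auto
    also have "1 * (d * P) + (n * Polynomial.smult (of_real \<mu>) Q) * 1 = h * q"
      by (simp add: q_def n1 P1 algebra_simps)
    finally have "1 + z * (y * tf_const \<mu>) = Fract (h * q) (d * P)" by simp
    then have "lft z (y * tf_const \<mu>) = Fract n d / Fract (h * q) (d * P)"
      by (simp only: lft_def z[symmetric])
    also have "\<dots> = Fract (n * P1) q"
      using d0 P0 h0 q0 by (simp add: eq_fract P1 mult_ac)
    finally show ?thesis .
  qed
  define F where "F = lft z (y * tf_const \<mu>)"
  have Fq: "poly (snd (quot_of_fract F)) s * poly (n * P1) s = poly (fst (quot_of_fract F)) s * poly q s" for s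
  proof -
    have "Fract (fst (quot_of_fract F)) (snd (quot_of_fract F)) = Fract (n * P1) q"
      by (simp add: F_def F)
    then have "fst (quot_of_fract F) * q = n * P1 * snd (quot_of_fract F)"
      using eq_fract(1) q0 by (metis snd_quot_of_fract_nonzero)
    then show ?thesis using arg_cong[of _ _ "\<lambda>f. poly f s"] by (metis poly_mult mult.commute)
  qed
  \<comment> \<open>A root of q in the closed right half plane is no pole of the stable F, so n P1
    would vanish there as well; positive realness excludes this.\<close>
  have hw: "hurwitz q"
    unfolding hurwitz_def
  proof (intro conjI q0 allI impI)
    fix s assume qs: "poly q s = 0"
    show "Re s < 0"
    proof (rule ccontr)
      assume "\<not> Re s < 0"
      then have s: "0 \<le> Re s" by simp
      then have "poly (snd (quot_of_fract F)) s \<noteq> 0"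
        using defd unfolding hinf_norm_defined_def tf_pole_def F_def[symmetric] by force
      then have "poly (n * P1) s = 0" using Fq[of s] qs by simp
      moreover have "poly (n * P1) s \<noteq> 0"
        by (rule passive_loop_no_hidden_zero[OF n1 P1 P0 cop1 cop PRz PRy \<mu> s qs[unfolded q_def]])
      ultimately show False by simp
    qed
  qed
  have bound: "cmod (poly (n * P1) (\<i> * of_real \<omega>)) \<le> hinf_norm F * cmod (poly q (\<i> * of_real \<omega>))" for \<omega>
  proof -
    let ?s = "\<i> * complex_of_real \<omega>"
    have qs: "poly q ?s \<noteq> 0" using hw by (auto simp: hurwitz_def)
    have "cmod (tf_eval F ?s) \<le> hinf_norm F"
      unfolding hinf_norm_def using defd by (intro cSUP_upper) (auto simp: hinf_norm_defined_def F_def)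
    also have "tf_eval F ?s = poly (n * P1) ?s / poly q ?s"
      unfolding F_def F by (rule tf_eval_Fract(2)[OF q0 qs])
    finally show ?thesis using qs by (simp add: norm_divide pos_divide_le_eq)
  qed
  show ?thesis
    by (rule that[OF n1 P1]) (use hw bound in \<open>simp_all only: q_def F_def\<close>)
qed

section \<open>Elimination of the interior nodes and decoupling into modes\<close>

lemma laplacian_row_complex:
  fixes x :: "nat \<Rightarrow> complex"
  assumes "weighted_graph M a" "m < M"
  shows "(\<Sum>n<M. of_real (laplacian M a $$ (m, n)) * x n) = (\<Sum>n<M. of_real (a m n) * (x m - x n))"
proof -
  have "complex_of_real (laplacian M a $$ (m, n)) = laplacian M (\<lambda>m n. complex_of_real (a m n)) $$ (m, n)" if "n < M" for n
    using assms(2) that by (simp add: laplacian_index)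
  then show ?thesis
    using laplacian_row_weighted[of m M "\<lambda>m n. complex_of_real (a m n)" x] assms by (simp add: weighted_graph_def)
qed

text \<open>P(D) is not injective in general, so currents are not solved for and the node equations
  keep the form P I = Q A V. The real row operations K commute with P and Q; they remove the
  interior voltages, and the interior injections that they bring in are 0.\<close>

lemma kron_signals:
  fixes V I :: "nat \<Rightarrow> signal" and B :: "nat \<Rightarrow> nat \<Rightarrow> signal" and L :: "real mat"
  assumes NM: "N \<le> M" and w: "weighted_graph M a"
    and K: "\<And>j k. j < N \<Longrightarrow> k < M \<Longrightarrow> laplacian M a $$ (j, k) - (\<Sum>m=N..<M. K j m * laplacian M a $$ (m, k)) =
      (if k < N then L $$ (j, k) else 0)"
    and B: "\<And>m n. m < M \<Longrightarrow> n < M \<Longrightarrow> act P (B m n) = scale (of_real (a m n)) (act Q (V m - V n))"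
    and I: "\<And>m. m < M \<Longrightarrow> I m = (\<Sum>n<M. B m n)" and I0: "\<And>m. N \<le> m \<Longrightarrow> m < M \<Longrightarrow> I m = 0"
    and j: "j < N"
  shows "act P (I j) = act Q (\<Sum>k<N. scale (of_real (L $$ (j, k))) (V k))"
proof -
  define S where "S m = (\<Sum>n<M. scale (of_real (laplacian M a $$ (m, n))) (V n))" for m
  have PI: "act P (I m) = act Q (S m)" if m: "m < M" for m
  proof -
    have "S m = (\<Sum>n<M. scale (of_real (a m n)) (V m - V n))"
      unfolding S_def using laplacian_row_complex[OF w m] by (intro signal_eqI) simp
    then have "act Q (S m) = (\<Sum>n<M. scale (of_real (a m n)) (act Q (V m - V n)))"
      by (simp only: signal.scale_sum_right act_scale_right)
    also have "\<dots> = (\<Sum>n<M. act P (B m n))" by (rule sum.cong) (simp_all add: B m)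
    also have "\<dots> = act P (I m)" by (simp only: I[OF m] signal.scale_sum_right)
    finally show ?thesis by simp
  qed
  have "(\<Sum>k<N. scale (of_real (L $$ (j, k))) (V k)) = S j - (\<Sum>m=N..<M. scale (of_real (K j m)) (S m))"
  proof (rule signal_eqI)
    fix t :: real
    define f where "f k = val (V k) t" for k
    have "(\<Sum>k<N. of_real (L $$ (j, k)) * f k) = (\<Sum>k<M. of_real (if k < N then L $$ (j, k) else 0) * f k)"
      using NM by (intro sum.mono_neutral_cong_left) auto
    also have "\<dots> = (\<Sum>k<M. of_real (laplacian M a $$ (j, k) - (\<Sum>m=N..<M. K j m * laplacian M a $$ (m, k))) * f k)"
      using j by (intro sum.cong refl) (simp add: K)
    also have "\<dots> = (\<Sum>k<M. of_real (laplacian M a $$ (j, k)) * f k)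
        - (\<Sum>k<M. \<Sum>m=N..<M. of_real (K j m) * (of_real (laplacian M a $$ (m, k)) * f k))"
      by (simp add: left_diff_distrib sum_subtractf sum_distrib_right mult.assoc)
    also have "(\<Sum>k<M. \<Sum>m=N..<M. of_real (K j m) * (of_real (laplacian M a $$ (m, k)) * f k))
        = (\<Sum>m=N..<M. of_real (K j m) * (\<Sum>k<M. of_real (laplacian M a $$ (m, k)) * f k))"
      by (subst sum.swap) (simp add: sum_distrib_left)
    finally show "val (\<Sum>k<N. scale (of_real (L $$ (j, k))) (V k)) t
        = val (S j - (\<Sum>m=N..<M. scale (of_real (K j m)) (S m))) t"
      by (simp add: S_def f_def)
  qed
  then have "act Q (\<Sum>k<N. scale (of_real (L $$ (j, k))) (V k))
      = act Q (S j) - (\<Sum>m=N..<M. scale (of_real (K j m)) (act Q (S m)))"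
    by (simp only: signal.scale_right_diff_distrib signal.scale_sum_right act_scale_right)
  also have "(\<Sum>m=N..<M. scale (of_real (K j m)) (act Q (S m))) = (\<Sum>m=N..<M. scale (of_real (K j m)) (act P (I m)))"
    by (rule sum.cong) (simp_all add: PI)
  also have "\<dots> = 0"
    by (rule sum.neutral) (auto simp: I0 intro: signal_eqI)
  also have "act Q (S j) = act P (I j)" using PI j NM by simp
  finally show ?thesis by simp
qed

text \<open>The circuit equation is multiplied by P1 only. Because P1 n = n1 P, this already lets
  the network equation eliminate the current, and the loop polynomial is formed without the common
  factor h.\<close>

lemma mode_signals:
  fixes V I G :: "nat \<Rightarrow> signal" and L :: "real mat" and u :: "nat \<Rightarrow> complex"
  assumes osc: "\<And>j. j < N \<Longrightarrow> act d (V j) + act n (G j + I j) = 0"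
    and net: "\<And>j. j < N \<Longrightarrow> act P (I j) = act Q (\<Sum>k<N. scale (of_real (L $$ (j, k))) (V k))"
    and eig: "\<And>k. k < N \<Longrightarrow> (\<Sum>j<N. cnj (u j) * of_real (L $$ (j, k))) = of_real \<mu> * cnj (u k)"
    and n: "n = h * n1" and P: "P = h * P1"
  shows "act (P1 * d + Polynomial.smult (of_real \<mu>) (n1 * Q)) (\<Sum>j<N. scale (cnj (u j)) (V j))
     + act (n * P1) (\<Sum>j<N. scale (cnj (u j)) (G j)) = 0"
proof -
  define m where "m X = (\<Sum>j<N. scale (cnj (u j)) (X j))" for X :: "nat \<Rightarrow> signal"
  have m_act: "act p (m X) = m (\<lambda>j. act p (X j))" for p X
    unfolding m_def by (simp only: signal.scale_sum_right act_scale_right)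
  have m_add: "m (\<lambda>j. X j + Y j) = m X + m Y" for X Y
    unfolding m_def by (simp only: scale_add sum.distrib)
  have 1: "act d (m V) + act n (m G + m I) = 0"
  proof -
    have "act d (m V) + act n (m G + m I) = m (\<lambda>j. act d (V j) + act n (G j + I j))"
      by (simp only: m_act m_add act_add_right)
    also have "\<dots> = m (\<lambda>j. 0)" unfolding m_def by (rule sum.cong) (simp_all add: osc)
    also have "\<dots> = 0" by (rule signal_eqI) (simp add: m_def)
    finally show ?thesis .
  qed
  have 2: "act P (m I) = scale (of_real \<mu>) (act Q (m V))"
  proof -
    have "act P (m I) = m (\<lambda>j. act Q (\<Sum>k<N. scale (of_real (L $$ (j, k))) (V k)))"
      unfolding m_act unfolding m_def by (rule sum.cong) (simp_all add: net)
    also have "\<dots> = act Q (m (\<lambda>j. \<Sum>k<N. scale (of_real (L $$ (j, k))) (V k)))" by (simp only: m_act)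
    also have "m (\<lambda>j. \<Sum>k<N. scale (of_real (L $$ (j, k))) (V k)) = scale (of_real \<mu>) (m V)"
    proof (rule signal_eqI)
      fix t :: real
      have "(\<Sum>j<N. cnj (u j) * (\<Sum>k<N. of_real (L $$ (j, k)) * val (V k) t))
          = (\<Sum>k<N. (\<Sum>j<N. cnj (u j) * of_real (L $$ (j, k))) * val (V k) t)"
        unfolding sum_distrib_left sum_distrib_right by (subst sum.swap) (simp add: mult.assoc)
      also have "\<dots> = of_real \<mu> * (\<Sum>k<N. cnj (u k) * val (V k) t)"
        by (simp add: eig sum_distrib_left mult.assoc)
      finally show "val (m (\<lambda>j. \<Sum>k<N. scale (of_real (L $$ (j, k))) (V k))) t = val (scale (of_real \<mu>) (m V)) t"
        by (simp add: m_def)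
    qed
    finally show ?thesis by (simp only: act_scale_right)
  qed
  have "act (P1 * d) (m V) + (act (n * P1) (m G) + act (n1 * P) (m I)) = act P1 (act d (m V) + act n (m G + m I))"
    by (simp add: act_add_right n P mult_ac)
  also have "\<dots> = 0" unfolding 1 by simp
  finally have "act (P1 * d) (m V) + (act (n * P1) (m G) + act n1 (act P (m I))) = 0" by (simp only: act_mult)
  then show ?thesis
    unfolding 2 m_def[symmetric] act_add_left act_smult act_mult act_scale_right
        by (simp only: add.assoc add.commute add.left_commute)
qed

text \<open>The modes with nonzero eigenvalue measure the deviation from consensus. The equality
  with the distance from the mean serves the voltages. For their images under g the inequality with
  a free constant is the right tool, since g of the mean need not be the mean of the images.\<close>

lemma laplacian_modes:
  assumes w: "weighted_graph N w" and c: "connected_graph N w" and N: "0 < N"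
  defines "L \<equiv> laplacian N w"
  shows "\<exists>(u :: nat \<Rightarrow> nat \<Rightarrow> complex) (lam :: nat \<Rightarrow> real).
    (\<forall>l<N. eigenvalue L (lam l) \<and> 0 \<le> lam l) \<and>
    (\<forall>l<N. \<forall>k<N. (\<Sum>j<N. cnj (u l j) * of_real (L $$ (j, k))) = of_real (lam l) * cnj (u l k)) \<and>
    (\<forall>x c. (\<Sum>l\<in>{l. l < N \<and> lam l \<noteq> 0}. (cmod (\<Sum>j<N. cnj (u l j) * of_real (x j)))\<^sup>2) \<le> (\<Sum>j<N. (x j - c)\<^sup>2)) \<and>
    (\<forall>x. (\<Sum>l\<in>{l. l < N \<and> lam l \<noteq> 0}. (cmod (\<Sum>j<N. cnj (u l j) * of_real (x j)))\<^sup>2) = (\<Sum>j<N. (x j - (\<Sum>j<N. x j) / N)\<^sup>2))"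
proof -
  have sym: "L $$ (j, k) = L $$ (k, j)" if "j < N" "k < N" for j k
    using w that unfolding L_def weighted_graph_def by (simp add: laplacian_index)
  have cL: "L \<in> carrier_mat N N" by (simp add: L_def)
  obtain u :: "nat \<Rightarrow> nat \<Rightarrow> complex" and lam :: "nat \<Rightarrow> real" where ev: "\<forall>l<N. eigenvalue L (lam l)"
    and eig: "\<forall>l<N. \<forall>j<N. (\<Sum>k<N. L $$ (j, k) * u l k) = lam l * u l j"
    and norm: "\<forall>l<N. (\<Sum>j<N. (cmod (u l j))\<^sup>2) = 1"
    and pars: "\<forall>x. (\<Sum>l<N. (cmod (\<Sum>j<N. cnj (u l j) * x j))\<^sup>2) = (\<Sum>j<N. (cmod (x j))\<^sup>2)"
    using real_symmetric_eigenbasis[OF cL sym] by blast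
  have energy: "lam l = (\<Sum>m<N. \<Sum>n<N. w m n * (cmod (u l m - u l n))\<^sup>2) / 2" if l: "l < N" for l
  proof -
    have "complex_of_real ((\<Sum>m<N. \<Sum>n<N. w m n * (cmod (u l m - u l n))\<^sup>2) / 2) =
        (\<Sum>m<N. cnj (u l m) * (\<Sum>n<N. of_real (L $$ (m, n)) * u l n))"
      unfolding L_def by (rule laplacian_energy[OF w, symmetric])
    also have "\<dots> = (\<Sum>m<N. of_real (lam l) * of_real ((cmod (u l m))\<^sup>2))"
      unfolding complex_norm_square using eig l by (intro sum.cong refl) (simp add: mult_ac)
    also have "\<dots> = of_real (lam l * (\<Sum>m<N. (cmod (u l m))\<^sup>2))" by (simp add: sum_distrib_left)
    finally have "(\<Sum>m<N. \<Sum>n<N. w m n * (cmod (u l m - u l n))\<^sup>2) / 2 = lam l * (\<Sum>m<N. (cmod (u l m))\<^sup>2)"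
      unfolding of_real_eq_iff .
    then show ?thesis using norm l by simp
  qed
  have nonneg: "0 \<le> lam l" if "l < N" for l
    unfolding energy[OF that] using w by (auto simp: weighted_graph_def intro!: divide_nonneg_pos sum_nonneg)
  have left: "(\<Sum>j<N. cnj (u l j) * of_real (L $$ (j, k))) = of_real (lam l) * cnj (u l k)" if l: "l < N" "k < N" for l k
  proof -
    have "cnj (\<Sum>j<N. L $$ (k, j) * u l j) = cnj (lam l * u l k)" using eig l by simp
    then have "(\<Sum>j<N. of_real (L $$ (k, j)) * cnj (u l j)) = of_real (lam l) * cnj (u l k)" by simp
    moreover have "(\<Sum>j<N. of_real (L $$ (k, j)) * cnj (u l j)) = (\<Sum>j<N. cnj (u l j) * complex_of_real (L $$ (j, k)))"
      using sym l by (intro sum.cong refl) (simp add: mult.commute)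
    ultimately show ?thesis by simp
  qed
  \<comment> \<open>Connectedness enters here: an eigenvector for the eigenvalue 0 has no
    energy.\<close>
  have const: "u l j = u l 0" if "l < N" "lam l = 0" "j < N" for l j
    using connected_zero_energy_const[OF w c _ N that(3), of "u l"] energy[OF that(1)] that(2) by simp
  have orth: "(\<Sum>j<N. cnj (u l j)) = 0" if l: "l < N" "lam l \<noteq> 0" for l
  proof -
    have "of_real (lam l) * (\<Sum>k<N. cnj (u l k)) = (\<Sum>k<N. \<Sum>j<N. cnj (u l j) * of_real (L $$ (j, k)))"
      using left l by (simp add: sum_distrib_left)
    also have "\<dots> = (\<Sum>j<N. cnj (u l j) * (\<Sum>k<N. of_real (L $$ (j, k)) * 1))"
      by (subst sum.swap) (simp add: sum_distrib_left)
    also have "\<dots> = 0"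
      unfolding L_def using laplacian_row_complex[OF w, of _ "\<lambda>_. 1"] by (intro sum.neutral) simp
    finally show ?thesis using l by simp
  qed
  define J where "J = {l. l < N \<and> lam l \<noteq> 0}"
  have J: "finite J" "J \<subseteq> {..<N}" by (auto simp: J_def)
  have shift: "(\<Sum>l\<in>J. (cmod (\<Sum>j<N. cnj (u l j) * of_real (x j)))\<^sup>2)
      = (\<Sum>l\<in>J. (cmod (\<Sum>j<N. cnj (u l j) * of_real (x j - c)))\<^sup>2)" for x c
  proof (rule sum.cong[OF refl])
    fix l assume "l \<in> J"
    then have "(\<Sum>j<N. cnj (u l j) * of_real (x j - c)) = (\<Sum>j<N. cnj (u l j) * of_real (x j))"
      using orth[of l] by (simp add: right_diff_distrib sum_subtractf sum_distrib_right[symmetric] J_def)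
    then show "(cmod (\<Sum>j<N. cnj (u l j) * of_real (x j)))\<^sup>2 = (cmod (\<Sum>j<N. cnj (u l j) * of_real (x j - c)))\<^sup>2" by simp
  qed
  have total: "(\<Sum>l<N. (cmod (\<Sum>j<N. cnj (u l j) * of_real (x j)))\<^sup>2) = (\<Sum>j<N. (x j)\<^sup>2)" for x :: "nat \<Rightarrow> real"
    using pars[rule_format, of "\<lambda>j. of_real (x j)"] by simp
  have M2: "(\<Sum>l\<in>J. (cmod (\<Sum>j<N. cnj (u l j) * of_real (x j)))\<^sup>2) \<le> (\<Sum>j<N. (x j - c)\<^sup>2)" for x c
    unfolding shift[of x c] total[of "\<lambda>j. x j - c", symmetric] by (rule sum_mono2) (use J in auto)
  have M1: "(\<Sum>l\<in>J. (cmod (\<Sum>j<N. cnj (u l j) * of_real (x j)))\<^sup>2) = (\<Sum>j<N. (x j - (\<Sum>j<N. x j) / N)\<^sup>2)" for x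
  proof -
    define c where "c = (\<Sum>j<N. x j) / N"
    have z: "(\<Sum>j<N. x j - c) = 0" using N by (simp add: c_def sum_subtractf)
    have "(\<Sum>j<N. cnj (u l j) * of_real (x j - c)) = 0" if "l < N" "lam l = 0" for l
    proof -
      have "(\<Sum>j<N. cnj (u l j) * of_real (x j - c)) = (\<Sum>j<N. cnj (u l 0) * of_real (x j - c))"
      proof (rule sum.cong[OF refl])
        fix j assume "j \<in> {..<N}"
        then have "u l j = u l 0" by (intro const that) simp
        then show "cnj (u l j) * complex_of_real (x j - c) = cnj (u l 0) * complex_of_real (x j - c)" by (simp only:)
      qed
      also have "\<dots> = cnj (u l 0) * of_real (\<Sum>j<N. x j - c)" by (simp only: sum_distrib_left of_real_sum)
      finally show ?thesis by (simp add: z)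
    qed
    then have "(\<Sum>l\<in>J. (cmod (\<Sum>j<N. cnj (u l j) * of_real (x j - c)))\<^sup>2)
        = (\<Sum>l<N. (cmod (\<Sum>j<N. cnj (u l j) * of_real (x j - c)))\<^sup>2)"
      by (intro sum.mono_neutral_left) (auto simp: J_def)
    then show ?thesis unfolding shift[of x c] total c_def .
  qed
  show ?thesis
    using ev nonneg left M1[unfolded J_def] M2[unfolded J_def]
    by (intro exI[of _ u] exI[of _ lam]) blast
qed

section \<open>Continuity of port signals and removal of their hidden modes\<close>

lemma port_trajectory_voltage_continuous:
  assumes "port_trajectory C v i"
  shows "continuous_on {0..} v"
proof -
  obtain \<phi> where "\<And>n. continuous_on {0..} (\<phi> n)" and v: "\<And>t. 0 \<le> t \<Longrightarrow> v t = \<phi> (plus_terminal C) t - \<phi> (minus_terminal C) t"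
    using assms unfolding port_trajectory_def by blast
  then have "continuous_on {0..} (\<lambda>t. \<phi> (plus_terminal C) t - \<phi> (minus_terminal C) t)"
    by (intro continuous_on_diff)
  then show ?thesis by (rule continuous_on_eq) (simp add: v)
qed

lemma port_trajectory_current_continuous:
  assumes "port_trajectory C v i" "plus_terminal C \<noteq> minus_terminal C"
  shows "continuous_on {0..} i"
proof -
  obtain c where c: "\<And>k p. continuous_on {0..} (c k p)" and kcl: "\<And>t. 0 \<le> t \<Longrightarrow> kcl C (\<lambda>k p. c k p t) (i t)"
    using assms(1) unfolding port_trajectory_def by blast
  let ?P = "\<lambda>k p. element_ports (elements C ! k) ! p" and ?n = "plus_terminal C"
  define f where "f t = (\<Sum>k<length (elements C). \<Sum>p<length (element_ports (elements C ! k)).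
     (if fst (?P k p) = ?n then c k p t else 0) - (if snd (?P k p) = ?n then c k p t else 0))" for t
  have if_c: "continuous_on {0..} (\<lambda>t. if A then c k p t else 0)" for A k p using c by (cases A) auto
  have "continuous_on {0..} f" unfolding f_def by (intro continuous_on_sum continuous_on_diff if_c)
  moreover have "f t = i t" if "0 \<le> t" for t
    using kcl[OF that] assms(2) unfolding kcl_def f_def by (auto dest: spec[of _ ?n])
  ultimately show ?thesis by (rule continuous_on_eq) simp
qed

lemma act_eq_0_dvd: "act p f = 0 \<Longrightarrow> p dvd q \<Longrightarrow> act q f = 0"
  by (elim dvdE) (simp only: mult.commute[of p] act_mult signal.scale_zero_right)

lemma port_trajectory_annihilated:
  assumes C: "passive_one_port C" and rel: "port_relation C n d"
  shows "\<exists>\<alpha>. hurwitz \<alpha> \<and> (\<forall>\<epsilon> b v i. bump \<epsilon> b \<longrightarrow> \<epsilon> \<le> 1 \<longrightarrow> port_trajectory C v i \<longrightarrow> continuous_on {0..} i \<longrightarrow>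
     act \<alpha> (act d (mollify_real b v) - act n (mollify_real b i)) = 0)"
proof -
  obtain \<alpha> where \<alpha>: "hurwitz \<alpha>" "\<forall>x. solves act C x \<longrightarrow> act \<alpha> (act d (port_voltage C x) - act n (x PortCurrent)) = 0"
    using port_relation_hurwitz[OF C rel] by blast
  show ?thesis
  proof (intro exI[of _ \<alpha>] conjI \<alpha>(1) allI impI)
    fix \<epsilon> :: real and b v i
    assume "bump \<epsilon> b" "\<epsilon> \<le> 1" "port_trajectory C v i" "continuous_on {0..} i"
    from port_trajectory_mollified[OF this C] \<alpha>(2)
    show "act \<alpha> (act d (mollify_real b v) - act n (mollify_real b i)) = 0" by metis
  qed
qed

theorem theorem2:
  fixes N M :: nat
    and C :: one_port
    and z y :: transfer_function
    and g :: "real \<Rightarrow> real"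
    and a :: "nat \<Rightarrow> nat \<Rightarrow> real"
    and line :: "nat \<Rightarrow> nat \<Rightarrow> one_port"
    and YA :: "transfer_function mat"
    and L :: "real mat"
  assumes "2 \<le> N" and "N \<le> M"
    and "passive_one_port C" and "has_impedance C z"
    and "bounded_slope_source g"
    and "weighted_graph M a" and "connected_graph M a"
    and "\<And>m n. m < n \<Longrightarrow> n < M \<Longrightarrow> 0 < a m n \<Longrightarrow>
           passive_one_port (line m n) \<and> has_admittance (line m n) (y * tf_const (a m n))"
    and "YA = laplacian M (\<lambda>m n. y * tf_const (a m n))"
    and "invertible_mat (interior_block N YA)"
    and "L = kron_reduction N (laplacian M a)"
    and "\<And>\<mu>. eigenvalue L \<mu> \<Longrightarrow> \<mu> \<noteq> 0 \<Longrightarrow>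
           hinf_norm_defined (lft z (y * tf_const \<mu>)) \<and>
           hinf_norm (lft z (y * tf_const \<mu>)) * max_slope g < 1"
  shows "kron_reduction N YA = y \<cdot>\<^sub>m map_mat tf_const L \<and>
         (\<exists>w. weighted_graph N w \<and> connected_graph N w \<and> L = laplacian N w) \<and>
         (\<forall>v i b. coupled_trajectory N M C g a line v i b \<longrightarrow>
            (\<forall>j<N. \<forall>k<N. ((\<lambda>t. v j t - v k t) \<longlongrightarrow> 0) at_top))"
proof -
  note NM = assms(1,2) and C = assms(3,4) and src = assms(5) and wa = assms(6) and ca = assms(7) and lines = assms(8)
    and inv = assms(10)[unfolded assms(9)] and L_def = assms(11) and gain = assms(12)
  have kron: "kron_reduction N YA = y \<cdot>\<^sub>m map_mat tf_const L"
    unfolding assms(9) L_def by (rule kron_reduction_uniform(1)[OF NM(2) inv])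
  obtain K where K: "\<forall>j<N. \<forall>k<M. laplacian M a $$ (j, k) - (\<Sum>m=N..<M. K j m * laplacian M a $$ (m, k)) =
    (if k < N then L $$ (j, k) else 0)"
    using kron_reduction_elimination[OF NM(2) wa inv] unfolding L_def by blast
  have cL: "L \<in> carrier_mat N N"
  proof -
    obtain R where R: "R \<in> carrier_mat (M - N) (M - N)" "mat_inverse (interior_block N (laplacian M a)) = Some R"
      using kron_reduction_uniform(2)[OF NM(2) inv] by blast
    then show ?thesis
      unfolding L_def by (auto simp: kron_reduction_def interior_block_def split_block_eq)
  qed
  have K': "laplacian M a $$ (j, k) - (\<Sum>m=N..<M. K j m * laplacian M a $$ (m, k)) =
    (if k < N then L $$ (j, k) else 0)" if "j < N" "k < M" for j k using K that by blast
  have ex_w: "\<exists>w. weighted_graph N w \<and> connected_graph N w \<and> L = laplacian N w"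
    by (rule kron_reduction_laplacian[OF _ NM(2) wa ca cL K']) (use NM in auto)
  then obtain w where w: "weighted_graph N w" "connected_graph N w" and Lw: "L = laplacian N w" by blast
  have N0: "0 < N" using NM by simp
  obtain u :: "nat \<Rightarrow> nat \<Rightarrow> complex" and lam :: "nat \<Rightarrow> real" where
    "\<forall>l<N. eigenvalue L (lam l) \<and> 0 \<le> lam l"
    "\<forall>l<N. \<forall>k<N. (\<Sum>j<N. cnj (u l j) * of_real (L $$ (j, k))) = of_real (lam l) * cnj (u l k)"
    "\<forall>x c. (\<Sum>l\<in>{l. l < N \<and> lam l \<noteq> 0}. (cmod (\<Sum>j<N. cnj (u l j) * of_real (x j)))\<^sup>2) \<le> (\<Sum>j<N. (x j - c)\<^sup>2)"
    "\<forall>x. (\<Sum>l\<in>{l. l < N \<and> lam l \<noteq> 0}. (cmod (\<Sum>j<N. cnj (u l j) * of_real (x j)))\<^sup>2) = (\<Sum>j<N. (x j - (\<Sum>j<N. x j) / N)\<^sup>2)"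
    using laplacian_modes[OF w N0, folded Lw] by blast
  then have ev: "\<And>l. l < N \<Longrightarrow> eigenvalue L (lam l)" and nonneg: "\<And>l. l < N \<Longrightarrow> 0 \<le> lam l"
    and eig: "\<And>l k. l < N \<Longrightarrow> k < N \<Longrightarrow> (\<Sum>j<N. cnj (u l j) * of_real (L $$ (j, k))) = of_real (lam l) * cnj (u l k)"
    and modes_le: "\<And>x c. (\<Sum>l\<in>{l. l < N \<and> lam l \<noteq> 0}. (cmod (\<Sum>j<N. cnj (u l j) * of_real (x j)))\<^sup>2) \<le> (\<Sum>j<N. (x j - c)\<^sup>2)"
    and modes_eq: "\<And>x. (\<Sum>l\<in>{l. l < N \<and> lam l \<noteq> 0}. (cmod (\<Sum>j<N. cnj (u l j) * of_real (x j)))\<^sup>2)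
        = (\<Sum>j<N. (x j - (\<Sum>j<N. x j) / N)\<^sup>2)"
    by blast+
  define J where "J = {l. l < N \<and> lam l \<noteq> 0}"
  have J: "finite J" by (simp add: J_def)
  define \<sigma> where "\<sigma> = max_slope g"
  have \<sigma>: "0 \<le> \<sigma>" "\<And>x y. \<bar>g x - g y\<bar> \<le> \<sigma> * \<bar>x - y\<bar>"
    unfolding \<sigma>_def by (rule max_slope_lipschitz[OF src])+
  define \<gamma>l where "\<gamma>l l = hinf_norm (lft z (y * tf_const (lam l)))" for l
  \<comment> \<open>The 0 covers an empty J and makes \<gamma> nonnegative; the maximum is attained,
    so the strict inequality survives.\<close>
  define \<gamma> where "\<gamma> = Max (insert 0 (\<gamma>l ` J))"
  have \<gamma>: "0 \<le> \<gamma>" and \<gamma>_le: "\<And>l. l \<in> J \<Longrightarrow> \<gamma>l l \<le> \<gamma>" unfolding \<gamma>_def using J by auto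
  have \<gamma>\<sigma>: "\<gamma> * \<sigma> < 1"
  proof -
    have "\<gamma> \<in> insert 0 (\<gamma>l ` J)" unfolding \<gamma>_def using J by (intro Max_in) auto
    then show ?thesis using gain ev unfolding \<gamma>l_def \<sigma>_def J_def by auto
  qed
  define n d Q P where "n = fst (quot_of_fract z)" and "d = snd (quot_of_fract z)"
    and "Q = fst (quot_of_fract y)" and "P = snd (quot_of_fract y)"
  \<comment> \<open>Positive realness of y is drawn from an actual line, so a branch must exist; it
    comes from connectedness and N >= 2.\<close>
  have "\<exists>m n. m < n \<and> n < M \<and> 0 < a m n"
  proof (rule ccontr)
    assume no: "\<not> ?thesis"
    have "(1::nat) = 0"
    proof (rule connected_graph_invariant[OF ca, where P = "\<lambda>n. n = 0" and m = 0])
      fix j k assume jk: "j < M" "k < M" "0 < a j k" "j = 0"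
      show "k = 0" using no jk by (cases "k = 0") auto
    qed (use NM in auto)
    then show False by simp
  qed
  then obtain m0 n0 where e0: "m0 < n0" "n0 < M" "0 < a m0 n0" by blast
  have loops: "\<exists>h n1 P1. n = h * n1 \<and> P = h * P1 \<and>
     hurwitz (P1 * d + Polynomial.smult (of_real (lam l)) (n1 * Q)) \<and>
     (\<forall>\<omega>::real. cmod (poly (n * P1) (\<i> * of_real \<omega>)) \<le> \<gamma>l l *
        cmod (poly (P1 * d + Polynomial.smult (of_real (lam l)) (n1 * Q)) (\<i> * of_real \<omega>)))" if l: "l \<in> J" for l
  proof -
    have "0 < lam l" using l nonneg[of l] by (auto simp: J_def)
    moreover have "hinf_norm_defined (lft z (y * tf_const (lam l)))" using gain ev l by (auto simp: J_def)
    moreover have "passive_one_port (line m0 n0)" "has_admittance (line m0 n0) (y * tf_const (a m0 n0))"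
      using lines[OF e0] by auto
    ultimately show ?thesis
      using loop_polynomials[OF C _ _ e0(3), of "line m0 n0" y "lam l"] unfolding n_def d_def Q_def P_def \<gamma>l_def by metis
  qed
  have "((\<lambda>t. v j t - v k t) \<longlongrightarrow> 0) at_top" if traj: "coupled_trajectory N M C g a line v i b" and jk: "j < N" "k < N"
      for v i b j k
  proof -
    have osc: "\<And>j. j < N \<Longrightarrow> port_trajectory C (v j) (\<lambda>t. - g (v j t) - i j t)"
      and branch: "\<And>m n. m < n \<Longrightarrow> n < M \<Longrightarrow> 0 < a m n \<Longrightarrow> port_trajectory (line m n) (\<lambda>t. v m t - v n t) (b m n)"
      and anti: "\<And>m n t. m < M \<Longrightarrow> n < M \<Longrightarrow> 0 \<le> t \<Longrightarrow> b n m t = - b m n t"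
      and nobranch: "\<And>m n t. m < M \<Longrightarrow> n < M \<Longrightarrow> 0 \<le> t \<Longrightarrow> a m n = 0 \<Longrightarrow> b m n t = 0"
      and inj: "\<And>m t. m < M \<Longrightarrow> 0 \<le> t \<Longrightarrow> i m t = (\<Sum>n<M. b m n t)"
      and interior: "\<And>m t. N \<le> m \<Longrightarrow> m < M \<Longrightarrow> 0 \<le> t \<Longrightarrow> i m t = 0"
      using traj unfolding coupled_trajectory_def by blast+
    have asym: "a m n = a n m" and ann: "0 \<le> a m n" and adiag: "a m m = 0" if "m < M" "n < M" for m n
      using wa that by (auto simp: weighted_graph_def)
    \<comment> \<open>A line has distinct terminals, which gives continuity for m < n; the opposite
      orientation and missing branches reduce to this.\<close>
    have cb: "continuous_on {0..} (b m n)" if mn: "m < M" "n < M" for m n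
    proof -
      have pos: "continuous_on {0..} (b m n)" if "m < n" "n < M" "0 < a m n" for m n
        by (rule port_trajectory_current_continuous[OF branch[OF that]
              admittance_terminals_distinct[OF conjunct2[OF lines[OF that]]]])
      consider "a m n = 0" | "m < n" "0 < a m n" | "n < m" "0 < a n m"
        using ann[OF mn] asym[OF mn] adiag[OF mn(1) mn(1)] by (metis less_eq_real_def linorder_neqE_nat)
      then show ?thesis
      proof cases
        case 1
        show ?thesis by (rule continuous_on_eq[of _ "\<lambda>t. 0"]) (use nobranch[OF mn _ 1] in auto)
      next
        case 2
        then show ?thesis using pos mn by blast
      next
        case 3
        have "continuous_on {0..} (\<lambda>t. - b n m t)" using pos[OF 3(1) mn(1) 3(2)] by (intro continuous_on_minus)
        then show ?thesis by (rule continuous_on_eq) (use anti[OF mn(2,1)] in simp)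
      qed
    qed
    have ci: "continuous_on {0..} (i m)" if m: "m < M" for m
    proof -
      have "continuous_on {0..} (\<lambda>t. \<Sum>n<M. b m n t)" using m by (intro continuous_on_sum cb) auto
      then show ?thesis by (rule continuous_on_eq) (use inj[OF m] in simp)
    qed
    \<comment> \<open>Interior nodes have no circuit of their own, so continuity of the voltages
      spreads from node 0 along branches, whose voltages are continuous.\<close>
    have cv: "continuous_on {0..} (v m)" if m: "m < M" for m
    proof (rule connected_graph_invariant[OF ca, where P = "\<lambda>m. continuous_on {0..} (v m)" and m = 0])
      show "continuous_on {0..} (v 0)" by (rule port_trajectory_voltage_continuous[OF osc[OF N0]])
      fix j k assume e: "j < M" "k < M" "0 < a j k" "continuous_on {0..} (v j)"
      have "continuous_on {0..} (\<lambda>t. v j t - v k t)"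
      proof (cases "j < k")
        case True
        show ?thesis by (rule port_trajectory_voltage_continuous[OF branch[OF True e(2,3)]])
      next
        case False
        with e adiag[OF e(1,1)] have "k < j" "0 < a k j" using asym[OF e(1,2)] by (auto simp: not_less le_less)
        then have "continuous_on {0..} (\<lambda>t. v k t - v j t)"
          using port_trajectory_voltage_continuous[OF branch] e(1) by blast
        then have "continuous_on {0..} (\<lambda>t. - (v k t - v j t))" by (rule continuous_on_minus)
        then show ?thesis by simp
      qed
      from continuous_on_diff[OF e(4) this] show "continuous_on {0..} (v k)" by simp
    qed (use m NM in auto)
    have "continuous_on UNIV g" using src by (simp add: bounded_slope_source_def)
    then have cg: "continuous_on {0..} (\<lambda>t. g (v j t))" if "j < N" for j
      by (rule continuous_on_compose2[OF _ cv]) (use that NM in simp_all)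

    \<comment> \<open>A common annihilator of all hidden modes\<close>
    have "\<exists>\<alpha>. hurwitz \<alpha> \<and> (\<forall>\<epsilon> b v i. bump \<epsilon> b \<longrightarrow> \<epsilon> \<le> 1 \<longrightarrow> port_trajectory C v i \<longrightarrow> continuous_on {0..} i \<longrightarrow>
       act \<alpha> (act d (mollify_real b v) - act n (mollify_real b i)) = 0)"
      unfolding n_def d_def by (rule port_trajectory_annihilated[OF C(1) impedance_port_relation[OF C(2)]])
    then obtain \<alpha>C where \<alpha>C0: "hurwitz \<alpha>C" "\<forall>\<epsilon> b v i. bump \<epsilon> b \<longrightarrow> \<epsilon> \<le> 1 \<longrightarrow> port_trajectory C v i \<longrightarrow> continuous_on {0..} i \<longrightarrow>
       act \<alpha>C (act d (mollify_real b v) - act n (mollify_real b i)) = 0" by blast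
    note \<alpha>C = \<alpha>C0(1) \<alpha>C0(2)[rule_format]
    define E where "E = {(m, n). m < n \<and> n < M \<and> 0 < a m n}"
    have E: "finite E" by (rule finite_subset[of _ "{..<M} \<times> {..<M}"]) (auto simp: E_def)
    have "\<forall>e\<in>E. \<exists>\<alpha>. hurwitz \<alpha> \<and> (\<forall>\<epsilon> \<beta>. bump \<epsilon> \<beta> \<longrightarrow> \<epsilon> \<le> 1 \<longrightarrow>
        act \<alpha> (act (Polynomial.smult (of_real (a (fst e) (snd e))) Q) (mollify_real \<beta> (\<lambda>t. v (fst e) t - v (snd e) t))
          - act P (mollify_real \<beta> (b (fst e) (snd e)))) = 0)"
    proof
      fix e assume "e \<in> E"
      then obtain m n where e: "e = (m, n)" "m < n" "n < M" "0 < a m n" by (auto simp: E_def)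
      note l = lines[OF e(2-4)]
      have "port_relation (line m n) P (Polynomial.smult (of_real (a m n)) Q)"
        unfolding P_def Q_def using l e(4) by (intro admittance_port_relation) auto
      from port_trajectory_annihilated[OF conjunct1[OF l] this] obtain \<alpha> where \<alpha>: "hurwitz \<alpha>"
        "\<forall>\<epsilon> \<beta> v i. bump \<epsilon> \<beta> \<longrightarrow> \<epsilon> \<le> 1 \<longrightarrow> port_trajectory (line m n) v i \<longrightarrow> continuous_on {0..} i \<longrightarrow>
         act \<alpha> (act (Polynomial.smult (of_real (a m n)) Q) (mollify_real \<beta> v) - act P (mollify_real \<beta> i)) = 0"
        by blast
      have "m < M" using e by simp
      then have "act \<alpha> (act (Polynomial.smult (of_real (a m n)) Q) (mollify_real \<beta> (\<lambda>t. v m t - v n t))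
          - act P (mollify_real \<beta> (b m n))) = 0"
        if "bump \<epsilon> \<beta>" "\<epsilon> \<le> 1" for \<epsilon> \<beta>
        using \<alpha>(2)[rule_format, OF that branch[OF e(2-4)] cb[OF _ e(3)]] by simp
      then show "\<exists>\<alpha>. hurwitz \<alpha> \<and> (\<forall>\<epsilon> \<beta>. bump \<epsilon> \<beta> \<longrightarrow> \<epsilon> \<le> 1 \<longrightarrow>
        act \<alpha> (act (Polynomial.smult (of_real (a (fst e) (snd e))) Q) (mollify_real \<beta> (\<lambda>t. v (fst e) t - v (snd e) t))
          - act P (mollify_real \<beta> (b (fst e) (snd e)))) = 0)"
        unfolding e(1) fst_conv snd_conv using \<alpha>(1) by blast
    qed
    from bchoice[OF this] obtain \<alpha>E where \<alpha>E0: "\<forall>e\<in>E. hurwitz (\<alpha>E e) \<and> (\<forall>\<epsilon> \<beta>. bump \<epsilon> \<beta> \<longrightarrow> \<epsilon> \<le> 1 \<longrightarrow>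
        act (\<alpha>E e) (act (Polynomial.smult (of_real (a (fst e) (snd e))) Q) (mollify_real \<beta> (\<lambda>t. v (fst e) t - v (snd e) t))
          - act P (mollify_real \<beta> (b (fst e) (snd e)))) = 0)" ..
    have \<alpha>E: "hurwitz (\<alpha>E e)" if "e \<in> E" for e using \<alpha>E0 that by blast
    have \<alpha>E_eq: "act (\<alpha>E e) (act (Polynomial.smult (of_real (a (fst e) (snd e))) Q) (mollify_real \<beta> (\<lambda>t. v (fst e) t - v (snd e) t))
          - act P (mollify_real \<beta> (b (fst e) (snd e)))) = 0" if "e \<in> E" "bump \<epsilon> \<beta>" "\<epsilon> \<le> 1" for e \<epsilon> \<beta>
      using \<alpha>E0 that by blast
    \<comment> \<open>On signals filtered by \<alpha> all port relations hold exactly. As \<alpha>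
      multiplies both polynomials of a mode equation, it is Hurwitz and leaves the gain
      unchanged.\<close>
    define \<alpha> where "\<alpha> = \<alpha>C * (\<Prod>e\<in>E. \<alpha>E e)"
    have \<alpha>: "hurwitz \<alpha>" unfolding \<alpha>_def by (intro hurwitz_mult \<alpha>C(1) hurwitz_prod \<alpha>E)
    have \<alpha>_dvd: "\<alpha>C dvd \<alpha>" "\<And>e. e \<in> E \<Longrightarrow> \<alpha>E e dvd \<alpha>"
      unfolding \<alpha>_def using E by (auto intro: dvd_mult dvd_prodI)

    \<comment> \<open>Modal coordinates of the voltages and of the source currents\<close>
    define x where "x l t = (\<Sum>j<N. cnj (u l j) * of_real (v j t))" for l t
    define yy where "yy l t = (\<Sum>j<N. cnj (u l j) * of_real (g (v j t)))" for l t
    have cx: "continuous_on {0..} (x l)" for l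
      unfolding x_def using cv NM by (intro continuous_on_sum continuous_on_mult continuous_on_const continuous_of_real) auto
    have cy: "continuous_on {0..} (yy l)" for l
      unfolding yy_def using cg by (intro continuous_on_sum continuous_on_mult continuous_on_const continuous_of_real) auto
    \<comment> \<open>g(v j) is compared with g at the mean voltage c, a constant that the mode
      inequality permits; the Lipschitz bound then leads back to the distance of the voltages from
      c.\<close>
    have slope: "(\<Sum>l\<in>J. (cmod (yy l t))\<^sup>2) \<le> \<sigma>\<^sup>2 * (\<Sum>l\<in>J. (cmod (x l t))\<^sup>2)" for t
    proof -
      define c where "c = (\<Sum>j<N. v j t) / N"
      have "(\<Sum>l\<in>J. (cmod (yy l t))\<^sup>2) \<le> (\<Sum>j<N. (g (v j t) - g c)\<^sup>2)"
        unfolding yy_def J_def by (rule modes_le)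
      also have "\<dots> \<le> (\<Sum>j<N. \<sigma>\<^sup>2 * (v j t - c)\<^sup>2)"
      proof (rule sum_mono)
        fix j
        have "\<bar>g (v j t) - g c\<bar>\<^sup>2 \<le> (\<sigma> * \<bar>v j t - c\<bar>)\<^sup>2" by (intro power_mono \<sigma>(2)) simp
        then show "(g (v j t) - g c)\<^sup>2 \<le> \<sigma>\<^sup>2 * (v j t - c)\<^sup>2" by (simp add: power_mult_distrib)
      qed
      also have "\<dots> = \<sigma>\<^sup>2 * (\<Sum>l\<in>J. (cmod (x l t))\<^sup>2)"
        unfolding x_def J_def modes_eq c_def by (simp add: sum_distrib_left)
      finally show ?thesis .
    qed

    have resp: "\<exists>H G. hurwitz H \<and> (\<forall>\<omega>::real. cmod (poly G (\<i> * of_real \<omega>)) \<le> \<gamma> * cmod (poly H (\<i> * of_real \<omega>))) \<and>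
        (\<forall>\<epsilon> \<beta>. 0 < \<epsilon> \<longrightarrow> \<epsilon> \<le> 1 \<longrightarrow> bump \<epsilon> \<beta> \<longrightarrow> act H (mollify \<beta> (x l)) + act G (mollify \<beta> (yy l)) = 0)" if l: "l \<in> J" for l
    proof -
      obtain h n1 P1 where hn: "n = h * n1" and hP: "P = h * P1"
        and hw: "hurwitz (P1 * d + Polynomial.smult (of_real (lam l)) (n1 * Q))"
        and bd: "\<And>\<omega>::real. cmod (poly (n * P1) (\<i> * of_real \<omega>)) \<le> \<gamma>l l *
          cmod (poly (P1 * d + Polynomial.smult (of_real (lam l)) (n1 * Q)) (\<i> * of_real \<omega>))"
        using loops[OF l] by blast
      define q where "q = P1 * d + Polynomial.smult (of_real (lam l)) (n1 * Q)"
      have "cmod (poly (\<alpha> * (n * P1)) (\<i> * of_real \<omega>)) \<le> \<gamma> * cmod (poly (\<alpha> * q) (\<i> * of_real \<omega>))" for \<omega> :: real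
      proof -
        have "cmod (poly (n * P1) (\<i> * of_real \<omega>)) \<le> \<gamma> * cmod (poly q (\<i> * of_real \<omega>))"
          using bd[of \<omega>] mult_right_mono[OF \<gamma>_le[OF l] norm_ge_zero[of "poly q (\<i> * of_real \<omega>)"]] unfolding q_def by linarith
        from mult_left_mono[OF this norm_ge_zero[of "poly \<alpha> (\<i> * of_real \<omega>)"]]
        show ?thesis by (simp add: norm_mult mult_ac)
      qed
      moreover have "act (\<alpha> * q) (mollify \<beta> (x l)) + act (\<alpha> * (n * P1)) (mollify \<beta> (yy l)) = 0" if \<beta>: "bump \<epsilon> \<beta>" "\<epsilon> \<le> 1"
          for \<epsilon> \<beta>
      proof -
        \<comment> \<open>After mollification and filtering by \<alpha>, circuits and network form
          an exact linear system over polynomials in D, with the source signals G as input.\<close>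
        define V where "V m = act \<alpha> (mollify_real \<beta> (v m))" for m
        define I where "I m = act \<alpha> (mollify_real \<beta> (i m))" for m
        define B where "B m n = act \<alpha> (mollify_real \<beta> (b m n))" for m n
        define G where "G j = act \<alpha> (mollify_real \<beta> (\<lambda>t. g (v j t)))" for j
        have vdiff: "act \<alpha> (mollify_real \<beta> (\<lambda>t. v m t - v n t)) = V m - V n" if "m < M" "n < M" for m n
          using mollify_diff[OF \<beta> continuous_of_real[OF cv[OF that(1)]] continuous_of_real[OF cv[OF that(2)]]]
          by (simp add: V_def signal.scale_right_diff_distrib)
        have 1: "act d (V j) + act n (G j + I j) = 0" if j: "j < N" for j
        proof -
          have jM: "j < M" using j NM by simp
          have "act \<alpha> (act d (mollify_real \<beta> (v j)) - act n (mollify_real \<beta> (\<lambda>t. - g (v j t) - i j t))) = 0"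
            by (rule act_eq_0_dvd[OF \<alpha>C(2)[OF \<beta> osc[OF j]] \<alpha>_dvd(1)])
               (intro continuous_on_diff continuous_on_minus cg[OF j] ci[OF jM])
          moreover have "mollify_real \<beta> (\<lambda>t. - g (v j t) - i j t)
              = - (mollify_real \<beta> (\<lambda>t. g (v j t)) + mollify_real \<beta> (i j))"
          proof -
            have "mollify_real \<beta> (\<lambda>t. - g (v j t) - i j t)
                = mollify \<beta> (\<lambda>t. - 1 * (of_real (g (v j t)) + of_real (i j t)))" by simp
            also have "\<dots> = scale (- 1) (mollify_real \<beta> (\<lambda>t. g (v j t)) + mollify_real \<beta> (i j))"
              using mollify_scale[OF \<beta> continuous_on_add[OF continuous_of_real[OF cg[OF j]] continuous_of_real[OF ci[OF jM]]], of "- 1"]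
                mollify_add[OF \<beta> continuous_of_real[OF cg[OF j]] continuous_of_real[OF ci[OF jM]]] by metis
            finally show ?thesis by (auto intro: signal_eqI)
          qed
          ultimately have "act d (V j) - act n (- (G j + I j)) = 0"
            unfolding V_def G_def I_def
            by (simp only: signal.scale_right_diff_distrib signal.scale_minus_right act_add_right act_commute[of \<alpha>])
          then show ?thesis by (simp only: signal.scale_minus_right diff_minus_eq_add)
        qed
        have B_pos: "act P (B m n) = scale (of_real (a m n)) (act Q (V m - V n))" if "m < n" "n < M" "0 < a m n" for m n
        proof -
          have mn: "(m, n) \<in> E" "m < M" using that by (auto simp: E_def)
          have "act \<alpha> (act (Polynomial.smult (of_real (a m n)) Q) (mollify_real \<beta> (\<lambda>t. v m t - v n t))
              - act P (mollify_real \<beta> (b m n))) = 0"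
            using act_eq_0_dvd[OF \<alpha>E_eq[OF mn(1) \<beta>] \<alpha>_dvd(2)[OF mn(1)]] by simp
          then have "act (Polynomial.smult (of_real (a m n)) Q) (act \<alpha> (mollify_real \<beta> (\<lambda>t. v m t - v n t))) = act P (B m n)"
            unfolding B_def by (simp only: signal.scale_right_diff_distrib act_commute[of \<alpha>] right_minus_eq)
          then show ?thesis by (simp only: vdiff[OF mn(2) that(2)] act_smult)
        qed
        have 2: "act P (B m n) = scale (of_real (a m n)) (act Q (V m - V n))" if mn: "m < M" "n < M" for m n
        proof -
          consider "a m n = 0" | "m < n" "0 < a m n" | "n < m" "0 < a n m"
            using ann[OF mn] asym[OF mn] adiag[OF mn(1) mn(1)] by (metis less_eq_real_def linorder_neqE_nat)
          then show ?thesis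
          proof cases
            case 1
            have "mollify_real \<beta> (b m n) = mollify \<beta> (\<lambda>t. 0)"
              by (rule mollify_cong) (simp add: nobranch[OF mn _ 1])
            then show ?thesis by (simp add: B_def 1 mollify_0[OF \<beta>] scale_zero)
          next
            case 2
            then show ?thesis using B_pos mn by blast
          next
            case 3
            have "mollify_real \<beta> (b m n) = mollify \<beta> (\<lambda>t. - 1 * of_real (b n m t))"
              by (rule mollify_cong) (simp add: anti[OF mn(2,1)])
            also have "\<dots> = scale (- 1) (mollify_real \<beta> (b n m))"
              by (rule mollify_scale[OF \<beta> continuous_of_real[OF cb[OF mn(2,1)]]])
            finally have "act P (B m n) = scale (- 1) (act P (B n m))" by (simp only: B_def act_scale_right)
            also have "\<dots> = scale (- 1) (scale (of_real (a n m)) (act Q (V n - V m)))"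
              using B_pos[OF 3(1) mn(1) 3(2)] by simp
            also have "\<dots> = scale (of_real (a m n)) (act Q (V m - V n))"
              using asym[OF mn] by (intro signal_eqI) (simp add: signal.scale_right_diff_distrib algebra_simps)
            finally show ?thesis .
          qed
        qed
        have 3: "I m = (\<Sum>n<M. B m n)" if m: "m < M" for m
        proof -
          have "mollify_real \<beta> (i m) = mollify \<beta> (\<lambda>t. \<Sum>n<M. of_real (b m n t))"
            by (rule mollify_cong) (simp add: inj[OF m])
          also have "\<dots> = (\<Sum>n<M. mollify_real \<beta> (b m n))"
            by (rule mollify_sum[OF \<beta>]) (use m in \<open>auto intro: continuous_of_real cb\<close>)
          finally show ?thesis by (simp only: I_def B_def signal.scale_sum_right)
        qed
        have 4: "I m = 0" if m: "N \<le> m" "m < M" for m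
        proof -
          have "mollify_real \<beta> (i m) = mollify \<beta> (\<lambda>t. 0)"
            by (rule mollify_cong) (simp add: interior[OF m])
          then show ?thesis by (simp add: I_def mollify_0[OF \<beta>])
        qed
        have 5: "act P (I j) = act Q (\<Sum>k<N. scale (of_real (L $$ (j, k))) (V k))" if "j < N" for j
          by (rule kron_signals[OF NM(2) wa K' 2 3 4 that])
        have mode: "act q (\<Sum>j<N. scale (cnj (u l j)) (V j)) + act (n * P1) (\<Sum>j<N. scale (cnj (u l j)) (G j)) = 0"
          unfolding q_def by (rule mode_signals[OF 1 5 eig hn hP]) (use l in \<open>auto simp: J_def\<close>)
        have mx: "act \<alpha> (mollify \<beta> (\<lambda>t. \<Sum>j<N. cnj (u l j) * of_real (f j t)))
            = (\<Sum>j<N. scale (cnj (u l j)) (act \<alpha> (mollify_real \<beta> (f j))))"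
          if cf: "\<And>j. j < N \<Longrightarrow> continuous_on {0..} (f j)" for f
        proof -
          have "mollify \<beta> (\<lambda>t. \<Sum>j<N. cnj (u l j) * of_real (f j t)) = (\<Sum>j<N. mollify \<beta> (\<lambda>t. cnj (u l j) * of_real (f j t)))"
            by (rule mollify_sum[OF \<beta>]) (use cf in \<open>auto intro!: continuous_on_mult continuous_on_const continuous_of_real\<close>)
          also have "\<dots> = (\<Sum>j<N. scale (cnj (u l j)) (mollify_real \<beta> (f j)))"
            by (rule sum.cong) (use mollify_scale[OF \<beta> continuous_of_real[OF cf]] in auto)
          finally show ?thesis by (simp only: signal.scale_sum_right act_scale_right)
        qed
        have "act \<alpha> (mollify \<beta> (x l)) = (\<Sum>j<N. scale (cnj (u l j)) (V j))"
          unfolding x_def V_def by (rule mx) (use cv NM in auto)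
        moreover have "act \<alpha> (mollify \<beta> (yy l)) = (\<Sum>j<N. scale (cnj (u l j)) (G j))"
          unfolding yy_def G_def by (rule mx) (rule cg)
        ultimately show ?thesis
          using mode by (simp only: mult.commute[of \<alpha>] act_mult)
      qed
      ultimately show ?thesis
        using hurwitz_mult[OF \<alpha> hw] unfolding q_def by blast
    qed

    \<comment> \<open>Convergence of the nonzero modes and synchronization\<close>
    have lim: "((\<lambda>t. \<Sum>l\<in>J. (cmod (x l t))\<^sup>2) \<longlongrightarrow> 0) at_top"
    proof (rule small_gain[OF J cx cy \<gamma> \<sigma>(1) \<gamma>\<sigma> slope])
      fix l assume l: "l \<in> J"
      obtain H G where HG: "hurwitz H" "\<And>\<omega>::real. cmod (poly G (\<i> * of_real \<omega>)) \<le> \<gamma> * cmod (poly H (\<i> * of_real \<omega>))"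
        "\<And>\<epsilon> \<beta>. 0 < \<epsilon> \<Longrightarrow> \<epsilon> \<le> 1 \<Longrightarrow> bump \<epsilon> \<beta> \<Longrightarrow> act H (mollify \<beta> (x l)) + act G (mollify \<beta> (yy l)) = 0"
        using resp[OF l] by blast
      show "\<exists>B. \<forall>\<eta>>0. \<forall>T\<ge>0. Int0 (\<lambda>t. (cmod (x l t))\<^sup>2) T \<le>
            (1 + \<eta>) * \<gamma>\<^sup>2 * Int0 (\<lambda>t. (cmod (yy l t))\<^sup>2) T + (1 + 1 / \<eta>) * B"
        by (rule weak_response(1)[OF cx cy HG(1,2) \<gamma>]) (rule HG(3))
      show "\<exists>D. cmod D \<le> \<gamma> \<and> ((\<lambda>t. x l t - D * yy l t) \<longlongrightarrow> 0) at_top" if "square_bounded (yy l)"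
        by (rule weak_response(2)[OF cx cy HG(1,2) \<gamma> _ that]) (rule HG(3))
    qed
    \<comment> \<open>S t is the squared distance of the voltages from their mean, so two of them
      differ by at most twice its root.\<close>
    define S where "S t = (\<Sum>l\<in>J. (cmod (x l t))\<^sup>2)" for t
    have bound: "\<bar>v m t - (\<Sum>j<N. v j t) / N\<bar> \<le> sqrt (S t)" if "m < N" for m t
    proof -
      have "(v m t - (\<Sum>j<N. v j t) / N)\<^sup>2 \<le> (\<Sum>m<N. (v m t - (\<Sum>j<N. v j t) / N)\<^sup>2)"
        using that by (intro member_le_sum) auto
      also have "\<dots> = S t" unfolding S_def x_def J_def modes_eq ..
      finally show ?thesis by (simp add: real_le_rsqrt)
    qed
    have "((\<lambda>t. 2 * sqrt (S t)) \<longlongrightarrow> 2 * sqrt 0) at_top"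
      using lim unfolding S_def[symmetric] by (intro tendsto_mult tendsto_const tendsto_real_sqrt)
    then have "((\<lambda>t. 2 * sqrt (S t)) \<longlongrightarrow> 0) at_top" by simp
    then show ?thesis
    proof (rule Lim_null_comparison[rotated])
      show "\<forall>\<^sub>F t in at_top. norm (v j t - v k t) \<le> 2 * sqrt (S t)"
      proof (intro always_eventually allI)
        fix t
        show "norm (v j t - v k t) \<le> 2 * sqrt (S t)"
          using bound[OF jk(1), of t] bound[OF jk(2), of t] by (simp add: abs_le_iff)
      qed
    qed
  qed
  with kron ex_w show ?thesis by blast
qed

end
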